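(* Let $\epsilon_0>0$ and $s\ge 2$ be fixed, let $u_0,\rho_0\in H^s(\mathbb{T}^1)$, and let $T>0$ and $(u^\epsilon,\rho^\epsilon)_{\epsilon>0}$ be the existence time and the solutions of the weakly compressible 1D isentropic Euler system described in the context. Then there exists a constant $K>0$ such that, for any $\epsilon\in\,]0,\epsilon_0]$, $$\Bigg(\int_0^T \Big\|u^\epsilon(\cdot,t)-U\big(\cdot,\tfrac{t}{\epsilon},t\big)\Big\|_{L^2(\mathbb{T}^1)}^2\,dt\Bigg)^{1/2}\le K\epsilon,\qquad \Bigg(\int_0^T \Big\|\rho^\epsilon(\cdot,t)-R\big(\cdot,\tfrac{t}{\epsilon},t\big)\Big\|_{L^2(\mathbb{T}^1)}^2\,dt\Bigg)^{1/2}\le K\epsilon,$$ where $U$ and $R$ are defined by $$U(x,\tau,t)=F(x-\tau,t)+B(x+\tau,t)+\frac{\overline{u}}{2\pi},\qquad R(x,\tau,t)=F(x-\tau,t)-B(x+\tau,t)+\frac{\overline{\rho}}{2\pi},$$ with $\overline{u}=\int_{\mathbb{T}^1}u_0(x)\,dx$, $\overline{\rho}=\int_{\mathbb{T}^1}\rho_0(x)\,dx$, and $F,B\in\mathcal{C}\big(0,T;H^s(\mathbb{T}^1)\big)$ satisfying $$\int_{\mathbb{T}^1}F(x,t)\,dx=\int_{\mathbb{T}^1}B(x,t)\,dx=0\qquad\forall\,t\in[0,T)$$ and $$\partial_tF+\partial_x\Big(\frac{\gamma+1}{4}F^2+\frac{2\overline{u}+(\gamma-1)\overline{\rho}}{4\pi}F\Big)=0,\qquad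 \partial_tB+\partial_x\Big(\frac{\gamma+1}{4}B^2+\frac{2\overline{u}-(\gamma-1)\overline{\rho}}{4\pi}B\Big)=0,$$ $$F_{|t=0}=\frac12\Big(u_0+\rho_0-\frac{\overline{u}+\overline{\rho}}{2\pi}\Big),\qquad B_{|t=0}=\frac12\Big(u_0-\rho_0-\frac{\overline{u}-\overline{\rho}}{2\pi}\Big).$$
   Context: $\mathbb{T}^1=\mathbb{R}/2\pi\mathbb{Z}$ is the one-dimensional torus of length $2\pi$; functions on $\mathbb{T}^1$ are identified with $2\pi$-periodic functions. $\gamma$ is a fixed real constant (the adiabatic coefficient). For $\epsilon>0$ (the Mach number), $(u^\epsilon,\rho^\epsilon)$ denotes the solution on $\mathbb{T}^1\times[0,T)$ of $$\partial_tu^\epsilon+\tfrac12\partial_x\big((u^\epsilon)^2\big)+\partial_x\big(q^\epsilon(\rho^\epsilon)\big)+\tfrac1\epsilon\,\partial_x\rho^\epsilon=0,\qquad \partial_t\rho^\epsilon+\partial_x(\rho^\epsilon u^\epsilon)+\tfrac1\epsilon\,\partial_xu^\epsilon=0,$$ $$u^\epsilon_{|t=0}=u_0,\qquad \rho^\epsilon_{|t=0}=\rho_0,$$ where $q^\epsilon(\rho)=\frac{\gamma-2}{2}\rho^2+\epsilon\,q_1^\epsilon(\rho)$ and $q_1^\epsilon$ is a given regular function (smooth, with derivatives bounded on bounded sets uniformly in $\epsilon\in\,]0,\epsilon_0]$). Standing facts about the solution: there is an existence time $T>0$, independent of $\epsilon$, such that for every $\epsilon>0$ the system has a unique solution $(u^\epsilon,\rho^\epsilon)$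 in $\big(\mathcal{C}(0,T;H^s(\mathbb{T}^1))\big)^2\cap\big(\mathcal{C}^1(0,T;H^{s-1}(\mathbb{T}^1))\big)^2$, and the family $(u^\epsilon,\rho^\epsilon)_{\epsilon>0}$ is bounded in $\big(\mathcal{C}(0,T;H^s(\mathbb{T}^1))\big)^2$. *)

theory Defs
  imports "HOL-Analysis.Analysis"
begin

text \<open>
  Functions on the torus of length \<open>2\<pi>\<close> are \<open>2\<pi>\<close>-periodic functions on the real line, and
  elements of \<open>L\<^sup>2\<close> or \<open>H\<^sup>\<sigma>\<close> are represented by Borel functions. No representative is singled out:
  equations in \<open>x\<close> are weak, and initial conditions hold almost everywhere. A time-dependent
  function \<open>w\<close> is curried with the time first, so that \<open>w t\<close> is the function \<open>w(\<cdot>,t)\<close>.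
\<close>

definition torus_integral ::
    "(real \<Rightarrow> 'a::{banach, second_countable_topology}) \<Rightarrow> 'a" where
  "torus_integral f = (LINT x:{0..2 * pi}|lborel. f x)"

definition torus_periodic :: "(real \<Rightarrow> real) \<Rightarrow> bool" where
  "torus_periodic f \<longleftrightarrow> (\<forall>x. f (x + 2 * pi) = f x)"

definition torus_L2 :: "(real \<Rightarrow> real) set" where
  "torus_L2 = {f. torus_periodic f \<and> f \<in> borel_measurable borel \<and>
     set_integrable lborel {0..2 * pi} (\<lambda>x. (f x)\<^sup>2)}"

definition L2_norm_torus :: "(real \<Rightarrow> real) \<Rightarrow> real" where
  "L2_norm_torus f = sqrt (torus_integral (\<lambda>x. (f x)\<^sup>2))"

definition fourier_coeff :: "(real \<Rightarrow> real) \<Rightarrow> int \<Rightarrow> complex" where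
  "fourier_coeff f k =
     torus_integral (\<lambda>x. complex_of_real (f x) * cis (- (of_int k * x))) / (2 * pi)"

definition sobolev :: "real \<Rightarrow> (real \<Rightarrow> real) set" where
  "sobolev \<sigma> = {f \<in> torus_L2.
     (\<lambda>k::int. (1 + (of_int k)\<^sup>2) powr \<sigma> * (cmod (fourier_coeff f k))\<^sup>2) summable_on UNIV}"

definition sobolev_norm :: "real \<Rightarrow> (real \<Rightarrow> real) \<Rightarrow> real" where
  "sobolev_norm \<sigma> f =
     sqrt (\<Sum>\<^sub>\<infinity>k::int. (1 + (of_int k)\<^sup>2) powr \<sigma> * (cmod (fourier_coeff f k))\<^sup>2)"

text \<open>The spaces \<open>C(0,T; H\<^sup>\<sigma>)\<close> and \<open>C\<^sup>1(0,T; H\<^sup>\<sigma>)\<close> refer to the half-open interval \<open>[0,T)\<close>.\<close>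

definition C0_sobolev :: "real \<Rightarrow> real \<Rightarrow> (real \<Rightarrow> real \<Rightarrow> real) set" where
  "C0_sobolev T \<sigma> = {w. \<forall>t\<in>{0..<T}. w t \<in> sobolev \<sigma> \<and>
     ((\<lambda>r. sobolev_norm \<sigma> (\<lambda>x. w r x - w t x)) \<longlongrightarrow> 0) (at t within {0..<T})}"

definition has_time_derivative ::
    "real \<Rightarrow> real \<Rightarrow> (real \<Rightarrow> real \<Rightarrow> real) \<Rightarrow> (real \<Rightarrow> real \<Rightarrow> real) \<Rightarrow> bool" where
  "has_time_derivative T \<sigma> w w' \<longleftrightarrow> (\<forall>t\<in>{0..<T}. w t \<in> sobolev \<sigma> \<and> w' t \<in> sobolev \<sigma> \<and>
     ((\<lambda>r. sobolev_norm \<sigma> (\<lambda>x. (w r x - w t x) / (r - t) - w' t x)) \<longlongrightarrow> 0)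
       (at t within {0..<T}))"

definition C1_sobolev :: "real \<Rightarrow> real \<Rightarrow> (real \<Rightarrow> real \<Rightarrow> real) set" where
  "C1_sobolev T \<sigma> = {w \<in> C0_sobolev T \<sigma>. \<exists>w'\<in>C0_sobolev T \<sigma>. has_time_derivative T \<sigma> w w'}"

definition smooth :: "(real \<Rightarrow> real) \<Rightarrow> bool" where
  "smooth f \<longleftrightarrow> (\<forall>n x. (deriv ^^ n) f differentiable (at x))"

text \<open>\<open>g\<close> is the derivative of \<open>f\<close> in the sense of distributions on the torus.\<close>

definition has_weak_derivative :: "(real \<Rightarrow> real) \<Rightarrow> (real \<Rightarrow> real) \<Rightarrow> bool" where
  "has_weak_derivative f g \<longleftrightarrow>
     set_integrable lborel {0..2 * pi} f \<and> set_integrable lborel {0..2 * pi} g \<and>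
     (\<forall>\<phi>. smooth \<phi> \<and> torus_periodic \<phi> \<longrightarrow>
        torus_integral (\<lambda>x. f x * deriv \<phi> x) = - torus_integral (\<lambda>x. g x * \<phi> x))"

text \<open>
  \<open>\<partial>\<^sub>t w + \<partial>\<^sub>x f = 0\<close> on \<open>[0,T)\<close>, with \<open>\<partial>\<^sub>t\<close> the derivative of an \<open>H\<^sup>\<sigma>\<close>-valued function (one-sided
  at \<open>0\<close>).
\<close>

definition conservation_law ::
    "real \<Rightarrow> real \<Rightarrow> (real \<Rightarrow> real \<Rightarrow> real) \<Rightarrow> (real \<Rightarrow> real \<Rightarrow> real) \<Rightarrow> bool" where
  "conservation_law T \<sigma> w f \<longleftrightarrow> (\<exists>w'. has_time_derivative T \<sigma> w w' \<and>
     (\<forall>t\<in>{0..<T}. has_weak_derivative (f t) (\<lambda>x. - w' t x)))"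

definition admissible_q1 :: "real \<Rightarrow> (real \<Rightarrow> real \<Rightarrow> real) \<Rightarrow> bool" where
  "admissible_q1 \<epsilon>\<^sub>0 q1 \<longleftrightarrow> (\<forall>\<epsilon>>0. smooth (q1 \<epsilon>)) \<and>
     (\<forall>n\<ge>1. \<forall>M. \<exists>C. \<forall>\<epsilon>\<in>{0<..\<epsilon>\<^sub>0}. \<forall>r\<in>{-M..M}. \<bar>(deriv ^^ n) (q1 \<epsilon>) r\<bar> \<le> C)"

definition pressure :: "real \<Rightarrow> (real \<Rightarrow> real \<Rightarrow> real) \<Rightarrow> real \<Rightarrow> real \<Rightarrow> real" where
  "pressure \<gamma> q1 \<epsilon> r = (\<gamma> - 2) / 2 * r\<^sup>2 + \<epsilon> * q1 \<epsilon> r"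

definition euler_solution ::
    "real \<Rightarrow> (real \<Rightarrow> real \<Rightarrow> real) \<Rightarrow> real \<Rightarrow> real \<Rightarrow> real \<Rightarrow> (real \<Rightarrow> real) \<Rightarrow> (real \<Rightarrow> real) \<Rightarrow>
      (real \<Rightarrow> real \<Rightarrow> real) \<Rightarrow> (real \<Rightarrow> real \<Rightarrow> real) \<Rightarrow> bool" where
  "euler_solution \<gamma> q1 \<epsilon> s T u0 \<rho>0 u \<rho> \<longleftrightarrow>
     u \<in> C0_sobolev T s \<inter> C1_sobolev T (s - 1) \<and>
     \<rho> \<in> C0_sobolev T s \<inter> C1_sobolev T (s - 1) \<and>
     conservation_law T (s - 1) u
       (\<lambda>t x. (u t x)\<^sup>2 / 2 + pressure \<gamma> q1 \<epsilon> (\<rho> t x) + \<rho> t x / \<epsilon>) \<and>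
     conservation_law T (s - 1) \<rho> (\<lambda>t x. \<rho> t x * u t x + u t x / \<epsilon>) \<and>
     (AE x in lborel. u 0 x = u0 x) \<and> (AE x in lborel. \<rho> 0 x = \<rho>0 x)"

text \<open>
  A zero-mean \<open>P \<in> C(0,T; H\<^sup>s)\<close> with \<open>\<partial>\<^sub>t P + \<partial>\<^sub>x ((\<gamma> + 1)/4 P\<^sup>2 + c P) = 0\<close> and initial value \<open>P0\<close>.
  For \<open>s \<ge> 2\<close> the flux is in \<open>C(0,T; H\<^sup>s)\<close>, so \<open>\<partial>\<^sub>t P\<close> in the sense of distributions is automatically
  a derivative in \<open>H\<close> of order \<open>s - 1\<close>.
\<close>

definition profile_solution ::
    "real \<Rightarrow> real \<Rightarrow> real \<Rightarrow> real \<Rightarrow> (real \<Rightarrow> real) \<Rightarrow> (real \<Rightarrow> real \<Rightarrow> real) \<Rightarrow> bool" where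
  "profile_solution \<gamma> s T c P0 P \<longleftrightarrow>
     P \<in> C0_sobolev T s \<and>
     (\<forall>t\<in>{0..<T}. torus_integral (P t) = 0) \<and>
     conservation_law T (s - 1) P (\<lambda>t x. (\<gamma> + 1) / 4 * (P t x)\<^sup>2 + c * P t x) \<and>
     (AE x in lborel. P 0 x = P0 x)"

definition profile_pair ::
    "real \<Rightarrow> real \<Rightarrow> real \<Rightarrow> (real \<Rightarrow> real) \<Rightarrow> (real \<Rightarrow> real) \<Rightarrow>
      (real \<Rightarrow> real \<Rightarrow> real) \<Rightarrow> (real \<Rightarrow> real \<Rightarrow> real) \<Rightarrow> bool" where
  "profile_pair \<gamma> s T u0 \<rho>0 F B \<longleftrightarrow>
     (let ub = torus_integral u0; \<rho>b = torus_integral \<rho>0 in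
       profile_solution \<gamma> s T ((2 * ub + (\<gamma> - 1) * \<rho>b) / (4 * pi))
         (\<lambda>x. (u0 x + \<rho>0 x - (ub + \<rho>b) / (2 * pi)) / 2) F \<and>
       profile_solution \<gamma> s T ((2 * ub - (\<gamma> - 1) * \<rho>b) / (4 * pi))
         (\<lambda>x. (u0 x - \<rho>0 x - (ub - \<rho>b) / (2 * pi)) / 2) B)"

definition profile_U ::
    "(real \<Rightarrow> real) \<Rightarrow> (real \<Rightarrow> real \<Rightarrow> real) \<Rightarrow> (real \<Rightarrow> real \<Rightarrow> real) \<Rightarrow>
      real \<Rightarrow> real \<Rightarrow> real \<Rightarrow> real" where
  "profile_U u0 F B x \<tau> t = F t (x - \<tau>) + B t (x + \<tau>) + torus_integral u0 / (2 * pi)"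

definition profile_R ::
    "(real \<Rightarrow> real) \<Rightarrow> (real \<Rightarrow> real \<Rightarrow> real) \<Rightarrow> (real \<Rightarrow> real \<Rightarrow> real) \<Rightarrow>
      real \<Rightarrow> real \<Rightarrow> real \<Rightarrow> real" where
  "profile_R \<rho>0 F B x \<tau> t = F t (x - \<tau>) - B t (x + \<tau>) + torus_integral \<rho>0 / (2 * pi)"

text \<open>
  The norm of \<open>w\<close> in \<open>L\<^sup>2(0,T; L\<^sup>2)\<close> is at most \<open>C\<close>. Integrability is required explicitly because the
  integral of a non-integrable function is \<open>0\<close>.
\<close>

definition L2_L2_bounded :: "real \<Rightarrow> (real \<Rightarrow> real \<Rightarrow> real) \<Rightarrow> real \<Rightarrow> bool" where
  "L2_L2_bounded T w C \<longleftrightarrow>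
     (\<forall>t\<in>{0..<T}. w t \<in> torus_L2) \<and>
     set_integrable lborel {0..<T} (\<lambda>t. (L2_norm_torus (w t))\<^sup>2) \<and>
     sqrt (LINT t:{0..<T}|lborel. (L2_norm_torus (w t))\<^sup>2) \<le> C"

end

theory Submission
  imports Defs
begin

text \<open>
  The proof works with Fourier coefficients. Put \<open>v = (u + \<rho>)/2\<close> and \<open>w = (u - \<rho>)/2\<close>, each without its
  mean. The singular terms of the system transport \<open>v\<close> with speed \<open>1/\<epsilon>\<close> and \<open>w\<close> with speed \<open>-1/\<epsilon>\<close>, so
  the filtered coefficients \<open>f\<^sub>k = e\<^bsup>ikt/\<epsilon>\<^esup> v\<^sub>k\<close> and \<open>b\<^sub>k = e\<^bsup>-ikt/\<epsilon>\<^esup> w\<^sub>k\<close> have time derivatives that are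
  bounded uniformly in \<open>\<epsilon>\<close> (\<open>filtered_derivative\<close>). The equation of \<open>f\<close> is the Burgers equation of the
  profile \<open>F\<close> with three further terms, quadratic or linear, that involve \<open>b\<close>. Each of these carries
  a phase \<open>e\<^bsup>2ijt/\<epsilon>\<^esup>\<close>, where \<open>j\<close> is the frequency at which it depends on \<open>b\<close>. The phase is never
  stationary: either \<open>j\<close> is the frequency of \<open>b\<close> itself, and \<open>b\<close> has mean zero, or \<open>j\<close> is the frequency
  of the whole term, which is differentiated in \<open>x\<close>. Hence each coupling term is \<open>\<epsilon>\<close> times the time
  derivative of a bounded corrector, up to \<open>O(\<epsilon>)\<close> (\<open>corrector_derivative\<close>), and \<open>f\<close> is an approximate
  solution of the Burgers equation in the sense of \<open>approx_solution\<close> (\<open>acoustic_approx_solution\<close>).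
  The change of sign of \<open>\<rho>\<close> and \<open>\<epsilon>\<close> carries the statement over to \<open>b\<close>.

  An energy estimate shows that two approximate solutions with the same initial value and errors
  \<open>\<epsilon>\<^sub>1, \<epsilon>\<^sub>2\<close> are within \<open>O(\<epsilon>\<^sub>1 + \<epsilon>\<^sub>2)\<close> of each other in \<open>L\<^sup>2\<close> (\<open>approx_solution_stability\<close>). This is used
  twice. For two values of \<open>\<epsilon>\<close> it says that the filtered waves converge, at the rate \<open>\<epsilon>\<close> of the theorem, to a
  solution \<open>F\<close> of the Burgers equation on all of \<open>[0,T)\<close>, which inherits the uniform bound in \<open>H\<^sup>s\<close>
  (\<open>approx_solution_limit\<close>); so it is the uniform bound on the Euler solutions that excludes shocks of
  the profiles before \<open>T\<close>. For two exact solutions it is uniqueness, so that every profile is this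
  limit (\<open>profile_unique\<close>).

  The limit is at first only bounded in \<open>H\<^sup>s\<close>. Its continuity in \<open>H\<^sup>s\<close> follows because its norm is
  Lipschitz in time, by the symmetry of the cubic form that governs the \<open>H\<^sup>s\<close> energy
  (\<open>energy_cubic\<close>, \<open>burgers_norm_growth\<close>, \<open>burgers_continuous\<close>), and the derivative in \<open>H\<^sup>s\<^sup>-\<^sup>1\<close> follows from
  that (\<open>burgers_difference_quotient\<close>).

  Functions and coefficients are connected by \<open>fourier_series_AE\<close>: a function of the class considered
  is almost everywhere the sum of its absolutely convergent Fourier series. Products then become
  convolutions (\<open>fourier_coeff_mult\<close>), norms become sums (\<open>parseval\<close>), and the pressure term \<open>q\<^sub>1(\<rho>)\<close> is
  estimated in \<open>composition_derivative_H1\<close>.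
\<close>

no_notation Infinite_Set_Sum.abs_summable_on (infix "abs'_summable'_on" 50)

section \<open>Weighted norms of sequences\<close>

text \<open>
  The power \<open>\<langle>k\<rangle>\<^sup>\<sigma>\<close> of the bracket \<open>\<langle>k\<rangle> = (1 + k\<^sup>2)\<^sup>1\<^sup>/\<^sup>2\<close>.
\<close>

definition weight :: "real \<Rightarrow> int \<Rightarrow> real" where
  "weight \<sigma> k = (1 + (of_int k)\<^sup>2) powr (\<sigma> / 2)"

text \<open>
  The norm in \<open>H\<^sup>\<sigma>\<close> of the function with coefficients \<open>a\<close> is at most \<open>M\<close>. With finite partial sums
  the predicate includes summability, and it is stable under pointwise limits (\<open>sob_le_limit\<close>).
\<close>

definition sob_le :: "real \<Rightarrow> (int \<Rightarrow> complex) \<Rightarrow> real \<Rightarrow> bool" where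
  "sob_le \<sigma> a M \<longleftrightarrow> (\<forall>A. finite A \<longrightarrow> L2_set (\<lambda>k. weight \<sigma> k * cmod (a k)) A \<le> M)"

definition l1_le :: "(int \<Rightarrow> complex) \<Rightarrow> real \<Rightarrow> bool" where
  "l1_le a M \<longleftrightarrow> (\<forall>A. finite A \<longrightarrow> (\<Sum>k\<in>A. cmod (a k)) \<le> M)"

definition conv :: "(int \<Rightarrow> complex) \<Rightarrow> (int \<Rightarrow> complex) \<Rightarrow> int \<Rightarrow> complex" where
  "conv a b k = (\<Sum>\<^sub>\<infinity>l. a (k - l) * b l)"

text \<open>The symmetry of the Fourier coefficients of real functions.\<close>

definition herm :: "(int \<Rightarrow> complex) \<Rightarrow> bool" where
  "herm a \<longleftrightarrow> (\<forall>k. a (- k) = cnj (a k))"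

text \<open>
  The norm of the embedding of \<open>H\<^sup>1\<close> into the absolutely convergent series, from the Cauchy-Schwarz inequality.
\<close>

definition l1_const :: real where
  "l1_const = sqrt (\<Sum>\<^sub>\<infinity>k::int. 1 / (1 + (of_int k)\<^sup>2))"

lemma weight_pos [simp]: "weight \<sigma> k > 0"
  by (simp add: weight_def add_nonneg_eq_0_iff)

lemma weight_nonneg [simp]: "weight \<sigma> k \<ge> 0"
  by (rule less_imp_le) simp

lemma weight_0 [simp]: "weight 0 k = 1"
  by (simp add: weight_def add_nonneg_eq_0_iff)

lemma weight_minus [simp]: "weight \<sigma> (- k) = weight \<sigma> k"
  by (simp add: weight_def)

lemma weight_mono: "\<sigma> \<le> \<tau> \<Longrightarrow> weight \<sigma> k \<le> weight \<tau> k"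
  unfolding weight_def by (rule powr_mono) auto

lemma weight_add: "weight (\<sigma> + \<tau>) k = weight \<sigma> k * weight \<tau> k"
  by (simp add: weight_def powr_add[symmetric] add_divide_distrib)

lemma weight_2: "weight 2 k = 1 + (of_int k)\<^sup>2"
proof -
  have "1 + (real_of_int k)\<^sup>2 > 0" by (simp add: add_pos_nonneg)
  then show ?thesis by (simp add: weight_def)
qed

lemma weight_double: "weight (2 * \<sigma>) k = (weight \<sigma> k)\<^sup>2"
  using weight_add[of \<sigma> \<sigma> k] by (simp add: power2_eq_square)

lemma weight_1_sq: "(weight 1 k)\<^sup>2 = 1 + (of_int k)\<^sup>2"
  using weight_double[of 1 k] weight_2[of k] by simp

lemma abs_le_weight_1: "\<bar>of_int k\<bar> \<le> weight 1 k"
  by (rule power2_le_imp_le) (auto simp: weight_1_sq)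

lemma weight_1_le: "k \<noteq> 0 \<Longrightarrow> weight 1 k \<le> 2 * \<bar>of_int k\<bar>"
proof (rule power2_le_imp_le)
  assume "k \<noteq> 0"
  then have "1 \<le> \<bar>k\<bar>" by linarith
  then have "(1::int) \<le> k\<^sup>2" by (metis one_le_power power2_abs)
  then have "(1::real) \<le> (of_int k)\<^sup>2" by (metis of_int_1_le_iff of_int_power)
  then show "(weight 1 k)\<^sup>2 \<le> (2 * \<bar>of_int k\<bar>)\<^sup>2" by (simp add: weight_1_sq power_mult_distrib)
qed auto

lemma weight_abs_mono:
  assumes "0 \<le> \<sigma>" "\<bar>k\<bar> \<le> \<bar>l\<bar>" shows "weight \<sigma> k \<le> weight \<sigma> l"
proof -
  have "k\<^sup>2 \<le> l\<^sup>2" using assms by (simp add: abs_le_square_iff)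
  then have "(of_int k)\<^sup>2 \<le> ((of_int l)\<^sup>2::real)" by (metis of_int_le_iff of_int_power)
  then show ?thesis using assms unfolding weight_def by (intro powr_mono2) auto
qed

lemma weight_double_arg:
  assumes "0 \<le> \<sigma>" shows "weight \<sigma> (2 * l) \<le> 2 powr \<sigma> * weight \<sigma> l"
proof -
  have "weight \<sigma> (2 * l) \<le> (4 * (1 + (of_int l)\<^sup>2)) powr (\<sigma> / 2)"
    unfolding weight_def using assms by (intro powr_mono2) (auto simp: power_mult_distrib)
  also have "\<dots> = 4 powr (\<sigma> / 2) * weight \<sigma> l"
    unfolding weight_def by (rule powr_mult) 
  also have "(4::real) powr (\<sigma> / 2) = (2 powr 2) powr (\<sigma> / 2)" by simp
  also have "\<dots> = 2 powr \<sigma>" by (simp only: powr_powr) simp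
  finally show ?thesis .
qed

text \<open>
  The larger of \<open>\<bar>k - l\<bar>\<close> and \<open>\<bar>l\<bar>\<close> is at least \<open>\<bar>k\<bar> / 2\<close>.
\<close>

lemma weight_split:
  assumes "0 \<le> \<sigma>"
  shows "weight \<sigma> k \<le> 2 powr \<sigma> * (weight \<sigma> (k - l) + weight \<sigma> l)"
proof -
  have "\<bar>k\<bar> \<le> \<bar>2 * l\<bar> \<or> \<bar>k\<bar> \<le> \<bar>2 * (k - l)\<bar>"
    using abs_triangle_ineq[of "k - l" l] unfolding abs_mult by auto
  then have "weight \<sigma> k \<le> 2 powr \<sigma> * weight \<sigma> l \<or> weight \<sigma> k \<le> 2 powr \<sigma> * weight \<sigma> (k - l)"
    using weight_abs_mono[OF assms] weight_double_arg[OF assms] by (meson order_trans)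
  moreover have "0 \<le> 2 powr \<sigma> * weight \<sigma> l" "0 \<le> 2 powr \<sigma> * weight \<sigma> (k - l)" by auto
  ultimately show ?thesis unfolding distrib_left by linarith
qed

lemma sob_leI: "(\<And>A. finite A \<Longrightarrow> L2_set (\<lambda>k. weight \<sigma> k * cmod (a k)) A \<le> M) \<Longrightarrow> sob_le \<sigma> a M"
  by (simp add: sob_le_def)

lemma sob_leD: "sob_le \<sigma> a M \<Longrightarrow> finite A \<Longrightarrow> L2_set (\<lambda>k. weight \<sigma> k * cmod (a k)) A \<le> M"
  by (simp add: sob_le_def)

lemma sob_le_nonneg: "sob_le \<sigma> a M \<Longrightarrow> 0 \<le> M"
  using sob_leD[of \<sigma> a M "{}"] by simp

lemma sob_le_mono: "sob_le \<sigma> a M \<Longrightarrow> M \<le> N \<Longrightarrow> sob_le \<sigma> a N"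
  unfolding sob_le_def by force

lemma sob_le_comparison:
  assumes "sob_le \<sigma> a M" "0 \<le> c"
    and "\<And>k. weight \<tau> k * cmod (b k) \<le> c * (weight \<sigma> k * cmod (a k))"
  shows "sob_le \<tau> b (c * M)"
proof (rule sob_leI)
  fix A :: "int set" assume "finite A"
  have "L2_set (\<lambda>k. weight \<tau> k * cmod (b k)) A \<le> L2_set (\<lambda>k. c * (weight \<sigma> k * cmod (a k))) A"
    by (intro L2_set_mono assms) auto
  also have "\<dots> = c * L2_set (\<lambda>k. weight \<sigma> k * cmod (a k)) A"
    using assms by (simp add: L2_set_right_distrib)
  also have "\<dots> \<le> c * M" using sob_leD[OF assms(1) \<open>finite A\<close>] assms(2) by (rule mult_left_mono)
  finally show "L2_set (\<lambda>k. weight \<tau> k * cmod (b k)) A \<le> c * M" .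
qed

lemma sob_le_weaken:
  assumes "sob_le \<sigma> a M" "\<tau> \<le> \<sigma>" shows "sob_le \<tau> a M"
  using sob_le_comparison[OF assms(1), of 1 \<tau> a] weight_mono[OF assms(2)]
  by (simp add: mult_right_mono)

lemma sob_le_multiplier:
  assumes "sob_le \<sigma> a M" "0 \<le> c" "\<And>k. cmod (\<theta> k) \<le> c"
  shows "sob_le \<sigma> (\<lambda>k. \<theta> k * a k) (c * M)"
proof (rule sob_le_comparison[OF assms(1,2)])
  fix k
  have "cmod (\<theta> k) * (weight \<sigma> k * cmod (a k)) \<le> c * (weight \<sigma> k * cmod (a k))"
    by (intro mult_right_mono assms) auto
  then show "weight \<sigma> k * cmod (\<theta> k * a k) \<le> c * (weight \<sigma> k * cmod (a k))"
    by (simp add: norm_mult mult_ac)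
qed

lemma sob_le_scale:
  assumes "sob_le \<sigma> a M" shows "sob_le \<sigma> (\<lambda>k. c * a k) (cmod c * M)"
  using sob_le_multiplier[OF assms, of "cmod c" "\<lambda>_. c"] by simp

lemma sob_le_add:
  assumes "sob_le \<sigma> a M" "sob_le \<sigma> b N" shows "sob_le \<sigma> (\<lambda>k. a k + b k) (M + N)"
proof (rule sob_leI)
  fix A :: "int set" assume "finite A"
  have "L2_set (\<lambda>k. weight \<sigma> k * cmod (a k + b k)) A
      \<le> L2_set (\<lambda>k. weight \<sigma> k * cmod (a k) + weight \<sigma> k * cmod (b k)) A"
    by (intro L2_set_mono) (auto simp: distrib_left[symmetric] intro!: mult_left_mono
        norm_triangle_ineq)
  also have "\<dots> \<le> L2_set (\<lambda>k. weight \<sigma> k * cmod (a k)) A + L2_set (\<lambda>k. weight \<sigma> k * cmod (b k)) A"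
    by (rule L2_set_triangle_ineq)
  also have "\<dots> \<le> M + N" using assms \<open>finite A\<close> by (intro add_mono sob_leD)
  finally show "L2_set (\<lambda>k. weight \<sigma> k * cmod (a k + b k)) A \<le> M + N" .
qed

lemma sob_le_uminus: "sob_le \<sigma> a M \<Longrightarrow> sob_le \<sigma> (\<lambda>k. - a k) M"
  by (simp add: sob_le_def)

lemma sob_le_diff:
  assumes "sob_le \<sigma> a M" "sob_le \<sigma> b N" shows "sob_le \<sigma> (\<lambda>k. a k - b k) (M + N)"
  using sob_le_add[OF assms(1) sob_le_uminus[OF assms(2)]] by simp

lemma sob_le_0: "0 \<le> M \<Longrightarrow> sob_le \<sigma> (\<lambda>k. 0) M"
  by (simp add: sob_le_def L2_set_def)

lemma sob_le_point: "sob_le \<sigma> a M \<Longrightarrow> weight \<sigma> k * cmod (a k) \<le> M"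
  using sob_leD[of \<sigma> a M "{k}"] by (simp add: L2_set_def)

lemma sob_le_coeff: "sob_le \<sigma> a M \<Longrightarrow> 0 \<le> \<sigma> \<Longrightarrow> cmod (a k) \<le> M"
  using sob_le_point[of 0 a M k] sob_le_weaken[of \<sigma> a M 0] by simp

lemma sob_le_deriv:
  assumes "sob_le (\<sigma> + 1) a M" shows "sob_le \<sigma> (\<lambda>k. \<i> * of_int k * a k) M"
proof -
  have "weight \<sigma> k * cmod (\<i> * of_int k * a k) \<le> 1 * (weight (\<sigma> + 1) k * cmod (a k))" for k
    using mult_right_mono[OF abs_le_weight_1[of k], of "weight \<sigma> k * cmod (a k)"]
    by (simp add: norm_mult weight_add mult_ac)
  from sob_le_comparison[OF assms _ this] show ?thesis by simp
qed

text \<open>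
  At \<open>k = 0\<close> the quotient is \<open>0\<close>, so this is the primitive of mean zero.
\<close>

lemma sob_le_primitive:
  assumes "sob_le \<sigma> a M" shows "sob_le (\<sigma> + 1) (\<lambda>k. a k / (\<i> * of_int k)) (2 * M)"
proof (rule sob_le_comparison[OF assms])
  fix k
  show "weight (\<sigma> + 1) k * cmod (a k / (\<i> * of_int k)) \<le> 2 * (weight \<sigma> k * cmod (a k))"
  proof (cases "k = 0")
    case False
    then have p: "\<bar>real_of_int k\<bar> > 0" by simp
    have "weight (\<sigma> + 1) k * cmod (a k / (\<i> * of_int k))
        = weight \<sigma> k * cmod (a k) * (weight 1 k / \<bar>real_of_int k\<bar>)"
      by (simp add: norm_divide norm_mult weight_add)
    also have "\<dots> \<le> weight \<sigma> k * cmod (a k) * 2"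
      using weight_1_le[OF False] p by (intro mult_left_mono) (auto simp: divide_le_eq)
    finally show ?thesis by (simp add: mult_ac)
  qed auto
qed simp

lemma sob_le_weighted:
  "sob_le \<sigma> a M \<longleftrightarrow> sob_le 0 (\<lambda>k. of_real (weight \<sigma> k) * a k) M"
  by (simp add: sob_le_def norm_mult)

text \<open>
  Only finite sums occur, so this form of Fatou's lemma is a passage to the limit in each of them.
\<close>

lemma sob_le_limit:
  assumes "F \<noteq> bot" "\<And>k. ((\<lambda>n. a n k) \<longlongrightarrow> b k) F" "\<forall>\<^sub>F n in F. sob_le \<sigma> (a n) M"
  shows "sob_le \<sigma> b M"
proof (rule sob_leI)
  fix A :: "int set" assume "finite A"
  have "((\<lambda>n. L2_set (\<lambda>k. weight \<sigma> k * cmod (a n k)) A) \<longlongrightarrow> L2_set (\<lambda>k. weight \<sigma> k * cmod (b k)) A) F"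
    unfolding L2_set_def by (intro tendsto_intros assms)
  moreover have "\<forall>\<^sub>F n in F. L2_set (\<lambda>k. weight \<sigma> k * cmod (a n k)) A \<le> M"
    using assms(3) by eventually_elim (rule sob_leD[OF _ \<open>finite A\<close>])
  ultimately show "L2_set (\<lambda>k. weight \<sigma> k * cmod (b k)) A \<le> M"
    by (rule tendsto_upperbound[OF _ _ assms(1)])
qed

lemma sob_le_0_sum: "sob_le 0 a M \<Longrightarrow> finite A \<Longrightarrow> (\<Sum>k\<in>A. (cmod (a k))\<^sup>2) \<le> M\<^sup>2"
proof -
  assume "sob_le 0 a M" "finite A"
  then have "L2_set (\<lambda>k. cmod (a k)) A \<le> M" using sob_leD[of 0 a M A] by simp
  then have "(L2_set (\<lambda>k. cmod (a k)) A)\<^sup>2 \<le> M\<^sup>2" by (rule power_mono) simp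
  then show ?thesis by (simp add: L2_set_def sum_nonneg)
qed

lemma sob_le_0_cauchy_schwarz:
  assumes "sob_le 0 a M" "sob_le 0 b N" "finite A"
  shows "(\<Sum>k\<in>A. cmod (a k) * cmod (b k)) \<le> M * N"
proof -
  have "(\<Sum>k\<in>A. cmod (a k) * cmod (b k)) \<le> L2_set (\<lambda>k. cmod (a k)) A * L2_set (\<lambda>k. cmod (b k)) A"
    using L2_set_mult_ineq[of "\<lambda>k. cmod (a k)" "\<lambda>k. cmod (b k)" A] by simp
  also have "\<dots> \<le> M * N"
    using sob_leD[OF assms(1,3)] sob_leD[OF assms(2,3)] sob_le_nonneg[OF assms(1)]
    by (intro mult_mono) auto
  finally show ?thesis .
qed

lemma sob_le_0_finite_support:
  assumes "finite S" "\<And>k. k \<notin> S \<Longrightarrow> a k = 0"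
  shows "sob_le 0 a (L2_set (\<lambda>k. cmod (a k)) S)"
proof (rule sob_leI)
  fix A :: "int set" assume "finite A"
  then have "(\<Sum>k\<in>A. (cmod (a k))\<^sup>2) = (\<Sum>k\<in>A \<inter> S. (cmod (a k))\<^sup>2)"
    using assms by (intro sum.mono_neutral_cong_right) auto
  also have "\<dots> \<le> (\<Sum>k\<in>S. (cmod (a k))\<^sup>2)" using assms(1) by (intro sum_mono2) auto
  finally show "L2_set (\<lambda>k. weight 0 k * cmod (a k)) A \<le> L2_set (\<lambda>k. cmod (a k)) S"
    by (simp add: L2_set_def)
qed

lemma sob_le_0_reindex:
  assumes "sob_le 0 a M" "inj g" shows "sob_le 0 (\<lambda>k. a (g k)) M"
proof (rule sob_leI)
  fix S :: "int set" assume "finite S"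
  then have "L2_set (\<lambda>k. weight 0 k * cmod (a k)) (g ` S) \<le> M" by (intro sob_leD[OF assms(1)]) auto
  then show "L2_set (\<lambda>k. weight 0 k * cmod (a (g k))) S \<le> M"
    unfolding L2_set_def using assms(2) by (subst (asm) sum.reindex) (auto intro: inj_on_subset)
qed

lemma infsum_diff:
  fixes f g :: "'a \<Rightarrow> complex"
  assumes "f summable_on A" "g summable_on A"
  shows "(\<lambda>x. f x - g x) summable_on A" "infsum (\<lambda>x. f x - g x) A = infsum f A - infsum g A"
proof -
  have m: "(\<lambda>x. - g x) summable_on A" using assms(2) by (simp add: summable_on_uminus)
  show "(\<lambda>x. f x - g x) summable_on A" using summable_on_add[OF assms(1) m] by simp
  show "infsum (\<lambda>x. f x - g x) A = infsum f A - infsum g A"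
    using infsum_add[OF assms(1) m] by (simp add: infsum_uminus)
qed

lemma l1_leD: "l1_le a M \<Longrightarrow> finite A \<Longrightarrow> (\<Sum>k\<in>A. cmod (a k)) \<le> M"
  by (simp add: l1_le_def)

lemma l1_le_nonneg: "l1_le a M \<Longrightarrow> 0 \<le> M"
  using l1_leD[of a M "{}"] by simp

lemma abs_summable_if_bounded:
  fixes f :: "'a \<Rightarrow> 'b::banach"
  assumes "\<And>A. finite A \<Longrightarrow> (\<Sum>k\<in>A. norm (f k)) \<le> M"
  shows "f abs_summable_on UNIV" "norm (infsum f UNIV) \<le> M"
proof -
  show s: "f abs_summable_on UNIV"
    by (rule nonneg_bounded_partial_sums_imp_summable_on[of _ _ M])
      (auto intro!: eventuallyI assms eventually_finite_subsets_at_top_weakI)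
  have "norm (infsum f UNIV) \<le> infsum (\<lambda>k. norm (f k)) UNIV"
    using s by (rule norm_infsum_bound)
  also have "\<dots> \<le> M" using s assms by (intro infsum_le_finite_sums) auto
  finally show "norm (infsum f UNIV) \<le> M" .
qed

lemma sob_le_summable:
  assumes "sob_le \<sigma> a M"
  shows "(\<lambda>k. (weight \<sigma> k * cmod (a k))\<^sup>2) summable_on UNIV"
      "(\<Sum>\<^sub>\<infinity>k. (weight \<sigma> k * cmod (a k))\<^sup>2) \<le> M\<^sup>2"
proof -
  have "(\<Sum>k\<in>A. norm ((weight \<sigma> k * cmod (a k))\<^sup>2)) \<le> M\<^sup>2" if "finite A" for A
    using sob_le_0_sum[OF assms[unfolded sob_le_weighted[of \<sigma>]] that] by (simp add: norm_mult)
  note S = abs_summable_if_bounded[of "\<lambda>k. (weight \<sigma> k * cmod (a k))\<^sup>2", OF this]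
  show "(\<lambda>k. (weight \<sigma> k * cmod (a k))\<^sup>2) summable_on UNIV" using S(1) by simp
  show "(\<Sum>\<^sub>\<infinity>k. (weight \<sigma> k * cmod (a k))\<^sup>2) \<le> M\<^sup>2" using S(2) by simp
qed

lemma l1_le_abs_summable: "l1_le a M \<Longrightarrow> a abs_summable_on UNIV"
  by (rule abs_summable_if_bounded(1)[of a M]) (rule l1_leD)

lemma summable_inverse_square_int: "(\<lambda>k::int. 1 / (1 + (of_int k)\<^sup>2) :: real) summable_on UNIV"
proof -
  have s: "summable (\<lambda>n. 1 / (1 + (real n)\<^sup>2))"
  proof (rule summable_comparison_test_ev)
    show "\<forall>\<^sub>F n in sequentially. norm (1 / (1 + (real n)\<^sup>2)) \<le> 1 / (real n)\<^sup>2"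
      using eventually_gt_at_top[of 0]
          by eventually_elim (auto intro!: divide_left_mono mult_pos_pos add_pos_pos)
    show "summable (\<lambda>n. 1 / (real n)\<^sup>2)"
      using inverse_power_summable[of 2, where 'a=real] by (simp add: inverse_eq_divide)
  qed
  then have n: "(\<lambda>n. 1 / (1 + (real n)\<^sup>2)) summable_on UNIV"
    by (intro summable_nonneg_imp_summable_on) auto
  have "(\<lambda>k::int. 1 / (1 + (of_int k)\<^sup>2) :: real) summable_on range int"
    using n by (subst summable_on_reindex) (auto simp: o_def)
  moreover have "(\<lambda>k::int. 1 / (1 + (of_int k)\<^sup>2) :: real) summable_on range (\<lambda>n. - int n)"
    using n by (subst summable_on_reindex) (auto simp: o_def inj_def)
  moreover have "(UNIV::int set) = range int \<union> range (\<lambda>n. - int n)"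
  proof (intro set_eqI iffI)
    fix k :: int
    show "k \<in> range int \<union> range (\<lambda>n. - int n)" by (cases k rule: int_cases2) auto
  qed auto
  ultimately show ?thesis by (metis summable_on_union)
qed

lemma l1_const_nonneg [simp]: "0 \<le> l1_const"
  unfolding l1_const_def by (intro real_sqrt_ge_zero infsum_nonneg) auto

lemma sob_le_1_imp_l1_le:
  assumes "sob_le 1 a M" shows "l1_le a (l1_const * M)"
  unfolding l1_le_def
proof (intro allI impI)
  fix A :: "int set" assume A: "finite A"
  have "(\<Sum>k\<in>A. cmod (a k)) = (\<Sum>k\<in>A. \<bar>1 / weight 1 k\<bar> * \<bar>weight 1 k * cmod (a k)\<bar>)"
    by (intro sum.cong) (auto simp: abs_mult less_imp_neq[symmetric])
  also have "\<dots> \<le> L2_set (\<lambda>k. 1 / weight 1 k) A * L2_set (\<lambda>k. weight 1 k * cmod (a k)) A"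
    by (rule L2_set_mult_ineq)
  also have "\<dots> \<le> l1_const * M"
  proof (intro mult_mono)
    have "(\<Sum>k\<in>A. (1 / weight 1 k)\<^sup>2) = (\<Sum>k\<in>A. 1 / (1 + (of_int k)\<^sup>2))"
      by (simp add: power_divide weight_1_sq)
    also have "\<dots> \<le> (\<Sum>\<^sub>\<infinity>k::int. 1 / (1 + (of_int k)\<^sup>2))"
      using A by (intro finite_sum_le_infsum summable_inverse_square_int) auto
    finally show "L2_set (\<lambda>k. 1 / weight 1 k) A \<le> l1_const"
      by (simp add: L2_set_def l1_const_def)
  qed (use sob_leD[OF assms A] in auto)
  finally show "(\<Sum>k\<in>A. cmod (a k)) \<le> l1_const * M" .
qed

section \<open>Convolution estimates\<close>

text \<open>
  With \<open>j = k - l\<close> the sum runs over \<open>\<bar>p\<^sub>j\<bar>\<close> times a sum over \<open>k\<close>, to which the Cauchy-Schwarz inequality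
  applies for each \<open>j\<close>.
\<close>

lemma trilinear_finite:
  assumes a: "sob_le 0 a A" and p: "l1_le p P" and b: "sob_le 0 b B" and Z: "finite Z"
  shows "(\<Sum>z\<in>Z. cmod ((\<lambda>(k, l). a k * p (k - l) * b l) z)) \<le> A * P * B"
proof -
  define K where "K = fst ` Z"
  define J where "J = (\<lambda>(k, l). k - l) ` Z"
  have fin: "finite K" "finite J" using Z by (auto simp: K_def J_def)
  have "(\<Sum>z\<in>Z. cmod ((\<lambda>(k, l). a k * p (k - l) * b l) z))
      = (\<Sum>(k, j)\<in>(\<lambda>(k, l). (k, k - l)) ` Z. cmod (p j) * (cmod (a k) * cmod (b (k - j))))"
    by (subst sum.reindex) (auto simp: inj_on_def norm_mult case_prod_unfold mult_ac intro!:
        sum.cong)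
  also have "\<dots> \<le> (\<Sum>(k, j)\<in>K \<times> J. cmod (p j) * (cmod (a k) * cmod (b (k - j))))"
  proof (rule sum_mono2)
    show "(\<lambda>(k, l). (k, k - l)) ` Z \<subseteq> K \<times> J"
      unfolding K_def J_def by force
  qed (use fin in auto)
  also have "\<dots> = (\<Sum>j\<in>J. cmod (p j) * (\<Sum>k\<in>K. cmod (a k) * cmod (b (k - j))))"
    unfolding sum.cartesian_product[symmetric] by (subst sum.swap) (simp add: sum_distrib_left)
  also have "\<dots> \<le> (\<Sum>j\<in>J. cmod (p j) * (A * B))"
  proof (intro sum_mono mult_left_mono)
    fix j
    have "sob_le 0 (\<lambda>k. b (k - j)) B" by (rule sob_le_0_reindex[OF b]) (auto simp: inj_def)
    from sob_le_0_cauchy_schwarz[OF a this fin(1)]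
    show "(\<Sum>k\<in>K. cmod (a k) * cmod (b (k - j))) \<le> A * B" .
  qed auto
  also have "\<dots> = (\<Sum>j\<in>J. cmod (p j)) * (A * B)" by (simp add: sum_distrib_right)
  also have "\<dots> \<le> P * (A * B)"
    using l1_leD[OF p fin(2)] sob_le_nonneg[OF a] sob_le_nonneg[OF b]
        by (intro mult_right_mono) auto
  finally show "(\<Sum>z\<in>Z. cmod ((\<lambda>(k, l). a k * p (k - l) * b l) z)) \<le> A * P * B"
      by (simp add: mult_ac)
qed

lemma trilinear:
  assumes a: "sob_le 0 a A" and p: "l1_le p P" and b: "sob_le 0 b B"
  shows "(\<lambda>(k, l). a k * p (k - l) * b l) abs_summable_on UNIV"
    and "cmod (\<Sum>\<^sub>\<infinity>(k, l). a k * p (k - l) * b l) \<le> A * P * B"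
  using abs_summable_if_bounded[of "\<lambda>(k, l). a k * p (k - l) * b l", OF trilinear_finite[OF a p b]]
  by auto

lemma conv_commute: "conv a b = conv b a"
proof
  fix k
  show "conv a b k = conv b a k" unfolding conv_def
    by (rule infsum_reindex_bij_witness[of _ "\<lambda>l. k - l" "\<lambda>l. k - l"]) auto
qed

lemma conv_summable:
  assumes "sob_le 0 a A" "sob_le 0 b B"
  shows "(\<lambda>l. a (k - l) * b l) abs_summable_on UNIV"
proof (rule abs_summable_if_bounded(1)[of _ "A * B"])
  fix S :: "int set" assume S: "finite S"
  have "sob_le 0 (\<lambda>l. a (k - l)) A" by (rule sob_le_0_reindex[OF assms(1)]) (auto simp: inj_def)
  from sob_le_0_cauchy_schwarz[OF this assms(2) S]
  show "(\<Sum>l\<in>S. cmod (a (k - l) * b l)) \<le> A * B" by (simp add: norm_mult)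
qed

lemma conv_add_left:
  assumes "sob_le 0 a A" "sob_le 0 a' A'" "sob_le 0 b B"
  shows "conv (\<lambda>k. a k + a' k) b k = conv a b k + conv a' b k"
  unfolding conv_def distrib_right
  using abs_summable_summable[OF conv_summable[OF assms(1,3), of k]]
    abs_summable_summable[OF conv_summable[OF assms(2,3), of k]]
  by (rule infsum_add)

lemma conv_add_right:
  assumes "sob_le 0 a A" "sob_le 0 b B" "sob_le 0 b' B'"
  shows "conv a (\<lambda>k. b k + b' k) k = conv a b k + conv a b' k"
  using conv_add_left[OF assms(2,3,1)] by (simp add: conv_commute[of a])

lemma conv_scale_left: "conv (\<lambda>k. c * a k) b k = c * conv a b k"
  unfolding conv_def by (simp add: mult.assoc infsum_cmult_right')

lemma conv_scale_right: "conv a (\<lambda>k. c * b k) k = c * conv a b k"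
  using conv_scale_left[of c b a k] by (simp add: conv_commute[of a])

lemma conv_diff_left:
  assumes "sob_le 0 a A" "sob_le 0 a' A'" "sob_le 0 b B"
  shows "conv (\<lambda>k. a k - a' k) b k = conv a b k - conv a' b k"
  using conv_add_left[OF assms(1) sob_le_uminus[OF assms(2)] assms(3)]
    conv_scale_left[of "-1" a' b k] by simp

lemma conv_diff_right:
  assumes "sob_le 0 a A" "sob_le 0 b B" "sob_le 0 b' B'"
  shows "conv a (\<lambda>k. b k - b' k) k = conv a b k - conv a b' k"
  using conv_diff_left[OF assms(2,3,1)] by (simp add: conv_commute[of a])

lemma conv_delta: "conv a (\<lambda>k. if k = 0 then c else 0) k = c * a k"
proof -
  have "conv a (\<lambda>k. if k = 0 then c else 0) k = (\<Sum>\<^sub>\<infinity>l\<in>{0}. a (k - l) * (if l = 0 then c else 0))"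
    unfolding conv_def by (rule infsum_cong_neutral) auto
  then show ?thesis by simp
qed

lemma conv_modulation:
  "conv (\<lambda>k. cis (of_int k * \<theta>) * a k) (\<lambda>k. cis (of_int k * \<theta>) * b k) k
      = cis (of_int k * \<theta>) * conv a b k"
proof -
  have e: "cis (of_int k * \<theta>) = cis (of_int (k - l) * \<theta>) * cis (of_int l * \<theta>)" for l
    by (simp add: cis_mult algebra_simps)
  have "cis (of_int (k - l) * \<theta>) * a (k - l) * (cis (of_int l * \<theta>) * b l)
      = cis (of_int k * \<theta>) * (a (k - l) * b l)" for l
    unfolding e[of l] by (rule mult.assoc[THEN trans]) (simp add: mult.assoc mult.left_commute)
  then show ?thesis unfolding conv_def by (simp only: infsum_cmult_right')
qed

lemma conv_cmod_le:
  assumes "sob_le 0 a A" "sob_le 0 b B"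
  shows "cmod (conv a b k) \<le> (\<Sum>\<^sub>\<infinity>l. cmod (a (k - l)) * cmod (b l))"
  unfolding conv_def using norm_infsum_bound[OF conv_summable[OF assms, of k]]
      by (simp add: norm_mult)

text \<open>
  By duality: pair the convolution, cut off to a finite set, with its own conjugate and apply the
  trilinear bound. This gives \<open>Y\<^sup>2 \<le> Y P B\<close> for the norm \<open>Y\<close> on the finite set.
\<close>

lemma young:
  assumes p: "l1_le p P" and b: "sob_le 0 b B" and p2: "sob_le 0 p P'"
  shows "sob_le 0 (conv p b) (P * B)"
proof (rule sob_leI)
  fix S :: "int set" assume S: "finite S"
  define y where "y k = (if k \<in> S then cnj (conv p b k) else 0)" for k
  define Y where "Y = L2_set (\<lambda>k. cmod (conv p b k)) S"
  have Y0: "0 \<le> Y" by (simp add: Y_def)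
  have "L2_set (\<lambda>k. cmod (y k)) S = Y" by (simp add: Y_def L2_set_def y_def)
  then have y: "sob_le 0 y Y" using sob_le_0_finite_support[OF S, of y] by (simp add: y_def)
  note t = trilinear[OF y p b]
  have s: "(\<lambda>(k, l). y k * p (k - l) * b l) summable_on UNIV \<times> UNIV"
    using abs_summable_summable[OF t(1)] by simp
  have "(\<Sum>\<^sub>\<infinity>(k, l). y k * p (k - l) * b l) = (\<Sum>\<^sub>\<infinity>k. \<Sum>\<^sub>\<infinity>l. y k * p (k - l) * b l)"
    using infsum_Sigma'_banach[OF s] by simp
  also have "\<dots> = (\<Sum>\<^sub>\<infinity>k. y k * conv p b k)"
    unfolding conv_def by (simp add: mult.assoc infsum_cmult_right')
  also have "\<dots> = (\<Sum>\<^sub>\<infinity>k\<in>S. y k * conv p b k)"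
    by (rule infsum_cong_neutral) (auto simp: y_def)
  also have "\<dots> = (\<Sum>k\<in>S. of_real ((cmod (conv p b k))\<^sup>2))"
    using S by (simp add: y_def complex_norm_square mult.commute del: of_real_power)
  also have "\<dots> = of_real (Y\<^sup>2)" by (simp add: Y_def L2_set_def sum_nonneg)
  finally have "Y\<^sup>2 \<le> Y * P * B" using t(2) by (simp add: norm_power)
  then have "Y * Y \<le> Y * (P * B)" by (simp add: power2_eq_square mult.assoc)
  moreover have "0 \<le> P * B" using l1_le_nonneg[OF p] sob_le_nonneg[OF b] by simp
  ultimately have "Y \<le> P * B" using Y0 by (cases "Y = 0") auto
  then show "L2_set (\<lambda>k. weight 0 k * cmod (conv p b k)) S \<le> P * B" by (simp add: Y_def)
qed

text \<open>
  The norm of multiplication in \<open>H\<^sup>\<sigma>\<close>, see \<open>sob_le_conv\<close>.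
\<close>

definition alg_const :: "real \<Rightarrow> real" where
  "alg_const \<sigma> = 2 powr \<sigma> * (2 * l1_const)"

lemma alg_const_nonneg [simp]: "0 \<le> alg_const \<sigma>"
  by (simp add: alg_const_def)

lemma sob_le_0_conv:
  assumes "sob_le 1 a A" "sob_le 0 b B"
  shows "sob_le 0 (conv a b) (l1_const * A * B)"
  by (rule young[OF sob_le_1_imp_l1_le[OF assms(1)] assms(2) sob_le_weaken[OF assms(1)]]) simp

text \<open>
  By \<open>weight_split\<close> the weight falls on one factor, which stays square summable; the other factor is
  absolutely summable because \<open>\<sigma> \<ge> 1\<close>, and Young's inequality applies.
\<close>

lemma sob_le_conv:
  assumes \<sigma>: "1 \<le> \<sigma>" and a: "sob_le \<sigma> a A" and b: "sob_le \<sigma> b B"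
  shows "sob_le \<sigma> (conv a b) (alg_const \<sigma> * (A * B))"
proof -
  define na where "na k = complex_of_real (cmod (a k))" for k
  define nb where "nb k = complex_of_real (cmod (b k))" for k
  define wa where "wa k = complex_of_real (weight \<sigma> k * cmod (a k))" for k
  define wb where "wb k = complex_of_real (weight \<sigma> k * cmod (b k))" for k
  have a1: "sob_le 1 a A" and b1: "sob_le 1 b B" using a b \<sigma> by (auto intro: sob_le_weaken)
  have na: "sob_le 1 na A" and nb: "sob_le 1 nb B"
    using a1 b1 by (auto simp: sob_le_def na_def nb_def)
  have wa: "sob_le 0 wa A" and wb: "sob_le 0 wb B"
    using a b by (auto simp: sob_le_def wa_def wb_def norm_mult)
  have na0: "sob_le 0 na A" and nb0: "sob_le 0 nb B"
    using na nb by (auto intro: sob_le_weaken)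
  have S: "sob_le 0 (\<lambda>k. conv na wb k + conv nb wa k) (l1_const * A * B + l1_const * B * A)"
    by (intro sob_le_add sob_le_0_conv na nb wa wb)
  have "sob_le \<sigma> (conv a b) (2 powr \<sigma> * (l1_const * A * B + l1_const * B * A))"
  proof (rule sob_le_comparison[OF S])
    fix k
    have s1: "(\<lambda>l. na (k - l) * wb l) summable_on UNIV" "(\<lambda>l. wa (k - l) * nb l) summable_on UNIV"
      using conv_summable[OF na0 wb] conv_summable[OF wa nb0] by (auto intro: abs_summable_summable)
    define m where "m l = weight \<sigma> k * (cmod (a (k - l)) * cmod (b l))" for l
    define n where "n l = 2 powr \<sigma> * (cmod (a (k - l)) * (weight \<sigma> l * cmod (b l))
        + weight \<sigma> (k - l) * cmod (a (k - l)) * cmod (b l))" for l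
    have sm: "m summable_on UNIV"
      unfolding m_def using conv_summable[OF sob_le_weaken[OF a] sob_le_weaken[OF b], of k] \<sigma>
      by (intro summable_on_cmult_right) (auto simp: norm_mult)
    have n_eq: "complex_of_real (n l) = 2 powr \<sigma> * (na (k - l) * wb l + wa (k - l) * nb l)" for l
      by (simp add: n_def na_def nb_def wa_def wb_def)
    have sn': "(\<lambda>l. complex_of_real (n l)) summable_on UNIV"
      unfolding n_eq by (intro summable_on_cmult_right summable_on_add s1)
    then have sn: "n summable_on UNIV" by (metis Re_complex_of_real summable_on_Re summable_on_cong)
    have "weight \<sigma> k * cmod (conv a b k) \<le> weight \<sigma> k * (\<Sum>\<^sub>\<infinity>l. cmod (a (k - l)) * cmod (b l))"
      using \<sigma> by (intro mult_left_mono conv_cmod_le[OF sob_le_weaken[OF a] sob_le_weaken[OF b]])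
          auto
    also have "\<dots> = infsum m UNIV"
      unfolding m_def by (simp add: infsum_cmult_right')
    also have "\<dots> \<le> infsum n UNIV"
    proof (rule infsum_mono[OF sm sn])
      fix l
      have "m l \<le> 2 powr \<sigma> * (weight \<sigma> (k - l) + weight \<sigma> l) * (cmod (a (k - l)) * cmod (b l))"
        unfolding m_def using \<sigma> by (intro mult_right_mono weight_split) auto
      then show "m l \<le> n l" by (simp add: n_def algebra_simps)
    qed
    also have "\<dots> \<le> \<bar>infsum n UNIV\<bar>" by simp
    also have "\<dots> = cmod (\<Sum>\<^sub>\<infinity>l. complex_of_real (n l))"
      using infsumI[OF has_sum_of_real[OF has_sum_infsum[OF sn]]] by (metis norm_of_real)
    also have "(\<Sum>\<^sub>\<infinity>l. complex_of_real (n l)) = 2 powr \<sigma> * (conv na wb k + conv wa nb k)"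
      unfolding n_eq conv_def using s1 by (simp add: infsum_cmult_right' infsum_add)
    also have "cmod \<dots> = 2 powr \<sigma> * cmod (conv na wb k + conv nb wa k)"
      by (simp add: norm_mult conv_commute[of wa])
    finally show "weight \<sigma> k * cmod (conv a b k)
        \<le> 2 powr \<sigma> * (weight 0 k * cmod (conv na wb k + conv nb wa k))"
      by simp
  qed auto
  then show ?thesis by (simp add: alg_const_def algebra_simps)
qed

section \<open>Hermitian sequences and energy identities\<close>

lemma hermD: "herm a \<Longrightarrow> a (- k) = cnj (a k)" by (simp add: herm_def)

lemma herm_add: "herm a \<Longrightarrow> herm b \<Longrightarrow> herm (\<lambda>k. a k + b k)" by (simp add: herm_def)

lemma herm_diff: "herm a \<Longrightarrow> herm b \<Longrightarrow> herm (\<lambda>k. a k - b k)" by (simp add: herm_def)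

lemma herm_scale: "herm a \<Longrightarrow> herm (\<lambda>k. complex_of_real c * a k)" by (simp add: herm_def)

lemma herm_0: "herm (\<lambda>k. 0)" by (simp add: herm_def)

lemma herm_deriv: "herm a \<Longrightarrow> herm (\<lambda>k. \<i> * of_int k * a k)" by (simp add: herm_def)

lemma herm_primitive: "herm a \<Longrightarrow> herm (\<lambda>k. a k / (\<i> * of_int k))" by (simp add: herm_def)

lemma herm_modulation: "herm a \<Longrightarrow> herm (\<lambda>k. cis (of_int k * \<theta>) * a k)"
  by (simp add: herm_def cis_cnj)

lemma herm_conv: assumes "herm a" "herm b" shows "herm (conv a b)"
  unfolding herm_def
proof
  fix k
  have "conv a b (- k) = (\<Sum>\<^sub>\<infinity>l. a (- (k - l)) * b (- l))"
    unfolding conv_def by (rule infsum_reindex_bij_witness[of _ uminus uminus]) auto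
  also have "\<dots> = (\<Sum>\<^sub>\<infinity>l. cnj (a (k - l) * b l))" using assms by (simp only: hermD complex_cnj_mult)
  finally show "conv a b (- k) = cnj (conv a b k)" by (simp only: conv_def infsum_cnj)
qed

lemma herm_limit:
  assumes "F \<noteq> bot" "\<And>k. ((\<lambda>n. a n k) \<longlongrightarrow> b k) F" "\<forall>\<^sub>F n in F. herm (a n)"
  shows "herm b"
  unfolding herm_def
proof
  fix k
  have "((\<lambda>n. cnj (a n k)) \<longlongrightarrow> cnj (b k)) F" by (intro tendsto_intros assms)
  moreover have "\<forall>\<^sub>F n in F. cnj (a n k) = a n (- k)"
    using assms(3) by eventually_elim (simp add: herm_def)
  ultimately have "((\<lambda>n. a n (- k)) \<longlongrightarrow> cnj (b k)) F" by (rule Lim_transform_eventually)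
  with assms(1,2) show "b (- k) = cnj (b k)" by (metis tendsto_unique)
qed

text \<open>
  Conjugation exchanges the summation indices, because \<open>p\<close> is hermitian, and so moves the multiplier
  from one factor \<open>D\<close> to the other.
\<close>

lemma trilinear_symbol_transport:
  assumes p: "herm p"
    and S: "(\<lambda>(k, l). cnj (h k * D k) * p (k - l) * D l) abs_summable_on UNIV"
  shows "cnj (\<Sum>\<^sub>\<infinity>(k, l). cnj (h k * D k) * p (k - l) * D l)
     = (\<Sum>\<^sub>\<infinity>(k, l). h l * (cnj (D k) * p (k - l) * D l))"
    (is "cnj ?X = ?Y")
proof -
  have "cnj ?X = (\<Sum>\<^sub>\<infinity>z. cnj ((\<lambda>(k, l). cnj (h k * D k) * p (k - l) * D l) z))"
    by simp
  also have "\<dots> = (\<Sum>\<^sub>\<infinity>(k, l). h l * (cnj (D k) * p (k - l) * D l))"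
  proof (rule infsum_reindex_bij_witness[of _ prod.swap prod.swap])
    fix z :: "int \<times> int"
    obtain k l where z: "z = (k, l)" by (cases z)
    have "cnj (p (k - l)) = p (l - k)" using hermD[OF p, of "k - l"] by simp
    then show "(case prod.swap z of (k, l) \<Rightarrow> h l * (cnj (D k) * p (k - l) * D l)) =
         cnj (case z of (k, l) \<Rightarrow> cnj (h k * D k) * p (k - l) * D l)"
      by (simp add: z mult_ac)
  qed auto
  finally show ?thesis .
qed

lemma trilinear_eq_infsum_conv:
  assumes "(\<lambda>(k, l). a k * p (k - l) * b l) abs_summable_on UNIV"
  shows "(\<lambda>k. a k * conv p b k) summable_on UNIV"
    and "(\<Sum>\<^sub>\<infinity>(k, l). a k * p (k - l) * b l) = (\<Sum>\<^sub>\<infinity>k. a k * conv p b k)"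
proof -
  have s: "(\<lambda>(k, l). a k * p (k - l) * b l) summable_on UNIV \<times> UNIV"
    using abs_summable_summable[OF assms] by simp
  show "(\<Sum>\<^sub>\<infinity>(k, l). a k * p (k - l) * b l) = (\<Sum>\<^sub>\<infinity>k. a k * conv p b k)"
    using infsum_Sigma'_banach[OF s] by (simp add: conv_def mult.assoc infsum_cmult_right')
  show "(\<lambda>k. a k * conv p b k) summable_on UNIV"
    using summable_on_Sigma_banach[OF s] by (simp add: conv_def mult.assoc infsum_cmult_right')
qed

text \<open>
  This is \<open>\<integral> D \<partial>\<^sub>x(p D) = \<integral> (\<partial>\<^sub>x p) D\<^sup>2 / 2\<close>: the sum minus its conjugate has the factor \<open>k - l\<close>, which
  differentiates \<open>p\<close> and neither of the factors \<open>D\<close>.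
\<close>

lemma energy_transport:
  assumes p: "herm p" "sob_le 2 p P" and D: "sob_le 1 D M" "sob_le 0 D \<eta>"
  shows "(\<lambda>k. cnj (of_int k * D k) * conv p D k) summable_on UNIV"
    and "\<bar>Im (\<Sum>\<^sub>\<infinity>k. cnj (of_int k * D k) * conv p D k)\<bar> \<le> l1_const * P * \<eta>\<^sup>2"
proof -
  have p1: "l1_le p (l1_const * P)"
    by (rule sob_le_1_imp_l1_le) (rule sob_le_weaken[OF p(2)], simp)
  have kp: "l1_le (\<lambda>k. \<i> * of_int k * p k) (l1_const * P)"
    by (rule sob_le_1_imp_l1_le) (rule sob_le_deriv, simp add: p(2))
  have kD: "sob_le 0 (\<lambda>k. cnj (of_int k * D k)) M"
    using sob_le_deriv[of 0 D M] D(1) by (simp add: sob_le_def norm_mult)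
  have D': "sob_le 0 (\<lambda>k. cnj (D k)) \<eta>" using D(2) by (simp add: sob_le_def)
  note T = trilinear[OF kD p1 D(2)]
  note U = trilinear[OF D' kp D(2)]
  have kD2: "sob_le 0 (\<lambda>k. of_int k * D k) M" using kD by (simp add: sob_le_def norm_mult)
  note V = trilinear[OF D' p1 kD2]
  show "(\<lambda>k. cnj (of_int k * D k) * conv p D k) summable_on UNIV"
    by (rule trilinear_eq_infsum_conv(1)[OF T(1)])
  define X where "X = (\<Sum>\<^sub>\<infinity>(k, l). cnj (of_int k * D k) * p (k - l) * D l)"
  define Y where "Y = (\<Sum>\<^sub>\<infinity>(k, l). of_int l * (cnj (D k) * p (k - l) * D l))"
  define Z where "Z = (\<Sum>\<^sub>\<infinity>(k, l). cnj (D k) * (\<i> * of_int (k - l) * p (k - l)) * D l)"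
  have "cnj X = Y" unfolding X_def Y_def by (rule trilinear_symbol_transport[OF p(1) T(1)])
  moreover have "\<i> * (X - Y) = Z"
  proof -
    have sX: "(\<lambda>z. case z of (k, l) \<Rightarrow> cnj (of_int k * D k) * p (k - l) * D l) summable_on UNIV"
      by (rule abs_summable_summable[OF T(1)])
    have "(\<lambda>z. case z of (k, l) \<Rightarrow> of_int l * (cnj (D k) * p (k - l) * D l))
      = (\<lambda>(k, l). cnj (D k) * p (k - l) * (of_int l * D l))" by (auto simp: fun_eq_iff)
    then have sY: "(\<lambda>z. case z of (k, l) \<Rightarrow> of_int l * (cnj (D k) * p (k - l) * D l)) summable_on
        UNIV"
      using abs_summable_summable[OF V(1)] by simp
    have "\<i> * (X - Y) = (\<Sum>\<^sub>\<infinity>z. \<i> * ((case z of (k, l) \<Rightarrow> cnj (of_int k * D k) * p (k - l) * D l) -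
        (case z of (k, l) \<Rightarrow> of_int l * (cnj (D k) * p (k - l) * D l))))"
      unfolding X_def Y_def by (simp only: infsum_cmult_right' infsum_diff(2)[OF sX sY])
    also have "\<dots> = Z" unfolding Z_def
      by (intro infsum_cong) (auto simp: algebra_simps)
    finally show ?thesis .
  qed
  ultimately have "\<i> * (X - cnj X) = Z" by simp
  then have "- 2 * Im X = Re Z" by (auto simp: complex_eq_iff)
  then have "2 * \<bar>Im X\<bar> \<le> cmod Z" using abs_Re_le_cmod[of Z] by linarith
  also have "cmod Z \<le> \<eta> * (l1_const * P) * \<eta>" unfolding Z_def by (rule U(2))
  finally have "\<bar>Im X\<bar> \<le> l1_const * P * \<eta>\<^sup>2" by (simp add: power2_eq_square algebra_simps)
  then show "\<bar>Im (\<Sum>\<^sub>\<infinity>k. cnj (of_int k * D k) * conv p D k)\<bar> \<le> l1_const * P * \<eta>\<^sup>2"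
    unfolding X_def trilinear_eq_infsum_conv(2)[OF T(1)] .
qed

text \<open>
  The cubic form is symmetric in its three frequencies \<open>k\<close>, \<open>l\<close>, \<open>k - l\<close>. Conjugation moves \<open>h\<close> to the
  frequency \<open>l\<close>, and the substitution \<open>l \<mapsto> k - l\<close> moves it on to \<open>k - l\<close>, so that only the combination
  \<open>h k - h l - h (k - l)\<close> is left. It vanishes for linear \<open>h\<close>, and for other \<open>h\<close> one derivative falls on the
  factor of lowest frequency.
\<close>

lemma energy_cubic:
  fixes h :: "int \<Rightarrow> real"
  assumes F: "herm F" "sob_le 1 F M" and hF: "sob_le 0 (\<lambda>k. of_real (h k) * F k) N"
  shows "(\<lambda>k. cnj (of_real (h k) * F k) * conv F F k) summable_on UNIV"
    and "3 * Im (\<Sum>\<^sub>\<infinity>k. cnj (of_real (h k) * F k) * conv F F k)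
      = Im (\<Sum>\<^sub>\<infinity>(k, l). of_real (h k - h l - h (k - l)) * (cnj (F k) * F (k - l) * F l))"
proof -
  have F0: "sob_le 0 F M" using F(2) by (rule sob_le_weaken) simp
  have F1: "l1_le F (l1_const * M)" by (rule sob_le_1_imp_l1_le[OF F(2)])
  have hF': "sob_le 0 (\<lambda>k. cnj (of_real (h k) * F k)) N" using hF
      by (simp add: sob_le_def norm_mult)
  have F': "sob_le 0 (\<lambda>k. cnj (F k)) M" using F0 by (simp add: sob_le_def)
  note T = trilinear[OF hF' F1 F0]
  note V = trilinear[OF F' F1 hF]
  show "(\<lambda>k. cnj (of_real (h k) * F k) * conv F F k) summable_on UNIV"
    by (rule trilinear_eq_infsum_conv(1)[OF T(1)])
  define X where "X = (\<Sum>\<^sub>\<infinity>(k, l). cnj (of_real (h k) * F k) * F (k - l) * F l)"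
  define Y where "Y = (\<Sum>\<^sub>\<infinity>(k, l). of_real (h l) * (cnj (F k) * F (k - l) * F l))"
  have sX: "(\<lambda>(k, l). cnj (of_real (h k) * F k) * F (k - l) * F l) summable_on UNIV"
    by (rule abs_summable_summable[OF T(1)])
  have "(\<lambda>z. case z of (k, l) \<Rightarrow> of_real (h l) * (cnj (F k) * F (k - l) * F l))
      = (\<lambda>(k, l). cnj (F k) * F (k - l) * (of_real (h l) * F l))" by (auto simp: fun_eq_iff)
  then have sY: "(\<lambda>(k, l). of_real (h l) * (cnj (F k) * F (k - l) * F l)) summable_on UNIV"
    using abs_summable_summable[OF V(1)] by simp
  \<comment> \<open>the substitution \<open>l \<mapsto> k - l\<close>\<close>
  have sub: "(\<lambda>(k, l). of_real (h (k - l)) * (cnj (F k) * F (k - l) * F l))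
      = (\<lambda>(k, l). of_real (h l) * (cnj (F k) * F (k - l) * F l)) \<circ> (\<lambda>(k, l). (k, k - l))"
    by (auto simp: fun_eq_iff)
  have bij: "bij (\<lambda>(k::int, l). (k, k - l))"
    by (rule involuntory_imp_bij) (auto)
  have sY': "(\<lambda>(k, l). of_real (h (k - l)) * (cnj (F k) * F (k - l) * F l)) summable_on UNIV"
    unfolding sub o_def using sY summable_on_reindex_bij_betw[OF bij] by blast
  have Y': "(\<Sum>\<^sub>\<infinity>(k, l). of_real (h (k - l)) * (cnj (F k) * F (k - l) * F l)) = Y"
    unfolding sub o_def Y_def by (rule infsum_reindex_bij_betw[OF bij])
  have "(\<Sum>\<^sub>\<infinity>(k, l). of_real (h k - h l - h (k - l)) * (cnj (F k) * F (k - l) * F l))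
     = (\<Sum>\<^sub>\<infinity>z. (case z of (k, l) \<Rightarrow> cnj (of_real (h k) * F k) * F (k - l) * F l) -
         (case z of (k, l) \<Rightarrow> of_real (h l) * (cnj (F k) * F (k - l) * F l)) -
         (case z of (k, l) \<Rightarrow> of_real (h (k - l)) * (cnj (F k) * F (k - l) * F l)))"
    by (intro infsum_cong) (auto simp: algebra_simps)
  also have "\<dots> = X - Y - Y"
    unfolding infsum_diff(2)[OF infsum_diff(1)[OF sX sY] sY'] infsum_diff(2)[OF sX sY] Y' X_def
        Y_def ..
  also have "Y = cnj X"
    unfolding X_def Y_def by (rule trilinear_symbol_transport[OF F(1) T(1), symmetric])
  finally have "Im (\<Sum>\<^sub>\<infinity>(k, l). of_real (h k - h l - h (k - l)) * (cnj (F k) * F (k - l) * F l))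
      = 3 * Im X"
    by simp
  then show "3 * Im (\<Sum>\<^sub>\<infinity>k. cnj (of_real (h k) * F k) * conv F F k)
      = Im (\<Sum>\<^sub>\<infinity>(k, l). of_real (h k - h l - h (k - l)) * (cnj (F k) * F (k - l) * F l))"
    unfolding X_def trilinear_eq_infsum_conv(2)[OF T(1)] by simp
qed

text \<open>
  The case \<open>h k = k\<close>, which is \<open>\<integral> D \<partial>\<^sub>x(D\<^sup>2) = 0\<close>.
\<close>

lemma energy_burgers:
  assumes "herm D" "sob_le 1 D M"
  shows "(\<lambda>k. cnj (of_int k * D k) * conv D D k) summable_on UNIV"
    and "Im (\<Sum>\<^sub>\<infinity>k. cnj (of_int k * D k) * conv D D k) = 0"
proof -
  have "sob_le 0 (\<lambda>k. of_real (of_int k) * D k) M"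
    using sob_le_deriv[of 0 D M] assms(2) by (simp add: sob_le_def norm_mult)
  from energy_cubic[OF assms this]
  show "(\<lambda>k. cnj (of_int k * D k) * conv D D k) summable_on UNIV"
    and "Im (\<Sum>\<^sub>\<infinity>k. cnj (of_int k * D k) * conv D D k) = 0" by (simp_all add: case_prod_unfold)
qed

section \<open>Stability of approximate Burgers solutions\<close>

lemma infsum_cauchy_schwarz:
  assumes "sob_le 0 a A" "sob_le 0 b B"
  shows "(\<lambda>k. a k * b k) summable_on UNIV" "cmod (\<Sum>\<^sub>\<infinity>k. a k * b k) \<le> A * B"
proof -
  have "(\<Sum>k\<in>S. norm (a k * b k)) \<le> A * B" if "finite S" for S
    using sob_le_0_cauchy_schwarz[OF assms that] by (simp add: norm_mult)
  from abs_summable_if_bounded[of "\<lambda>k. a k * b k", OF this]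
  show "(\<lambda>k. a k * b k) summable_on UNIV" "cmod (\<Sum>\<^sub>\<infinity>k. a k * b k) \<le> A * B"
    by (auto intro: abs_summable_summable)
qed

text \<open>
  Under a bound in \<open>H\<^sup>1\<close> the frequencies above \<open>n\<close> contribute \<open>O(1/n)\<close>. Energy estimates can therefore be
  carried out for finitely many coefficients, which may be differentiated in time one by one, with an
  error that vanishes as \<open>n\<close> grows.
\<close>

lemma sob_le_tail:
  assumes "sob_le 1 a M" "0 < n"
  shows "sob_le 0 (\<lambda>k. if \<bar>k\<bar> \<le> int n then 0 else a k) (M / real n)"
proof -
  have "weight 0 k * cmod (if \<bar>k\<bar> \<le> int n then 0 else a k)
      \<le> 1 / real n * (weight 1 k * cmod (a k))" for k
  proof (cases "\<bar>k\<bar> \<le> int n")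
    case False
    then have "real n \<le> \<bar>real_of_int k\<bar>" by linarith
    also have "\<dots> \<le> weight 1 k" by (rule abs_le_weight_1)
    finally have "1 \<le> weight 1 k / real n" using assms(2) by (simp add: le_divide_eq)
    from mult_right_mono[OF this, of "cmod (a k)"] False show ?thesis by simp
  qed auto
  from sob_le_comparison[OF assms(1) _ this] show ?thesis by simp
qed

lemma low_plus_tail:
  assumes a: "sob_le 0 a A" and b: "sob_le 0 b B"
  shows "(\<Sum>\<^sub>\<infinity>k. a k * b k) = (\<Sum>k\<in>{-int n..int n}. a k * b k)
    + (\<Sum>\<^sub>\<infinity>k. a k * (if \<bar>k\<bar> \<le> int n then 0 else b k))"
proof -
  have bt: "sob_le 0 (\<lambda>k. if \<bar>k\<bar> \<le> int n then 0 else b k) B"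
    using sob_le_comparison[OF b, of 1 0 "\<lambda>k. if \<bar>k\<bar> \<le> int n then 0 else b k"] by auto
  have "(\<Sum>\<^sub>\<infinity>k. a k * b k) - (\<Sum>\<^sub>\<infinity>k. a k * (if \<bar>k\<bar> \<le> int n then 0 else b k))
    = (\<Sum>\<^sub>\<infinity>k. a k * b k - a k * (if \<bar>k\<bar> \<le> int n then 0 else b k))"
    by (rule infsum_diff(2)[OF infsum_cauchy_schwarz(1)[OF a b] infsum_cauchy_schwarz(1)[OF a bt],
        symmetric])
  also have "\<dots> = (\<Sum>\<^sub>\<infinity>k\<in>{-int n..int n}. a k * b k)"
    by (rule infsum_cong_neutral) auto
  also have "\<dots> = (\<Sum>k\<in>{-int n..int n}. a k * b k)" by simp
  finally show ?thesis by (simp add: algebra_simps)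
qed

lemma sob_le_low_tail:
  assumes "sob_le 1 a M" "0 < n"
  shows "sob_le 0 a (sqrt (\<Sum>k\<in>{-int n..int n}. (cmod (a k))\<^sup>2) + M / real n)"
proof -
  have low: "sob_le 0 (\<lambda>k. if \<bar>k\<bar>
      \<le> int n then a k else 0) (sqrt (\<Sum>k\<in>{-int n..int n}. (cmod (a k))\<^sup>2))"
  proof -
    let ?c = "\<lambda>k. if \<bar>k\<bar> \<le> int n then a k else 0"
    have "sob_le 0 ?c (L2_set (\<lambda>k. cmod (?c k)) {-int n..int n})"
      by (rule sob_le_0_finite_support) auto
    moreover have "L2_set (\<lambda>k. cmod (?c k)) {-int n..int n}
        = sqrt (\<Sum>k\<in>{-int n..int n}. (cmod (a k))\<^sup>2)"
      unfolding L2_set_def by (intro arg_cong[where f = sqrt] sum.cong) auto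
    ultimately show ?thesis by simp
  qed
  have "a = (\<lambda>k. (if \<bar>k\<bar> \<le> int n then a k else 0) + (if \<bar>k\<bar> \<le> int n then 0 else a k))" by auto
  with sob_le_add[OF low sob_le_tail[OF assms]] show ?thesis by simp
qed

lemma filterlim_int_intervals:
    "filterlim (\<lambda>n. {-int n..int n}) (finite_subsets_at_top UNIV) sequentially"
  unfolding filterlim_finite_subsets_at_top
proof (intro allI impI)
  fix A :: "int set" assume A: "finite A \<and> A \<subseteq> UNIV"
  obtain n0 where n0: "A \<subseteq> {-int n0..int n0}"
  proof -
    have "A \<subseteq> {-int (nat (\<Sum>k\<in>A. \<bar>k\<bar>))..int (nat (\<Sum>k\<in>A. \<bar>k\<bar>))}"
    proof
      fix k assume "k \<in> A"
      then have "\<bar>k\<bar> \<le> (\<Sum>k\<in>A. \<bar>k\<bar>)" using A by (intro member_le_sum) auto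
      then show "k \<in> {-int (nat (\<Sum>k\<in>A. \<bar>k\<bar>))..int (nat (\<Sum>k\<in>A. \<bar>k\<bar>))}" by auto
    qed
    then show thesis by (rule that)
  qed
  show "\<forall>\<^sub>F n in sequentially. finite {-int n..int n} \<and> A \<subseteq> {-int n..int n}
      \<and> {-int n..int n} \<subseteq> UNIV"
    using eventually_ge_at_top[of n0] by eventually_elim (use n0 in auto)
qed

lemma at_within_atLeastLessThan: "0 < t \<Longrightarrow> t < T \<Longrightarrow> at t within {0..<T} = at (t::real)"
  by (rule at_within_interior) (auto simp: interior_atLeastLessThan)

lemma gronwall:
  fixes y y' :: "real \<Rightarrow> real"
  assumes d: "\<And>t. 0 \<le> t \<Longrightarrow> t < T \<Longrightarrow> (y has_vector_derivative y' t) (at t within {0..<T})"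
    and le: "\<And>t. 0 \<le> t \<Longrightarrow> t < T \<Longrightarrow> y' t \<le> L * y t + b"
    and L: "0 \<le> L" "0 \<le> b" and t: "0 \<le> t" "t < T"
  shows "y t \<le> (y 0 + b * t) * exp (L * t)"
proof -
  define z where "z s = y s * exp (- L * s) - b * s" for s
  have dz: "(z has_vector_derivative (y' s - L * y s) * exp (- L * s) - b) (at s within {0..<T})"
    if "0 \<le> s" "s < T" for s
    unfolding z_def has_real_derivative_iff_has_vector_derivative[symmetric]
    using d[OF that, folded has_real_derivative_iff_has_vector_derivative]
    by (auto intro!: derivative_eq_intros simp: algebra_simps)
  have "z t \<le> z 0"
  proof (rule DERIV_nonpos_imp_decreasing_open[OF t(1)])
    fix s assume s: "0 < s" "s < t"
    then have "(z has_vector_derivative (y' s - L * y s) * exp (- L * s) - b) (at s)"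
      using dz[of s] t at_within_atLeastLessThan[of s T] by simp
    moreover have "(y' s - L * y s) * exp (- L * s) \<le> b * 1"
      using le[of s] s t L by (intro mult_mono) auto
    ultimately show "\<exists>D. (z has_real_derivative D) (at s) \<and> D \<le> 0"
      by (auto simp: has_real_derivative_iff_has_vector_derivative)
  next
    have "continuous_on {0..<T} z"
      using dz by (intro continuous_on_vector_derivative) auto
    then show "continuous_on {0..t} z" by (rule continuous_on_subset) (use t in auto)
  qed
  then have "y t * exp (- L * t) \<le> y 0 + b * t" by (simp add: z_def)
  then have "y t * exp (- L * t) * exp (L * t) \<le> (y 0 + b * t) * exp (L * t)"
    by (rule mult_right_mono) simp
  then show ?thesis by (simp add: mult.assoc exp_add[symmetric])
qed

text \<open>
  The coefficients \<open>f\<close> satisfy \<open>\<partial>\<^sub>t f + \<partial>\<^sub>x (a f\<^sup>2 + c f) = 0\<close> up to the error \<open>\<epsilon> R\<close>, once the time derivative is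
  taken of \<open>f + \<epsilon> G\<close> instead of \<open>f\<close>. The corrector \<open>G\<close> is bounded, but its time derivative is of size
  \<open>1/\<epsilon>\<close>, so \<open>\<epsilon> G\<close> cannot be absorbed into \<open>R\<close>.
\<close>

definition approx_solution ::
    "real \<Rightarrow> real \<Rightarrow> real \<Rightarrow> real \<Rightarrow> real \<Rightarrow> (real \<Rightarrow> int \<Rightarrow> complex) \<Rightarrow> (real \<Rightarrow> int \<Rightarrow> complex) \<Rightarrow>
      (real \<Rightarrow> int \<Rightarrow> complex) \<Rightarrow> bool" where
  "approx_solution a c T \<epsilon> M f G R \<longleftrightarrow> (\<forall>t\<in>{0..<T}.
     sob_le 2 (f t) M \<and> sob_le 1 (G t) M \<and> sob_le 0 (R t) M \<and> herm (f t) \<and> herm (G t) \<and>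
     (\<forall>k. ((\<lambda>t. f t k + of_real \<epsilon> * G t k) has_vector_derivative
        (of_real \<epsilon> * R t k - \<i> * of_int k * (of_real a * conv (f t) (f t) k + of_real c * f t k)))
        (at t within {0..<T})))"

lemma cmod_square_has_vector_derivative:
  assumes "(z has_vector_derivative z') (at t within S)"
  shows "((\<lambda>t. (cmod (z t))\<^sup>2) has_vector_derivative 2 * Re (cnj (z t) * z')) (at t within S)"
proof -
  note Re = bounded_linear.has_vector_derivative[OF bounded_linear_Re assms]
  note Im = bounded_linear.has_vector_derivative[OF bounded_linear_Im assms]
  show ?thesis
    using DERIV_add[OF DERIV_mult[OF Re[folded has_real_derivative_iff_has_vector_derivative]
        Re[folded has_real_derivative_iff_has_vector_derivative]]
      DERIV_mult[OF Im[folded has_real_derivative_iff_has_vector_derivative]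
        Im[folded has_real_derivative_iff_has_vector_derivative]]]
    unfolding has_real_derivative_iff_has_vector_derivative[symmetric] cmod_power2
    unfolding power2_eq_square by (simp add: algebra_simps)
qed

text \<open>
  The difference of the nonlinear terms of two approximate solutions, written with the quantity \<open>D\<close>
  whose time derivative is known. The terms without the small \<open>g\<close> are \<open>2 f D - D\<^sup>2\<close>, and the energy
  identities handle both of them.
\<close>

lemma conv_square_diff:
  assumes f: "sob_le 0 f F" and d: "sob_le 0 d N" and g: "sob_le 0 g P"
    and f2: "f2 = (\<lambda>k. f k - d k)" and D: "D = (\<lambda>k. d k + g k)"
  shows "conv f f k - conv f2 f2 k
    = 2 * conv f D k - conv D D k - 2 * conv f g k + conv g (\<lambda>k. D k + d k) k"
proof -
  have D0: "sob_le 0 D (N + P)" unfolding D by (intro sob_le_add d g)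
  have f20: "sob_le 0 f2 (F + N)" unfolding f2 by (intro sob_le_diff f d)
  have "conv f2 f2 k = (conv f f k - conv f d k) - (conv d f k - conv d d k)"
  proof -
    have "conv f2 f2 k = conv f f2 k - conv d f2 k"
      using conv_diff_left[OF f d f20] by (simp only: f2[symmetric])
    then show ?thesis
      using conv_diff_right[OF f f d] conv_diff_right[OF d f d] by (simp only: f2[symmetric])
  qed
  moreover have "conv D D k = (conv d d k + conv d g k) + (conv g d k + conv g g k)"
  proof -
    have "conv D D k = conv d D k + conv g D k"
      using conv_add_left[OF d g D0] by (simp only: D[symmetric])
    then show ?thesis
      using conv_add_right[OF d d g] conv_add_right[OF g d g] by (simp only: D[symmetric])
  qed
  moreover have "conv f D k = conv f d k + conv f g k"
    using conv_add_right[OF f d g] by (simp only: D[symmetric])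
  moreover have "conv g (\<lambda>k. D k + d k) k = conv g d k + conv g g k + conv g d k"
    using conv_add_right[OF g D0 d] conv_add_right[OF g d g] by (simp only: D[symmetric])
  moreover have "conv d f k = conv f d k" "conv d g k = conv g d k"
    by (simp_all add: conv_commute[of d])
  ultimately show ?thesis by (simp add: algebra_simps)
qed

text \<open>
  In \<open>2 f D - D\<^sup>2\<close> the derivative falls on \<open>f\<close>, which is bounded in \<open>H\<^sup>2\<close> (\<open>energy_transport\<close>), and the cubic
  term vanishes (\<open>energy_burgers\<close>). So \<open>D\<close> enters only through its \<open>L\<^sup>2\<close> norm, except for the tails, which
  cost its \<open>H\<^sup>1\<close> norm but carry the factor \<open>1/n\<close>.
\<close>

lemma energy_inequality:
  assumes f: "herm f" "sob_le 2 f M" and D: "herm D" "sob_le 1 D N"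
    and E: "sob_le 0 E K" and n: "0 < n"
    and D': "\<And>k. D' k = E k - \<i> * of_int k
        * (of_real a * (2 * conv f D k - conv D D k) + of_real c * D k)"
  shows "2 * (\<Sum>k\<in>{-int n..int n}. Re (cnj (D k) * D' k))
    \<le> (1 + 8 * \<bar>a\<bar> * l1_const * M) * (\<Sum>k\<in>{-int n..int n}. (cmod (D k))\<^sup>2) + K\<^sup>2
      + (8 * \<bar>a\<bar> * l1_const * M * N\<^sup>2 + 2 * \<bar>a\<bar> * N *
          (2 * (alg_const 1 * (M * N)) + alg_const 1 * (N * N))) / n"
proof -
  define I where "I = {-int n..int n}"
  define Y where "Y = (\<Sum>k\<in>I. (cmod (D k))\<^sup>2)"
  define W where "W = (\<lambda>k. 2 * conv f D k - conv D D k)"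
  define kD where "kD = (\<lambda>k. cnj (of_int k * D k))"
  define K3 where "K3 = 2 * (alg_const 1 * (M * N)) + alg_const 1 * (N * N)"
  have Y0: "0 \<le> Y" by (simp add: Y_def sum_nonneg)
  have M0: "0 \<le> M" and N0: "0 \<le> N" and K0: "0 \<le> K" using f D E by (auto dest: sob_le_nonneg)
  have f1: "sob_le 1 f M" by (rule sob_le_weaken[OF f(2)]) simp
  have f0: "sob_le 0 f M" by (rule sob_le_weaken[OF f(2)]) simp
  have W1: "sob_le 1 W K3"
    unfolding W_def K3_def
    using sob_le_diff[OF sob_le_scale[OF sob_le_conv[OF _ f1 D(2)], of 2]
        sob_le_conv[OF _ D(2) D(2)]] by simp
  have W0: "sob_le 0 W K3" by (rule sob_le_weaken[OF W1]) simp
  have kD0: "sob_le 0 kD N"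
    using sob_le_deriv[of 0 D N] D(2) by (simp add: kD_def sob_le_def norm_mult)
  define \<eta> where "\<eta> = sqrt Y + N / real n"
  have D0: "sob_le 0 D \<eta>" unfolding \<eta>_def Y_def I_def by (rule sob_le_low_tail[OF D(2) n])
  have \<eta>: "\<eta>\<^sup>2 \<le> 2 * Y + 2 * N\<^sup>2 / n"
  proof -
    have "\<eta>\<^sup>2 \<le> 2 * (sqrt Y)\<^sup>2 + 2 * (N / n)\<^sup>2"
      using zero_le_power2[of "sqrt Y - N / n"] unfolding \<eta>_def power2_sum power2_diff by linarith
    also have "(N / n)\<^sup>2 \<le> N\<^sup>2 / n"
    proof -
      have "real n \<le> (real n)\<^sup>2" using n by (simp add: power2_eq_square)
      then show ?thesis unfolding power_divide using n by (intro divide_left_mono) auto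
    qed
    finally show ?thesis using Y0 by simp
  qed
  note T1 = energy_transport[OF f D(2) D0]
  note T2 = energy_burgers[OF D]
  have full: "\<bar>Im (\<Sum>\<^sub>\<infinity>k. kD k * W k)\<bar> \<le> 2 * (l1_const * M * \<eta>\<^sup>2)"
  proof -
    have "(\<Sum>\<^sub>\<infinity>k. kD k * W k) = (\<Sum>\<^sub>\<infinity>k. 2 * (kD k * conv f D k) - kD k * conv D D k)"
      by (intro infsum_cong) (simp add: W_def algebra_simps)
    also have "\<dots> = 2 * (\<Sum>\<^sub>\<infinity>k. kD k * conv f D k) - (\<Sum>\<^sub>\<infinity>k. kD k * conv D D k)"
      using T1(1) T2(1)
      by (subst infsum_diff(2)) (auto simp: kD_def infsum_cmult_right' intro:
          summable_on_cmult_right)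
    finally show ?thesis using T1(2) T2(2) by (simp add: kD_def)
  qed
  have tail: "cmod (\<Sum>\<^sub>\<infinity>k. kD k * (if \<bar>k\<bar> \<le> int n then 0 else W k)) \<le> N * (K3 / n)"
    by (rule infsum_cauchy_schwarz(2)[OF kD0 sob_le_tail[OF W1 n]])
  have "\<bar>Im (\<Sum>k\<in>I. kD k * W k)\<bar> \<le> 2 * (l1_const * M * \<eta>\<^sup>2) + N * (K3 / n)"
    using low_plus_tail[OF kD0 W0, of n] full tail
      abs_Im_le_cmod[of "\<Sum>\<^sub>\<infinity>k. kD k * (if \<bar>k\<bar> \<le> int n then 0 else W k)"]
    unfolding I_def by simp
  then have *: "\<bar>a * Im (\<Sum>k\<in>I. kD k * W k)\<bar> \<le> \<bar>a\<bar> * (2 * (l1_const * M * \<eta>\<^sup>2) + N * (K3 / n))"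
    unfolding abs_mult by (intro mult_left_mono) auto
  have ED: "(\<Sum>k\<in>I. cmod (D k) * cmod (E k)) \<le> (Y + K\<^sup>2) / 2"
  proof -
    have "(\<Sum>k\<in>I. cmod (D k) * cmod (E k)) \<le> L2_set (\<lambda>k. cmod (D k)) I * L2_set (\<lambda>k. cmod (E k)) I"
      using L2_set_mult_ineq[of "\<lambda>k. cmod (D k)" "\<lambda>k. cmod (E k)" I] by simp
    also have "\<dots> \<le> sqrt Y * K"
      using sob_leD[OF E, of I] by (intro mult_mono) (auto simp: L2_set_def Y_def I_def sum_nonneg)
    also have "\<dots> \<le> (Y + K\<^sup>2) / 2"
      using zero_le_power2[of "sqrt Y - K"] Y0 unfolding power2_diff by simp
    finally show ?thesis .
  qed
  have "Re (cnj (D k) * D' k) = Re (cnj (D k) * E k) + a * Im (kD k * W k)" for k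
  proof -
    have "cnj (D k) * D' k = cnj (D k) * E k - \<i> * of_real a * (kD k * W k) - \<i>
        * of_real (of_int k * c * (cmod (D k))\<^sup>2)"
      unfolding D' W_def kD_def by (simp add: complex_norm_square algebra_simps del: of_real_power)
    then show ?thesis by simp
  qed
  then have "(\<Sum>k\<in>I. Re (cnj (D k) * D' k))
      = (\<Sum>k\<in>I. Re (cnj (D k) * E k)) + a * Im (\<Sum>k\<in>I. kD k * W k)"
    by (simp only: sum.distrib sum_distrib_left Im_sum)
  moreover have "(\<Sum>k\<in>I. Re (cnj (D k) * E k)) \<le> (\<Sum>k\<in>I. cmod (D k) * cmod (E k))"
  proof (rule sum_mono)
    fix k show "Re (cnj (D k) * E k) \<le> cmod (D k) * cmod (E k)"
      using complex_Re_le_cmod[of "cnj (D k) * E k"] by (simp add: norm_mult)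
  qed
  ultimately have "(\<Sum>k\<in>I. Re (cnj (D k) * D' k))
      \<le> (Y + K\<^sup>2) / 2 + \<bar>a\<bar> * (2 * (l1_const * M * \<eta>\<^sup>2) + N * (K3 / n))"
    using add_mono[OF order_trans[OF _ ED] abs_le_D1[OF *]] by simp
  then have "2 * (\<Sum>k\<in>I. Re (cnj (D k) * D' k))
      \<le> (Y + K\<^sup>2) + 2 * (\<bar>a\<bar> * (2 * (l1_const * M * \<eta>\<^sup>2) + N * (K3 / n)))"
    by (simp add: field_simps)
  also have "\<dots> \<le> (Y + K\<^sup>2) + 2
      * (\<bar>a\<bar> * (2 * (l1_const * M * (2 * Y + 2 * N\<^sup>2 / n)) + N * (K3 / n)))"
    using \<eta> M0 by (intro add_left_mono mult_left_mono add_right_mono) auto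
  also have "\<dots> = (1 + 8 * \<bar>a\<bar> * l1_const * M) * Y + K\<^sup>2
      + (8 * \<bar>a\<bar> * l1_const * M * N\<^sup>2 + 2 * \<bar>a\<bar> * N * K3) / n"
    by (simp add: add_divide_distrib algebra_simps)
  finally show ?thesis unfolding I_def Y_def K3_def .
qed

text \<open>
  Energy estimate for \<open>D = f\<^sub>1 - f\<^sub>2 + \<epsilon>\<^sub>1 G\<^sub>1 - \<epsilon>\<^sub>2 G\<^sub>2\<close>: the correctors and the remainders are \<open>O(\<epsilon>\<^sub>1 + \<epsilon>\<^sub>2)\<close>,
  so Gronwall's inequality for the sums over \<open>\<bar>k\<bar> \<le> n\<close> gives a bound by \<open>(\<epsilon>\<^sub>1 + \<epsilon>\<^sub>2)\<^sup>2 + 1/n\<close>, up to constants,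
  and \<open>n\<close> tends to infinity.
\<close>

theorem approx_solution_stability:
  fixes a c T E M :: real
  assumes E0: "0 \<le> E" and M0: "0 \<le> M" and T0: "0 \<le> T"
  obtains K where "0 \<le> K"
    "\<And>\<epsilon>1 \<epsilon>2 f1 G1 R1 f2 G2 R2 t. \<lbrakk>approx_solution a c T \<epsilon>1 M f1 G1 R1; approx_solution a c T \<epsilon>2 M
        f2 G2 R2;
      \<bar>\<epsilon>1\<bar> \<le> E; \<bar>\<epsilon>2\<bar> \<le> E; f1 0 = f2 0; t \<in> {0..<T}\<rbrakk>
      \<Longrightarrow> sob_le 0 (\<lambda>k. f1 t k - f2 t k) (K * (\<bar>\<epsilon>1\<bar> + \<bar>\<epsilon>2\<bar>))"
proof -
  define N where "N = 2 * M + 2 * M * E"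
  define K1 where "K1 = \<bar>a\<bar> * (2 * (alg_const 1 * (M * M)) + alg_const 1 * (M * (N + 2 * M)))
      + \<bar>c\<bar> * M"
  define K2 where "K2 = M + K1"
  define L where "L = 1 + 8 * \<bar>a\<bar> * l1_const * M"
  define K4 where "K4 = 8 * \<bar>a\<bar> * l1_const * M * N\<^sup>2
    + 2 * \<bar>a\<bar> * N * (2 * (alg_const 1 * (M * N)) + alg_const 1 * (N * N))"
  define K5 where "K5 = sqrt ((M\<^sup>2 + K2\<^sup>2 * T) * exp (L * T))"
  have N0: "0 \<le> N" using M0 E0 by (simp add: N_def)
  have K10: "0 \<le> K1" using M0 N0 by (simp add: K1_def)
  have L0: "0 \<le> L" using M0 by (simp add: L_def)
  have K40: "0 \<le> K4" using M0 N0 by (simp add: K4_def)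
  have K50: "0 \<le> K5" using T0 by (simp add: K5_def)
  show thesis
  proof (rule that[of "K5 + M"])
    show "0 \<le> K5 + M" using K50 M0 by simp
    fix \<epsilon>1 \<epsilon>2 f1 G1 R1 f2 G2 R2 t
    assume s1: "approx_solution a c T \<epsilon>1 M f1 G1 R1" and s2: "approx_solution a c T \<epsilon>2 M f2 G2 R2"
      and e: "\<bar>\<epsilon>1\<bar> \<le> E" "\<bar>\<epsilon>2\<bar> \<le> E" and init: "f1 0 = f2 0" and t: "t \<in> {0..<T}"
    define \<delta> where "\<delta> = \<bar>\<epsilon>1\<bar> + \<bar>\<epsilon>2\<bar>"
    have \<delta>: "0 \<le> \<delta>" "\<delta> \<le> 2 * E" using e by (auto simp: \<delta>_def)
    define g where "g t = (\<lambda>k. of_real \<epsilon>1 * G1 t k - of_real \<epsilon>2 * G2 t k)" for t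
    define d where "d t = (\<lambda>k. f1 t k - f2 t k)" for t
    define D where "D t = (\<lambda>k. d t k + g t k)" for t
    define r where "r t = (\<lambda>k. of_real \<epsilon>1 * R1 t k - of_real \<epsilon>2 * R2 t k)" for t
    define q where "q t = (\<lambda>k. of_real a
        * (conv (g t) (\<lambda>k. D t k + d t k) k - 2 * conv (f1 t) (g t) k) - of_real c * g t k)" for t
    define F where "F t = (\<lambda>k. r t k - \<i> * of_int k * q t k)" for t
    define D' where "D' t = (\<lambda>k. F t k - \<i> * of_int k
        * (of_real a * (2 * conv (f1 t) (D t) k - conv (D t) (D t) k) + of_real c * D t k))" for t
    have sol: "sob_le 2 (f1 t) M" "sob_le 1 (G1 t) M" "sob_le 0 (R1 t) M" "herm (f1 t)"
        "herm (G1 t)"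
        "sob_le 2 (f2 t) M" "sob_le 1 (G2 t) M" "sob_le 0 (R2 t) M" "herm (f2 t)" "herm (G2 t)"
      if "t \<in> {0..<T}" for t
      using s1 s2 that by (auto simp: approx_solution_def)
    have g1: "sob_le 1 (g t) (M * \<delta>)" and r0: "sob_le 0 (r t) (M * \<delta>)"
        and d1: "sob_le 1 (d t) (2 * M)"
      and hD: "herm (D t)" if "t \<in> {0..<T}" for t
    proof -
      note S = sol[OF that]
      show "sob_le 1 (g t) (M * \<delta>)" "sob_le 0 (r t) (M * \<delta>)"
        using sob_le_diff[OF sob_le_scale[OF S(2), of "of_real \<epsilon>1"] sob_le_scale[OF S(7), of
            "of_real \<epsilon>2"]]
          sob_le_diff[OF sob_le_scale[OF S(3), of "of_real \<epsilon>1"] sob_le_scale[OF S(8), of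
              "of_real \<epsilon>2"]]
        by (simp_all add: g_def r_def \<delta>_def algebra_simps)
      show "sob_le 1 (d t) (2 * M)" unfolding d_def
        using sob_le_weaken[OF sob_le_diff[OF S(1,6)], of 1] by simp
      show "herm (D t)" unfolding D_def d_def g_def
        by (rule herm_add[OF herm_diff[OF S(4) S(9)]
            herm_diff[OF herm_scale[OF S(5)] herm_scale[OF S(10)]]])
    qed
    have D1: "sob_le 1 (D t) N" if "t \<in> {0..<T}" for t
    proof -
      have "sob_le 1 (D t) (2 * M + M * \<delta>)"
        unfolding D_def by (intro sob_le_add d1 g1 that)
      moreover have "M * \<delta> \<le> 2 * M * E" using mult_left_mono[OF \<delta>(2) M0] by simp
      ultimately show ?thesis unfolding N_def by (auto elim: sob_le_mono)
    qed
    have F0: "sob_le 0 (F t) (K2 * \<delta>)" if "t \<in> {0..<T}" for t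
    proof -
      have f: "sob_le 1 (f1 t) M" by (rule sob_le_weaken[OF sol(1)[OF that]]) simp
      have "sob_le 1 (q t) (\<bar>a\<bar> * (alg_const 1 * ((M * \<delta>) * (N + 2 * M)) + 2
          * (alg_const 1 * (M * (M * \<delta>)))) + \<bar>c\<bar> * (M * \<delta>))"
        unfolding q_def
        using sob_le_diff[OF sob_le_scale[OF
            sob_le_diff[OF sob_le_conv[OF _ g1[OF that] sob_le_add[OF D1[OF that] d1[OF that]]]
           sob_le_scale[OF sob_le_conv[OF _ f g1[OF that]], of 2]], of
               "of_real a"] sob_le_scale[OF g1[OF that], of "of_real c"]]
        by simp
      then have "sob_le 1 (q t) (K1 * \<delta>)" by (simp add: K1_def algebra_simps)
      then show ?thesis unfolding F_def K2_def
        using sob_le_diff[OF r0[OF that] sob_le_deriv[of 0 "q t" "K1 * \<delta>"]]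
            by (simp add: algebra_simps)
    qed
    have dD: "((\<lambda>t. D t k) has_vector_derivative D' t k) (at t within {0..<T})" if "t \<in> {0..<T}"
        for t k
    proof -
      have "((\<lambda>t. (f1 t k + of_real \<epsilon>1 * G1 t k) - (f2 t k + of_real \<epsilon>2 * G2 t k))
          has_vector_derivative
        (of_real \<epsilon>1 * R1 t k - \<i> * of_int k *
            (of_real a * conv (f1 t) (f1 t) k + of_real c * f1 t k))
         - (of_real \<epsilon>2 * R2 t k - \<i> * of_int k *
             (of_real a * conv (f2 t) (f2 t) k + of_real c * f2 t k)))
         (at t within {0..<T})"
        using s1 s2 that by (intro has_vector_derivative_diff) (auto simp: approx_solution_def)
      moreover have "(\<lambda>t. (f1 t k + of_real \<epsilon>1 * G1 t k) - (f2 t k + of_real \<epsilon>2 * G2 t k))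
          = (\<lambda>t. D t k)"
        by (simp add: D_def d_def g_def algebra_simps)
      moreover have eq: "conv (f1 t) (f1 t) k - conv (f2 t) (f2 t) k
        = 2 * conv (f1 t) (D t) k - conv (D t) (D t) k - 2 * conv (f1 t) (g t) k + conv (g t)
            (\<lambda>k. D t k + d t k) k"
        by (rule conv_square_diff[OF sob_le_weaken[OF sol(1)[OF that]]
            sob_le_weaken[OF d1[OF that]] sob_le_weaken[OF g1[OF that]]])
          (auto simp: D_def d_def)
      have "(of_real \<epsilon>1 * R1 t k - \<i> * of_int k
          * (of_real a * conv (f1 t) (f1 t) k + of_real c * f1 t k))
         - (of_real \<epsilon>2 * R2 t k - \<i> * of_int k *
             (of_real a * conv (f2 t) (f2 t) k + of_real c * f2 t k)) = D' t k"
      proof -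
        have a: "conv (f1 t) (f1 t) k = conv (f2 t) (f2 t) k
            + (2 * conv (f1 t) (D t) k - conv (D t) (D t) k - 2 * conv (f1 t) (g t) k + conv (g t)
                (\<lambda>k. D t k + d t k) k)"
          using eq by (simp add: algebra_simps)
        have b: "D t k = f1 t k - f2 t k + g t k" by (simp add: D_def d_def)
        show ?thesis unfolding D'_def F_def q_def r_def a b by (simp add: algebra_simps)
      qed
      ultimately show ?thesis by simp
    qed
    have Y: "(\<Sum>k\<in>{-int n..int n}. (cmod (D t k))\<^sup>2)
        \<le> (M\<^sup>2 * \<delta>\<^sup>2 + (K2\<^sup>2 * \<delta>\<^sup>2 + K4 / n) * T) * exp (L * T)"
      if n: "0 < n" for n
    proof -
      have "(\<Sum>k\<in>{-int n..int n}. (cmod (D t k))\<^sup>2)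
        \<le> ((\<Sum>k\<in>{-int n..int n}. (cmod (D 0 k))\<^sup>2) + ((K2 * \<delta>)\<^sup>2 + K4 / n) * t) * exp (L * t)"
      proof (rule gronwall[where T = T])
        fix s assume "0 \<le> s" "s < T"
        then have s: "s \<in> {0..<T}" by simp
        show "((\<lambda>t. \<Sum>k\<in>{-int n..int n}. (cmod (D t k))\<^sup>2) has_vector_derivative
            (\<Sum>k\<in>{-int n..int n}. 2 * Re (cnj (D s k) * D' s k))) (at s within {0..<T})"
          by (intro has_vector_derivative_sum cmod_square_has_vector_derivative dD s)
        have "2 * (\<Sum>k\<in>{-int n..int n}. Re (cnj (D s k) * D' s k))
          \<le> L * (\<Sum>k\<in>{-int n..int n}. (cmod (D s k))\<^sup>2) + (K2 * \<delta>)\<^sup>2 + K4 / n"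
          unfolding L_def K4_def
          by (rule energy_inequality[OF sol(4,1)[OF s] hD[OF s] D1[OF s] F0[OF s] n, where c = c])
              (simp add: D'_def)
        then show "(\<Sum>k\<in>{-int n..int n}. 2 * Re (cnj (D s k) * D' s k))
          \<le> L * (\<Sum>k\<in>{-int n..int n}. (cmod (D s k))\<^sup>2) + ((K2 * \<delta>)\<^sup>2 + K4 / n)"
          by (simp add: sum_distrib_left)
      qed (use L0 K40 t in auto)
      also have "\<dots> \<le> (M\<^sup>2 * \<delta>\<^sup>2 + (K2\<^sup>2 * \<delta>\<^sup>2 + K4 / n) * T) * exp (L * T)"
      proof (intro mult_mono add_mono)
        have "D 0 = g 0" by (simp add: D_def d_def init)
        moreover have "sob_le 0 (g 0) (M * \<delta>)" using sob_le_weaken[OF g1[of 0], of 0] t by auto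
        ultimately show "(\<Sum>k\<in>{-int n..int n}. (cmod (D 0 k))\<^sup>2) \<le> M\<^sup>2 * \<delta>\<^sup>2"
          using sob_le_0_sum[of "g 0" "M * \<delta>" "{-int n..int n}"] by (simp add: power_mult_distrib)
      qed (use t L0 K40 in \<open>auto intro!: mult_left_mono add_nonneg_nonneg simp: power_mult_distrib\<close>)
      finally show ?thesis .
    qed
    have "sob_le 0 (D t) (K5 * \<delta>)"
    proof (rule sob_leI)
      fix A :: "int set" assume A: "finite A"
      have "(\<Sum>k\<in>A. (cmod (D t k))\<^sup>2) \<le> (M\<^sup>2 * \<delta>\<^sup>2 + (K2\<^sup>2 * \<delta>\<^sup>2 + 0) * T) * exp (L * T)"
      proof (rule tendsto_lowerbound)
        show "((\<lambda>n. (M\<^sup>2 * \<delta>\<^sup>2 + (K2\<^sup>2 * \<delta>\<^sup>2 + K4 / real n) * T) * exp (L * T)) \<longlongrightarrow>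
           (M\<^sup>2 * \<delta>\<^sup>2 + (K2\<^sup>2 * \<delta>\<^sup>2 + 0) * T) * exp (L * T)) sequentially"
          by (intro tendsto_intros lim_const_over_n)
        have "\<forall>\<^sub>F n in sequentially. finite {-int n..int n} \<and> A \<subseteq> {-int n..int n}
            \<and> {-int n..int n} \<subseteq> UNIV"
          using filterlim_int_intervals[unfolded filterlim_finite_subsets_at_top, rule_format, of
              A] A by simp
        then show "\<forall>\<^sub>F n in sequentially. (\<Sum>k\<in>A. (cmod (D t k))\<^sup>2)
          \<le> (M\<^sup>2 * \<delta>\<^sup>2 + (K2\<^sup>2 * \<delta>\<^sup>2 + K4 / real n) * T) * exp (L * T)"
          using eventually_gt_at_top[of 0]
        proof eventually_elim
          case (elim n)
          have "(\<Sum>k\<in>A. (cmod (D t k))\<^sup>2) \<le> (\<Sum>k\<in>{-int n..int n}. (cmod (D t k))\<^sup>2)"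
            using elim by (intro sum_mono2) auto
          with Y[of n] elim show ?case by simp
        qed
      qed simp
      then have "(\<Sum>k\<in>A. (cmod (D t k))\<^sup>2) \<le> ((M\<^sup>2 + K2\<^sup>2 * T) * exp (L * T)) * \<delta>\<^sup>2"
        by (simp add: algebra_simps)
      then have "sqrt (\<Sum>k\<in>A. (cmod (D t k))\<^sup>2) \<le> sqrt (((M\<^sup>2 + K2\<^sup>2 * T) * exp (L * T)) * \<delta>\<^sup>2)"
        by (rule real_sqrt_le_mono)
      also have "\<dots> = K5 * \<delta>" using \<delta> by (simp add: K5_def real_sqrt_mult)
      finally show "L2_set (\<lambda>k. weight 0 k * cmod (D t k)) A \<le> K5 * \<delta>" by (simp add: L2_set_def)
    qed
    moreover have "sob_le 0 (g t) (M * \<delta>)" by (rule sob_le_weaken[OF g1[OF t]]) simp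
    ultimately have "sob_le 0 (\<lambda>k. D t k - g t k) (K5 * \<delta> + M * \<delta>)" by (rule sob_le_diff)
    then show "sob_le 0 (\<lambda>k. f1 t k - f2 t k) ((K5 + M) * (\<bar>\<epsilon>1\<bar> + \<bar>\<epsilon>2\<bar>))"
      by (simp add: D_def d_def \<delta>_def algebra_simps)
  qed
qed

section \<open>Integrals and series on the torus\<close>

abbreviation integrable_T :: "(real \<Rightarrow> 'a::{banach, second_countable_topology}) \<Rightarrow> bool" where
  "integrable_T f \<equiv> set_integrable lborel {0..2 * pi} f"

lemma torus_integral_add: "integrable_T f \<Longrightarrow> integrable_T g \<Longrightarrow>
    torus_integral (\<lambda>x. f x + g x) = torus_integral f + torus_integral g"
  by (simp add: torus_integral_def)

lemma torus_integral_diff: "integrable_T f \<Longrightarrow> integrable_T g \<Longrightarrow>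
    torus_integral (\<lambda>x. f x - g x) = torus_integral f - torus_integral g"
  by (simp add: torus_integral_def)

lemma torus_integral_cmult:
  "torus_integral (\<lambda>x. (c::'a::{real_normed_field,second_countable_topology,banach}) * f x)
      = c * torus_integral f"
  by (simp add: torus_integral_def)

lemma torus_integral_of_real: "torus_integral (\<lambda>x. complex_of_real (f x))
    = of_real (torus_integral f)"
  by (simp add: torus_integral_def set_integral_complex_of_real)

lemma integrable_T_of_real: "integrable_T f \<Longrightarrow> integrable_T (\<lambda>x. complex_of_real (f x))"
  unfolding set_integrable_def
  by (drule integrable_of_real[where 'a=complex]) (simp add: scaleR_conv_of_real)

lemma torus_integral_Re: "integrable_T f \<Longrightarrow> torus_integral (\<lambda>x. Re (f x)) = Re (torus_integral f)"
  unfolding set_integrable_def torus_integral_def set_lebesgue_integral_def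
  by (drule integral_Re) simp

lemma integrable_T_continuous: "continuous_on {0..2 * pi} f \<Longrightarrow> integrable_T f"
  unfolding set_integrable_def by (rule borel_integrable_compact) auto

lemma integrable_T_0: "integrable_T (\<lambda>x. 0)"
  by (rule integrable_T_continuous) (rule continuous_on_const)

lemma integrable_T_times_bounded:
  fixes f g :: "real \<Rightarrow> 'a::{real_normed_field,second_countable_topology,banach}"
  assumes "integrable_T f" "g \<in> borel_measurable borel" "\<And>x. norm (g x) \<le> B"
  shows "integrable_T (\<lambda>x. f x * g x)"
  unfolding set_integrable_def
proof (rule Bochner_Integration.integrable_bound)
  have f: "integrable lborel (\<lambda>x. indicator {0..2 * pi} x *\<^sub>R f x)"
    using assms(1) by (simp add: set_integrable_def)
  show "integrable lborel (\<lambda>x. B *\<^sub>R (indicator {0..2 * pi} x *\<^sub>R f x))" using f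
      by (intro integrable_scaleR_right)
  have "(\<lambda>x. (indicator {0..2 * pi} x *\<^sub>R f x) * g x) \<in> borel_measurable lborel"
    using borel_measurable_integrable[OF f] assms(2) by (intro borel_measurable_times) auto
  then show "(\<lambda>x. indicator {0..2 * pi} x *\<^sub>R (f x * g x)) \<in> borel_measurable lborel"
    by simp
  have B: "0 \<le> B" using assms(3)[of 0] norm_ge_zero[of "g 0"] by linarith
  have "norm (f x) * norm (g x) \<le> B * norm (f x)" for x
    using mult_left_mono[OF assms(3)[of x], of "norm (f x)"] by (simp add: mult.commute)
  then show "AE x in lborel. norm (indicator {0..2 * pi} x *\<^sub>R (f x * g x))
      \<le> norm (B *\<^sub>R (indicator {0..2 * pi} x *\<^sub>R f x))"
    using B by (auto simp: norm_mult indicator_def)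
qed

lemma torus_integral_norm_bound:
  assumes "integrable_T g" "integrable_T h" "\<And>x. norm (g x) \<le> h x"
  shows "norm (torus_integral g) \<le> torus_integral h"
  unfolding torus_integral_def set_lebesgue_integral_def
proof (rule Bochner_Integration.integral_norm_bound_integral)
  fix x :: real
  show "norm (indicat_real {0..2 * pi} x *\<^sub>R g x) \<le> indicat_real {0..2 * pi} x *\<^sub>R h x"
    using assms(3)[of x] by (simp add: indicator_def)
qed (use assms in \<open>auto simp: set_integrable_def\<close>)

lemma torus_integral_cong_AE:
  assumes "AE x in lborel. f x = g x" "f \<in> borel_measurable borel" "g \<in> borel_measurable borel"
  shows "torus_integral f = torus_integral g"
  unfolding torus_integral_def set_lebesgue_integral_def
  by (rule integral_cong_AE) (use assms in auto)

lemma torus_integral_FTC: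
  fixes F f :: "real \<Rightarrow> 'a::euclidean_space"
  assumes "\<And>x. (F has_vector_derivative f x) (at x)" "continuous_on UNIV f"
  shows "torus_integral f = F (2 * pi) - F 0"
  unfolding torus_integral_def set_lebesgue_integral_def
  by (rule integral_FTC_Icc)
    (use assms in \<open>auto intro: has_vector_derivative_at_within continuous_on_subset\<close>)

lemma torus_integral_one: "torus_integral (\<lambda>x. 1::'a::{euclidean_space,real_normed_algebra_1})
    = of_real (2 * pi)"
proof -
  have "torus_integral (\<lambda>x. 1::'a) = of_real (2 * pi) - of_real 0"
    by (rule torus_integral_FTC) (auto intro!: derivative_eq_intros simp: of_real_def)
  then show ?thesis by simp
qed

lemma cis_has_vector_derivative:
  "((\<lambda>x. cis (c * x)) has_vector_derivative \<i> * of_real c * cis (c * x)) (at x within S)"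
proof -
  have "((\<lambda>x. exp (\<i> * of_real c * of_real x)) has_vector_derivative \<i> * of_real c
      * exp (\<i> * of_real c * of_real x)) (at x within S)"
    by (rule has_vector_derivative_real_field) (auto intro!: derivative_eq_intros)
  then show ?thesis by (simp add: cis_conv_exp mult_ac)
qed

lemma torus_integral_cis:
  "torus_integral (\<lambda>x. cis (of_int k * x)) = (if k = 0 then 2 * pi else 0)"
proof (cases "k = 0")
  case True
  then show ?thesis using torus_integral_one[where 'a=complex] by simp
next
  case False
  let ?F = "\<lambda>x. cis (of_int k * x) / (\<i> * of_int k)"
  have "torus_integral (\<lambda>x. cis (of_int k * x)) = ?F (2 * pi) - ?F 0"
  proof (rule torus_integral_FTC)
    fix x
    show "(?F has_vector_derivative cis (of_int k * x)) (at x)"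
      using False by (auto intro!: derivative_eq_intros cis_has_vector_derivative)
  qed (intro continuous_intros)
  also have "cis (of_int k * (2 * pi)) = 1"
    using cis_multiple_2pi[of "of_int k"] by (simp add: mult_ac)
  finally show ?thesis using False by simp
qed

lemma infsum_minus_finite_bound:
  fixes \<phi> :: "int \<Rightarrow> complex"
  assumes "\<And>k. cmod (\<phi> k) \<le> m k" "m summable_on UNIV" "finite A"
  shows "\<phi> summable_on UNIV" "cmod (infsum \<phi> UNIV - sum \<phi> A) \<le> infsum m UNIV - sum m A"
proof -
  have abs: "\<phi> abs_summable_on S" if "m summable_on S" for S
    using that by (rule summable_on_comparison_test) (use assms in auto)
  have mS: "m summable_on S" for S using assms(2) by (rule summable_on_subset_banach) auto
  show s: "\<phi> summable_on UNIV" using abs[OF assms(2)] by (rule abs_summable_summable)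
  have sA: "\<phi> summable_on - A" using abs[OF mS] by (rule abs_summable_summable)
  have U: "UNIV = A \<union> - A" by auto
  have "infsum \<phi> UNIV = sum \<phi> A + infsum \<phi> (- A)"
    using infsum_Un_disjoint[of \<phi> A "- A"] sA assms(3) by simp
  moreover have "infsum m UNIV = sum m A + infsum m (- A)"
    using infsum_Un_disjoint[of m A "- A"] mS assms(3) by simp
  moreover have "cmod (infsum \<phi> (- A)) \<le> infsum m (- A)"
    by (rule norm_infsum_le[OF has_sum_infsum[OF sA] has_sum_infsum[OF mS]]) (use assms in auto)
  ultimately show "cmod (infsum \<phi> UNIV - sum \<phi> A) \<le> infsum m UNIV - sum m A" by simp
qed

lemma has_vector_derivative_infsum:
  fixes \<phi> :: "int \<Rightarrow> real \<Rightarrow> complex"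
  assumes S: "convex S" and t: "t \<in> S"
    and d: "\<And>k t. t \<in> S \<Longrightarrow> (\<phi> k has_vector_derivative \<phi>' k t) (at t within S)"
    and m: "\<And>k t. t \<in> S \<Longrightarrow> cmod (\<phi>' k t) \<le> m k" "m summable_on UNIV"
    and s: "\<And>t. t \<in> S \<Longrightarrow> (\<lambda>k. \<phi> k t) summable_on UNIV"
  shows "((\<lambda>t. \<Sum>\<^sub>\<infinity>k. \<phi> k t) has_vector_derivative (\<Sum>\<^sub>\<infinity>k. \<phi>' k t)) (at t within S)"
proof -
  define f where "f n t = (\<Sum>k\<in>{-int n..int n}. \<phi> k t)" for n t
  define D where "D t = (\<Sum>\<^sub>\<infinity>k. \<phi>' k t)" for t
  have lim: "(\<lambda>n. f n t) \<longlonglongrightarrow> (\<Sum>\<^sub>\<infinity>k. \<phi> k t)" if "t \<in> S" for t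
    unfolding f_def by (rule filterlim_compose[OF infsum_tendsto[OF s[OF that]]
        filterlim_int_intervals])
  have "\<exists>g. \<forall>t\<in>S. (\<lambda>n. f n t) \<longlonglongrightarrow> g t \<and> (g has_derivative (\<lambda>h. h *\<^sub>R D t)) (at t within S)"
  proof (rule has_derivative_sequence[where f = f and S = S and ?x0.0 = t, OF S _ _ t lim[OF t]])
    fix n t assume "t \<in> S"
    then have "(f n has_vector_derivative (\<Sum>k\<in>{-int n..int n}. \<phi>' k t)) (at t within S)"
      unfolding f_def by (intro has_vector_derivative_sum d)
    then show "(f n has_derivative (\<lambda>h. h *\<^sub>R (\<Sum>k\<in>{-int n..int n}. \<phi>' k t))) (at t within S)"
      by (simp add: has_vector_derivative_def)
  next
    fix e :: real assume "0 < e"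
    have "((\<lambda>n. \<Sum>k\<in>{-int n..int n}. m k) \<longlongrightarrow> infsum m UNIV) sequentially"
      by (rule filterlim_compose[OF infsum_tendsto[OF m(2)] filterlim_int_intervals])
    then have "\<forall>\<^sub>F n in sequentially. dist (\<Sum>k\<in>{-int n..int n}. m k) (infsum m UNIV) < e"
      using \<open>0 < e\<close> by (rule tendstoD)
    then show "\<forall>\<^sub>F n in sequentially. \<forall>t\<in>S. \<forall>h. norm (h *\<^sub>R (\<Sum>k\<in>{-int n..int n}. \<phi>' k t)
        - h *\<^sub>R D t) \<le> e * norm h"
    proof eventually_elim
      case (elim n)
      show ?case
      proof (intro ballI allI)
        fix t h assume "t \<in> S"
        have "norm (D t - (\<Sum>k\<in>{-int n..int n}. \<phi>' k t)) \<le> infsum m UNIV - (\<Sum>k\<in>{-int n..int n}. m k)"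
          unfolding D_def by (rule infsum_minus_finite_bound(2)) (use m \<open>t \<in> S\<close> in auto)
        also have "\<dots> \<le> e" using elim by (simp add: dist_real_def)
        finally have "\<bar>h\<bar> * norm ((\<Sum>k\<in>{-int n..int n}. \<phi>' k t) - D t) \<le> \<bar>h\<bar> * e"
          by (intro mult_left_mono) (auto simp: norm_minus_commute)
        then show "norm (h *\<^sub>R (\<Sum>k\<in>{-int n..int n}. \<phi>' k t) - h *\<^sub>R D t) \<le> e * norm h"
          by (simp add: scaleR_diff_right[symmetric] mult.commute)
      qed
    qed
  qed
  then obtain g where g: "\<And>t. t \<in> S \<Longrightarrow> (\<lambda>n. f n t) \<longlonglongrightarrow> g t"
      "\<And>t. t \<in> S \<Longrightarrow> (g has_derivative (\<lambda>h. h *\<^sub>R D t)) (at t within S)" by blast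
  have "g u = (\<Sum>\<^sub>\<infinity>k. \<phi> k u)" if "u \<in> S" for u
    using g(1)[OF that] lim[OF that] by (rule LIMSEQ_unique)
  with has_derivative_transform[OF t _ g(2)[OF t], of "\<lambda>u. \<Sum>\<^sub>\<infinity>k. \<phi> k u"]
  show ?thesis by (simp add: has_vector_derivative_def D_def)
qed

definition fseries :: "(int \<Rightarrow> complex) \<Rightarrow> real \<Rightarrow> complex" where
  "fseries c x = (\<Sum>\<^sub>\<infinity>k. c k * cis (of_int k * x))"

text \<open>
  For hermitian \<open>c\<close> the series is real (\<open>fseries_real\<close>), and the real part only adjusts the type.
\<close>

definition rseries :: "(int \<Rightarrow> complex) \<Rightarrow> real \<Rightarrow> real" where
  "rseries c x = Re (fseries c x)"

lemma l1_le_summable: "l1_le c M \<Longrightarrow> (\<lambda>k. cmod (c k)) summable_on UNIV"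
  by (rule l1_le_abs_summable)

lemma fseries_approx:
  assumes "l1_le c M" "finite A"
  shows "cmod (fseries c x - (\<Sum>k\<in>A. c k * cis (of_int k * x)))
      \<le> (\<Sum>\<^sub>\<infinity>k. cmod (c k)) - (\<Sum>k\<in>A. cmod (c k))"
  unfolding fseries_def
  by (rule infsum_minus_finite_bound(2)[OF _ l1_le_summable[OF assms(1)] assms(2)])
      (simp add: norm_mult)

lemma fseries_summable:
  assumes "l1_le c M" shows "(\<lambda>k. c k * cis (of_int k * x)) summable_on UNIV"
  by (rule infsum_minus_finite_bound(1)[OF _ l1_le_summable[OF assms(1)], of _ "{}"])
      (simp_all add: norm_mult)

lemma fseries_bound:
  assumes "l1_le c M" shows "cmod (fseries c x) \<le> M"
proof -
  have "cmod (fseries c x) \<le> (\<Sum>\<^sub>\<infinity>k. cmod (c k))" using fseries_approx[OF assms, of "{}" x] by simp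
  also have "\<dots> \<le> M" using l1_le_summable[OF assms] l1_leD[OF assms] by (rule infsum_le_finite_sums)
  finally show ?thesis .
qed

lemma l1_tail_tendsto:
  assumes "l1_le c M"
  shows "((\<lambda>A. (\<Sum>\<^sub>\<infinity>k. cmod (c k)) - (\<Sum>k\<in>A. cmod (c k))) \<longlongrightarrow> 0) (finite_subsets_at_top UNIV)"
  using tendsto_diff[OF tendsto_const[of
      "\<Sum>\<^sub>\<infinity>k. cmod (c k)"] infsum_tendsto[OF l1_le_summable[OF assms]]] by simp

lemma fseries_continuous: assumes "l1_le c M" shows "continuous_on UNIV (fseries c)"
proof (rule uniform_limit_theorem[where F = "finite_subsets_at_top UNIV"
    and f = "\<lambda>A x. \<Sum>k\<in>A. c k * cis (of_int k * x)"])
  show "uniform_limit UNIV (\<lambda>A x. \<Sum>k\<in>A. c k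
      * cis (of_int k * x)) (fseries c) (finite_subsets_at_top UNIV)"
  proof (rule uniform_limitI)
    fix e :: real assume "0 < e"
    from tendstoD[OF l1_tail_tendsto[OF assms] this]
    have "\<forall>\<^sub>F A in finite_subsets_at_top UNIV. dist ((\<Sum>\<^sub>\<infinity>k. cmod (c k)) - (\<Sum>k\<in>A. cmod (c k))) 0
        < e" .
    moreover have "\<forall>\<^sub>F A in finite_subsets_at_top (UNIV::int set). finite A"
      by (rule eventually_finite_subsets_at_top_weakI)
    ultimately show "\<forall>\<^sub>F A in finite_subsets_at_top UNIV. \<forall>x\<in>UNIV. dist (\<Sum>k\<in>A. c k
        * cis (of_int k * x)) (fseries c x) < e"
    proof eventually_elim
      case (elim A)
      then show ?case using fseries_approx[OF assms, of A]
        by (auto simp: dist_norm norm_minus_commute[of "\<Sum>k\<in>A. c k * cis (real_of_int k * x)" for x]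
            intro: le_less_trans[OF _ abs_ge_self[THEN le_less_trans]])
    qed
  qed
qed (auto intro!: always_eventually continuous_intros)

text \<open>
  The series converges uniformly, and its tail is bounded by the tail of \<open>\<Sum> \<bar>c\<^sub>k\<bar>\<close>.
\<close>

lemma fseries_integral:
  assumes c: "l1_le c M" and f: "integrable_T f"
  shows "((\<lambda>k. c k * torus_integral (\<lambda>x. f x * cis (of_int k * x)))
      has_sum torus_integral (\<lambda>x. f x * fseries c x)) UNIV"
  unfolding has_sum_def
proof (rule Lim_null[THEN iffD2])
  have fk: "integrable_T (\<lambda>x. f x * cis (of_int k * x))" for k :: int
    by (rule integrable_T_times_bounded[OF f, of _ 1])
        (auto intro!: borel_measurable_continuous_onI continuous_intros)
  have ff: "integrable_T (\<lambda>x. f x * fseries c x)"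
    by (rule integrable_T_times_bounded[OF f, of _ M])
      (auto intro: borel_measurable_continuous_onI fseries_continuous[OF c] fseries_bound[OF c])
  have nf: "integrable_T (\<lambda>x. norm (f x))"
    using f unfolding set_integrable_def by (drule_tac integrable_norm) simp
  define B where "B = torus_integral (\<lambda>x. norm (f x))"
  show "((\<lambda>A. (\<Sum>k\<in>A. c k * torus_integral (\<lambda>x. f x * cis (of_int k * x)))
      - torus_integral (\<lambda>x. f x * fseries c x)) \<longlongrightarrow> 0) (finite_subsets_at_top UNIV)"
  proof (rule Lim_null_comparison)
    show "((\<lambda>A. B * ((\<Sum>\<^sub>\<infinity>k. cmod (c k)) - (\<Sum>k\<in>A. cmod (c k)))) \<longlongrightarrow> 0) (finite_subsets_at_top UNIV)"
      using tendsto_mult_left[OF l1_tail_tendsto[OF c], of B] by simp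
    show "\<forall>\<^sub>F A in finite_subsets_at_top UNIV. norm
        ((\<Sum>k\<in>A. c k * torus_integral (\<lambda>x. f x * cis (of_int k * x))) - torus_integral
        (\<lambda>x. f x * fseries c x))
        \<le> B * ((\<Sum>\<^sub>\<infinity>k. cmod (c k)) - (\<Sum>k\<in>A. cmod (c k)))"
    proof (rule eventually_finite_subsets_at_top_weakI)
      fix A :: "int set" assume A: "finite A" "A \<subseteq> UNIV"
      define h where "h x = (\<Sum>k\<in>A. c k * (f x * cis (of_int k * x)))" for x
      have h: "integrable_T h" unfolding h_def using A(1)
        by (induction A rule: finite_induct) (auto intro!: set_integral_add fk integrable_T_0)
      have "torus_integral h = (\<Sum>k\<in>A. c k * torus_integral (\<lambda>x. f x * cis (of_int k * x)))"
        unfolding h_def using A(1)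
      proof (induction A rule: finite_induct)
        case empty then show ?case by (simp add: torus_integral_def)
      next
        case (insert k A)
        have "integrable_T (\<lambda>x. \<Sum>k\<in>A. c k * (f x * cis (of_int k * x)))" using insert(1)
          by (induction A rule: finite_induct) (auto intro!: set_integral_add fk integrable_T_0)
        then show ?case using insert fk by (simp add: torus_integral_add torus_integral_cmult)
      qed
      then have "norm ((\<Sum>k\<in>A. c k * torus_integral (\<lambda>x. f x * cis (of_int k * x)))
          - torus_integral (\<lambda>x. f x * fseries c x))
         = norm (torus_integral (\<lambda>x. h x - f x * fseries c x))"
        using h ff by (simp add: torus_integral_diff)
      also have "\<dots> \<le> torus_integral (\<lambda>x. ((\<Sum>\<^sub>\<infinity>k. cmod (c k)) - (\<Sum>k\<in>A. cmod (c k))) * norm (f x))"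
      proof (rule torus_integral_norm_bound)
        show "integrable_T (\<lambda>x. h x - f x * fseries c x)" using h ff by (rule set_integral_diff)
        show "integrable_T (\<lambda>x. ((\<Sum>\<^sub>\<infinity>k. cmod (c k)) - (\<Sum>k\<in>A. cmod (c k))) * norm (f x))" using nf
            by simp
        fix x
        have "h x - f x * fseries c x = - f x * (fseries c x - (\<Sum>k\<in>A. c k * cis (of_int k * x)))"
          by (simp add: h_def right_diff_distrib sum_distrib_left sum_negf mult_ac)
        then have "norm (h x - f x * fseries c x)
            = norm (f x) * norm (fseries c x - (\<Sum>k\<in>A. c k * cis (of_int k * x)))"
          by (simp add: norm_mult)
        also have "\<dots> \<le> norm (f x) * ((\<Sum>\<^sub>\<infinity>k. cmod (c k)) - (\<Sum>k\<in>A. cmod (c k)))"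
          by (intro mult_left_mono fseries_approx[OF c A(1)]) auto
        finally show "norm (h x - f x * fseries c x)
            \<le> ((\<Sum>\<^sub>\<infinity>k. cmod (c k)) - (\<Sum>k\<in>A. cmod (c k))) * norm (f x)"
          by (simp add: mult.commute)
      qed
      also have "\<dots> = B * ((\<Sum>\<^sub>\<infinity>k. cmod (c k)) - (\<Sum>k\<in>A. cmod (c k)))"
        by (simp add: torus_integral_cmult B_def)
      finally show "norm ((\<Sum>k\<in>A. c k * torus_integral (\<lambda>x. f x * cis (of_int k * x)))
          - torus_integral (\<lambda>x. f x * fseries c x))
        \<le> B * ((\<Sum>\<^sub>\<infinity>k. cmod (c k)) - (\<Sum>k\<in>A. cmod (c k)))" .
    qed
  qed
qed

lemma fseries_periodic: "fseries c (x + 2 * pi) = fseries c x"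
proof -
  have "cis (of_int k * (x + 2 * pi)) = cis (of_int k * x)" for k :: int
  proof -
    have "of_int k * (x + 2 * pi) = of_int k * x + 2 * pi * of_int k" by (simp add: algebra_simps)
    then show ?thesis using cis_multiple_2pi[of "of_int k"] by (simp add: cis_mult[symmetric])
  qed
  then show ?thesis by (simp add: fseries_def)
qed

lemma fseries_translate: "fseries c (x - \<theta>) = fseries (\<lambda>k. cis (of_int k * - \<theta>) * c k) x"
proof -
  have "c k * cis (of_int k * (x - \<theta>)) = cis (of_int k * - \<theta>) * c k * cis (of_int k * x)"
      for k :: int
  proof -
    have "cis (of_int k * (x - \<theta>)) = cis (of_int k * - \<theta>) * cis (of_int k * x)"
      by (simp add: cis_mult algebra_simps)
    then show ?thesis by simp
  qed
  then show ?thesis by (simp only: fseries_def)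
qed

lemma fseries_real:
  assumes "l1_le c M" "herm c" shows "fseries c x = complex_of_real (rseries c x)"
proof -
  have "cnj (fseries c x) = (\<Sum>\<^sub>\<infinity>k. c (- k) * cis (of_int (- k) * x))"
    unfolding fseries_def infsum_cnj[symmetric] using assms(2)
    by (intro infsum_cong) (simp add: hermD cis_cnj)
  also have "\<dots> = fseries c x"
    unfolding fseries_def by (rule infsum_reindex_bij_witness[of _ uminus uminus]) auto
  finally have "Im (fseries c x) = 0"
      by (metis Im_complex_of_real complex_cnj_cancel_iff Reals_cnj_iff complex_is_Real_iff)
  then show ?thesis by (simp add: rseries_def complex_eq_iff)
qed

lemma fseries_has_vector_derivative:
  assumes "sob_le 2 c M"
  shows "(fseries c has_vector_derivative fseries (\<lambda>k. \<i> * of_int k * c k) x) (at x)"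
proof -
  have d: "sob_le 1 (\<lambda>k. \<i> * of_int k * c k) M" using sob_le_deriv[of 1 c M] assms by simp
  have s: "l1_le c (l1_const * M)" by (rule sob_le_1_imp_l1_le[OF sob_le_weaken[OF assms]]) simp
  have "((\<lambda>x. \<Sum>\<^sub>\<infinity>k. c k * cis (of_int k * x)) has_vector_derivative
      (\<Sum>\<^sub>\<infinity>k. c k * (\<i> * of_int k * cis (of_int k * x)))) (at x within UNIV)"
  proof (rule has_vector_derivative_infsum)
    fix k :: int and t :: real
    show "((\<lambda>x. c k * cis (of_int k * x)) has_vector_derivative c k
        * (\<i> * of_int k * cis (of_int k * t))) (at t within UNIV)"
      using cis_has_vector_derivative[of "of_int k" t UNIV]
          by (intro has_vector_derivative_mult_right) simp
    show "cmod (c k * (\<i> * of_int k * cis (of_int k * t))) \<le> cmod (\<i> * of_int k * c k)"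
      by (simp add: norm_mult)
    show "(\<lambda>k. cmod (\<i> * of_int k * c k)) summable_on UNIV"
      by (rule l1_le_summable[OF sob_le_1_imp_l1_le[OF d]])
  qed (auto intro: fseries_summable[OF s])
  then show ?thesis by (simp add: fseries_def[abs_def] mult_ac)
qed

lemma rseries_continuous: "l1_le c M \<Longrightarrow> continuous_on UNIV (rseries c)"
  unfolding rseries_def using fseries_continuous by (intro continuous_on_Re)

lemma rseries_measurable: "l1_le c M \<Longrightarrow> rseries c \<in> borel_measurable borel"
  by (rule borel_measurable_continuous_onI) (rule rseries_continuous)

lemma rseries_bound: "l1_le c M \<Longrightarrow> \<bar>rseries c x\<bar> \<le> M"
  unfolding rseries_def using fseries_bound[of c M x] abs_Re_le_cmod[of "fseries c x"] by linarith

lemma rseries_periodic: "torus_periodic (rseries c)"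
  by (simp add: torus_periodic_def rseries_def fseries_periodic)

lemma rseries_has_derivative:
  assumes "sob_le 2 c M"
  shows "(rseries c has_real_derivative rseries (\<lambda>k. \<i> * of_int k * c k) x) (at x)"
  unfolding has_real_derivative_iff_has_vector_derivative rseries_def
  by (rule bounded_linear.has_vector_derivative[OF bounded_linear_Re
      fseries_has_vector_derivative[OF assms]])

section \<open>Fourier coefficients\<close>

lemma fourier_coeff_rseries:
  assumes "l1_le c M" "herm c" shows "fourier_coeff (rseries c) k = c k"
proof -
  have "((\<lambda>l. c l * torus_integral (\<lambda>x. cis (- (of_int k * x)) * cis (of_int l * x))) has_sum
      torus_integral (\<lambda>x. cis (- (of_int k * x)) * fseries c x)) UNIV"
    by (rule fseries_integral[OF assms(1)]) (intro integrable_T_continuous continuous_intros)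
  moreover have "torus_integral (\<lambda>x. cis (- (of_int k * x)) * cis (of_int l * x))
      = (if l = k then 2 * pi else 0)" for l
  proof -
    have "(\<lambda>x. cis (- (of_int k * x)) * cis (of_int l * x)) = (\<lambda>x. cis (of_int (l - k) * x))"
      by (simp add: cis_mult algebra_simps)
    then show ?thesis by (simp only: torus_integral_cis) simp
  qed
  ultimately have "((\<lambda>l. c l * complex_of_real (if l = k then 2 * pi else 0)) has_sum
      torus_integral (\<lambda>x. cis (- (of_int k * x)) * fseries c x)) UNIV" by (simp only: )
  moreover have "((\<lambda>l. c l * complex_of_real (if l = k then 2 * pi else 0))
      has_sum (c k * (2 * pi))) UNIV"
    by (rule has_sum_finite_neutralI[of "{k}"]) auto
  ultimately have "torus_integral (\<lambda>x. cis (- (of_int k * x)) * fseries c x) = c k * (2 * pi)"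
    by (rule has_sum_unique)
  then show ?thesis
    by (simp add: fourier_coeff_def fseries_real[OF assms] mult.commute)
qed

lemma herm_fourier_coeff: "herm (fourier_coeff f)"
  unfolding herm_def
proof
  fix k
  have "cnj (torus_integral (\<lambda>x. complex_of_real (f x) * cis (- (of_int k * x))))
     = torus_integral (\<lambda>x. complex_of_real (f x) * cis (of_int k * x))"
    unfolding torus_integral_def set_lebesgue_integral_def
    by (subst Bochner_Integration.integral_cnj[symmetric]) (simp add: cis_cnj)
  then show "fourier_coeff f (- k) = cnj (fourier_coeff f k)"
    by (simp add: fourier_coeff_def)
qed

lemma fourier_integrable: "integrable_T f
    \<Longrightarrow> integrable_T (\<lambda>x. complex_of_real (f x) * cis (- (of_int k * x)))"
  by (rule integrable_T_times_bounded[OF integrable_T_of_real, of _ _ 1])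
    (auto intro!: borel_measurable_continuous_onI continuous_intros)

lemma fourier_coeff_add:
  assumes "integrable_T f" "integrable_T g"
  shows "fourier_coeff (\<lambda>x. f x + g x) k = fourier_coeff f k + fourier_coeff g k"
  using torus_integral_add[OF fourier_integrable[OF assms(1)] fourier_integrable[OF assms(2)], of
      k k]
  by (simp add: fourier_coeff_def distrib_right add_divide_distrib)

lemma fourier_coeff_cmult: "fourier_coeff (\<lambda>x. c * f x) k = of_real c * fourier_coeff f k"
  using torus_integral_cmult[of "of_real c" "\<lambda>x. complex_of_real (f x) * cis (- (of_int k * x))"]
  by (simp add: fourier_coeff_def mult.assoc)

lemma fourier_coeff_diff:
  assumes "integrable_T f" "integrable_T g"
  shows "fourier_coeff (\<lambda>x. f x - g x) k = fourier_coeff f k - fourier_coeff g k"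
proof -
  have "integrable_T (\<lambda>x. - 1 * g x)" using assms(2) by (rule set_integrable_mult_right)
  from fourier_coeff_add[OF assms(1) this, of k] fourier_coeff_cmult[of "-1" g k] show ?thesis
      by simp
qed

lemma fourier_coeff_cong_AE:
  assumes "AE x in lborel. f x = g x" "f \<in> borel_measurable borel" "g \<in> borel_measurable borel"
  shows "fourier_coeff f k = fourier_coeff g k"
proof -
  have c: "(\<lambda>x. cis (- (of_int k * x))) \<in> borel_measurable borel"
    by (intro borel_measurable_continuous_onI continuous_intros)
  have "torus_integral (\<lambda>x. complex_of_real (f x) * cis (- (of_int k * x)))
      = torus_integral (\<lambda>x. complex_of_real (g x) * cis (- (of_int k * x)))"
    using assms(1) by (intro torus_integral_cong_AE borel_measurable_times c) (use assms in auto)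
  then show ?thesis by (simp add: fourier_coeff_def)
qed

lemma fourier_coeff_0: "fourier_coeff f 0 = of_real (torus_integral f / (2 * pi))"
  by (simp add: fourier_coeff_def torus_integral_of_real)

lemma fourier_coeff_const: "fourier_coeff (\<lambda>x. c) k = (if k = 0 then of_real c else 0)"
proof -
  have "torus_integral (\<lambda>x. complex_of_real c * cis (- (of_int k * x)))
      = of_real c * torus_integral (\<lambda>x. cis (of_int (- k) * x))"
    by (simp add: torus_integral_cmult)
  also have "\<dots> = of_real c * (if k = 0 then 2 * pi else 0)" by (simp only: torus_integral_cis) simp
  finally show ?thesis by (simp add: fourier_coeff_def)
qed

lemma torus_L2_imp_integrable: assumes "f \<in> torus_L2" shows "integrable_T f"
proof -
  have "integrable_T (\<lambda>x. 1 + (f x)\<^sup>2)"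
    using assms by (intro set_integral_add) (auto simp: torus_L2_def intro: integrable_T_continuous)
  moreover have "f \<in> borel_measurable borel" using assms by (simp add: torus_L2_def)
  moreover have "\<bar>f x\<bar> \<le> 1 + (f x)\<^sup>2" for x
    using zero_le_power2[of "\<bar>f x\<bar> - 1"] unfolding power2_diff
        by (simp add: abs_if split: if_splits)
  ultimately show ?thesis
    unfolding set_integrable_def
    by (elim Bochner_Integration.integrable_bound) (auto simp: indicator_def intro!: AE_I2)
qed

lemma rseries_in_torus_L2: assumes "l1_le c M" shows "rseries c \<in> torus_L2"
  unfolding torus_L2_def
  using rseries_periodic rseries_measurable[OF assms]
  by (auto intro!: integrable_T_continuous continuous_on_power
      continuous_on_subset[OF rseries_continuous[OF assms]])

section \<open>Uniqueness of Fourier coefficients\<close>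

text \<open>
  Trigonometric polynomials, generated by monomials and sums, so that closure under products is an
  induction on both factors.
\<close>

inductive trig_poly :: "(real \<Rightarrow> complex) \<Rightarrow> bool" where
  monomial: "trig_poly (\<lambda>x. c * cis (of_int k * x))"
| plus: "trig_poly f \<Longrightarrow> trig_poly g \<Longrightarrow> trig_poly (\<lambda>x. f x + g x)"

lemma trig_poly_mult_monomial: "trig_poly f \<Longrightarrow> trig_poly (\<lambda>x. f x * (c * cis (of_int k * x)))"
proof (induction rule: trig_poly.induct)
  case (monomial d l)
  have "(\<lambda>x. d * cis (of_int l * x) * (c * cis (of_int k * x)))
      = (\<lambda>x. (d * c) * cis (of_int (l + k) * x))"
  proof
    fix x
    have "cis (of_int (l + k) * x) = cis (of_int l * x) * cis (of_int k * x)"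
      by (simp add: cis_mult algebra_simps)
    then show "d * cis (of_int l * x) * (c * cis (of_int k * x))
        = (d * c) * cis (of_int (l + k) * x)"
      by (simp only: mult_ac)
  qed
  then show ?case using trig_poly.monomial[of "d * c" "l + k"] by simp
next
  case (plus f g)
  then show ?case using trig_poly.plus by (simp add: distrib_right)
qed

lemma trig_poly_mult: "trig_poly g \<Longrightarrow> trig_poly f \<Longrightarrow> trig_poly (\<lambda>x. f x * g x)"
proof (induction rule: trig_poly.induct)
  case (monomial c k) then show ?case using trig_poly_mult_monomial by simp
next
  case (plus g h) then show ?case using trig_poly.plus[of "\<lambda>x. f x * g x" "\<lambda>x. f x * h x"]
      by (simp add: distrib_left)
qed

text \<open>
  The Stone-Weierstrass theorem is applied on the unit circle. There \<open>cis\<close> turns real polynomials in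
  the two coordinates into trigonometric polynomials.
\<close>

lemma trig_poly_real_polynomial_cis:
  assumes "real_polynomial_function p"
  shows "trig_poly (\<lambda>x. complex_of_real (p (cis x)))"
  using assms
proof (induction rule: real_polynomial_function.induct)
  case (linear p)
  interpret bounded_linear p by fact
  define z where "z = Complex (p 1 / 2) (- p \<i> / 2)"
  have "complex_of_real (p (cis x)) = z * cis (of_int 1 * x) + cnj z * cis (of_int (-1) * x)" for x
  proof -
    have "cis x = cos x *\<^sub>R 1 + sin x *\<^sub>R \<i>" by (simp add: complex_eq_iff)
    then have "p (cis x) = cos x * p 1 + sin x * p \<i>" by (simp only: add scaleR) simp
    then show ?thesis by (simp add: z_def complex_eq_iff algebra_simps)
  qed
  then show ?case using plus[OF monomial[of z 1] monomial[of "cnj z" "-1"]] by simp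
next
  case (const c) then show ?case using monomial[of "complex_of_real c" 0] by simp
next
  case (add f g) then show ?case using trig_poly.plus[OF add.IH] by simp
next
  case (mult f g) then show ?case using trig_poly_mult[OF mult.IH(2,1)] by simp
qed

context
  fixes g :: "real \<Rightarrow> real"
  assumes g: "integrable_T g" and g0: "\<And>k. fourier_coeff g k = 0"
begin

lemma trig_poly_orthogonal:
  assumes "trig_poly h"
  shows "continuous_on UNIV h \<and> (\<exists>B. \<forall>x. cmod (h x) \<le> B)
      \<and> torus_integral (\<lambda>x. complex_of_real (g x) * h x) = 0"
  using assms
proof (induction rule: trig_poly.induct)
  case (monomial c k)
  have "torus_integral (\<lambda>x. complex_of_real (g x) * cis (of_int k * x)) = 0"
    using g0[of "- k"] by (simp add: fourier_coeff_def)
  moreover have "torus_integral (\<lambda>x. complex_of_real (g x) * (c * cis (of_int k * x)))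
      = c * torus_integral (\<lambda>x. complex_of_real (g x) * cis (of_int k * x))"
    by (simp add: torus_integral_cmult[symmetric] mult_ac)
  moreover have "\<forall>x. cmod (c * cis (of_int k * x)) \<le> cmod c" by (simp add: norm_mult)
  ultimately show ?case by (auto intro!: continuous_intros)
next
  case (plus h h')
  have i: "integrable_T (\<lambda>x. complex_of_real (g x) * f x)"
      if "continuous_on UNIV f" "\<forall>x. cmod (f x) \<le> B" for f B
    by (rule integrable_T_times_bounded[OF integrable_T_of_real[OF g], of _ B])
        (use that in \<open>auto intro: borel_measurable_continuous_onI\<close>)
  obtain B B' where B: "\<forall>x. cmod (h x) \<le> B" "\<forall>x. cmod (h' x) \<le> B'" using plus by auto
  have "\<forall>x. cmod (h x + h' x) \<le> B + B'" using B by (meson add_mono norm_triangle_ineq order_trans)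
  moreover have "torus_integral (\<lambda>x. complex_of_real (g x) * h x + complex_of_real (g x) * h' x)
      = 0"
    using plus B by (subst torus_integral_add) (auto intro: i)
  ultimately show ?case using plus by (auto intro!: continuous_intros simp: distrib_left)
qed

text \<open>Approximate \<open>\<psi>\<close> uniformly by polynomials.\<close>

lemma continuous_orthogonal:
  assumes \<psi>: "continuous_on (sphere 0 1) \<psi>"
  shows "torus_integral (\<lambda>x. g x * \<psi> (cis x)) = 0"
proof -
  have cis: "cis x \<in> sphere 0 1" for x by simp
  have c\<psi>: "continuous_on UNIV (\<lambda>x. \<psi> (cis x))"
    by (rule continuous_on_compose2[OF \<psi>]) (auto intro!: continuous_intros)
  have "compact (\<psi> ` sphere 0 1)" by (intro compact_continuous_image \<psi>) auto
  then obtain B where B: "\<And>x. \<bar>\<psi> (cis x)\<bar> \<le> B"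
    by (metis bounded_iff cis compact_imp_bounded image_eqI real_norm_def)
  have ig: "integrable_T (\<lambda>x. \<bar>g x\<bar>)" by (rule set_integrable_abs[OF g])
  have i\<psi>: "integrable_T (\<lambda>x. g x * \<psi> (cis x))"
    by (rule integrable_T_times_bounded[OF g, of _ B])
        (use B in \<open>auto intro: borel_measurable_continuous_onI c\<psi>\<close>)
  have small: "\<bar>torus_integral (\<lambda>x. g x * \<psi> (cis x))\<bar> \<le> e * torus_integral (\<lambda>x. \<bar>g x\<bar>)" if "0 < e"
      for e
  proof -
    obtain p where p: "real_polynomial_function p" "\<And>z. z \<in> sphere 0 1 \<Longrightarrow> \<bar>\<psi> z - p z\<bar> < e"
      using Stone_Weierstrass_real_polynomial_function[OF compact_sphere \<psi> \<open>0 < e\<close>] by blast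
    note T = trig_poly_orthogonal[OF trig_poly_real_polynomial_cis[OF p(1)]]
    then obtain B' where B': "\<And>x. \<bar>p (cis x)\<bar> \<le> B'" by auto
    have cp: "continuous_on UNIV (\<lambda>x. p (cis x))"
      using T continuous_on_Re[of UNIV "\<lambda>x. complex_of_real (p (cis x))"] by simp
    have ip: "integrable_T (\<lambda>x. g x * p (cis x))"
      by (rule integrable_T_times_bounded[OF g, of _ B'])
          (use B' in \<open>auto intro: borel_measurable_continuous_onI cp\<close>)
    have "torus_integral (\<lambda>x. complex_of_real (g x * p (cis x))) = 0" using T by simp
    then have p0: "torus_integral (\<lambda>x. g x * p (cis x)) = 0"
        by (simp only: torus_integral_of_real of_real_eq_0_iff)
    have "norm (torus_integral (\<lambda>x. g x * \<psi> (cis x) - g x * p (cis x)))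
        \<le> torus_integral (\<lambda>x. e * \<bar>g x\<bar>)"
    proof (rule torus_integral_norm_bound)
      fix x
      have "\<bar>g x\<bar> * \<bar>\<psi> (cis x) - p (cis x)\<bar> \<le> \<bar>g x\<bar> * e"
        using p(2)[OF cis[of x]] by (intro mult_left_mono) auto
      then show "norm (g x * \<psi> (cis x) - g x * p (cis x)) \<le> e * \<bar>g x\<bar>"
        by (simp add: right_diff_distrib[symmetric] abs_mult mult.commute)
    qed (use i\<psi> ip ig in \<open>auto intro: set_integral_diff\<close>)
    then show ?thesis using i\<psi> ip by (simp add: torus_integral_diff torus_integral_cmult p0)
  qed
  define G where "G = torus_integral (\<lambda>x. \<bar>g x\<bar>)"
  have "\<bar>torus_integral (\<lambda>x. g x * \<psi> (cis x))\<bar> \<le> 0"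
  proof (rule tendsto_lowerbound)
    show "((\<lambda>e. e * G) \<longlongrightarrow> 0) (at_right 0)" by (auto intro!: tendsto_eq_intros)
    show "\<forall>\<^sub>F e in at_right 0. \<bar>torus_integral (\<lambda>x. g x * \<psi> (cis x))\<bar> \<le> e * G"
      using eventually_at_right_less[of 0] by eventually_elim (use small in \<open>auto simp: G_def\<close>)
  qed simp
  then show ?thesis by simp
qed

text \<open>
  The indicator of an open set is the limit of functions that are continuous on the circle. The ends
  \<open>0\<close> and \<open>2\<pi>\<close>, which \<open>cis\<close> identifies, lie outside the open set, so membership can be read off
  from \<open>cis x\<close>.
\<close>

lemma integral_open_eq_0:
  assumes V: "open V"
  shows "torus_integral (\<lambda>x. g x * indicator (V \<inter> {0<..<2 * pi}) x) = 0"
proof -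
  define V' where "V' = V \<inter> {0<..<2 * pi}"
  define K where "K = cis ` ({0..2 * pi} - V')"
  have V': "open V'" using V by (auto simp: V'_def)
  have "compact ({0..2 * pi} - V')" using V' by (intro compact_diff) auto
  then have "compact K" unfolding K_def by (intro compact_continuous_image continuous_intros)
  then have K: "closed K" by (rule compact_imp_closed)
  have "0 \<in> {0..2 * pi} - V'" by (auto simp: V'_def)
  then have "cis 0 \<in> K" unfolding K_def by (rule imageI)
  then have Kne: "K \<noteq> {}" by auto
  have mem: "cis x \<in> K \<longleftrightarrow> x \<notin> V'" if x: "x \<in> {0..2 * pi}" for x
  proof
    assume "cis x \<in> K"
    then obtain y where y: "y \<in> {0..2 * pi}" "y \<notin> V'" "cis x = cis y" by (auto simp: K_def)
    show "x \<notin> V'"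
    proof
      assume xV: "x \<in> V'"
      then have x': "0 < x" "x < 2 * pi" by (auto simp: V'_def)
      have "sin x = sin y \<and> cos x = cos y" using y(3) by (simp add: complex_eq_iff)
      then obtain n :: int where n: "x = y + 2 * pi * n" using sin_cos_eq_iff[of x y] by auto
      have y0: "0 \<le> y" "y \<le> 2 * pi" using y(1) by auto
      have "n = 0"
      proof (rule ccontr)
        assume "n \<noteq> 0"
        then have "n \<ge> 1 \<or> n \<le> -1" by linarith
        then show False
        proof
          assume "n \<ge> 1"
          then have "2 * pi * 1 \<le> 2 * pi * real_of_int n" by (intro mult_left_mono) auto
          then show False using n x' y0 by linarith
        next
          assume "n \<le> -1"
          then have "2 * pi * real_of_int n \<le> 2 * pi * (-1)" by (intro mult_left_mono) auto
          then show False using n x' y0 by linarith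
        qed
      qed
      then show False using n xV y(2) by simp
    qed
  qed (use x in \<open>auto simp: K_def\<close>)
  \<comment> \<open>these continuous functions increase to the indicator of the complement of \<open>K\<close>\<close>
  define \<psi> where "\<psi> n z = min 1 (real n * infdist z K)" for n :: nat and z
  have \<psi>0: "torus_integral (\<lambda>x. g x * \<psi> n (cis x)) = 0" for n
    by (rule continuous_orthogonal) (auto simp: \<psi>_def intro!: continuous_intros)
  have gm: "(\<lambda>x. indicator {0..2 * pi} x * g x) \<in> borel_measurable lborel"
    using borel_measurable_integrable[OF g[unfolded set_integrable_def]] by simp
  have \<psi>m: "(\<lambda>x. \<psi> n (cis x)) \<in> borel_measurable borel" for n
    unfolding \<psi>_def by (intro borel_measurable_continuous_onI continuous_intros)
  have "(\<lambda>n. torus_integral (\<lambda>x. g x * \<psi> n (cis x))) \<longlonglongrightarrow> torus_integral (\<lambda>x. g x * indicator V' x)"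
    unfolding torus_integral_def set_lebesgue_integral_def
  proof (rule integral_dominated_convergence)
    show "integrable lborel (\<lambda>x. indicator {0..2 * pi} x *\<^sub>R \<bar>g x\<bar>)"
      using set_integrable_abs[OF g] by (simp add: set_integrable_def)
    have "(\<lambda>x. (indicator {0..2 * pi} x * g x) * indicator V' x) \<in> borel_measurable lborel"
      by (rule borel_measurable_times[OF gm]) (use V' in auto)
    then show "(\<lambda>x. indicator {0..2 * pi} x *\<^sub>R (g x * indicator V' x)) \<in> borel_measurable lborel"
      by (simp add: mult.assoc)
    fix n
    have "(\<lambda>x. (indicator {0..2 * pi} x * g x) * \<psi> n (cis x)) \<in> borel_measurable lborel"
      by (rule borel_measurable_times[OF gm]) (use \<psi>m[of n] in auto)
    then show "(\<lambda>x. indicator {0..2 * pi} x *\<^sub>R (g x * \<psi> n (cis x))) \<in> borel_measurable lborel"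
      by (simp add: mult.assoc)
    have "\<bar>\<psi> n z\<bar> \<le> 1" for z by (auto simp: \<psi>_def min_def infdist_nonneg)
    then show "AE x in lborel. norm (indicator {0..2 * pi} x *\<^sub>R (g x * \<psi> n (cis x)))
        \<le> indicator {0..2 * pi} x *\<^sub>R \<bar>g x\<bar>"
      by (intro AE_I2) (auto simp: indicator_def abs_mult intro!: mult_right_le_one_le)
  next
    show "AE x in lborel. (\<lambda>n. indicator {0..2 * pi} x *\<^sub>R (g x * \<psi> n (cis x)))
        \<longlonglongrightarrow> indicator {0..2 * pi} x *\<^sub>R (g x * indicator V' x)"
    proof (intro AE_I2)
      fix x :: real
      show "(\<lambda>n. indicator {0..2 * pi} x *\<^sub>R (g x * \<psi> n (cis x)))
          \<longlonglongrightarrow> indicator {0..2 * pi} x *\<^sub>R (g x * indicator V' x)"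
      proof (cases "x \<in> {0..2 * pi}")
        case True
        have "(\<lambda>n. \<psi> n (cis x)) \<longlonglongrightarrow> indicator V' x"
        proof (cases "x \<in> V'")
          case False
          then have "cis x \<in> K" using mem[OF True] by simp
          then have "\<psi> n (cis x) = 0" for n by (simp add: \<psi>_def)
          with False show ?thesis by simp
        next
          case inV: True
          then have "cis x \<notin> K" using mem[OF True] by simp
          then have pos: "0 < infdist (cis x) K"
            using in_closed_iff_infdist_zero[OF K Kne, of "cis x"] infdist_nonneg[of "cis x" K]
                by linarith
          obtain n0 :: nat where n0: "1 / infdist (cis x) K \<le> n0" using real_arch_simple by blast
          have "\<forall>\<^sub>F n in sequentially. 1 = \<psi> n (cis x)"
            using eventually_ge_at_top[of n0]
          proof eventually_elim
            case (elim n)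
            then have "1 / infdist (cis x) K \<le> real n" using n0 by linarith
            then have "1 \<le> real n * infdist (cis x) K" using pos by (simp add: divide_le_eq)
            then show ?case by (simp add: \<psi>_def)
          qed
          then have "(\<lambda>n. \<psi> n (cis x)) \<longlonglongrightarrow> 1" by (rule Lim_transform_eventually[OF tendsto_const])
          with inV show ?thesis by simp
        qed
        then show ?thesis using True by (intro tendsto_intros)
      qed simp
    qed
  qed
  then have "(\<lambda>n::nat. 0::real) \<longlonglongrightarrow> torus_integral (\<lambda>x. g x * indicator V' x)" by (simp only: \<psi>0)
  then show ?thesis unfolding V'_def by (metis LIMSEQ_const_iff)
qed

text \<open>
  Open sets generate the Borel sets, so \<open>g\<close> has integral \<open>0\<close> over all of them.
\<close>

lemma zero_fourier_imp_AE_zero: "AE x in lborel. x \<in> {0<..<2 * pi} \<longrightarrow> g x = 0"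
proof -
  define G where "G x = indicator {0<..<2 * pi} x * g x" for x
  have "integrable lborel (\<lambda>x. indicator {0<..<2 * pi} x *\<^sub>R (indicator {0..2 * pi} x *\<^sub>R g x))"
    by (intro integrable_mult_indicator g[unfolded set_integrable_def]) simp
  moreover have "indicator {0<..<2 * pi} x *\<^sub>R (indicator {0..2 * pi} x *\<^sub>R g x) = G x" for x
    by (auto simp: G_def indicator_def)
  ultimately have G: "integrable lborel G" by simp
  have siG: "set_integrable lborel A G" if "A \<in> sets borel" for A
    unfolding set_integrable_def using that G by (intro integrable_mult_indicator) auto
  have op: "(LINT x:A|lborel. G x) = 0" if "open A" for A
  proof -
    have "(LINT x:A|lborel. G x) = torus_integral (\<lambda>x. g x * indicator (A \<inter> {0<..<2 * pi}) x)"
      unfolding torus_integral_def set_lebesgue_integral_def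
      by (intro Bochner_Integration.integral_cong) (auto simp: G_def indicator_def)
    then show ?thesis using integral_open_eq_0[OF that] by simp
  qed
  have sets: "sets borel = sigma_sets UNIV {S::real set. open S}" unfolding borel_def by simp
  have all: "(LINT x:A|lborel. G x) = 0" if "A \<in> sets borel" for A
  proof -
    have "A \<in> sigma_sets UNIV {S. open S}" using that sets by simp
    show ?thesis
    proof (rule sigma_sets_induct_disjoint[where G = "{S::real set. open S}" and \<Omega> = UNIV and A = A
          and P = "\<lambda>A. (LINT x:A|lborel. G x) = 0"])
      show "Int_stable {S::real set. open S}" by (auto simp: Int_stable_def)
      show "A \<in> sigma_sets UNIV {S. open S}" by fact
    next
      fix A :: "real set" assume "A \<in> {S. open S}"
      then show "(LINT x:A|lborel. G x) = 0" using op by simp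
    next
      show "(LINT x:{}|lborel. G x) = 0" by (simp add: set_lebesgue_integral_def)
    next
      fix A assume A: "A \<in> sigma_sets UNIV {S. open S}" "(LINT x:A|lborel. G x) = 0"
      have "(LINT x:UNIV|lborel. G x) = (LINT x:A \<union> (UNIV - A)|lborel. G x)" by simp
      also have "\<dots> = (LINT x:A|lborel. G x) + (LINT x:(UNIV - A)|lborel. G x)"
        using A(1) unfolding sets[symmetric] by (intro set_integral_Un siG) auto
      finally show "(LINT x:(UNIV - A)|lborel. G x) = 0" using op[of UNIV] A(2) by simp
    next
      fix A :: "nat \<Rightarrow> real set"
      assume A: "disjoint_family A" "range A \<subseteq> sigma_sets UNIV {S. open S}"
          "\<And>i. (LINT x:(A i)|lborel. G x) = 0"
      have "(LINT x:(\<Union>i. A i)|lborel. G x) = (\<Sum>i. (LINT x:(A i)|lborel. G x))"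
      proof (rule lebesgue_integral_countable_add)
        show "A i \<in> sets lborel" for i using A(2) unfolding sets[symmetric] by auto
        show "set_integrable lborel (\<Union>i. A i) G" using A(2) unfolding sets[symmetric]
            by (intro siG) auto
      qed (use A(1) in \<open>auto simp: disjoint_family_on_def\<close>)
      then show "(LINT x:(\<Union>i. A i)|lborel. G x) = 0" using A(3) by simp
    qed auto
  qed
  have "AE x in lborel. G x = (\<lambda>x. 0) x"
    by (rule density_unique_real[OF G]) (use all in auto)
  then show ?thesis by eventually_elim (auto simp: G_def)
qed

end

lemma periodic_shift_int: assumes "torus_periodic f" shows "f (x + of_int n * (2 * pi)) = f x"
proof -
  have nat: "f (x + real m * (2 * pi)) = f x" for m x
  proof (induction m)
    case (Suc m)
    have "f (x + real (Suc m) * (2 * pi)) = f ((x + real m * (2 * pi)) + 2 * pi)"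
        by (simp add: algebra_simps)
    also have "\<dots> = f x" using assms Suc by (simp add: torus_periodic_def)
    finally show ?case .
  qed simp
  show ?thesis
  proof (cases n rule: int_cases2)
    case (nonneg m) then show ?thesis using nat by simp
  next
    case (nonpos m) then show ?thesis using nat[of "x + of_int n * (2 * pi)" m] by simp
  qed
qed

lemma AE_periodic_extend:
  assumes p: "torus_periodic f" "torus_periodic h"
    and m: "f \<in> borel_measurable borel" "h \<in> borel_measurable borel"
    and ae: "AE x in lborel. x \<in> {0<..<2 * pi} \<longrightarrow> f x = h x"
  shows "AE x in lborel. f x = h x"
proof -
  define N where "N = {x \<in> {0<..<2 * pi}. f x \<noteq> h x} \<union> {0}"
  have "{x \<in> space lborel. \<not> (x \<in> {0<..<2 * pi} \<longrightarrow> f x = h x)} \<in> null_sets lborel"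
  proof (rule AE_iff_null[THEN iffD1, OF _ ae])
    have [measurable]: "f \<in> borel_measurable lborel" "h \<in> borel_measurable lborel" using m by auto
    show "{x \<in> space lborel. \<not> (x \<in> {0<..<2 * pi} \<longrightarrow> f x = h x)} \<in> sets lborel" by measurable
  qed
  moreover have "{x \<in> space lborel. \<not> (x \<in> {0<..<2 * pi} \<longrightarrow> f x = h x)}
      = {x \<in> {0<..<2 * pi}. f x \<noteq> h x}" by auto
  ultimately have N: "N \<in> null_sets lborel" unfolding N_def by (intro null_sets.Un) auto
  have "(\<Union>n::int. {x. x - of_int n * (2 * pi) \<in> N}) \<in> null_sets lborel"
    by (intro null_sets_UN' null_sets_translation N) auto
  then show ?thesis
  proof (rule AE_I')
    show "{x \<in> space lborel. f x \<noteq> h x} \<subseteq> (\<Union>n::int. {x. x - of_int n * (2 * pi) \<in> N})"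
    proof
      fix x assume "x \<in> {x \<in> space lborel. f x \<noteq> h x}"
      then have ne: "f x \<noteq> h x" by simp
      define n where "n = \<lfloor>x / (2 * pi)\<rfloor>"
      define y where "y = x - of_int n * (2 * pi)"
      have "of_int n \<le> x / (2 * pi)" "x / (2 * pi) < of_int n + 1" unfolding n_def by linarith+
      then have y: "0 \<le> y" "y < 2 * pi" unfolding y_def by (simp_all add: field_simps)
      have "f x = f y" "h x = h y"
        using periodic_shift_int[OF p(1), of y n] periodic_shift_int[OF p(2), of y n]
            by (simp_all add: y_def)
      then have "y \<in> N" using ne y unfolding N_def by (cases "y = 0") auto
      then show "x \<in> (\<Union>n::int. {x. x - of_int n * (2 * pi) \<in> N})" by (auto simp: y_def)
    qed
  qed
qed

text \<open>
  The difference of \<open>f\<close> and the sum of its series is integrable and has vanishing Fourier coefficients.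
\<close>

theorem fourier_series_AE:
  assumes f: "f \<in> torus_L2" and c: "sob_le 1 (fourier_coeff f) M"
  shows "AE x in lborel. f x = rseries (fourier_coeff f) x"
proof -
  let ?h = "rseries (fourier_coeff f)"
  note l1 = sob_le_1_imp_l1_le[OF c]
  have fi: "integrable_T f" by (rule torus_L2_imp_integrable[OF f])
  have hi: "integrable_T ?h" by (rule torus_L2_imp_integrable[OF rseries_in_torus_L2[OF l1]])
  have d: "integrable_T (\<lambda>x. f x - ?h x)" using fi hi by (rule set_integral_diff)
  have "fourier_coeff (\<lambda>x. f x - ?h x) k = 0" for k
    using fourier_coeff_diff[OF fi hi] fourier_coeff_rseries[OF l1 herm_fourier_coeff] by simp
  from zero_fourier_imp_AE_zero[OF d this]
  have "AE x in lborel. x \<in> {0<..<2 * pi} \<longrightarrow> f x = ?h x" by simp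
  then show ?thesis
    using f rseries_measurable[OF l1]
        by (intro AE_periodic_extend rseries_periodic) (auto simp: torus_L2_def)
qed

section \<open>Products and Parseval identity\<close>

text \<open>Integrate the series of the second factor term by term.\<close>

lemma fourier_coeff_mult_rseries:
  assumes f: "integrable_T f" and c: "l1_le c M" "herm c"
  shows "integrable_T (\<lambda>x. f x * rseries c x)"
    and "fourier_coeff (\<lambda>x. f x * rseries c x) k = conv (fourier_coeff f) c k"
proof -
  show "integrable_T (\<lambda>x. f x * rseries c x)"
    by (rule integrable_T_times_bounded[OF f, of _ M])
        (use rseries_measurable[OF c(1)] rseries_bound[OF c(1)] in auto)
  have "((\<lambda>l. c l * torus_integral (\<lambda>x. complex_of_real (f x) * cis (- (of_int k * x))
      * cis (of_int l * x))) has_sum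
      torus_integral (\<lambda>x. complex_of_real (f x) * cis (- (of_int k * x)) * fseries c x)) UNIV"
    by (rule fseries_integral[OF c(1) fourier_integrable[OF f]])
  moreover have "torus_integral (\<lambda>x. complex_of_real (f x) * cis (- (of_int k * x))
      * cis (of_int l * x))
      = 2 * pi * fourier_coeff f (k - l)" for l
  proof -
    have "(\<lambda>x. complex_of_real (f x) * cis (- (of_int k * x)) * cis (of_int l * x))
      = (\<lambda>x. complex_of_real (f x) * cis (- (of_int (k - l) * x)))"
      by (simp add: mult.assoc cis_mult algebra_simps)
    then show ?thesis by (simp add: fourier_coeff_def)
  qed
  moreover have "(\<lambda>x. complex_of_real (f x) * cis (- (of_int k * x)) * fseries c x)
      = (\<lambda>x. complex_of_real (f x * rseries c x) * cis (- (of_int k * x)))"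
    by (simp add: fseries_real[OF c] mult_ac)
  ultimately have "((\<lambda>l. c l * (2 * pi * fourier_coeff f (k - l))) has_sum
      (2 * pi * fourier_coeff (\<lambda>x. f x * rseries c x) k)) UNIV"
    by (simp add: fourier_coeff_def)
  then have "(2 * pi * fourier_coeff (\<lambda>x. f x * rseries c x) k)
      = (\<Sum>\<^sub>\<infinity>l. (2 * pi) * (fourier_coeff f (k - l) * c l))"
    by (subst (asm) has_sum_iff) (simp add: mult_ac)
  then show "fourier_coeff (\<lambda>x. f x * rseries c x) k = conv (fourier_coeff f) c k"
    by (simp add: conv_def infsum_cmult_right' mult.assoc)
qed

lemma integrable_T_cong_AE:
  fixes f g :: "real \<Rightarrow> real"
  assumes "integrable_T f" "AE x in lborel. f x = g x" "g \<in> borel_measurable borel"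
  shows "integrable_T g"
proof -
  have "integrable lborel (\<lambda>x. indicator {0..2 * pi} x *\<^sub>R g x) \<longleftrightarrow> integrable lborel
      (\<lambda>x. indicator {0..2 * pi} x *\<^sub>R f x)"
  proof (rule integrable_cong_AE)
    show "(\<lambda>x. indicator {0..2 * pi} x *\<^sub>R f x) \<in> borel_measurable lborel"
      using assms(1) unfolding set_integrable_def by (rule borel_measurable_integrable)
    show "(\<lambda>x. indicator {0..2 * pi} x *\<^sub>R g x) \<in> borel_measurable lborel"
      using assms(3) by (intro borel_measurable_scaleR) auto
    show "AE x in lborel. indicator {0..2 * pi} x *\<^sub>R g x = indicator {0..2 * pi} x *\<^sub>R f x"
      using assms(2) by eventually_elim simp
  qed
  then show ?thesis using assms(1) by (simp add: set_integrable_def)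
qed

lemma fourier_coeff_mult:
  assumes f: "f \<in> torus_L2" and g: "g \<in> torus_L2" "sob_le 1 (fourier_coeff g) N"
  shows "integrable_T (\<lambda>x. f x * g x)"
    and "fourier_coeff (\<lambda>x. f x * g x) k = conv (fourier_coeff f) (fourier_coeff g) k"
proof -
  let ?r = "rseries (fourier_coeff g)"
  note l1 = sob_le_1_imp_l1_le[OF g(2)]
  note m = fourier_coeff_mult_rseries[OF torus_L2_imp_integrable[OF f] l1 herm_fourier_coeff]
  have "AE x in lborel. g x = ?r x" by (rule fourier_series_AE[OF g])
  then have ae: "AE x in lborel. f x * ?r x = f x * g x" by eventually_elim simp
  have fm: "f \<in> borel_measurable borel" and gm: "g \<in> borel_measurable borel" using f g
      by (auto simp: torus_L2_def)
  have rm: "?r \<in> borel_measurable borel" by (rule rseries_measurable[OF l1])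
  show "integrable_T (\<lambda>x. f x * g x)"
    by (rule integrable_T_cong_AE[OF m(1) ae]) (intro borel_measurable_times fm gm)
  show "fourier_coeff (\<lambda>x. f x * g x) k = conv (fourier_coeff f) (fourier_coeff g) k"
    using fourier_coeff_cong_AE[OF ae borel_measurable_times[OF fm rm]
        borel_measurable_times[OF fm gm], of k] m(2)[of k] by simp
qed

text \<open>
  This is the coefficient of \<open>f\<^sup>2\<close> at frequency \<open>0\<close>, where the convolution is \<open>\<Sum> f\<^sub>-\<^sub>l f\<^sub>l\<close>.
\<close>

lemma parseval:
  assumes f: "f \<in> torus_L2" "sob_le 1 (fourier_coeff f) M"
  shows "(\<lambda>k. (cmod (fourier_coeff f k))\<^sup>2) summable_on UNIV"
    and "(L2_norm_torus f)\<^sup>2 = 2 * pi * (\<Sum>\<^sub>\<infinity>k. (cmod (fourier_coeff f k))\<^sup>2)"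
proof -
  let ?c = "fourier_coeff f"
  have c0: "sob_le 0 ?c M" by (rule sob_le_weaken[OF f(2)]) simp
  have e: "?c (0 - l) * ?c l = complex_of_real ((cmod (?c l))\<^sup>2)" for l
    using hermD[OF herm_fourier_coeff, of f l]
        by (simp add: complex_norm_square mult.commute del: of_real_power)
  have "(\<lambda>l. norm (?c (0 - l) * ?c l)) summable_on UNIV" by (rule conv_summable[OF c0 c0])
  then show s: "(\<lambda>k. (cmod (?c k))\<^sup>2) summable_on UNIV" unfolding e norm_of_real abs_power2 .
  have "complex_of_real (torus_integral (\<lambda>x. f x * f x) / (2 * pi)) = conv ?c ?c 0"
    using fourier_coeff_mult(2)[OF f(1) f, of 0] fourier_coeff_0[of "\<lambda>x. f x * f x"] by simp
  also have "\<dots> = (\<Sum>\<^sub>\<infinity>l. complex_of_real ((cmod (?c l))\<^sup>2))" unfolding conv_def e ..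
  also have "\<dots> = complex_of_real (\<Sum>\<^sub>\<infinity>l. (cmod (?c l))\<^sup>2)"
    by (rule infsumI[OF has_sum_of_real[OF has_sum_infsum[OF s]]])
  finally have "torus_integral (\<lambda>x. f x * f x) = 2 * pi * (\<Sum>\<^sub>\<infinity>k. (cmod (?c k))\<^sup>2)"
    unfolding of_real_eq_iff by (simp add: field_simps)
  moreover have "0 \<le> torus_integral (\<lambda>x. (f x)\<^sup>2)"
    unfolding torus_integral_def set_lebesgue_integral_def
        by (intro Bochner_Integration.integral_nonneg) auto
  ultimately show "(L2_norm_torus f)\<^sup>2 = 2 * pi * (\<Sum>\<^sub>\<infinity>k. (cmod (?c k))\<^sup>2)"
    by (simp add: L2_norm_torus_def power2_eq_square)
qed

section \<open>Sobolev spaces and time derivatives\<close>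

lemma torus_L2_add: assumes "f \<in> torus_L2" "g \<in> torus_L2" shows "(\<lambda>x. f x + g x) \<in> torus_L2"
proof -
  have m: "f \<in> borel_measurable borel" "g \<in> borel_measurable borel" using assms
      by (auto simp: torus_L2_def)
  have i: "integrable_T (\<lambda>x. 2 * (f x)\<^sup>2 + 2 * (g x)\<^sup>2)"
    using assms by (intro set_integral_add(1) set_integrable_mult_right) (auto simp: torus_L2_def)
  have "integrable_T (\<lambda>x. (f x + g x)\<^sup>2)"
    unfolding set_integrable_def
  proof (rule Bochner_Integration.integrable_bound[OF i[unfolded set_integrable_def]])
    show "(\<lambda>x. indicator {0..2 * pi} x *\<^sub>R (f x + g x)\<^sup>2) \<in> borel_measurable lborel"
      using m by (intro borel_measurable_scaleR borel_measurable_power borel_measurable_add) auto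
    have "(f x + g x)\<^sup>2 \<le> 2 * (f x)\<^sup>2 + 2 * (g x)\<^sup>2" for x
      using zero_le_power2[of "f x - g x"] unfolding power2_sum power2_diff by linarith
    then show "AE x in lborel. norm (indicator {0..2 * pi} x *\<^sub>R (f x + g x)\<^sup>2)
        \<le> norm (indicator {0..2 * pi} x *\<^sub>R (2 * (f x)\<^sup>2 + 2 * (g x)\<^sup>2))"
      by (intro AE_I2) (auto simp: indicator_def)
  qed
  then show ?thesis using assms m by (auto simp: torus_L2_def torus_periodic_def)
qed

lemma torus_L2_cmult: assumes "f \<in> torus_L2" shows "(\<lambda>x. c * f x) \<in> torus_L2"
  using assms by (auto simp: torus_L2_def torus_periodic_def power_mult_distrib)

lemma torus_L2_diff: assumes "f \<in> torus_L2" "g \<in> torus_L2" shows "(\<lambda>x. f x - g x) \<in> torus_L2"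
  using torus_L2_add[OF assms(1) torus_L2_cmult[OF assms(2), of "-1"]] by simp

lemma torus_L2_const: "(\<lambda>x. c) \<in> torus_L2"
  by (auto simp: torus_L2_def torus_periodic_def intro: integrable_T_continuous)

lemma sobolev_summand: "(1 + (of_int k)\<^sup>2) powr \<sigma> * (cmod (a k))\<^sup>2 = (weight \<sigma> k * cmod (a k))\<^sup>2"
  by (simp add: power_mult_distrib weight_double[symmetric]) (simp add: weight_def)

lemma sobolev_imp_sob_le:
  assumes "f \<in> sobolev \<sigma>"
  shows "f \<in> torus_L2" "sob_le \<sigma> (fourier_coeff f) (sobolev_norm \<sigma> f)"
proof -
  show "f \<in> torus_L2" using assms by (simp add: sobolev_def)
  have s: "(\<lambda>k. (weight \<sigma> k * cmod (fourier_coeff f k))\<^sup>2) summable_on UNIV"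
    using assms by (simp add: sobolev_def sobolev_summand)
  show "sob_le \<sigma> (fourier_coeff f) (sobolev_norm \<sigma> f)"
  proof (rule sob_leI)
    fix A :: "int set" assume "finite A"
    then have "(\<Sum>k\<in>A. (weight \<sigma> k * cmod (fourier_coeff f k))\<^sup>2)
        \<le> (\<Sum>\<^sub>\<infinity>k. (weight \<sigma> k * cmod (fourier_coeff f k))\<^sup>2)"
      by (intro finite_sum_le_infsum s) auto
    then show "L2_set (\<lambda>k. weight \<sigma> k * cmod (fourier_coeff f k)) A \<le> sobolev_norm \<sigma> f"
      by (simp add: L2_set_def sobolev_norm_def sobolev_summand)
  qed
qed

lemma sob_le_imp_sobolev:
  assumes "f \<in> torus_L2" "sob_le \<sigma> (fourier_coeff f) M"
  shows "f \<in> sobolev \<sigma>" "sobolev_norm \<sigma> f \<le> M"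
proof -
  note S = sob_le_summable[OF assms(2)]
  show "f \<in> sobolev \<sigma>" using assms(1) S(1) by (simp add: sobolev_def sobolev_summand)
  have "(\<Sum>\<^sub>\<infinity>k. (weight \<sigma> k * cmod (fourier_coeff f k))\<^sup>2) \<le> M\<^sup>2" by (rule S(2))
  then have "sobolev_norm \<sigma> f \<le> sqrt (M\<^sup>2)"
    unfolding sobolev_norm_def sobolev_summand by (rule real_sqrt_le_mono)
  then show "sobolev_norm \<sigma> f \<le> M" using sob_le_nonneg[OF assms(2)] by simp
qed

lemma rseries_sobolev:
  assumes "sob_le \<sigma> c M" "1 \<le> \<sigma>" "herm c"
  shows "rseries c \<in> sobolev \<sigma>" "sobolev_norm \<sigma> (rseries c) \<le> M" "fourier_coeff (rseries c) = c"
proof -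
  note l1 = sob_le_1_imp_l1_le[OF sob_le_weaken[OF assms(1,2)]]
  show eq: "fourier_coeff (rseries c) = c" using fourier_coeff_rseries[OF l1 assms(3)] by auto
  show "rseries c \<in> sobolev \<sigma>" "sobolev_norm \<sigma> (rseries c) \<le> M"
    using sob_le_imp_sobolev[OF rseries_in_torus_L2[OF l1], of \<sigma> M] assms(1) by (simp_all add: eq)
qed

text \<open>
  Each coefficient of the difference quotient is bounded by its norm in \<open>H\<^sup>\<sigma>\<close>.
\<close>

lemma time_derivative_fourier_coeff:
  assumes w: "has_time_derivative T \<sigma> w w'" and \<sigma>: "0 \<le> \<sigma>" and t: "t \<in> {0..<T}"
  shows "((\<lambda>t. fourier_coeff (w t) k) has_vector_derivative fourier_coeff (w' t) k)
      (at t within {0..<T})"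
  unfolding has_vector_derivative_def has_derivative_within
proof (intro conjI)
  show "bounded_linear (\<lambda>h. h *\<^sub>R fourier_coeff (w' t) k)" by (rule bounded_linear_scaleR_left)
  show "((\<lambda>r. (1 / norm (r - t)) *\<^sub>R (fourier_coeff (w r) k
      - (fourier_coeff (w t) k + (r - t) *\<^sub>R fourier_coeff (w' t) k))) \<longlongrightarrow> 0) (at t within {0..<T})"
  proof (rule Lim_null_comparison)
    show "((\<lambda>r. sobolev_norm \<sigma> (\<lambda>x. (w r x - w t x) / (r - t) - w' t x)) \<longlongrightarrow> 0) (at t within {0..<T})"
      using w t by (simp add: has_time_derivative_def)
    show "\<forall>\<^sub>F r in at t within {0..<T}. norm ((1 / norm (r - t)) *\<^sub>R (fourier_coeff (w r) k
        - (fourier_coeff (w t) k + (r - t) *\<^sub>R fourier_coeff (w' t) k)))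
        \<le> sobolev_norm \<sigma> (\<lambda>x. (w r x - w t x) / (r - t) - w' t x)"
      unfolding eventually_at_filter
    proof (intro always_eventually allI impI)
      fix r assume "r \<noteq> t" "r \<in> {0..<T}"
      then have S: "w r \<in> sobolev \<sigma>" "w t \<in> sobolev \<sigma>" "w' t \<in> sobolev \<sigma>"
        using w t by (auto simp: has_time_derivative_def)
      note L = sobolev_imp_sob_le[OF S(1)] sobolev_imp_sob_le[OF S(2)] sobolev_imp_sob_le[OF S(3)]
      have eq: "(\<lambda>x. (w r x - w t x) / (r - t) - w' t x)
          = (\<lambda>x. 1 / (r - t) * (w r x - w t x) - w' t x)" by simp
      have d: "(\<lambda>x. w r x - w t x) \<in> torus_L2" using L by (intro torus_L2_diff)
      have cd: "(\<lambda>x. 1 / (r - t) * (w r x - w t x)) \<in> torus_L2" using d by (rule torus_L2_cmult)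
      have L2: "(\<lambda>x. 1 / (r - t) * (w r x - w t x) - w' t x) \<in> torus_L2"
        using cd L by (intro torus_L2_diff)
      have F: "fourier_coeff (\<lambda>x. 1 / (r - t) * (w r x - w t x) - w' t x)
        = (\<lambda>k. of_real (1 / (r - t)) * (fourier_coeff (w r) k - fourier_coeff (w t) k)
            - fourier_coeff (w' t) k)"
        unfolding fourier_coeff_diff[OF torus_L2_imp_integrable[OF cd]
            torus_L2_imp_integrable[OF L(5)], abs_def]
          fourier_coeff_cmult fourier_coeff_diff[OF torus_L2_imp_integrable[OF L(1)]
              torus_L2_imp_integrable[OF L(3)]] ..
      have "sob_le \<sigma> (fourier_coeff (\<lambda>x. 1 / (r - t) * (w r x - w t x) - w' t x))
         (cmod (of_real (1 / (r - t))) * (sobolev_norm \<sigma> (w r) + sobolev_norm \<sigma> (w t))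
             + sobolev_norm \<sigma> (w' t))"
        unfolding F by (rule sob_le_diff[OF sob_le_scale[OF sob_le_diff[OF L(2) L(4)]] L(6)])
      then have "(\<lambda>x. 1 / (r - t) * (w r x - w t x) - w' t x) \<in> sobolev \<sigma>"
          by (rule sob_le_imp_sobolev(1)[OF L2])
      from sob_le_coeff[OF sobolev_imp_sob_le(2)[OF this] \<sigma>, of k]
      have "cmod (of_real (1 / (r - t)) * (fourier_coeff (w r) k - fourier_coeff (w t) k)
          - fourier_coeff (w' t) k)
        \<le> sobolev_norm \<sigma> (\<lambda>x. (w r x - w t x) / (r - t) - w' t x)" unfolding F eq .
      moreover have "norm ((1 / norm (r - t)) *\<^sub>R (fourier_coeff (w r) k
          - (fourier_coeff (w t) k + (r - t) *\<^sub>R fourier_coeff (w' t) k)))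
        = cmod (of_real (1 / (r - t)) * (fourier_coeff (w r) k - fourier_coeff (w t) k)
            - fourier_coeff (w' t) k)"
      proof -
        have "fourier_coeff (w r) k - (fourier_coeff (w t) k + (r - t) *\<^sub>R fourier_coeff (w' t) k)
          = of_real (r - t) * (of_real (1 / (r - t)) *
              (fourier_coeff (w r) k - fourier_coeff (w t) k) - fourier_coeff (w' t) k)"
          using \<open>r \<noteq> t\<close> by (simp add: right_diff_distrib scaleR_conv_of_real mult.assoc[symmetric])
        then show ?thesis using \<open>r \<noteq> t\<close> by (simp add: norm_mult del: of_real_diff)
      qed
      ultimately show "norm ((1 / norm (r - t)) *\<^sub>R (fourier_coeff (w r) k
          - (fourier_coeff (w t) k + (r - t) *\<^sub>R fourier_coeff (w' t) k)))
        \<le> sobolev_norm \<sigma> (\<lambda>x. (w r x - w t x) / (r - t) - w' t x)" by simp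
    qed
  qed
qed

section \<open>Weak derivatives and nonlinear compositions\<close>

lemma smooth_cos_sin: "smooth (\<lambda>x. A * cos (c * x) + B * sin (c * x))"
proof -
  have *: "\<exists>A' B'. (deriv ^^ n) (\<lambda>x. A * cos (c * x) + B * sin (c * x))
      = (\<lambda>x. A' * cos (c * x) + B' * sin (c * x))" for n
  proof (induction n)
    case 0 then show ?case by auto
  next
    case (Suc n)
    then obtain A' B' where ab: "(deriv ^^ n) (\<lambda>x. A * cos (c * x) + B * sin (c * x))
        = (\<lambda>x. A' * cos (c * x) + B' * sin (c * x))" by auto
    have "deriv (\<lambda>x. A' * cos (c * x) + B' * sin (c * x)) x
        = (B' * c) * cos (c * x) + (- A' * c) * sin (c * x)" for x
      by (rule DERIV_imp_deriv) (auto intro!: derivative_eq_intros)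
    then have "(deriv ^^ Suc n) (\<lambda>x. A * cos (c * x) + B * sin (c * x))
        = (\<lambda>x. (B' * c) * cos (c * x) + (- A' * c) * sin (c * x))"
      by (auto simp: ab)
    then show ?case by blast
  qed
  then show ?thesis unfolding smooth_def
  proof (intro allI)
    fix n x
    obtain A' B' where "(deriv ^^ n) (\<lambda>x. A * cos (c * x) + B * sin (c * x))
        = (\<lambda>x. A' * cos (c * x) + B' * sin (c * x))"
      using * by blast
    then show "(deriv ^^ n) (\<lambda>x. A * cos (c * x) + B * sin (c * x)) differentiable (at x)"
    proof -
      have "((\<lambda>x. A' * cos (c * x) + B' * sin (c * x))
          has_real_derivative (- A' * c * sin (c * x) + B' * c * cos (c * x))) (at x)"
        by (auto intro!: derivative_eq_intros)
      then show ?thesis unfolding \<open>(deriv ^^ n) _ = _\<close> real_differentiable_def by blast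
    qed
  qed
qed

lemma fourier_coeff_cos_sin:
  assumes "integrable_T f"
  shows "fourier_coeff f k = Complex (torus_integral (\<lambda>x. f x * cos (of_int k * x)))
      (- torus_integral (\<lambda>x. f x * sin (of_int k * x))) / (2 * pi)"
proof -
  have "integrable_T (\<lambda>x. complex_of_real (f x) * cis (- (of_int k * x)))"
      by (rule fourier_integrable[OF assms])
  from torus_integral_Re[OF this] have
    "Re (torus_integral (\<lambda>x. complex_of_real (f x) * cis (- (of_int k * x))))
        = torus_integral (\<lambda>x. f x * cos (of_int k * x))" by simp
  moreover have "Im (torus_integral (\<lambda>x. complex_of_real (f x) * cis (- (of_int k * x))))
      = - torus_integral (\<lambda>x. f x * sin (of_int k * x))"
  proof -
    have "integrable_T (\<lambda>x. - \<i> * (complex_of_real (f x) * cis (- (of_int k * x))))"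
      by (intro set_integrable_mult_right fourier_integrable[OF assms])
    note re = torus_integral_Re[OF this]
    have "Im (torus_integral (\<lambda>x. complex_of_real (f x) * cis (- (of_int k * x))))
      = Re (- \<i> * torus_integral (\<lambda>x. complex_of_real (f x) * cis (- (of_int k * x))))" by simp
    also have "\<dots> = torus_integral (\<lambda>x. Re (- \<i> * (complex_of_real (f x) * cis (- (of_int k * x)))))"
      unfolding re torus_integral_cmult ..
    also have "\<dots> = torus_integral (\<lambda>x. - 1 * (f x * sin (of_int k * x)))" by simp
    also have "\<dots> = - 1 * torus_integral (\<lambda>x. f x * sin (of_int k * x))"
        by (rule torus_integral_cmult)
    finally show ?thesis by simp
  qed
  ultimately have "torus_integral (\<lambda>x. complex_of_real (f x) * cis (- (of_int k * x)))
      = Complex (torus_integral (\<lambda>x. f x * cos (of_int k * x)))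
          (- torus_integral (\<lambda>x. f x * sin (of_int k * x)))"
    by (intro complex_eqI) simp_all
  then show ?thesis unfolding fourier_coeff_def by simp
qed

lemma periodic_cos_sin: "torus_periodic (\<lambda>x. A * cos (of_int k * x) + B * sin (of_int k * x))"
proof -
  have "cis (of_int k * (x + 2 * pi)) = cis (of_int k * x)" for x
  proof -
    have "of_int k * (x + 2 * pi) = of_int k * x + 2 * pi * of_int k" by (simp add: algebra_simps)
    then show ?thesis using cis_multiple_2pi[of "of_int k"] by (simp add: cis_mult[symmetric])
  qed
  then show ?thesis by (simp add: torus_periodic_def complex_eq_iff)
qed

text \<open>The test functions are \<open>cos (k x)\<close> and \<open>sin (k x)\<close>.\<close>

lemma weak_derivative_fourier_coeff:
  assumes "has_weak_derivative f g"
  shows "fourier_coeff g k = \<i> * of_int k * fourier_coeff f k"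
proof -
  have f: "integrable_T f" and g: "integrable_T g"
    and ibp: "\<And>\<phi>. smooth \<phi> \<Longrightarrow> torus_periodic \<phi>
        \<Longrightarrow> torus_integral (\<lambda>x. f x * deriv \<phi> x) = - torus_integral (\<lambda>x. g x * \<phi> x)"
    using assms by (auto simp: has_weak_derivative_def)
  have dc: "deriv (\<lambda>x. cos (of_int k * x)) = (\<lambda>x. - of_int k * sin (of_int k * x :: real))"
    by (rule ext, rule DERIV_imp_deriv) (auto intro!: derivative_eq_intros)
  have ds: "deriv (\<lambda>x. sin (of_int k * x)) = (\<lambda>x. of_int k * cos (of_int k * x :: real))"
    by (rule ext, rule DERIV_imp_deriv) (auto intro!: derivative_eq_intros)
  have c: "of_int k * torus_integral (\<lambda>x. f x * sin (of_int k * x))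
      = torus_integral (\<lambda>x. g x * cos (of_int k * x))"
    using ibp[of "\<lambda>x. cos (of_int k * x)"] smooth_cos_sin[of 1
        "of_int k" 0] periodic_cos_sin[of 1 k 0]
      torus_integral_cmult[of "- of_int k" "\<lambda>x. f x * sin (of_int k * x)"]
    by (simp add: dc mult.left_commute)
  have s: "of_int k * torus_integral (\<lambda>x. f x * cos (of_int k * x))
      = - torus_integral (\<lambda>x. g x * sin (of_int k * x))"
    using ibp[of "\<lambda>x. sin (of_int k * x)"] smooth_cos_sin[of 0
        "of_int k" 1] periodic_cos_sin[of 0 k 1]
      torus_integral_cmult[of "of_int k" "\<lambda>x. f x * cos (of_int k * x)"]
    by (simp add: ds mult.left_commute)
  show ?thesis unfolding fourier_coeff_cos_sin[OF f] fourier_coeff_cos_sin[OF g]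
    by (simp add: complex_eq_iff c[symmetric] s[symmetric])
qed

lemma torus_integral_sum:
  assumes "finite A" "\<And>k. k \<in> A \<Longrightarrow> integrable_T (h k)"
  shows "integrable_T (\<lambda>x. \<Sum>k\<in>A. h k x)"
      "torus_integral (\<lambda>x. \<Sum>k\<in>A. h k x) = (\<Sum>k\<in>A. torus_integral (h k))"
proof -
  have "integrable_T (\<lambda>x. \<Sum>k\<in>A. h k x) \<and> torus_integral (\<lambda>x. \<Sum>k\<in>A. h k x)
      = (\<Sum>k\<in>A. torus_integral (h k))"
    using assms
  proof (induction A rule: finite_induct)
    case empty then show ?case using integrable_T_0 by (simp add: torus_integral_def)
  next
    case (insert k A)
    then show ?case by (auto simp: torus_integral_add intro!: set_integral_add)
  qed
  then show "integrable_T (\<lambda>x. \<Sum>k\<in>A. h k x)"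
      "torus_integral (\<lambda>x. \<Sum>k\<in>A. h k x) = (\<Sum>k\<in>A. torus_integral (h k))" by auto
qed

text \<open>
  Expand \<open>0 \<le> \<integral> \<bar>h - P\<bar>\<^sup>2\<close>, where \<open>P\<close> is the part of the Fourier series of \<open>h\<close> with frequencies in \<open>A\<close>.
\<close>

lemma bessel:
  assumes h: "continuous_on UNIV h" "\<And>x. \<bar>h x\<bar> \<le> B"
  shows "sob_le 0 (fourier_coeff h) B"
proof (rule sob_leI)
  fix A :: "int set" assume A: "finite A"
  have B: "0 \<le> B" using h(2)[of 0] by linarith
  define c where "c = fourier_coeff h"
  define P where "P x = (\<Sum>k\<in>A. c k * cis (of_int k * x))" for x
  have hi: "integrable_T h" by (rule integrable_T_continuous)
      (rule continuous_on_subset[OF h(1)], simp)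
  have cP: "continuous_on S P" for S unfolding P_def by (intro continuous_intros)
  have ch: "continuous_on S (\<lambda>x. complex_of_real (h x))" for S
    using continuous_on_subset[OF h(1)] by (intro continuous_on_of_real) auto
  have sq: "cmod (of_real (h x) - P x) ^ 2
      = (h x)\<^sup>2 - 2 * Re (of_real (h x) * cnj (P x)) + Re (P x * cnj (P x))" for x
    by (simp only: cmod_power2) (simp add: power2_eq_square algebra_simps)
  have hP: "torus_integral (\<lambda>x. of_real (h x) * cnj (P x))
      = complex_of_real (2 * pi) * (\<Sum>k\<in>A. complex_of_real ((cmod (c k))\<^sup>2))"
  proof -
    have "(\<lambda>x. of_real (h x) * cnj (P x))
        = (\<lambda>x. \<Sum>k\<in>A. cnj (c k) * (of_real (h x) * cis (- (of_int k * x))))"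
      by (simp add: P_def sum_distrib_left cis_cnj mult_ac)
    then have "torus_integral (\<lambda>x. of_real (h x) * cnj (P x))
        = (\<Sum>k\<in>A. torus_integral (\<lambda>x. cnj (c k) * (of_real (h x) * cis (- (of_int k * x)))))"
      using A by (simp only: ) (intro torus_integral_sum(2) set_integrable_mult_right
          fourier_integrable[OF hi])
    also have "\<dots> = (\<Sum>k\<in>A. complex_of_real (2 * pi) * complex_of_real ((cmod (c k))\<^sup>2))"
    proof (intro sum.cong refl)
      fix k
      have "torus_integral (\<lambda>x. of_real (h x) * cis (- (of_int k * x))) = 2 * pi * c k"
        by (simp add: c_def fourier_coeff_def)
      then show "torus_integral (\<lambda>x. cnj (c k) * (of_real (h x) * cis (- (of_int k * x))))
          = complex_of_real (2 * pi) * complex_of_real ((cmod (c k))\<^sup>2)"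
        unfolding torus_integral_cmult by (simp add: complex_norm_square mult_ac del: of_real_power)
    qed
    finally show ?thesis by (simp add: sum_distrib_left)
  qed
  have PP: "torus_integral (\<lambda>x. P x * cnj (P x))
      = complex_of_real (2 * pi) * (\<Sum>k\<in>A. complex_of_real ((cmod (c k))\<^sup>2))"
  proof -
    have Pl: "torus_integral (\<lambda>x. P x * cis (of_int (- l) * x))
        = (if l \<in> A then 2 * pi * c l else 0)" for l
    proof -
      have "(\<lambda>x. P x * cis (of_int (- l) * x)) = (\<lambda>x. \<Sum>k\<in>A. c k * cis (of_int (k - l) * x))"
      proof
        fix x
        have "cis (of_int k * x) * cis (of_int (- l) * x) = cis (of_int (k - l) * x)" for k
          by (simp add: cis_mult algebra_simps)
        then show "P x * cis (of_int (- l) * x) = (\<Sum>k\<in>A. c k * cis (of_int (k - l) * x))"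
          by (simp only: P_def sum_distrib_right mult.assoc)
      qed
      then have "torus_integral (\<lambda>x. P x * cis (of_int (- l) * x))
          = (\<Sum>k\<in>A. torus_integral (\<lambda>x. c k * cis (of_int (k - l) * x)))"
        using A by (simp only: ) (intro torus_integral_sum(2) integrable_T_continuous
            continuous_intros)
      also have "\<dots> = (\<Sum>k\<in>A. if k = l then 2 * pi * c k else 0)"
        unfolding torus_integral_cmult torus_integral_cis by (intro sum.cong) auto
      finally show ?thesis using A by (simp add: sum.delta')
    qed
    have "(\<lambda>x. P x * cnj (P x)) = (\<lambda>x. \<Sum>k\<in>A. cnj (c k) * (P x * cis (of_int (- k) * x)))"
    proof
      fix x
      have "cnj (P x) = (\<Sum>k\<in>A. cnj (c k) * cis (of_int (- k) * x))" by (simp add: P_def cis_cnj)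
      then show "P x * cnj (P x) = (\<Sum>k\<in>A. cnj (c k) * (P x * cis (of_int (- k) * x)))"
        by (simp only: sum_distrib_left) (simp add: mult_ac)
    qed
    then have "torus_integral (\<lambda>x. P x * cnj (P x))
        = (\<Sum>k\<in>A. torus_integral (\<lambda>x. cnj (c k) * (P x * cis (of_int (- k) * x))))"
      using A by (simp only: ) (intro torus_integral_sum(2) integrable_T_continuous
          continuous_intros cP)
    also have "\<dots> = (\<Sum>k\<in>A. complex_of_real (2 * pi) * complex_of_real ((cmod (c k))\<^sup>2))"
      unfolding torus_integral_cmult Pl
          by (intro sum.cong) (auto simp: complex_norm_square mult_ac simp del: of_real_power)
    finally show ?thesis by (simp add: sum_distrib_left)
  qed
  define S where "S = (\<Sum>k\<in>A. (cmod (c k))\<^sup>2)"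
  have "torus_integral (\<lambda>x. (h x)\<^sup>2 - 2 * Re (of_real (h x) * cnj (P x)) + Re (P x * cnj (P x)))
      = torus_integral (\<lambda>x. (h x)\<^sup>2) - 2 * torus_integral (\<lambda>x. Re (of_real (h x) * cnj (P x)))
          + torus_integral (\<lambda>x. Re (P x * cnj (P x)))"
  proof -
    have i1: "integrable_T (\<lambda>x. (h x)\<^sup>2)"
        by (intro integrable_T_continuous continuous_intros continuous_on_subset[OF h(1)]) auto
    have i2: "integrable_T (\<lambda>x. 2 * Re (of_real (h x) * cnj (P x)))"
        by (intro integrable_T_continuous continuous_intros ch cP)
    have i3: "integrable_T (\<lambda>x. Re (P x * cnj (P x)))"
        by (intro integrable_T_continuous continuous_intros cP)
    show ?thesis
      using torus_integral_add[OF set_integral_diff(1)[OF i1 i2] i3] torus_integral_diff[OF i1 i2]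
        torus_integral_cmult[of 2 "\<lambda>x. Re (of_real (h x) * cnj (P x))"] by simp
  qed
  also have "torus_integral (\<lambda>x. Re (of_real (h x) * cnj (P x))) = 2 * pi * S"
    by (subst torus_integral_Re)
        (auto intro!: integrable_T_continuous continuous_intros ch cP simp: hP S_def)
  also have "torus_integral (\<lambda>x. Re (P x * cnj (P x))) = 2 * pi * S"
    by (subst torus_integral_Re)
        (auto intro!: integrable_T_continuous continuous_intros ch cP simp: PP S_def)
  finally have eq: "torus_integral (\<lambda>x. (cmod (of_real (h x) - P x))\<^sup>2)
      = torus_integral (\<lambda>x. (h x)\<^sup>2) - 2 * pi * S"
    by (simp only: sq)
  moreover have "0 \<le> torus_integral (\<lambda>x. (cmod (of_real (h x) - P x))\<^sup>2)"
    unfolding torus_integral_def set_lebesgue_integral_def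
        by (intro Bochner_Integration.integral_nonneg) auto
  moreover have "torus_integral (\<lambda>x. (h x)\<^sup>2) \<le> 2 * pi * B\<^sup>2"
  proof -
    have "norm (torus_integral (\<lambda>x. (h x)\<^sup>2)) \<le> torus_integral (\<lambda>x. B\<^sup>2 * 1)"
    proof (rule torus_integral_norm_bound)
      show "norm ((h x)\<^sup>2) \<le> B\<^sup>2 * 1" for x using h(2)[of x] B
          by (simp add: abs_le_square_iff[symmetric])
      show "integrable_T (\<lambda>x. (h x)\<^sup>2)"
        by (intro integrable_T_continuous continuous_on_power continuous_on_subset[OF h(1)]) simp
      show "integrable_T (\<lambda>x. B\<^sup>2 * 1)" by (intro integrable_T_continuous continuous_on_const)
    qed
    then show ?thesis unfolding torus_integral_cmult torus_integral_one by (simp add: mult_ac)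
  qed
  ultimately have "2 * pi * S \<le> 2 * pi * B\<^sup>2" by linarith
  then have "S \<le> B\<^sup>2" by simp
  then have "sqrt S \<le> sqrt (B\<^sup>2)" by (rule real_sqrt_le_mono)
  then show "L2_set (\<lambda>k. weight 0 k * cmod (fourier_coeff h k)) A \<le> B"
    using B by (simp add: L2_set_def S_def c_def)
qed

lemma composition_fourier_coeff:
  assumes c: "sob_le 2 c M" "herm c"
    and p: "\<And>x. (p has_real_derivative p' x) (at x)" "continuous_on UNIV p'"
  shows "\<i> * of_int k * fourier_coeff (\<lambda>x. p (rseries c x)) k
     = fourier_coeff (\<lambda>x. p' (rseries c x) * rseries (\<lambda>k. \<i> * of_int k * c k) x) k"
proof -
  let ?g = "rseries c" and ?g' = "rseries (\<lambda>k. \<i> * of_int k * c k)"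
  have l1: "l1_le c (l1_const * M)" by (rule sob_le_1_imp_l1_le[OF sob_le_weaken[OF c(1)]]) simp
  have d1: "sob_le 1 (\<lambda>k. \<i> * of_int k * c k) M" using sob_le_deriv[of 1 c M] c by simp
  have cg: "continuous_on UNIV ?g" by (rule rseries_continuous[OF l1])
  have cg': "continuous_on UNIV ?g'" by (rule rseries_continuous[OF sob_le_1_imp_l1_le[OF d1]])
  have cp: "continuous_on UNIV p" using p(1)
      by (intro continuous_at_imp_continuous_on) (auto intro: DERIV_isCont)
  have cpg: "continuous_on S (\<lambda>x. p (?g x))" for S
    by (rule continuous_on_subset[OF continuous_on_compose2[OF cp cg]]) auto
  have cpg': "continuous_on S (\<lambda>x. p' (?g x) * ?g' x)" for S
    by (intro continuous_on_mult continuous_on_subset[OF continuous_on_compose2[OF p(2) cg]]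
        continuous_on_subset[OF cg']) auto
  have dpg: "((\<lambda>x. p (?g x)) has_real_derivative p' (?g x) * ?g' x) (at x)" for x
    by (rule DERIV_chain2[OF p(1) rseries_has_derivative[OF c(1)]])
  define F where "F x = complex_of_real (p (?g x)) * cis (of_int (- k) * x)" for x
  define f where "f x = complex_of_real (p' (?g x) * ?g' x) * cis (of_int (- k) * x)
     - \<i> * of_int k * (complex_of_real (p (?g x)) * cis (of_int (- k) * x))" for x
  have "torus_integral f = F (2 * pi) - F 0"
  proof (rule torus_integral_FTC)
    fix x
    have "((\<lambda>x. complex_of_real (p (?g x)))
        has_vector_derivative complex_of_real (p' (?g x) * ?g' x)) (at x)"
      using dpg by (intro bounded_linear.has_vector_derivative[OF bounded_linear_of_real])
          (simp add: has_real_derivative_iff_has_vector_derivative)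
    from has_vector_derivative_mult[OF this cis_has_vector_derivative[of "of_int (- k)" x UNIV]]
    show "(F has_vector_derivative f x) (at x)" by (simp add: F_def[abs_def] f_def algebra_simps)
  qed (unfold f_def, intro continuous_intros cpg cpg')
  also have "F (2 * pi) = F 0"
  proof -
    have "?g (2 * pi) = ?g 0" using rseries_periodic[of c]
        by (simp add: torus_periodic_def) (metis add_0)
    moreover have "cis (of_int (- k) * (2 * pi)) = 1"
      using cis_multiple_2pi[of "of_int (- k)"] by (simp add: mult_ac)
    ultimately show ?thesis by (simp add: F_def)
  qed
  finally have "torus_integral f = 0" by simp
  moreover have "torus_integral f
      = torus_integral (\<lambda>x. complex_of_real (p' (?g x) * ?g' x) * cis (of_int (- k) * x))
     - \<i> * of_int k * torus_integral (\<lambda>x. complex_of_real (p (?g x)) * cis (of_int (- k) * x))"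
    unfolding f_def
    by (subst torus_integral_diff)
        (auto intro!: integrable_T_continuous continuous_intros cpg cpg' simp only:
        torus_integral_cmult)
  ultimately show ?thesis by (simp add: fourier_coeff_def)
qed

text \<open>
  The chain rule shows that \<open>p \<circ> g\<close> has a bounded continuous derivative, and Bessel's inequality bounds
  the coefficients of this derivative.
\<close>

lemma composition_H1:
  assumes c: "sob_le 2 c M" "herm c"
    and p: "\<And>x. (p has_real_derivative p' x) (at x)" "continuous_on UNIV p'"
    and L: "\<And>x. \<bar>x\<bar> \<le> l1_const * M \<Longrightarrow> \<bar>p x\<bar> \<le> L" "\<And>x. \<bar>x\<bar> \<le> l1_const * M \<Longrightarrow> \<bar>p' x\<bar> \<le> L"
  shows "sob_le 1 (fourier_coeff (\<lambda>x. p (rseries c x))) (L + L * (l1_const * M))"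
proof -
  let ?g = "rseries c" and ?g' = "rseries (\<lambda>k. \<i> * of_int k * c k)"
  let ?a = "fourier_coeff (\<lambda>x. p (?g x))"
  have l1: "l1_le c (l1_const * M)" by (rule sob_le_1_imp_l1_le[OF sob_le_weaken[OF c(1)]]) simp
  have "sob_le 1 (\<lambda>k. \<i> * of_int k * c k) M" using sob_le_deriv[of 1 c M] c by simp
  note d1 = sob_le_1_imp_l1_le[OF this]
  have cg: "continuous_on UNIV ?g" by (rule rseries_continuous[OF l1])
  have cp: "continuous_on UNIV p" using p(1)
      by (intro continuous_at_imp_continuous_on) (auto intro: DERIV_isCont)
  have a0: "sob_le 0 ?a L"
    by (rule bessel) (auto intro: continuous_on_compose2[OF cp cg] L rseries_bound[OF l1])
  have "sob_le 0 (fourier_coeff (\<lambda>x. p' (?g x) * ?g' x)) (L * (l1_const * M))"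
  proof (rule bessel)
    show "continuous_on UNIV (\<lambda>x. p' (?g x) * ?g' x)"
      by (intro continuous_on_mult continuous_on_compose2[OF p(2) cg] rseries_continuous[OF d1])
          auto
    fix x
    show "\<bar>p' (?g x) * ?g' x\<bar> \<le> L * (l1_const * M)"
      unfolding abs_mult using L(2)[OF rseries_bound[OF l1]] rseries_bound[OF d1]
      by (intro mult_mono) (auto intro: order_trans[OF abs_ge_zero])
  qed
  then have ka: "sob_le 0 (\<lambda>k. \<i> * of_int k * ?a k) (L * (l1_const * M))"
    unfolding composition_fourier_coeff[OF c p] .
  have "sob_le 0 (\<lambda>k. of_real (cmod (?a k)) + of_real (cmod (\<i> * of_int k * ?a k))) (L + L
      * (l1_const * M))"
    by (rule sob_le_add) (use a0 ka in \<open>simp_all add: sob_le_def\<close>)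
  from sob_le_comparison[OF this, of 1 1 ?a] show ?thesis
  proof (simp, elim meta_mp)
    fix k
    have "weight 1 k \<le> 1 + \<bar>real_of_int k\<bar>"
      by (rule power2_le_imp_le) (auto simp: weight_1_sq power2_sum)
    from mult_right_mono[OF this, of "cmod (?a k)"]
    have "weight 1 k * cmod (?a k) \<le> cmod (?a k) + \<bar>real_of_int k\<bar> * cmod (?a k)"
        by (simp add: algebra_simps)
    also have "\<dots> = cmod (of_real (cmod (?a k) + cmod (\<i> * of_int k * ?a k)))"
      unfolding norm_of_real by (simp add: norm_mult)
    finally show "weight 1 k * cmod (?a k)
        \<le> cmod (complex_of_real (cmod (?a k)) + complex_of_real
        (cmod (\<i> * complex_of_int k * ?a k)))"
      by simp
  qed
qed

lemma smooth_derivatives: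
  assumes "smooth q"
  shows "((deriv ^^ n) q has_real_derivative (deriv ^^ Suc n) q x) (at x)"
      "continuous_on UNIV ((deriv ^^ n) q)"
proof -
  have d: "(deriv ^^ n) q differentiable (at x)" for n x using assms by (simp add: smooth_def)
  then obtain D where "((deriv ^^ n) q has_real_derivative D) (at x)"
      by (auto simp: real_differentiable_def)
  then show "((deriv ^^ n) q has_real_derivative (deriv ^^ Suc n) q x) (at x)"
      by (simp add: DERIV_imp_deriv)
  show "continuous_on UNIV ((deriv ^^ n) q)"
    using d by (intro continuous_at_imp_continuous_on ballI differentiable_imp_continuous_within)
        auto
qed

text \<open>
  The derivative \<open>(q' \<circ> g) g'\<close> is a product of two functions in \<open>H\<^sup>1\<close>. This bounds \<open>q \<circ> g\<close> in \<open>H\<^sup>2\<close> up to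
  its mean.
\<close>

lemma composition_derivative_H1:
  assumes c: "sob_le 2 c M" "herm c" and q: "smooth q"
    and L: "\<And>x. \<bar>x\<bar> \<le> l1_const * M \<Longrightarrow> \<bar>deriv q x\<bar> \<le> L" "\<And>x. \<bar>x\<bar> \<le> l1_const * M
        \<Longrightarrow> \<bar>(deriv ^^ 2) q x\<bar> \<le> L"
  shows "sob_le 1 (\<lambda>k. \<i> * of_int k * fourier_coeff (\<lambda>x. q (rseries c x)) k)
    (alg_const 1 * ((L + L * (l1_const * M)) * M))"
proof -
  have d1: "sob_le 1 (\<lambda>k. \<i> * of_int k * c k) M" using sob_le_deriv[of 1 c M] c by simp
  have l1: "l1_le c (l1_const * M)" by (rule sob_le_1_imp_l1_le[OF sob_le_weaken[OF c(1)]]) simp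
  have q1: "\<And>x. (q has_real_derivative deriv q x) (at x)" "continuous_on UNIV (deriv q)"
    using smooth_derivatives[OF q, of 0] smooth_derivatives[OF q, of 1] by simp_all
  have q2: "\<And>x. (deriv q has_real_derivative (deriv ^^ 2) q x) (at x)"
      "continuous_on UNIV ((deriv ^^ 2) q)"
    using smooth_derivatives[OF q, of 1] smooth_derivatives[OF q, of 2]
        by (simp_all add: numeral_2_eq_2)
  have i: "integrable_T (\<lambda>x. deriv q (rseries c x))"
    by (rule integrable_T_continuous[OF
        continuous_on_subset[OF continuous_on_compose2[OF q1(2) rseries_continuous[OF l1]]]]) auto
  have "(\<lambda>k. \<i> * of_int k * fourier_coeff (\<lambda>x. q (rseries c x)) k)
     = conv (fourier_coeff (\<lambda>x. deriv q (rseries c x))) (\<lambda>k. \<i> * of_int k * c k)"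
    unfolding composition_fourier_coeff[OF c q1]
        fourier_coeff_mult_rseries(2)[OF i sob_le_1_imp_l1_le[OF d1] herm_deriv[OF c(2)]] ..
  then show ?thesis using sob_le_conv[OF _ composition_H1[OF c q2 L] d1] by simp
qed

section \<open>The Euler system in Fourier coefficients\<close>

text \<open>
  The pressure term is a composition with the Fourier series of \<open>\<rho>\<close>, which agrees with \<open>\<rho>\<close> almost
  everywhere and is continuously differentiable.
\<close>

lemma euler_fourier:
  assumes sol: "euler_solution \<gamma> q1 \<epsilon> s T u0 \<rho>0 u \<rho>" and \<epsilon>: "0 < \<epsilon>" and s: "2 \<le> s"
    and q: "smooth (q1 \<epsilon>)" and t: "t \<in> {0..<T}"
  shows "((\<lambda>t. fourier_coeff (u t) k) has_vector_derivative
      - \<i> * of_int k * (conv (fourier_coeff (u t)) (fourier_coeff (u t)) k / 2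
        + of_real ((\<gamma> - 2) / 2) * conv (fourier_coeff (\<rho> t)) (fourier_coeff (\<rho> t)) k
            + fourier_coeff (\<rho> t) k / of_real \<epsilon>)
      - of_real \<epsilon> * (\<i> * of_int k * fourier_coeff (\<lambda>x. q1 \<epsilon> (rseries (fourier_coeff (\<rho> t)) x)) k))
          (at t within {0..<T})"
    and "((\<lambda>t. fourier_coeff (\<rho> t) k) has_vector_derivative
      - \<i> * of_int k * (conv (fourier_coeff (\<rho> t)) (fourier_coeff (u t)) k + fourier_coeff
          (u t) k / of_real \<epsilon>)) (at t within {0..<T})"
proof -
  have S: "u t \<in> sobolev s" "\<rho> t \<in> sobolev s" using sol t
      by (auto simp: euler_solution_def C0_sobolev_def)
  note U = sobolev_imp_sob_le[OF S(1)] and R = sobolev_imp_sob_le[OF S(2)]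
  have U1: "sob_le 1 (fourier_coeff (u t)) (sobolev_norm s (u t))"
      and R1: "sob_le 1 (fourier_coeff (\<rho> t)) (sobolev_norm s (\<rho> t))"
    using U(2) R(2) s by (auto intro: sob_le_weaken)
  obtain u' where u': "has_time_derivative T (s - 1) u u'"
    "has_weak_derivative (\<lambda>x. (u t x)\<^sup>2 / 2 + pressure \<gamma> q1 \<epsilon> (\<rho> t x) + \<rho> t x / \<epsilon>) (\<lambda>x. - u' t x)"
    using sol t by (auto simp: euler_solution_def conservation_law_def)
  obtain r' where r': "has_time_derivative T (s - 1) \<rho> r'"
    "has_weak_derivative (\<lambda>x. \<rho> t x * u t x + u t x / \<epsilon>) (\<lambda>x. - r' t x)"
    using sol t by (auto simp: euler_solution_def conservation_law_def)
  note ui = torus_L2_imp_integrable[OF U(1)] and ri = torus_L2_imp_integrable[OF R(1)]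
  note uu = fourier_coeff_mult[OF U(1) U(1) U1] and rr = fourier_coeff_mult[OF R(1) R(1) R1]
      and ru = fourier_coeff_mult[OF R(1) U(1) U1]
  let ?q = "\<lambda>x. q1 \<epsilon> (\<rho> t x)"
  let ?rs = "rseries (fourier_coeff (\<rho> t))"
  note l1 = sob_le_1_imp_l1_le[OF R1]
  have cq: "continuous_on UNIV (q1 \<epsilon>)" using smooth_derivatives(2)[OF q, of 0] by simp
  have cqr: "continuous_on UNIV (\<lambda>x. q1 \<epsilon> (?rs x))"
    by (rule continuous_on_compose2[OF cq rseries_continuous[OF l1]]) simp
  have ae: "AE x in lborel. q1 \<epsilon> (?rs x) = ?q x"
    using fourier_series_AE[OF R(1) R1] by eventually_elim simp
  have qm: "?q \<in> borel_measurable borel"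
    using R(1) by (intro measurable_compose[OF _ borel_measurable_continuous_onI[OF cq]])
        (simp add: torus_L2_def)
  have qi: "integrable_T ?q"
    by (rule integrable_T_cong_AE[OF integrable_T_continuous[OF continuous_on_subset[OF cqr]] ae
        qm]) simp
  have qf: "fourier_coeff ?q k = fourier_coeff (\<lambda>x. q1 \<epsilon> (?rs x)) k"
    by (rule fourier_coeff_cong_AE[OF ae borel_measurable_continuous_onI[OF cqr] qm, symmetric])
  have flux: "(\<lambda>x. (u t x)\<^sup>2 / 2 + pressure \<gamma> q1 \<epsilon> (\<rho> t x) + \<rho> t x / \<epsilon>)
     = (\<lambda>x. (1 / 2 * (u t x * u t x) + ((\<gamma> - 2) / 2 * (\<rho> t x * \<rho> t x) + \<epsilon> * ?q x)) + 1 / \<epsilon> * \<rho> t x)"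
    by (simp add: pressure_def power2_eq_square)
  have F1: "fourier_coeff (\<lambda>x. (u t x)\<^sup>2 / 2 + pressure \<gamma> q1 \<epsilon> (\<rho> t x) + \<rho> t x / \<epsilon>) k
     = of_real (1 / 2) * conv (fourier_coeff (u t)) (fourier_coeff (u t)) k
      + (of_real ((\<gamma> - 2) / 2) * conv (fourier_coeff (\<rho> t)) (fourier_coeff (\<rho> t)) k + of_real \<epsilon>
          * fourier_coeff (\<lambda>x. q1 \<epsilon> (?rs x)) k)
      + of_real (1 / \<epsilon>) * fourier_coeff (\<rho> t) k"
    unfolding flux
    by (subst fourier_coeff_add fourier_coeff_cmult,
        (intro set_integral_add(1) set_integrable_mult_right uu rr qi ri)+)+
      (simp only: fourier_coeff_cmult uu rr qf)
  have flux2: "(\<lambda>x. \<rho> t x * u t x + u t x / \<epsilon>) = (\<lambda>x. \<rho> t x * u t x + 1 / \<epsilon> * u t x)" by simp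
  have F2: "fourier_coeff (\<lambda>x. \<rho> t x * u t x + u t x / \<epsilon>) k
     = conv (fourier_coeff (\<rho> t)) (fourier_coeff (u t)) k + of_real (1 / \<epsilon>) * fourier_coeff (u t) k"
    unfolding flux2
    using fourier_coeff_add[OF ru(1) set_integrable_mult_right[OF ui, of "1 / \<epsilon>"], of k]
    by (simp only: fourier_coeff_cmult ru)
  have neg: "fourier_coeff (\<lambda>x. - f x) k = - fourier_coeff f k" for f
      using fourier_coeff_cmult[of "-1" f k] by simp
  have "fourier_coeff (u' t) k
      = - (\<i> * of_int k * fourier_coeff
      (\<lambda>x. (u t x)\<^sup>2 / 2 + pressure \<gamma> q1 \<epsilon> (\<rho> t x) + \<rho> t x / \<epsilon>) k)"
    using weak_derivative_fourier_coeff[OF u'(2), of k] unfolding neg by (metis minus_minus)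
  also have "\<dots> = - \<i> * of_int k * (conv (fourier_coeff (u t)) (fourier_coeff (u t)) k / 2
        + of_real ((\<gamma> - 2) / 2) * conv (fourier_coeff (\<rho> t)) (fourier_coeff (\<rho> t)) k
            + fourier_coeff (\<rho> t) k / of_real \<epsilon>)
      - of_real \<epsilon> * (\<i> * of_int k * fourier_coeff (\<lambda>x. q1 \<epsilon> (rseries (fourier_coeff (\<rho> t)) x)) k)"
  proof -
    define g where "g = (\<gamma> - 2) / 2"
    show ?thesis unfolding F1 g_def[symmetric] by (simp add: algebra_simps)
  qed
  finally show "((\<lambda>t. fourier_coeff (u t) k) has_vector_derivative
      - \<i> * of_int k * (conv (fourier_coeff (u t)) (fourier_coeff (u t)) k / 2
        + of_real ((\<gamma> - 2) / 2) * conv (fourier_coeff (\<rho> t)) (fourier_coeff (\<rho> t)) k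
            + fourier_coeff (\<rho> t) k / of_real \<epsilon>)
      - of_real \<epsilon> * (\<i> * of_int k * fourier_coeff (\<lambda>x. q1 \<epsilon> (rseries (fourier_coeff (\<rho> t)) x)) k))
          (at t within {0..<T})"
    using time_derivative_fourier_coeff[OF u'(1) _ t, of k] s by (simp only: )
  have "fourier_coeff (r' t) k = - (\<i> * of_int k * fourier_coeff (\<lambda>x. \<rho> t x * u t x + u t x / \<epsilon>) k)"
    using weak_derivative_fourier_coeff[OF r'(2), of k] unfolding neg by (metis minus_minus)
  also have "\<dots> = - \<i> * of_int k
      * (conv (fourier_coeff (\<rho> t)) (fourier_coeff (u t)) k + fourier_coeff (u t) k / of_real \<epsilon>)"
    unfolding F2 by (simp add: algebra_simps)
  finally show "((\<lambda>t. fourier_coeff (\<rho> t) k) has_vector_derivative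
      - \<i> * of_int k * (conv (fourier_coeff (\<rho> t)) (fourier_coeff (u t)) k + fourier_coeff
          (u t) k / of_real \<epsilon>)) (at t within {0..<T})"
    using time_derivative_fourier_coeff[OF r'(1) _ t, of k] s by (simp only: )
qed

section \<open>Filtering the acoustic waves\<close>

text \<open>
  The coefficients of \<open>x \<mapsto> f (x + \<theta>)\<close>, if \<open>a\<close> are those of \<open>f\<close>.
\<close>

definition modulate :: "real \<Rightarrow> (int \<Rightarrow> complex) \<Rightarrow> int \<Rightarrow> complex" where
  "modulate \<theta> a = (\<lambda>k. cis (of_int k * \<theta>) * a k)"

lemma modulate_modulate: "modulate \<theta> (modulate \<eta> a) = modulate (\<theta> + \<eta>) a"
proof
  fix k
  have "cis (of_int k * (\<theta> + \<eta>)) = cis (of_int k * \<theta>) * cis (of_int k * \<eta>)"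
    by (simp add: cis_mult distrib_left)
  then show "modulate \<theta> (modulate \<eta> a) k = modulate (\<theta> + \<eta>) a k" by (simp add: modulate_def)
qed

lemma modulate_0 [simp]: "modulate 0 a = a"
  by (simp add: modulate_def)

lemma conv_modulate: "conv (modulate \<theta> a) (modulate \<theta> b) = modulate \<theta> (conv a b)"
  unfolding modulate_def by (rule ext) (rule conv_modulation)

lemma sob_le_modulate: "sob_le \<sigma> a M \<Longrightarrow> sob_le \<sigma> (modulate \<theta> a) M"
  by (simp add: sob_le_def modulate_def norm_mult)

lemma herm_modulate: "herm a \<Longrightarrow> herm (modulate \<theta> a)"
  unfolding modulate_def by (rule herm_modulation)

text \<open>
  Coefficients bounded in \<open>H\<^sup>1\<close> are bounded by a multiple of \<open>\<langle>l\<rangle>\<^sup>-\<^sup>1\<close>, and \<open>\<langle>k - l\<rangle>\<^sup>-\<^sup>1 \<langle>l\<rangle>\<^sup>-\<^sup>1\<close> is a summable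
  majorant.
\<close>

lemma conv_has_vector_derivative:
  assumes S: "convex S" "t \<in> S"
    and x: "\<And>k t. t \<in> S \<Longrightarrow> ((\<lambda>t. x t k) has_vector_derivative x' t k) (at t within S)"
    and y: "\<And>k t. t \<in> S \<Longrightarrow> ((\<lambda>t. y t k) has_vector_derivative y' t k) (at t within S)"
    and b: "\<And>t. t \<in> S \<Longrightarrow> sob_le 1 (x t) X" "\<And>t. t \<in> S \<Longrightarrow> sob_le 1 (x' t) X'"
      "\<And>t. t \<in> S \<Longrightarrow> sob_le 1 (y t) Y" "\<And>t. t \<in> S \<Longrightarrow> sob_le 1 (y' t) Y'"
  shows "((\<lambda>t. conv (x t) (y t) k) has_vector_derivative conv (x' t) (y t) k
      + conv (x t) (y' t) k) (at t within S)"
proof -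
  define m where "m l = (X' * Y + X * Y') * ((1 / (weight 1 (k - l))\<^sup>2 + 1 / (weight 1 l)\<^sup>2) / 2)"
      for l
  have pt: "cmod (a l) \<le> A / weight 1 l" if "sob_le 1 a A" for a A l
    using sob_le_point[OF that, of l] by (simp add: le_divide_eq mult.commute)
  \<comment> \<open>the majorant, by the inequality of arithmetic and geometric means\<close>
  have am: "1 / weight 1 (k - l) * (1 / weight 1 l)
      \<le> (1 / (weight 1 (k - l))\<^sup>2 + 1 / (weight 1 l)\<^sup>2) / 2" for l
    using zero_le_power2[of "1 / weight 1 (k - l) - 1 / weight 1 l"]
    unfolding power2_diff by (simp add: power_divide)
  have prod: "cmod (a (k - l) * c l)
      \<le> A * C * ((1 / (weight 1 (k - l))\<^sup>2 + 1 / (weight 1 l)\<^sup>2) / 2)"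
    if "sob_le 1 a A" "sob_le 1 c C" for a c A C l
  proof -
    have "cmod (a (k - l) * c l) \<le> (A / weight 1 (k - l)) * (C / weight 1 l)"
      unfolding norm_mult using pt[OF that(1)] pt[OF that(2)] sob_le_nonneg[OF that(1)]
      by (intro mult_mono) auto
    also have "\<dots> = A * C * (1 / weight 1 (k - l) * (1 / weight 1 l))" by simp
    also have "\<dots> \<le> A * C * ((1 / (weight 1 (k - l))\<^sup>2 + 1 / (weight 1 l)\<^sup>2) / 2)"
      using sob_le_nonneg[OF that(1)] sob_le_nonneg[OF that(2)] by (intro mult_left_mono am) auto
    finally show ?thesis .
  qed
  have sw: "(\<lambda>l. 1 / (weight 1 l)\<^sup>2) summable_on UNIV"
    using summable_inverse_square_int by (simp add: weight_1_sq)
  have sw': "(\<lambda>l. 1 / (weight 1 (k - l))\<^sup>2) summable_on UNIV"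
    using sw by (subst summable_on_reindex_bij_witness[of UNIV "\<lambda>l. k - l" "\<lambda>l. k - l" UNIV
        "\<lambda>l. 1 / (weight 1 l)\<^sup>2"]) auto
  have sm: "m summable_on UNIV"
  proof -
    have "m = (\<lambda>l. (X' * Y + X * Y') / 2 * (1 / (weight 1 (k - l))\<^sup>2 + 1 / (weight 1 l)\<^sup>2))"
      by (simp add: m_def fun_eq_iff)
    then show ?thesis by (simp only:) (intro summable_on_cmult_right summable_on_add sw sw')
  qed
  have b0: "sob_le 0 (x t) X" "sob_le 0 (x' t) X'" "sob_le 0 (y t) Y" "sob_le 0 (y' t) Y'"
      if "t \<in> S" for t
    using b[OF that] by (auto intro: sob_le_weaken)
  have s1: "(\<lambda>l. x' t (k - l) * y t l) summable_on UNIV"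
      "(\<lambda>l. x t (k - l) * y' t l) summable_on UNIV" 
    "(\<lambda>l. x t (k - l) * y t l) summable_on UNIV" if "t \<in> S" for t
    using conv_summable[OF b0(2)[OF that] b0(3)[OF that]]
        conv_summable[OF b0(1)[OF that] b0(4)[OF that]]
      conv_summable[OF b0(1)[OF that] b0(3)[OF that]]
    by (auto intro: abs_summable_summable)
  have "((\<lambda>t. \<Sum>\<^sub>\<infinity>l. x t (k - l) * y t l)
      has_vector_derivative (\<Sum>\<^sub>\<infinity>l. x' t (k - l) * y t l + x t (k - l) * y' t l)) (at t within S)"
  proof (rule has_vector_derivative_infsum[OF S _ _ sm])
    fix l t assume t: "t \<in> S"
    show "((\<lambda>t. x t (k - l) * y t l) has_vector_derivative x' t (k - l) * y t l + x t (k - l)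
        * y' t l) (at t within S)"
      using has_vector_derivative_mult[OF x[OF t] y[OF t], of "k - l" l] by (simp add: add.commute)
    show "cmod (x' t (k - l) * y t l + x t (k - l) * y' t l) \<le> m l"
      using norm_triangle_le[OF add_mono[OF prod[OF b(2)[OF t] b(3)[OF t], of l]
          prod[OF b(1)[OF t] b(4)[OF t], of l]]]
      unfolding m_def by (simp only: distrib_right)
  qed (use s1 in auto)
  moreover have "(\<Sum>\<^sub>\<infinity>l. x' t (k - l) * y t l + x t (k - l) * y' t l)
      = conv (x' t) (y t) k + conv (x t) (y' t) k"
    unfolding conv_def by (rule infsum_add) (use s1 S(2) in auto)
  ultimately show ?thesis by (simp add: conv_def)
qed

lemma modulate_has_vector_derivative:
  assumes "((\<lambda>t. x t k) has_vector_derivative x' k) (at t within S)"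
  shows "((\<lambda>t. modulate (c * t) (x t) k) has_vector_derivative
    cis (of_int k * (c * t)) * (x' k + \<i> * of_int k * of_real c * x t k)) (at t within S)"
proof -
  have "((\<lambda>t. cis ((of_int k * c) * t) * x t k) has_vector_derivative
      cis ((of_int k * c) * t) * x' k + \<i> * of_real (of_int k * c) * cis ((of_int k * c) * t)
          * x t k) (at t within S)"
    by (rule has_vector_derivative_mult[OF cis_has_vector_derivative assms])
  then show ?thesis by (simp add: modulate_def algebra_simps)
qed

text \<open>
  The system for the coefficients \<open>u\<close>, \<open>r\<close> of velocity and density; \<open>Q\<close> stands for the coefficients of
  \<open>\<partial>\<^sub>x q\<^sub>1(\<rho>)\<close>. The parameter \<open>e\<close> may be negative, see \<open>acoustic_system_reflect\<close>.
\<close>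

definition acoustic_system ::
    "real \<Rightarrow> real \<Rightarrow> real \<Rightarrow> (real \<Rightarrow> int \<Rightarrow> complex) \<Rightarrow> (real \<Rightarrow> int \<Rightarrow> complex) \<Rightarrow> (real \<Rightarrow> int \<Rightarrow> complex)
        \<Rightarrow> bool" where
  "acoustic_system \<gamma> e T u r Q \<longleftrightarrow> (\<forall>t\<in>{0..<T}. \<forall>k.
    ((\<lambda>t. u t k) has_vector_derivative
      - \<i> * of_int k * (conv (u t) (u t) k / 2 + of_real ((\<gamma> - 2) / 2) * conv (r t) (r t) k
          + r t k / of_real e)
      - of_real e * Q t k) (at t within {0..<T}) \<and>
    ((\<lambda>t. r t k) has_vector_derivative
      - \<i> * of_int k * (conv (r t) (u t) k + u t k / of_real e)) (at t within {0..<T}))"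

text \<open>
  Changing the signs of the density and of \<open>e\<close> exchanges the two directions of propagation. Results
  on the wave \<open>(u + r)/2\<close> thus hold for \<open>(u - r)/2\<close> too.
\<close>

lemma acoustic_system_reflect:
  assumes "acoustic_system \<gamma> e T u r Q"
  shows "acoustic_system \<gamma> (- e) T u (\<lambda>t k. - r t k) (\<lambda>t k. - Q t k)"
  unfolding acoustic_system_def
proof (intro ballI allI conjI)
  fix t k assume t: "t \<in> {0..<T}"
  have neg: "conv (\<lambda>k. - a k) b k = - conv a b k" for a b k using conv_scale_left[of "-1" a b k]
      by simp
  have neg': "conv a (\<lambda>k. - b k) k = - conv a b k" for a b k using conv_scale_right[of a "-1" b k]
      by simp
  show "((\<lambda>t. u t k) has_vector_derivative
      - \<i> * of_int k * (conv (u t) (u t) k / 2 + of_real ((\<gamma> - 2) / 2) * conv (\<lambda>k. - r t k)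
          (\<lambda>k. - r t k) k + - r t k / of_real (- e))
      - of_real (- e) * - Q t k) (at t within {0..<T})"
    using assms t by (simp add: acoustic_system_def neg neg')
  have "((\<lambda>t. r t k) has_vector_derivative
      - \<i> * of_int k * (conv (r t) (u t) k + u t k / of_real e)) (at t within {0..<T})"
    using assms t by (simp add: acoustic_system_def)
  from has_vector_derivative_minus[OF this]
  show "((\<lambda>t. - r t k) has_vector_derivative
      - \<i> * of_int k * (conv (\<lambda>k. - r t k) (u t) k + u t k / of_real (- e))) (at t within {0..<T})"
    by (simp add: neg algebra_simps)
qed

text \<open>
  The flux of the filtered wave \<open>f\<close>: the Burgers flux of the profile, and the three terms coupling \<open>f\<close> to
  the wave \<open>b\<close> of the opposite direction, which \<open>f\<close> meets with the phase \<open>2 \<theta>\<close>, where \<open>\<theta> = t / e\<close>.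
\<close>

definition slow_rate :: "real \<Rightarrow> real \<Rightarrow> real \<Rightarrow> real \<Rightarrow> (int \<Rightarrow> complex) \<Rightarrow> (int \<Rightarrow> complex) \<Rightarrow> int \<Rightarrow>
    complex" where
  "slow_rate \<gamma> m n \<theta> f b = (\<lambda>k. of_real ((\<gamma> + 1) / 4) * conv f f k
      + of_real ((2 * m + (\<gamma> - 1) * n) / 2) * f k
    + of_real ((\<gamma> - 3) / 4) * modulate (2 * \<theta>) (conv b b) k
    + of_real ((3 - \<gamma>) / 2) * conv f (modulate (2 * \<theta>) b) k
    + of_real ((3 - \<gamma>) * n / 2) * modulate (2 * \<theta>) b k)"

definition slow_derivative ::
    "real \<Rightarrow> real \<Rightarrow> real \<Rightarrow> real \<Rightarrow> real \<Rightarrow> (int \<Rightarrow> complex) \<Rightarrow> (int \<Rightarrow> complex) \<Rightarrow> (int \<Rightarrow> complex) \<Rightarrow> int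
    \<Rightarrow> complex" where
  "slow_derivative \<gamma> m n e \<theta> f b Q
      = (\<lambda>k. - (\<i> * of_int k * slow_rate \<gamma> m n \<theta> f b k) - of_real (e / 2) * modulate \<theta> Q k)"

text \<open>The Riemann invariant of the wave operator, without its mean.\<close>

definition half_sum :: "(int \<Rightarrow> complex) \<Rightarrow> (int \<Rightarrow> complex) \<Rightarrow> int \<Rightarrow> complex" where
  "half_sum u r = (\<lambda>k. if k = 0 then 0 else (u k + r k) / 2)"

lemma conv_shift_mean:
  assumes x: "sob_le 0 x X" and y: "sob_le 0 y Y"
  shows "conv (\<lambda>k. x k + (if k = 0 then m else 0)) (\<lambda>k. y k + (if k = 0 then n else 0)) k
    = conv x y k + n * x k + m * y k + (if k = 0 then m * n else 0)"
proof -
  have d: "sob_le 0 (\<lambda>k. if k = 0 then c else 0 :: complex) (cmod c)" for c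
    using sob_le_0_finite_support[of "{0}" "\<lambda>k. if k = 0 then c else 0"] by (simp add: L2_set_def)
  have "conv (\<lambda>k. x k + (if k = 0 then m else 0)) (\<lambda>k. y k + (if k = 0 then n else 0)) k
    = conv x (\<lambda>k. y k + (if k = 0 then n else 0)) k + conv (\<lambda>k.
        if k = 0 then m else 0) (\<lambda>k. y k + (if k = 0 then n else 0)) k"
    by (rule conv_add_left[OF x d sob_le_add[OF y d]])
  also have "conv x (\<lambda>k. y k + (if k = 0 then n else 0)) k = conv x y k + n * x k"
    using conv_add_right[OF x y d] by (simp add: conv_delta)
  also have "conv (\<lambda>k. if k = 0 then m else 0) (\<lambda>k. y k + (if k = 0 then n else 0)) k
      = m * (y k + (if k = 0 then n else 0))"
    unfolding conv_commute[of "\<lambda>k. if k = 0 then m else 0"] conv_delta ..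
  finally show ?thesis by (simp add: algebra_simps)
qed

text \<open>
  The fluxes of the two equations, added and expressed by the waves \<open>v\<close> and \<open>w\<close> and the means. The
  products of the means sit at frequency \<open>0\<close> and disappear.
\<close>

lemma flux_decomposition:
  assumes v: "sob_le 0 v V" and w: "sob_le 0 w W" and k: "k \<noteq> 0"
    and u: "u = (\<lambda>k. (v k + w k) + (if k = 0 then of_real m else 0))"
    and r: "r = (\<lambda>k. (v k - w k) + (if k = 0 then of_real n else 0))"
  shows "conv u u k / 2 + of_real ((\<gamma> - 2) / 2) * conv r r k + conv r u k
    = 2 * (of_real ((\<gamma> + 1) / 4) * conv v v k + of_real ((2 * m + (\<gamma> - 1) * n) / 2) * v k
      + of_real ((\<gamma> - 3) / 4) * conv w w k + of_real ((3 - \<gamma>) / 2) * conv v w k + of_real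
          ((3 - \<gamma>) * n / 2) * w k)"
proof -
  have p: "sob_le 0 (\<lambda>k. v k + w k) (V + W)" by (rule sob_le_add[OF v w])
  have q: "sob_le 0 (\<lambda>k. v k - w k) (V + W)" by (rule sob_le_diff[OF v w])
  have uu: "conv u u k = conv v v k + 2 * conv v w k + conv w w k + 2 * m * (v k + w k)"
    using conv_shift_mean[OF p p, of "of_real m" "of_real m" k] k
      conv_add_left[OF v w p, of k] conv_add_right[OF v v w, of k] conv_add_right[OF w v w, of k]
          conv_commute[of w v]
    by (simp add: u)
  have rr: "conv r r k = conv v v k - 2 * conv v w k + conv w w k + 2 * n * (v k - w k)"
    using conv_shift_mean[OF q q, of "of_real n" "of_real n" k] k
      conv_diff_left[OF v w q, of k] conv_diff_right[OF v v w, of k]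
          conv_diff_right[OF w v w, of k] conv_commute[of w v]
    by (simp add: r algebra_simps)
  have ru: "conv r u k = conv v v k - conv w w k + m * (v k - w k) + n * (v k + w k)"
    using conv_shift_mean[OF q p, of "of_real n" "of_real m" k] k
      conv_diff_left[OF v w p, of k] conv_add_right[OF v v w, of k] conv_add_right[OF w v w, of k]
          conv_commute[of w v]
    by (simp add: u r algebra_simps)
  show ?thesis unfolding uu rr ru by (simp add: field_simps)
qed

lemma half_sum_bound:
  assumes "sob_le \<sigma> u M" "sob_le \<sigma> r M" shows "sob_le \<sigma> (half_sum u r) M"
proof -
  have "sob_le \<sigma> (\<lambda>k. u k + r k) (M + M)" by (rule sob_le_add[OF assms])
  from sob_le_comparison[OF this, of "1/2" \<sigma> "half_sum u r"] show ?thesis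
    by (auto simp: half_sum_def norm_divide)
qed

lemma herm_half_sum: "herm u \<Longrightarrow> herm r \<Longrightarrow> herm (half_sum u r)"
  by (simp add: herm_def half_sum_def)

text \<open>
  The modulation by \<open>t / e\<close> cancels the singular term \<open>i k v\<^sub>k / e\<close>. Modulations pass through convolutions
  (\<open>conv_modulate\<close>), so only the phase between the two waves remains. At frequency \<open>0\<close> both sides vanish.
\<close>

lemma filtered_derivative:
  assumes sys: "acoustic_system \<gamma> e T u r Q" and e: "e \<noteq> 0" and t: "t \<in> {0..<T}"
    and b: "sob_le 0 (u t) M" "sob_le 0 (r t) M"
    and mean: "u t 0 = of_real m" "r t 0 = of_real n" and Q0: "Q t 0 = 0"
  shows "((\<lambda>t. modulate (t / e) (half_sum (u t) (r t)) k) has_vector_derivative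
    slow_derivative \<gamma> m n e (t / e) (modulate (t / e) (half_sum (u t) (r t)))
      (modulate (- (t / e)) (half_sum (u t) (\<lambda>k. - r t k))) (Q t) k) (at t within {0..<T})"
proof (cases "k = 0")
  case True
  then show ?thesis by (simp add: modulate_def half_sum_def slow_derivative_def Q0)
next
  case False
  define \<theta> where "\<theta> = t / e"
  define v where "v = half_sum (u t) (r t)"
  define w where "w = half_sum (u t) (\<lambda>k. - r t k)"
  define f where "f = modulate \<theta> v"
  define g where "g = modulate (- \<theta>) w"
  have r': "sob_le 0 (\<lambda>k. - r t k) M" by (rule sob_le_uminus[OF b(2)])
  have v0: "sob_le 0 v M" unfolding v_def by (rule half_sum_bound[OF b])
  have w0: "sob_le 0 w M" unfolding w_def by (rule half_sum_bound[OF b(1) r'])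
  \<comment> \<open>the waves and the means recover the unknowns\<close>
  have u_eq: "u t = (\<lambda>k. (v k + w k) + (if k = 0 then of_real m else 0))"
    using mean(1) by (auto simp: v_def w_def half_sum_def fun_eq_iff field_simps)
  have r_eq: "r t = (\<lambda>k. (v k - w k) + (if k = 0 then of_real n else 0))"
    using mean(2) by (auto simp: v_def w_def half_sum_def fun_eq_iff field_simps)
  define u' where "u' = - \<i> * of_int k
      * (conv (u t) (u t) k / 2 + of_real ((\<gamma> - 2) / 2) * conv (r t) (r t) k + r t k / of_real e)
      - of_real e * Q t k"
  define r' where "r' = - \<i> * of_int k * (conv (r t) (u t) k + u t k / of_real e)"
  define N where "N = of_real ((\<gamma> + 1) / 4) * conv v v k + of_real ((2 * m + (\<gamma> - 1) * n) / 2) * v k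
      + of_real ((\<gamma> - 3) / 4) * conv w w k + of_real ((3 - \<gamma>) / 2) * conv v w k + of_real
          ((3 - \<gamma>) * n / 2) * w k"
  have flux: "conv (u t) (u t) k / 2 + of_real ((\<gamma> - 2) / 2) * conv (r t) (r t) k
      + conv (r t) (u t) k = 2 * N"
    unfolding N_def by (rule flux_decomposition[OF v0 w0 False u_eq r_eq])
  have "((\<lambda>t. (u t k + r t k) / 2) has_vector_derivative (u' + r') / 2) (at t within {0..<T})"
    using sys t unfolding acoustic_system_def u'_def r'_def
    by (intro has_vector_derivative_divide has_vector_derivative_add) auto
  then have dv: "((\<lambda>t. half_sum (u t) (r t) k)
      has_vector_derivative (u' + r') / 2) (at t within {0..<T})"
    using False by (simp add: half_sum_def)
  have "((\<lambda>t. modulate ((1 / e) * t) (half_sum (u t) (r t)) k) has_vector_derivative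
      cis (of_int k * ((1 / e) * t)) *
          ((u' + r') / 2 + \<i> * of_int k * of_real (1 / e) * half_sum (u t) (r t) k))
          (at t within {0..<T})"
    by (rule modulate_has_vector_derivative[where x = "\<lambda>t. half_sum (u t) (r t)"
        and x' = "\<lambda>k. (u' + r') / 2", OF dv])
  then have D: "((\<lambda>t. modulate (t / e) (half_sum (u t) (r t)) k) has_vector_derivative
      cis (of_int k * \<theta>) * ((u' + r') / 2 + \<i> * of_int k / of_real e * v k)) (at t within {0..<T})"
    by (simp add: \<theta>_def v_def)
  have A: "(u' + r') / 2 + \<i> * of_int k / of_real e * v k
      = - \<i> * of_int k * N - of_real (e / 2) * Q t k"
  proof -
    have "u' + r' = - \<i> * of_int k * (2 * N) - \<i> * of_int k * ((u t k + r t k) / of_real e)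
        - of_real e * Q t k"
      unfolding u'_def r'_def flux[symmetric] by (simp add: algebra_simps add_divide_distrib)
    also have "u t k + r t k = 2 * v k" using False by (simp add: v_def half_sum_def)
    finally have *: "u' + r' = - \<i> * of_int k * (2 * N) - \<i> * of_int k * ((2 * v k) / of_real e)
        - of_real e * Q t k" .
    show ?thesis unfolding * by (simp add: algebra_simps diff_divide_distrib add_divide_distrib)
  qed
  have B: "cis (of_int k * \<theta>) * N = slow_rate \<gamma> m n \<theta> f g k"
  proof -
    have wg: "w = modulate \<theta> g" unfolding g_def modulate_modulate by simp
    have m: "cis (of_int k * \<theta>) * x k = modulate \<theta> x k" for x by (simp add: modulate_def)
    have w2: "modulate \<theta> w = modulate (2 * \<theta>) g" unfolding wg modulate_modulate by simp
    have 1: "cis (of_int k * \<theta>) * conv v v k = conv f f k" unfolding f_def conv_modulate m ..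
    have 2: "cis (of_int k * \<theta>) * conv w w k = modulate (2 * \<theta>) (conv g g) k"
      unfolding wg conv_modulate m modulate_modulate by simp
    have 3: "cis (of_int k * \<theta>) * conv v w k = conv f (modulate (2 * \<theta>) g) k"
      unfolding w2[symmetric] f_def conv_modulate m ..
    have 4: "cis (of_int k * \<theta>) * w k = modulate (2 * \<theta>) g k" unfolding m w2 ..
    have 5: "cis (of_int k * \<theta>) * v k = f k" unfolding m f_def ..
    have "cis (of_int k * \<theta>) * N = of_real ((\<gamma> + 1) / 4) * (cis (of_int k * \<theta>) * conv v v k)
      + of_real ((2 * m + (\<gamma> - 1) * n) / 2) * (cis (of_int k * \<theta>) * v k)
      + of_real ((\<gamma> - 3) / 4) * (cis (of_int k * \<theta>) * conv w w k)
      + of_real ((3 - \<gamma>) / 2) * (cis (of_int k * \<theta>) * conv v w k) + of_real ((3 - \<gamma>) * n / 2) *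
          (cis (of_int k * \<theta>) * w k)"
      unfolding N_def by (simp only: distrib_left mult.left_commute)
    then show ?thesis unfolding 1 2 3 4 5 slow_rate_def .
  qed
  have "cis (of_int k * \<theta>) * ((u' + r') / 2 + \<i> * of_int k / of_real e * v k)
     = slow_derivative \<gamma> m n e \<theta> f g (Q t) k"
    unfolding A by (simp add: slow_derivative_def modulate_def B[symmetric] algebra_simps)
  with D show ?thesis by (simp add: \<theta>_def v_def w_def f_def g_def)
qed

definition slow_rate_const :: "real \<Rightarrow> real \<Rightarrow> real \<Rightarrow> real \<Rightarrow> real" where
  "slow_rate_const \<gamma> m n M = \<bar>(\<gamma> + 1) / 4\<bar> * (alg_const 2 * (M * M)) + \<bar>(2 * m + (\<gamma> - 1) * n) / 2\<bar>
      * M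
    + \<bar>(\<gamma> - 3) / 4\<bar> * (alg_const 2 * (M * M)) + \<bar>(3 - \<gamma>) / 2\<bar> * (alg_const 2 * (M * M)) + \<bar>(3 - \<gamma>)
        * n / 2\<bar> * M"

lemma slow_derivative_bound:
  assumes f: "sob_le 2 f M" and b: "sob_le 2 b M" and Q: "sob_le 1 Q N" and e: "\<bar>e\<bar> \<le> E"
  shows "sob_le 1 (slow_derivative \<gamma> m n e \<theta> f b Q) (slow_rate_const \<gamma> m n M + E / 2 * N)"
proof -
  have "sob_le 2 (slow_rate \<gamma> m n \<theta> f b) (slow_rate_const \<gamma> m n M)"
    unfolding slow_rate_def slow_rate_const_def
    using sob_le_scale[OF sob_le_conv[OF _ f f], of "of_real ((\<gamma> + 1) / 4)"]
      sob_le_scale[OF f, of "of_real ((2 * m + (\<gamma> - 1) * n) / 2)"]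
      sob_le_scale[OF sob_le_modulate[OF sob_le_conv[OF _ b b]], of "of_real ((\<gamma> - 3) / 4)" "2 * \<theta>"]
      sob_le_scale[OF sob_le_conv[OF _ f sob_le_modulate[OF b]], of "of_real ((3 - \<gamma>) / 2)" "2 * \<theta>"]
      sob_le_scale[OF sob_le_modulate[OF b], of "of_real ((3 - \<gamma>) * n / 2)" "2 * \<theta>"]
    unfolding norm_of_real by (intro sob_le_add) simp_all
  then have 1: "sob_le 1 (\<lambda>k. - (\<i> * of_int k * slow_rate \<gamma> m n \<theta> f b k)) (slow_rate_const \<gamma> m n M)"
    using sob_le_deriv[of 1] by (intro sob_le_uminus) simp
  have "sob_le 1 (\<lambda>k. of_real (e / 2) * modulate \<theta> Q k) (cmod (of_real (e / 2)) * N)"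
    by (rule sob_le_scale[OF sob_le_modulate[OF Q]])
  moreover have "cmod (of_real (e / 2)) * N \<le> E / 2 * N"
    unfolding norm_of_real using e sob_le_nonneg[OF Q] by (intro mult_right_mono) auto
  ultimately have "sob_le 1 (\<lambda>k. of_real (e / 2) * modulate \<theta> Q k) (E / 2 * N)"
      by (rule sob_le_mono)
  from sob_le_diff[OF 1 this] show ?thesis by (simp add: slow_derivative_def)
qed

text \<open>
  The primitive of mean zero; division by \<open>0\<close> gives the value \<open>0\<close> at frequency \<open>0\<close>.
\<close>

definition primitive :: "(int \<Rightarrow> complex) \<Rightarrow> int \<Rightarrow> complex" where
  "primitive b = (\<lambda>k. b k / (\<i> * of_int k))"

text \<open>
  Each coupling term of \<open>slow_rate\<close>, differentiated in \<open>x\<close> and divided by the frequency of its phase. For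
  the product of \<open>f\<close> and \<open>b\<close> this is the frequency of \<open>b\<close>, so a primitive of \<open>b\<close> appears; for the other
  two it is the frequency of the whole term and cancels the derivative.
\<close>

definition corrector :: "real \<Rightarrow> real \<Rightarrow> real \<Rightarrow> (int \<Rightarrow> complex) \<Rightarrow> (int \<Rightarrow> complex) \<Rightarrow> int \<Rightarrow> complex"
    where
  "corrector \<gamma> n \<theta> f b = (\<lambda>k. of_real ((\<gamma> - 3) / 8) * modulate (2 * \<theta>) (conv b b) k
    + of_real ((3 - \<gamma>) / 4) * (\<i> * of_int k * conv f (modulate (2 * \<theta>) (primitive b)) k)
    + of_real ((3 - \<gamma>) * n / 4) * modulate (2 * \<theta>) b k)"

text \<open>
  What is left of the time derivative of the corrector when the phases are not differentiated, together with the pressure term.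
\<close>

definition remainder :: "real \<Rightarrow> real \<Rightarrow> real \<Rightarrow> (int \<Rightarrow> complex) \<Rightarrow> (int \<Rightarrow> complex) \<Rightarrow> (int \<Rightarrow> complex)
    \<Rightarrow> (int \<Rightarrow> complex) \<Rightarrow> (int \<Rightarrow> complex) \<Rightarrow> int \<Rightarrow> complex" where
  "remainder \<gamma> n \<theta> f b f' b' Q = (\<lambda>k. of_real ((\<gamma> - 3) / 4) * modulate (2 * \<theta>) (conv b' b) k
    + of_real ((3 - \<gamma>) / 4) * (\<i> * of_int k * (conv f' (modulate (2 * \<theta>) (primitive b)) k
        + conv f (modulate (2 * \<theta>) (primitive b')) k))
    + of_real ((3 - \<gamma>) * n / 4) * modulate (2 * \<theta>) b' k - of_real (1 / 2) * modulate \<theta> Q k)"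

lemma primitive_bound: "sob_le \<sigma> b M \<Longrightarrow> sob_le (\<sigma> + 1) (primitive b) (2 * M)"
  unfolding primitive_def by (rule sob_le_primitive)

lemma corrector_bound:
  assumes f: "sob_le 2 f M" and b: "sob_le 2 b M"
  shows "sob_le 1 (corrector \<gamma> n \<theta> f b) (\<bar>(\<gamma> - 3) / 8\<bar> * (alg_const 1 * (M * M))
    + \<bar>(3 - \<gamma>) / 4\<bar> * (alg_const 2 * (M * (2 * M))) + \<bar>(3 - \<gamma>) * n / 4\<bar> * M)"
proof -
  have b1: "sob_le 1 b M" by (rule sob_le_weaken[OF b]) simp
  have P: "sob_le 2 (primitive b) (2 * M)" using primitive_bound[OF b1] by simp
  have "sob_le 2 (conv f (modulate (2 * \<theta>) (primitive b))) (alg_const 2 * (M * (2 * M)))"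
    by (rule sob_le_conv[OF _ f sob_le_modulate[OF P]]) simp
  then have "sob_le 1 (\<lambda>k. \<i> * of_int k * conv f (modulate (2 * \<theta>) (primitive b)) k) (alg_const 2
      * (M * (2 * M)))"
    using sob_le_deriv[of 1] by simp
  from sob_le_add[OF sob_le_add[OF
      sob_le_scale[OF sob_le_modulate[OF sob_le_conv[OF order_refl b1 b1]], of
      "of_real ((\<gamma> - 3) / 8)" "2 * \<theta>"]
      sob_le_scale[OF this, of "of_real ((3 - \<gamma>) / 4)"]]
          sob_le_scale[OF sob_le_modulate[OF b1], of "of_real ((3 - \<gamma>) * n / 4)" "2 * \<theta>"]]
  show ?thesis unfolding corrector_def norm_of_real .
qed

lemma remainder_bound:
  assumes f: "sob_le 2 f M" and b: "sob_le 2 b M" and f': "sob_le 1 f' N" and b': "sob_le 1 b' N"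
      and Q: "sob_le 1 Q P"
  shows "sob_le 0 (remainder \<gamma> n \<theta> f b f' b' Q) (\<bar>(\<gamma> - 3) / 4\<bar> * (alg_const 1 * (N * M))
    + \<bar>(3 - \<gamma>) / 4\<bar> * (alg_const 1 * (N * (2 * M)) + alg_const 1 * (M * (2 * N))) + \<bar>(3 - \<gamma>)
        * n / 4\<bar> * N + \<bar>1 / 2\<bar> * P)"
proof -
  have b1: "sob_le 1 b M" and f1: "sob_le 1 f M" using f b by (auto intro: sob_le_weaken)
  have b0: "sob_le 0 b M" and b'0: "sob_le 0 b' N" and Q0: "sob_le 0 Q P" using b b' Q
      by (auto intro: sob_le_weaken)
  have P: "sob_le 1 (primitive b) (2 * M)" "sob_le 1 (primitive b') (2 * N)"
      using primitive_bound[OF b0] primitive_bound[OF b'0] by simp_all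
  have "sob_le 1 (\<lambda>k. conv f' (modulate (2 * \<theta>) (primitive b)) k
      + conv f (modulate (2 * \<theta>) (primitive b')) k)
     (alg_const 1 * (N * (2 * M)) + alg_const 1 * (M * (2 * N)))"
    by (intro sob_le_add sob_le_conv f' f1 sob_le_modulate P) simp_all
  then have D: "sob_le 0 (\<lambda>k. \<i> * of_int k
      * (conv f' (modulate (2 * \<theta>) (primitive b)) k + conv f (modulate (2 * \<theta>) (primitive b')) k))
     (alg_const 1 * (N * (2 * M)) + alg_const 1 * (M * (2 * N)))" using sob_le_deriv[of 0] by simp
  have C: "sob_le 0 (conv b' b) (alg_const 1 * (N * M))"
    by (rule sob_le_weaken[OF sob_le_conv[OF order_refl b' b1]]) simp
  from sob_le_diff[OF sob_le_add[OF sob_le_add[OF sob_le_scale[OF sob_le_modulate[OF C], of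
      "of_real ((\<gamma> - 3) / 4)" "2 * \<theta>"]
      sob_le_scale[OF D, of "of_real ((3 - \<gamma>) / 4)"]] sob_le_scale[OF sob_le_modulate[OF b'0], of
          "of_real ((3 - \<gamma>) * n / 4)" "2 * \<theta>"]]
     sob_le_scale[OF sob_le_modulate[OF Q0], of "of_real (1 / 2)" \<theta>]]
  show ?thesis unfolding remainder_def norm_of_real .
qed

lemma herm_corrector: assumes "herm f" "herm b" shows "herm (corrector \<gamma> n \<theta> f b)"
proof -
  have "herm (primitive b)" unfolding primitive_def by (rule herm_primitive[OF assms(2)])
  note P = herm_conv[OF assms(1) herm_modulate[OF this, of "2 * \<theta>"]]
  show ?thesis unfolding corrector_def
    by (rule herm_add[OF herm_add[OF herm_scale[OF herm_modulate[OF herm_conv[OF assms(2,2)]]]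
         herm_scale[OF herm_deriv[OF P]]] herm_scale[OF herm_modulate[OF assms(2)]]])
qed

text \<open>
  Differentiating the phase \<open>2 t / e\<close> reproduces the coupling terms of \<open>slow_rate\<close>. The mean of \<open>b\<close> is \<open>0\<close>,
  so \<open>b\<close> is the derivative of its primitive at every frequency.
\<close>

lemma corrector_derivative:
  assumes e: "e \<noteq> 0" and t: "t \<in> {0..<T}"
    and df: "\<And>k t. t \<in> {0..<T} \<Longrightarrow> ((\<lambda>t. f t k) has_vector_derivative f' t k) (at t within {0..<T})"
    and db: "\<And>k t. t \<in> {0..<T} \<Longrightarrow> ((\<lambda>t. b t k) has_vector_derivative b' t k) (at t within {0..<T})"
    and f: "\<And>t. t \<in> {0..<T} \<Longrightarrow> sob_le 2 (f t) M" and b: "\<And>t. t \<in> {0..<T} \<Longrightarrow> sob_le 2 (b t) M"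
    and f': "\<And>t. t \<in> {0..<T} \<Longrightarrow> sob_le 1 (f' t) N" and b': "\<And>t. t \<in> {0..<T} \<Longrightarrow> sob_le 1 (b' t) N"
    and b0: "\<And>t. t \<in> {0..<T} \<Longrightarrow> b t 0 = 0"
  shows "((\<lambda>t. of_real e * corrector \<gamma> n (t / e) (f t) (b t) k) has_vector_derivative
     (of_real ((\<gamma> - 3) / 4) * (\<i> * of_int k * modulate (2 * (t / e)) (conv (b t) (b t)) k)
      + of_real ((3 - \<gamma>) / 2) * (\<i> * of_int k * conv (f t) (modulate (2 * (t / e)) (b t)) k)
      + of_real ((3 - \<gamma>) * n / 2) * (\<i> * of_int k * modulate (2 * (t / e)) (b t) k)
      + of_real e * (remainder \<gamma> n (t / e) (f t) (b t) (f' t) (b' t) (\<lambda>k. 0) k)))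
          (at t within {0..<T})"
proof -
  let ?S = "{0..<T}"
  have cS: "convex ?S" by simp
  have f1: "sob_le 1 (f t) M" and b1: "sob_le 1 (b t) M" if "t \<in> ?S" for t
    using f[OF that] b[OF that] by (auto intro: sob_le_weaken)
  let ?c = "2 / e"
  have ct: "?c * t = 2 * (t / e)" for t by simp
  \<comment> \<open>the three parts of the corrector; \<open>y\<close> is the modulated primitive of \<open>b\<close>\<close>
  have dbb: "((\<lambda>t. conv (b t) (b t) k) has_vector_derivative 2
      * conv (b' t) (b t) k) (at t within ?S)"
    using conv_has_vector_derivative[OF cS t db db b1 b' b1 b', of k]
        by (simp add: conv_commute[of "b t" "b' t"])
  have 1: "((\<lambda>t. modulate (2 * (t / e)) (conv (b t) (b t)) k) has_vector_derivative
      cis (of_int k * (2 * (t / e))) *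
          (2 * conv (b' t) (b t) k + \<i> * of_int k * of_real ?c * conv (b t) (b t) k))
          (at t within ?S)"
    using modulate_has_vector_derivative[where x = "\<lambda>t. conv (b t) (b t)"
        and x' = "\<lambda>k. 2 * conv (b' t) (b t) k" and c = ?c, OF dbb]
    unfolding ct .
  have 3: "((\<lambda>t. modulate (2 * (t / e)) (b t) k) has_vector_derivative
      cis (of_int k * (2 * (t / e))) * (b' t k + \<i> * of_int k * of_real ?c * b t k))
          (at t within ?S)"
    using modulate_has_vector_derivative[where x = b and x' = "b' t" and c = ?c, OF db[OF t]]
    unfolding ct .
  define y where "y t = modulate (2 * (t / e)) (primitive (b t))" for t
  define y' where "y' t = (\<lambda>k. modulate (2 * (t / e)) (primitive (b' t)) k + of_real ?c
      * modulate (2 * (t / e)) (b t) k)" for t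
  have dy: "((\<lambda>t. y t k) has_vector_derivative y' t k) (at t within ?S)" if t: "t \<in> ?S" for t k
  proof -
    have "((\<lambda>t. primitive (b t) k) has_vector_derivative primitive (b' t) k) (at t within ?S)"
      unfolding primitive_def by (rule has_vector_derivative_divide[OF db[OF t]])
    from modulate_has_vector_derivative[where x = "\<lambda>t. primitive (b t)"
        and x' = "primitive (b' t)" and c = ?c, OF this]
    have "((\<lambda>t. y t k) has_vector_derivative cis (of_int k * (2 * (t / e)))
        * (primitive (b' t) k + \<i> * of_int k * of_real ?c * primitive (b t) k)) (at t within ?S)"
      unfolding ct y_def .
    moreover have "\<i> * of_int k * primitive (b t) k = b t k"
      using b0[OF t] by (cases "k = 0") (auto simp: primitive_def)
    then have "cis (of_int k * (2 * (t / e)))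
        * (primitive (b' t) k + \<i> * of_int k * of_real ?c * primitive (b t) k) = y' t k"
      unfolding y'_def modulate_def by (simp add: algebra_simps)
    ultimately show ?thesis by simp
  qed
  have y1: "sob_le 1 (y t) (2 * M)" if "t \<in> ?S" for t
    unfolding y_def by (rule sob_le_modulate)
        (use primitive_bound[OF sob_le_weaken[OF b[OF that], of 0]] in simp)
  have y'1: "sob_le 1 (y' t) (2 * N + cmod (of_real ?c) * M)" if "t \<in> ?S" for t
    unfolding y'_def
    by (intro sob_le_add sob_le_scale sob_le_modulate b1 that)
        (use primitive_bound[OF sob_le_weaken[OF b'[OF that], of 0]] in simp)
  have 2: "((\<lambda>t. conv (f t) (y t) k) has_vector_derivative conv (f' t) (y t) k
      + conv (f t) (y' t) k) (at t within ?S)"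
    by (rule conv_has_vector_derivative[OF cS t df dy f1 f' y1 y'1])
  have fy': "conv (f t) (y' t) k
      = conv (f t) (modulate (2 * (t / e)) (primitive (b' t))) k + of_real ?c * conv (f t)
      (modulate (2 * (t / e)) (b t)) k"
  proof -
    have m: "sob_le 0 (modulate (2 * (t / e)) (b t)) M"
        by (rule sob_le_modulate[OF sob_le_weaken[OF b1[OF t]]]) simp
    have p: "sob_le 0 (modulate (2 * (t / e)) (primitive (b' t))) (2 * N)"
      using sob_le_weaken[OF primitive_bound[OF sob_le_weaken[OF b'[OF t], of 0]], of 0]
          by (intro sob_le_modulate) simp
    have f0: "sob_le 0 (f t) M" using f1[OF t] by (rule sob_le_weaken) simp
    show ?thesis unfolding y'_def conv_add_right[OF f0 p sob_le_scale[OF m, of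
        "of_real ?c"]] conv_scale_right ..
  qed
  have "((\<lambda>t. of_real e * (of_real ((\<gamma> - 3) / 8) * modulate (2 * (t / e)) (conv (b t) (b t)) k
    + of_real ((3 - \<gamma>) / 4) * (\<i> * of_int k * conv (f t) (y t) k)
    + of_real ((3 - \<gamma>) * n / 4) * modulate (2 * (t / e)) (b t) k)) has_vector_derivative
    of_real e * (of_real ((\<gamma> - 3) / 8) *
        (cis (of_int k * (2 * (t / e))) *
        (2 * conv (b' t) (b t) k + \<i> * of_int k * of_real ?c * conv (b t) (b t) k))
    + of_real ((3 - \<gamma>) / 4) * (\<i> * of_int k * (conv (f' t) (y t) k + conv (f t) (y' t) k))
    + of_real ((3 - \<gamma>) * n / 4) *
        (cis (of_int k * (2 * (t / e))) * (b' t k + \<i> * of_int k * of_real ?c * b t k))))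
        (at t within ?S)"
    by (intro has_vector_derivative_mult_right has_vector_derivative_add 1 2 3)
  moreover have "of_real e * (of_real ((\<gamma> - 3) / 8)
      * (cis (of_int k * (2 * (t / e))) *
      (2 * conv (b' t) (b t) k + \<i> * of_int k * of_real ?c * conv (b t) (b t) k))
    + of_real ((3 - \<gamma>) / 4) * (\<i> * of_int k * (conv (f' t) (y t) k + conv (f t) (y' t) k))
    + of_real ((3 - \<gamma>) * n / 4) *
        (cis (of_int k * (2 * (t / e))) * (b' t k + \<i> * of_int k * of_real ?c * b t k)))
   = of_real ((\<gamma> - 3) / 4) * (\<i> * of_int k * modulate (2 * (t / e)) (conv (b t) (b t)) k)
      + of_real ((3 - \<gamma>) / 2) * (\<i> * of_int k * conv (f t) (modulate (2 * (t / e)) (b t)) k)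
      + of_real ((3 - \<gamma>) * n / 2) * (\<i> * of_int k * modulate (2 * (t / e)) (b t) k)
      + of_real e * (remainder \<gamma> n (t / e) (f t) (b t) (f' t) (b' t) (\<lambda>k. 0) k)"
  proof -
    define \<alpha> \<beta> \<delta> where d: "\<alpha> = complex_of_real ((\<gamma> - 3) / 8)" "\<beta> = complex_of_real ((3 - \<gamma>) / 4)"
        "\<delta> = complex_of_real ((3 - \<gamma>) * n / 4)"
    have d2: "complex_of_real ((\<gamma> - 3) / 4) = 2 * \<alpha>" "complex_of_real ((3 - \<gamma>) / 2) = 2 * \<beta>"
        "complex_of_real ((3 - \<gamma>) * n / 2) = 2 * \<delta>"
      by (simp_all add: d)
    define C where "C = complex_of_real ?c"
    \<comment> \<open>the only cancellation: \<open>e\<close> times the frequency \<open>2 / e\<close> of the phase\<close>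
    have ec: "complex_of_real e * C = 2" using e by (simp add: C_def)
    define c0 where "c0 = cis (of_int k * (2 * (t / e)))"
    have mk: "modulate (2 * (t / e)) x k = c0 * x k" for x by (simp add: modulate_def c0_def)
    have m0: "modulate (t / e) (\<lambda>k. 0) k = 0" by (simp add: modulate_def)
    show ?thesis
      unfolding fy' remainder_def d2 d[symmetric] C_def[symmetric] c0_def[symmetric] mk m0
          y_def[symmetric]
    proof -
      fix X1 X2 Y1 Y2 Y3 z w i :: complex
      have "of_real e * (\<alpha> * (c0 * (2 * X1 + i * C * X2)) + \<beta> * (i * (Y1 + (Y2 + C * Y3))) + \<delta>
          * (c0 * (w + i * C * z)))
        = (of_real e * C) * (\<alpha> * (i * (c0 * X2)) + \<beta> * (i * Y3) + \<delta> * (i * (c0 * z)))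
          + of_real e * (2 * \<alpha> * (c0 * X1) + \<beta> * (i * (Y1 + Y2)) + \<delta> * (c0 * w) - complex_of_real
              (1 / 2) * 0)"
        by (simp add: algebra_simps)
      then show "of_real e * (\<alpha> * (c0 * (2 * X1 + i * C * X2)) + \<beta> * (i * (Y1 + (Y2 + C * Y3)))
          + \<delta> * (c0 * (w + i * C * z)))
        = 2 * \<alpha> * (i * (c0 * X2)) + 2 * \<beta> * (i * Y3) + 2 * \<delta> * (i * (c0 * z))
          + of_real e * (2 * \<alpha> * (c0 * X1) + \<beta> * (i * (Y1 + Y2)) + \<delta> * (c0 * w) - complex_of_real
              (1 / 2) * 0)"
        unfolding ec by (simp add: algebra_simps)
    qed
  qed
  ultimately show ?thesis unfolding corrector_def y_def by simp
qed

text \<open>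
  The corrector removes the coupling terms. All bounds depend on \<open>M\<close> and \<open>E\<close> but not on \<open>e\<close>, because the
  time derivatives of the filtered waves of both directions are bounded uniformly in \<open>e\<close>.
\<close>

theorem acoustic_approx_solution:
  fixes \<gamma> E M m n :: real
  assumes E: "0 \<le> E" and M: "0 \<le> M"
  obtains K where "M \<le> K"
    "\<And>e T u r Q. \<lbrakk>acoustic_system \<gamma> e T u r Q; e \<noteq> 0; \<bar>e\<bar> \<le> E;
        \<And>t. t \<in> {0..<T} \<Longrightarrow> sob_le 2 (u t) M \<and> sob_le 2 (r t) M \<and> sob_le 1 (Q t) M \<and> herm (u t)
            \<and> herm (r t)
          \<and> u t 0 = of_real m \<and> r t 0 = of_real n \<and> Q t 0 = 0\<rbrakk>
      \<Longrightarrow> \<exists>G R. approx_solution ((\<gamma> + 1) / 4) ((2 * m + (\<gamma> - 1) * n) / 2) T e K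
            (\<lambda>t. modulate (t / e) (half_sum (u t) (r t))) G R"
proof -
  define N where "N = max (slow_rate_const \<gamma> m n M) (slow_rate_const \<gamma> m (- n) M) + E / 2 * M"
  define K1 where "K1 = \<bar>(\<gamma> - 3) / 8\<bar> * (alg_const 1 * (M * M)) + \<bar>(3 - \<gamma>) / 4\<bar>
      * (alg_const 2 * (M * (2 * M))) + \<bar>(3 - \<gamma>) * n / 4\<bar> * M"
  define K2 where "K2 = \<bar>(\<gamma> - 3) / 4\<bar> * (alg_const 1 * (N * M))
    + \<bar>(3 - \<gamma>) / 4\<bar> * (alg_const 1 * (N * (2 * M)) + alg_const 1 * (M * (2 * N))) + \<bar>(3 - \<gamma>)
        * n / 4\<bar> * N + \<bar>1 / 2\<bar> * M"
  define K where "K = max M (max K1 K2)"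
  show thesis
  proof (rule that[of K])
    show "M \<le> K" by (simp add: K_def)
    fix e T u r Q
    assume sys: "acoustic_system \<gamma> e T u r Q" and e: "e \<noteq> 0" "\<bar>e\<bar> \<le> E"
      and b: "\<And>t. t \<in> {0..<T} \<Longrightarrow> sob_le 2 (u t) M \<and> sob_le 2 (r t) M \<and> sob_le 1 (Q t) M
          \<and> herm (u t) \<and> herm (r t)
          \<and> u t 0 = of_real m \<and> r t 0 = of_real n \<and> Q t 0 = 0"
    let ?S = "{0..<T}"
    define f where "f t = modulate (t / e) (half_sum (u t) (r t))" for t
    define g where "g t = modulate (- (t / e)) (half_sum (u t) (\<lambda>k. - r t k))" for t
    define f' where "f' t = slow_derivative \<gamma> m n e (t / e) (f t) (g t) (Q t)" for t
    define g' where "g' t = slow_derivative \<gamma> m (- n) (- e) (- (t / e)) (g t) (f t) (\<lambda>k. - Q t k)"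
        for t
    have b2: "sob_le 2 (u t) M" "sob_le 2 (r t) M" "sob_le 1 (Q t) M" "herm (u t)" "herm (r t)"
       "u t 0 = of_real m" "r t 0 = of_real n" "Q t 0 = 0" if "t \<in> ?S" for t using b[OF that]
           by auto
    have b0: "sob_le 0 (u t) M" "sob_le 0 (r t) M" if "t \<in> ?S" for t
      using b2(1,2)[OF that] by (auto intro: sob_le_weaken)
    have nr: "sob_le \<sigma> (\<lambda>k. - r t k) M" if "sob_le \<sigma> (r t) M" for t \<sigma> using that
        by (rule sob_le_uminus)
    have f2: "sob_le 2 (f t) M" and g2: "sob_le 2 (g t) M" if "t \<in> ?S" for t
      unfolding f_def g_def using that by (auto intro!: sob_le_modulate half_sum_bound nr b2)
    have hr: "herm (\<lambda>k. - r t k)" if "t \<in> ?S" for t using b2(5)[OF that] by (simp add: herm_def)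
    have hf: "herm (f t)" and hg: "herm (g t)" if "t \<in> ?S" for t
      unfolding f_def g_def
      by (rule herm_modulate[OF herm_half_sum[OF b2(4,5)[OF that]]])
        (rule herm_modulate[OF herm_half_sum[OF b2(4)[OF that] hr[OF that]]])
    have df: "((\<lambda>t. f t k) has_vector_derivative f' t k) (at t within ?S)" if "t \<in> ?S" for t k
      unfolding f'_def unfolding f_def g_def
      by (rule filtered_derivative[OF sys e(1) that b0[OF that] b2(6-8)[OF that]])
    have dg: "((\<lambda>t. g t k) has_vector_derivative g' t k) (at t within ?S)" if "t \<in> ?S" for t k
    proof -
      have "((\<lambda>t. modulate (t / - e) (half_sum (u t) (\<lambda>k. - r t k)) k) has_vector_derivative
        slow_derivative \<gamma> m (- n) (- e) (t / - e)
            (modulate (t / - e) (half_sum (u t) (\<lambda>k. - r t k)))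
          (modulate (- (t / - e)) (half_sum (u t) (\<lambda>k. - (- r t k)))) (\<lambda>k. - Q t k) k)
              (at t within ?S)"
        by (rule filtered_derivative[OF acoustic_system_reflect[OF sys] _ that b0(1)[OF that]
            sob_le_uminus[OF b0(2)[OF that]]])
          (use e b2(6-8)[OF that] in auto)
      then show ?thesis unfolding g'_def f_def g_def by simp
    qed
    have M0: "slow_rate_const \<gamma> m n M + E / 2 * M \<le> N" "slow_rate_const \<gamma> m (- n) M + E / 2 * M \<le> N"
      by (simp_all add: N_def)
    have f'1: "sob_le 1 (f' t) N" if "t \<in> ?S" for t
      unfolding f'_def by (rule sob_le_mono[OF
          slow_derivative_bound[OF f2[OF that] g2[OF that] b2(3)[OF that] e(2)] M0(1)])
    have g'1: "sob_le 1 (g' t) N" if "t \<in> ?S" for t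
      unfolding g'_def
      by (rule sob_le_mono[OF slow_derivative_bound[OF g2[OF that] f2[OF that]
          sob_le_uminus[OF b2(3)[OF that]]] M0(2)]) (use e in simp)
    have g0: "g t 0 = 0" for t by (simp add: g_def modulate_def half_sum_def)
    define G where "G t = corrector \<gamma> n (t / e) (f t) (g t)" for t
    define R where "R t = remainder \<gamma> n (t / e) (f t) (g t) (f' t) (g' t) (Q t)" for t
    have "approx_solution ((\<gamma> + 1) / 4) ((2 * m + (\<gamma> - 1) * n) / 2) T e K f G R"
      unfolding approx_solution_def
    proof (intro ballI conjI allI)
      fix t assume t: "t \<in> ?S"
      show "sob_le 2 (f t) K" by (rule sob_le_mono[OF f2[OF t]]) (simp add: K_def)
      show "sob_le 1 (G t) K" unfolding G_def
        by (rule sob_le_mono[OF corrector_bound[OF f2[OF t] g2[OF t], of \<gamma> n, folded K1_def]])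
            (simp add: K_def)
      show "sob_le 0 (R t) K" unfolding R_def
        by (rule sob_le_mono[OF remainder_bound[OF f2[OF t] g2[OF t] f'1[OF t] g'1[OF t]
            b2(3)[OF t], of \<gamma> n, folded K2_def]]) (simp add: K_def)
      show "herm (f t)" by (rule hf[OF t])
      show "herm (G t)" unfolding G_def by (rule herm_corrector[OF hf[OF t] hg[OF t]])
      fix k
      have "((\<lambda>t. f t k + of_real e * G t k) has_vector_derivative f' t k + 
        (of_real ((\<gamma> - 3) / 4) * (\<i> * of_int k * modulate (2 * (t / e)) (conv (g t) (g t)) k)
      + of_real ((3 - \<gamma>) / 2) * (\<i> * of_int k * conv (f t) (modulate (2 * (t / e)) (g t)) k)
      + of_real ((3 - \<gamma>) * n / 2) * (\<i> * of_int k * modulate (2 * (t / e)) (g t) k)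
      + of_real e * (remainder \<gamma> n (t / e) (f t) (g t) (f' t) (g' t) (\<lambda>k. 0) k))) (at t within ?S)"
        unfolding G_def
        by (rule has_vector_derivative_add[OF df[OF t] corrector_derivative[where f' = f'
            and b' = g', OF e(1) t df dg f2 g2 f'1 g'1 g0]])
      moreover have "f' t k + 
        (of_real ((\<gamma> - 3) / 4) * (\<i> * of_int k * modulate (2 * (t / e)) (conv (g t) (g t)) k)
      + of_real ((3 - \<gamma>) / 2) * (\<i> * of_int k * conv (f t) (modulate (2 * (t / e)) (g t)) k)
      + of_real ((3 - \<gamma>) * n / 2) * (\<i> * of_int k * modulate (2 * (t / e)) (g t) k)
      + of_real e * (remainder \<gamma> n (t / e) (f t) (g t) (f' t) (g' t) (\<lambda>k. 0) k))
       = of_real e * R t k - \<i> * of_int k *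
           (of_real ((\<gamma> + 1) / 4) * conv (f t) (f t) k + of_real ((2 * m + (\<gamma> - 1) * n) / 2)
           * f t k)"
      proof -
        have R: "R t k = remainder \<gamma> n (t / e) (f t) (g t) (f' t) (g' t) (\<lambda>k. 0) k
            - of_real (1 / 2) * modulate (t / e) (Q t) k"
          by (simp add: R_def remainder_def modulate_def)
        define A B C D where d: "A = complex_of_real ((\<gamma> - 3) / 4)"
            "B = complex_of_real ((3 - \<gamma>) / 2)" "C = complex_of_real ((3 - \<gamma>) * n / 2)"
          "D = complex_of_real ((2 * m + (\<gamma> - 1) * n) / 2)"
        define A' where d': "A' = complex_of_real ((\<gamma> + 1) / 4)"
        show ?thesis unfolding R f'_def slow_derivative_def slow_rate_def d[symmetric] d'[symmetric]
          by (simp add: algebra_simps)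
      qed
      ultimately show "((\<lambda>t. f t k + of_real e * G t k) has_vector_derivative
        of_real e * R t k - \<i> * of_int k *
            (of_real ((\<gamma> + 1) / 4) * conv (f t) (f t) k + of_real ((2 * m + (\<gamma> - 1) * n) / 2)
            * f t k)) (at t within ?S)"
        by simp
    qed
    then show "\<exists>G R. approx_solution ((\<gamma> + 1) / 4) ((2 * m + (\<gamma> - 1) * n) / 2) T e K
            (\<lambda>t. modulate (t / e) (half_sum (u t) (r t))) G R"
      unfolding f_def by blast
  qed
qed

section \<open>Continuity in time of Burgers solutions\<close>

lemma vector_derivative_bound:
  fixes f :: "real \<Rightarrow> 'a::real_normed_vector"
  assumes "convex S" "\<And>x. x \<in> S \<Longrightarrow> (f has_vector_derivative f' x) (at x within S)"
    "\<And>x. x \<in> S \<Longrightarrow> norm (f' x) \<le> B" "x \<in> S" "y \<in> S"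
  shows "norm (f x - f y) \<le> B * \<bar>x - y\<bar>"
proof -
  have "norm (f x - f y) \<le> B * norm (x - y)"
  proof (rule differentiable_bound[OF assms(1)])
    fix z assume z: "z \<in> S"
    show "(f has_derivative (\<lambda>h. h *\<^sub>R f' z)) (at z within S)"
      using assms(2)[OF z] by (simp add: has_vector_derivative_def)
    show "onorm (\<lambda>h. h *\<^sub>R f' z) \<le> B"
      using mult_left_mono[OF assms(3)[OF z] abs_ge_zero]
          by (intro onorm_le) (simp add: mult.commute)
  qed (use assms in auto)
  then show ?thesis by simp
qed

text \<open>
  The mean value theorem; the derivative \<open>2 s z (1 + z\<^sup>2)\<^sup>s\<^sup>-\<^sup>1\<close>, multiplied by \<open>y \<le> z\<close>, is at most \<open>2 s (1 + z\<^sup>2)\<^sup>s\<close>.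
\<close>

lemma power_weight_lipschitz:
  fixes s x y :: real
  assumes s: "0 < s" and xy: "0 \<le> y" "y \<le> x"
  shows "y * ((1 + x\<^sup>2) powr s - (1 + y\<^sup>2) powr s) \<le> 2 * s * (x - y) * (1 + x\<^sup>2) powr s" (is
      "y * (?w x - ?w y) \<le> _")
proof (cases "y = x")
  case False
  then have lt: "y < x" using xy by simp
  have pos: "0 < 1 + z\<^sup>2" for z :: real by (simp add: add_pos_nonneg)
  have "\<exists>z. y < z \<and> z < x \<and> ?w x - ?w y = (x - y) * (s * (1 + z\<^sup>2) powr (s - 1) * (2 * z))"
  proof (rule MVT2[OF lt])
    fix z
    show "(?w has_real_derivative (s * (1 + z\<^sup>2) powr (s - 1) * (2 * z))) (at z)"
      using pos[of z] by (auto intro!: derivative_eq_intros simp: powr_diff field_simps)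
  qed
  then obtain z where z: "y < z" "z < x"
      "?w x - ?w y = (x - y) * (s * (1 + z\<^sup>2) powr (s - 1) * (2 * z))" by blast
  have "y * (?w x - ?w y) = 2 * s * (x - y) * (y * z * (1 + z\<^sup>2) powr (s - 1))" unfolding z(3)
      by simp
  also have "\<dots> \<le> 2 * s * (x - y) * (1 + x\<^sup>2) powr s"
  proof (rule mult_left_mono)
    have "y * z \<le> 1 + z\<^sup>2"
    proof -
      have "y * z \<le> z * z" using z xy by (intro mult_right_mono) auto
      then show ?thesis by (simp add: power2_eq_square)
    qed
    then have "y * z * (1 + z\<^sup>2) powr (s - 1) \<le> (1 + z\<^sup>2) * (1 + z\<^sup>2) powr (s - 1)"
      by (intro mult_right_mono) auto
    also have "\<dots> = (1 + z\<^sup>2) powr 1 * (1 + z\<^sup>2) powr (s - 1)" using pos[of z] by simp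
    also have "\<dots> = (1 + z\<^sup>2) powr s" unfolding powr_add[symmetric] by simp
    also have "\<dots> \<le> (1 + x\<^sup>2) powr s"
      using s z xy by (intro powr_mono2 add_left_mono power_mono) (auto intro: add_nonneg_nonneg)
    finally show "y * z * (1 + z\<^sup>2) powr (s - 1) \<le> (1 + x\<^sup>2) powr s" .
  qed (use s lt in auto)
  finally show ?thesis .
qed auto

text \<open>
  A cut-off with a finite support, which makes the energy a finite sum. Its slope \<open>1/n\<close> is compensated
  by the frequencies, at most \<open>n\<close>, on its support, so the weighted symbol satisfies Lipschitz bounds
  uniformly in \<open>n\<close> (\<open>tent_symbol_lipschitz\<close>).
\<close>

definition tent :: "nat \<Rightarrow> int \<Rightarrow> real" where
  "tent n k = max 0 (1 - \<bar>of_int k\<bar> / real n)"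

definition tent_symbol :: "real \<Rightarrow> nat \<Rightarrow> int \<Rightarrow> real" where
  "tent_symbol s n k = of_int k * (weight (2 * s) k * tent n k)"

lemma tent_bounds: "0 \<le> tent n k" "tent n k \<le> 1"
  by (auto simp: tent_def)

lemma tent_minus [simp]: "tent n (- k) = tent n k" by (simp add: tent_def)

lemma tent_symbol_minus: "tent_symbol s n (- k) = - tent_symbol s n k"
  by (simp add: tent_symbol_def)

lemma tent_eq_0: "0 < n \<Longrightarrow> int n \<le> \<bar>k\<bar> \<Longrightarrow> tent n k = 0"
proof -
  assume "0 < n" "int n \<le> \<bar>k\<bar>"
  then have "real n \<le> \<bar>real_of_int k\<bar>" by linarith
  then show ?thesis using \<open>0 < n\<close> by (simp add: tent_def le_divide_eq)
qed

lemma tent_lipschitz: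
  assumes n: "0 < n" and le: "\<bar>l\<bar> \<le> \<bar>k\<bar>"
  shows "\<bar>of_int l\<bar> * \<bar>tent n k - tent n l\<bar> \<le> \<bar>of_int (k - l)\<bar>"
proof (cases "int n \<le> \<bar>l\<bar>")
  case True
  then have "tent n l = 0" "tent n k = 0" using n le by (auto intro: tent_eq_0)
  then show ?thesis by simp
next
  case False
  then have l: "\<bar>real_of_int l\<bar> \<le> real n" by linarith
  have "\<bar>tent n k - tent n l\<bar> \<le> \<bar>\<bar>of_int k\<bar> / real n - \<bar>of_int l\<bar> / real n\<bar>"
    unfolding tent_def by (auto simp: max_def)
  also have "\<dots> = \<bar>\<bar>of_int k\<bar> - \<bar>of_int l\<bar>\<bar> / real n" using n
      by (simp add: diff_divide_distrib[symmetric])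
  also have "\<dots> \<le> \<bar>of_int (k - l)\<bar> / real n" by (intro divide_right_mono) auto
  finally have "\<bar>of_int l\<bar> * \<bar>tent n k - tent n l\<bar> \<le> real n * (\<bar>of_int (k - l)\<bar> / real n)"
    using l by (intro mult_mono) auto
  then show ?thesis using n by simp
qed

lemma tent_symbol_lipschitz:
  assumes n: "0 < n" and s: "0 < s" and le: "\<bar>l\<bar> \<le> \<bar>k\<bar>"
  shows "\<bar>tent_symbol s n k - tent_symbol s n l\<bar>
      \<le> (2 + 2 * s) * (\<bar>of_int (k - l)\<bar> * weight (2 * s) k)"
proof -
  let ?W = "weight (2 * s)"
  have W: "?W l \<le> ?W k" using s le by (intro weight_abs_mono) auto
  have eq: "tent_symbol s n k - tent_symbol s n l = of_int (k - l) * ?W k * tent n k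
    + of_int l * (?W k - ?W l) * tent n k + of_int l * ?W l * (tent n k - tent n l)"
    by (simp add: tent_symbol_def algebra_simps)
  have 1: "\<bar>of_int (k - l) * ?W k * tent n k\<bar> \<le> \<bar>of_int (k - l)\<bar> * ?W k"
    using tent_bounds[of n k] by (simp add: abs_mult mult_left_le)
  have 2: "\<bar>of_int l * (?W k - ?W l) * tent n k\<bar> \<le> 2 * s * (\<bar>of_int (k - l)\<bar> * ?W k)"
  proof -
    have "\<bar>of_int l * (?W k - ?W l) * tent n k\<bar> \<le> \<bar>of_int l\<bar> * (?W k - ?W l)"
      using tent_bounds[of n k] W by (simp add: abs_mult mult_left_le)
    also have "\<dots> \<le> 2 * s * (\<bar>of_int k\<bar> - \<bar>of_int l\<bar>) * ?W k"
      using power_weight_lipschitz[OF s, of "\<bar>of_int l\<bar>" "\<bar>of_int k\<bar>"] le by (simp add: weight_def)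
    also have "\<dots> \<le> 2 * s * \<bar>of_int (k - l)\<bar> * ?W k"
      using s by (intro mult_right_mono mult_left_mono) auto
    finally show ?thesis by simp
  qed
  have 3: "\<bar>of_int l * ?W l * (tent n k - tent n l)\<bar> \<le> \<bar>of_int (k - l)\<bar> * ?W k"
  proof -
    have "\<bar>of_int l * ?W l * (tent n k - tent n l)\<bar> = (\<bar>of_int l\<bar> * \<bar>tent n k - tent n l\<bar>) * ?W l"
      by (simp add: abs_mult)
    also have "\<dots> \<le> \<bar>of_int (k - l)\<bar> * ?W k"
      using tent_lipschitz[OF n le] W by (intro mult_mono) auto
    finally show ?thesis .
  qed
  have "\<bar>tent_symbol s n k - tent_symbol s n l\<bar>
      \<le> \<bar>of_int (k - l)\<bar> * ?W k + 2 * s * (\<bar>of_int (k - l)\<bar> * ?W k) + \<bar>of_int (k - l)\<bar> * ?W k"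
    unfolding eq using 1 2 3 abs_triangle_ineq[of
        "of_int (k - l) * ?W k * tent n k + of_int l * (?W k - ?W l) * tent n k"
        "of_int l * ?W l * (tent n k - tent n l)"]
      abs_triangle_ineq[of "of_int (k - l) * ?W k * tent n k"
          "of_int l * (?W k - ?W l) * tent n k"] by linarith
  then show ?thesis by (simp add: algebra_simps)
qed

text \<open>
  The two larger frequencies \<open>y\<close>, \<open>z\<close> are comparable, and \<open>- y = z + x\<close>. As the symbol is odd, its values
  at \<open>y\<close> and \<open>z\<close> cancel up to its increment over the distance \<open>\<bar>x\<bar>\<close>, and its value at \<open>x\<close> is itself of
  this size.
\<close>

lemma tent_symbol_resonance_ordered:
  assumes n: "0 < n" and s: "0 < s" and xyz: "x + y + z = 0" and le: "\<bar>x\<bar> \<le> \<bar>y\<bar>" "\<bar>y\<bar> \<le> \<bar>z\<bar>"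
  shows "\<bar>tent_symbol s n x + tent_symbol s n y + tent_symbol s n z\<bar>
    \<le> (1 + (2 + 2 * s) * 2 powr s) * (\<bar>of_int x\<bar> * weight s y * weight s z)"
proof -
  let ?h = "tent_symbol s n" and ?w = "weight s"
  have w: "?w x \<le> ?w y" "?w y \<le> ?w z" using s le by (auto intro: weight_abs_mono)
  have yz: "?w z \<le> 2 powr s * ?w y"
  proof -
    have "\<bar>z\<bar> \<le> \<bar>2 * y\<bar>" using xyz le by linarith
    then show ?thesis using weight_abs_mono[of s z "2 * y"] weight_double_arg[of s y] s by simp
  qed
  have "\<bar>?h z - ?h (- y)\<bar> \<le> (2 + 2 * s) * (\<bar>of_int (z - - y)\<bar> * weight (2 * s) z)"
    using le by (intro tent_symbol_lipschitz n s) auto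
  also have "z - - y = - x" using xyz by simp
  also have "weight (2 * s) z = ?w z * ?w z" by (simp add: weight_double power2_eq_square)
  also have "(2 + 2 * s) * (\<bar>of_int (- x)\<bar> * (?w z * ?w z))
      \<le> (2 + 2 * s) * (\<bar>of_int (- x)\<bar> * (2 powr s * ?w y * ?w z))"
    using yz s by (intro mult_left_mono mult_right_mono) auto
  finally have 1: "\<bar>?h z + ?h y\<bar> \<le> (2 + 2 * s) * 2 powr s * (\<bar>of_int x\<bar> * ?w y * ?w z)"
    by (simp add: tent_symbol_minus algebra_simps)
  have "\<bar>?h x\<bar> = \<bar>of_int x\<bar> * (?w x * ?w x) * tent n x"
    using tent_bounds[of n x] by (simp add: tent_symbol_def abs_mult weight_double power2_eq_square)
  also have "\<dots> \<le> \<bar>of_int x\<bar> * (?w y * ?w z) * 1"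
    using w tent_bounds[of n x] by (intro mult_mono) (auto intro: order_trans)
  finally have 2: "\<bar>?h x\<bar> \<le> \<bar>of_int x\<bar> * ?w y * ?w z" by simp
  have "\<bar>?h x + ?h y + ?h z\<bar> \<le> \<bar>?h x\<bar> + \<bar>?h z + ?h y\<bar>" by linarith
  also have "\<dots> \<le> \<bar>of_int x\<bar> * ?w y * ?w z + (2 + 2 * s) * 2 powr s * (\<bar>of_int x\<bar> * ?w y * ?w z)"
    by (intro add_mono 1 2)
  finally show ?thesis by (simp add: algebra_simps)
qed

lemma tent_symbol_resonance:
  assumes n: "0 < n" and s: "0 < s" and xyz: "x + y + z = 0"
  shows "\<bar>tent_symbol s n x + tent_symbol s n y + tent_symbol s n z\<bar>
      \<le> (1 + (2 + 2 * s) * 2 powr s) *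
    (\<bar>of_int x\<bar> * weight s y * weight s z + \<bar>of_int y\<bar> * weight s x * weight s z + \<bar>of_int z\<bar>
        * weight s x * weight s y)"
    (is "?L \<le> ?C * (?X + ?Y + ?Z)")
proof -
  have nn: "0 \<le> ?X" "0 \<le> ?Y" "0 \<le> ?Z" by auto
  have C: "0 \<le> ?C" using s by (intro add_nonneg_nonneg) auto
  have "?L \<le> ?C * ?X \<or> ?L \<le> ?C * ?Y \<or> ?L \<le> ?C * ?Z"
  proof -
    consider "\<bar>x\<bar> \<le> \<bar>y\<bar>" "\<bar>y\<bar> \<le> \<bar>z\<bar>" | "\<bar>x\<bar> \<le> \<bar>z\<bar>" "\<bar>z\<bar> \<le> \<bar>y\<bar>" | "\<bar>y\<bar> \<le> \<bar>x\<bar>" "\<bar>x\<bar> \<le> \<bar>z\<bar>"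
      | "\<bar>y\<bar> \<le> \<bar>z\<bar>" "\<bar>z\<bar> \<le> \<bar>x\<bar>" | "\<bar>z\<bar> \<le> \<bar>x\<bar>" "\<bar>x\<bar> \<le> \<bar>y\<bar>" | "\<bar>z\<bar> \<le> \<bar>y\<bar>" "\<bar>y\<bar> \<le> \<bar>x\<bar>" by linarith
    then show ?thesis
    proof cases
      case 1 then show ?thesis using tent_symbol_resonance_ordered[OF n s xyz]
          by (simp add: mult_ac)
    next
      case 2 then show ?thesis using tent_symbol_resonance_ordered[OF n s, of x z y] xyz
          by (simp add: mult_ac add_ac)
    next
      case 3 then show ?thesis using tent_symbol_resonance_ordered[OF n s, of y x z] xyz
          by (simp add: mult_ac add_ac)
    next
      case 4 then show ?thesis using tent_symbol_resonance_ordered[OF n s, of y z x] xyz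
          by (simp add: mult_ac add_ac)
    next
      case 5 then show ?thesis using tent_symbol_resonance_ordered[OF n s, of z x y] xyz
          by (simp add: mult_ac add_ac)
    next
      case 6 then show ?thesis using tent_symbol_resonance_ordered[OF n s, of z y x] xyz
          by (simp add: mult_ac add_ac)
    qed
  qed
  moreover have "?C * ?X \<le> ?C * (?X + ?Y + ?Z)" "?C * ?Y \<le> ?C * (?X + ?Y + ?Z)"
      "?C * ?Z \<le> ?C * (?X + ?Y + ?Z)"
    by (rule mult_left_mono[OF _ C], use nn in linarith)+
  ultimately show ?thesis by linarith
qed

text \<open>
  The substitution \<open>l \<mapsto> k - l\<close> brings this to the form of \<open>trilinear_finite\<close>.
\<close>

lemma trilinear_finite_right:
  assumes a: "sob_le 0 a A" and p: "l1_le p P" and b: "sob_le 0 b B" and Z: "finite Z"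
  shows "(\<Sum>(k, l)\<in>Z. cmod (a k) * cmod (b (k - l)) * cmod (p l)) \<le> A * P * B"
proof -
  have "(\<Sum>(k, l)\<in>Z. cmod (a k) * cmod (b (k - l)) * cmod (p l))
    = (\<Sum>z\<in>(\<lambda>(k, l). (k, k - l)) ` Z. cmod ((\<lambda>(k, l). a k * p (k - l) * b l) z))"
    by (subst sum.reindex) (auto simp: inj_on_def norm_mult case_prod_unfold mult_ac intro!:
        sum.cong)
  also have "\<dots> \<le> A * P * B" by (rule trilinear_finite[OF a p b]) (use Z in simp)
  finally show ?thesis .
qed

text \<open>
  Here the factor \<open>p\<close> receives the difference of the indices by the substitution \<open>(k, l) \<mapsto> (l, l - k)\<close>.
\<close>

lemma trilinear_finite_left:
  assumes a: "sob_le 0 a A" and p: "l1_le p P" and b: "sob_le 0 b B" and Z: "finite Z"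
  shows "(\<Sum>(k, l)\<in>Z. cmod (p k) * cmod (b (k - l)) * cmod (a l)) \<le> A * P * B"
proof -
  have b': "sob_le 0 (\<lambda>k. b (- k)) B" by (rule sob_le_0_reindex[OF b]) (simp add: inj_def)
  have "(\<Sum>(k, l)\<in>Z. cmod (p k) * cmod (b (k - l)) * cmod (a l))
    = (\<Sum>z\<in>(\<lambda>(k, l). (l, l - k)) ` Z. cmod ((\<lambda>(k, l). a k * p (k - l) * b (- l)) z))"
    by (subst sum.reindex) (auto simp: inj_on_def norm_mult case_prod_unfold mult_ac intro!:
        sum.cong)
  also have "\<dots> \<le> A * P * B" by (rule trilinear_finite[OF a p b']) (use Z in simp)
  finally show ?thesis .
qed

text \<open>
  By \<open>energy_cubic\<close> and \<open>tent_symbol_resonance\<close> each term has one derivative on one factor, which is then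
  absolutely summable because \<open>s \<ge> 2\<close>, and the weights \<open>\<langle>\<cdot>\<rangle>\<^sup>s\<close> on the two others.
\<close>

lemma tent_energy_bound:
  assumes n: "0 < n" and s: "2 \<le> s" and F: "herm F" "sob_le s F M"
  shows "\<bar>Im (\<Sum>k\<in>{-int n..int n}. cnj (of_real (tent_symbol s n k) * F k) * conv F F k)\<bar>
    \<le> (1 + (2 + 2 * s) * 2 powr s) * (l1_const * M * M\<^sup>2)"
proof -
  let ?h = "tent_symbol s n" and ?w = "weight s"
  define C where "C = 1 + (2 + 2 * s) * 2 powr s"
  have C: "0 \<le> C" using s unfolding C_def by (intro add_nonneg_nonneg) auto
  have F1: "sob_le 1 F M" and F2: "sob_le 2 F M" using F(2) s by (auto intro: sob_le_weaken)
  have supp: "?h k = 0" if "k \<notin> {-int n..int n}" for k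
    using that n tent_eq_0[OF n, of k] by (auto simp: tent_symbol_def)
  have N: "sob_le 0 (\<lambda>k. of_real (?h k)
      * F k) (L2_set (\<lambda>k. cmod (of_real (?h k) * F k)) {-int n..int n})"
    by (rule sob_le_0_finite_support) (use supp in auto)
  note E = energy_cubic[OF F(1) F1 N]
  have "(\<Sum>k\<in>{-int n..int n}. cnj (of_real (?h k) * F k) * conv F F k)
      = (\<Sum>\<^sub>\<infinity>k\<in>{-int n..int n}. cnj (of_real (?h k) * F k) * conv F F k)"
    by simp
  also have "\<dots> = (\<Sum>\<^sub>\<infinity>k. cnj (of_real (?h k) * F k) * conv F F k)"
    by (rule infsum_cong_neutral) (use supp in auto)
  finally have fin: "(\<Sum>k\<in>{-int n..int n}. cnj (of_real (?h k) * F k) * conv F F k)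
      = (\<Sum>\<^sub>\<infinity>k. cnj (of_real (?h k) * F k) * conv F F k)" .
  define wF where "wF k = of_real (?w k) * F k" for k
  define dF where "dF k = \<i> * of_int k * F k" for k
  have wF: "sob_le 0 wF M" using F(2) unfolding wF_def by (simp add: sob_le_weighted[of s])
  have dF: "l1_le dF (l1_const * M)"
    unfolding dF_def by (rule sob_le_1_imp_l1_le, rule sob_le_deriv) (simp add: F2)
  have aw: "cmod (wF k) = ?w k * cmod (F k)" for k by (simp add: wF_def norm_mult)
  have ad: "cmod (dF k) = \<bar>of_int k\<bar> * cmod (F k)" for k by (simp add: dF_def norm_mult)
  have "cmod (\<Sum>\<^sub>\<infinity>(k, l). of_real (?h k - ?h l - ?h (k - l)) * (cnj (F k) * F (k - l) * F l))
      \<le> 3 * (C * (M * (l1_const * M) * M))"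
  proof (rule abs_summable_if_bounded(2))
    fix Z :: "(int \<times> int) set" assume Z: "finite Z"
    have "(\<Sum>z\<in>Z. cmod (case z of (k, l) \<Rightarrow> of_real (?h k - ?h l - ?h (k - l))
        * (cnj (F k) * F (k - l) * F l)))
      \<le> (\<Sum>(k, l)\<in>Z. C * (cmod (wF k) * cmod (dF (k - l)) * cmod (wF l) + cmod (wF k) * cmod
          (wF (k - l)) * cmod (dF l)
           + cmod (dF k) * cmod (wF (k - l)) * cmod (wF l)))"
    proof (rule sum_mono, clarify)
      fix k l
      have "\<bar>?h k - ?h l - ?h (k - l)\<bar> = \<bar>?h (- k) + ?h l + ?h (k - l)\<bar>"
        by (simp add: tent_symbol_minus)
      also have "\<dots> \<le> C * (\<bar>of_int (- k)\<bar> * ?w l * ?w (k - l) + \<bar>of_int l\<bar> * ?w (- k) * ?w (k - l)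
          + \<bar>of_int (k - l)\<bar> * ?w (- k) * ?w l)"
        unfolding C_def by (rule tent_symbol_resonance[OF n]) (use s in auto)
      finally have "\<bar>?h k - ?h l - ?h (k - l)\<bar> * (cmod (F k) * cmod (F (k - l)) * cmod (F l))
        \<le> C * (\<bar>of_int (- k)\<bar> * ?w l * ?w (k - l) + \<bar>of_int l\<bar> * ?w (- k) * ?w (k - l) + \<bar>of_int
            (k - l)\<bar> * ?w (- k) * ?w l)
           * (cmod (F k) * cmod (F (k - l)) * cmod (F l))"
        by (rule mult_right_mono) auto
      then show "cmod (of_real (?h k - ?h l - ?h (k - l)) * (cnj (F k) * F (k - l) * F l))
        \<le> C * (cmod (wF k) * cmod (dF (k - l)) * cmod (wF l) + cmod (wF k) * cmod (wF (k - l))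
            * cmod (dF l)
           + cmod (dF k) * cmod (wF (k - l)) * cmod (wF l))"
        unfolding norm_mult norm_of_real aw ad by (simp add: algebra_simps)
    qed
    also have "\<dots> = C * ((\<Sum>(k, l)\<in>Z. cmod (wF k) * cmod (dF (k - l)) * cmod (wF l))
        + (\<Sum>(k, l)\<in>Z. cmod (wF k) * cmod (wF (k - l)) * cmod (dF l))
           + (\<Sum>(k, l)\<in>Z. cmod (dF k) * cmod (wF (k - l)) * cmod (wF l)))"
      by (simp add: sum_distrib_left sum.distrib case_prod_unfold distrib_left)
    also have "\<dots> \<le> C * (M * (l1_const * M) * M + M * (l1_const * M) * M + M * (l1_const * M) * M)"
    proof (intro mult_left_mono[OF _ C] add_mono)
      show "(\<Sum>(k, l)\<in>Z. cmod (wF k) * cmod (dF (k - l)) * cmod (wF l)) \<le> M * (l1_const * M) * M"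
        using trilinear_finite[OF wF dF wF Z] by (simp add: norm_mult case_prod_unfold)
      show "(\<Sum>(k, l)\<in>Z. cmod (wF k) * cmod (wF (k - l)) * cmod (dF l)) \<le> M * (l1_const * M) * M"
        by (rule trilinear_finite_right[OF wF dF wF Z])
      show "(\<Sum>(k, l)\<in>Z. cmod (dF k) * cmod (wF (k - l)) * cmod (wF l)) \<le> M * (l1_const * M) * M"
        by (rule trilinear_finite_left[OF wF dF wF Z])
    qed
    also have "\<dots> = 3 * (C * (M * (l1_const * M) * M))" by (simp add: algebra_simps)
    finally show "(\<Sum>z\<in>Z. cmod (case z of (k, l) \<Rightarrow> of_real (?h k - ?h l - ?h (k - l))
        * (cnj (F k) * F (k - l) * F l)))
      \<le> 3 * (C * (M * (l1_const * M) * M))" .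
  qed
  then have "\<bar>3 * Im (\<Sum>\<^sub>\<infinity>k. cnj (of_real (?h k) * F k) * conv F F k)\<bar>
      \<le> 3 * (C * (M * (l1_const * M) * M))"
    unfolding E(2) by (rule order_trans[OF abs_Im_le_cmod])
  then show ?thesis unfolding fin C_def[symmetric] by (simp add: power2_eq_square mult_ac)
qed

definition burgers_rhs :: "real \<Rightarrow> real \<Rightarrow> (int \<Rightarrow> complex) \<Rightarrow> int \<Rightarrow> complex" where
  "burgers_rhs a c F = (\<lambda>k. - (\<i> * of_int k * (of_real a * conv F F k + of_real c * F k)))"

text \<open>
  Coefficients of a real solution of \<open>\<partial>\<^sub>t F + \<partial>\<^sub>x (a F\<^sup>2 + c F) = 0\<close>, bounded in \<open>H\<^sup>s\<close>.
\<close>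

definition burgers_coeffs ::
    "real \<Rightarrow> real \<Rightarrow> real \<Rightarrow> real \<Rightarrow> real \<Rightarrow> (real \<Rightarrow> int \<Rightarrow> complex) \<Rightarrow> bool" where
  "burgers_coeffs a c s T M F \<longleftrightarrow> (\<forall>t\<in>{0..<T}. herm (F t) \<and> sob_le s (F t) M \<and>
     (\<forall>k. ((\<lambda>t. F t k) has_vector_derivative burgers_rhs a c (F t) k) (at t within {0..<T})))"

text \<open>The linear part of the flux is antisymmetric and drops out of the energy.\<close>

lemma burgers_tent_norm_lipschitz:
  assumes B: "burgers_coeffs a c s T M F" and s: "2 \<le> s" and n: "0 < n"
      and rt: "r \<in> {0..<T}" "t \<in> {0..<T}"
  shows "\<bar>(\<Sum>k\<in>{-int n..int n}. weight (2 * s) k * tent n k * (cmod (F r k))\<^sup>2)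
      - (\<Sum>k\<in>{-int n..int n}. weight (2 * s) k * tent n k * (cmod (F t k))\<^sup>2)\<bar>
    \<le> (2 * \<bar>a\<bar> * ((1 + (2 + 2 * s) * 2 powr s) * (l1_const * M * M\<^sup>2))) * \<bar>r - t\<bar>"
proof -
  let ?I = "{-int n..int n}" and ?S = "{0..<T}"
  let ?W = "\<lambda>k. weight (2 * s) k * tent n k"
  have "norm ((\<Sum>k\<in>?I. ?W k * (cmod (F r k))\<^sup>2) - (\<Sum>k\<in>?I. ?W k * (cmod (F t k))\<^sup>2))
    \<le> (2 * \<bar>a\<bar> * ((1 + (2 + 2 * s) * 2 powr s) * (l1_const * M * M\<^sup>2))) * \<bar>r - t\<bar>"
  proof (rule vector_derivative_bound[where S = ?S and f = "\<lambda>t. \<Sum>k\<in>?I. ?W k * (cmod (F t k))\<^sup>2"])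
    fix t assume t: "t \<in> ?S"
    have h: "herm (F t)" "sob_le s (F t) M"
        and d: "\<And>k. ((\<lambda>t. F t k) has_vector_derivative burgers_rhs a c (F t) k) (at t within ?S)"
      using B t by (auto simp: burgers_coeffs_def)
    show "((\<lambda>t. \<Sum>k\<in>?I. ?W k * (cmod (F t k))\<^sup>2)
        has_vector_derivative (\<Sum>k\<in>?I. ?W k * (2 * Re (cnj (F t k) * burgers_rhs a c (F t) k))))
        (at t within ?S)"
      by (intro has_vector_derivative_sum has_vector_derivative_mult_right
          cmod_square_has_vector_derivative d)
    have "?W k * (2 * Re (cnj (F t k) * burgers_rhs a c (F t) k))
        = 2 * a * Im (cnj (of_real (tent_symbol s n k) * F t k) * conv (F t) (F t) k)" for k
    proof -
      have e: "cnj (F t k) * burgers_rhs a c (F t) k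
          = - \<i> * of_real a * (of_int k * (cnj (F t k) * conv (F t) (F t) k)) - \<i> * of_real
          (of_int k * c * (cmod (F t k))\<^sup>2)"
        unfolding burgers_rhs_def by
            (simp add: complex_norm_square algebra_simps del: of_real_power)
      have "Re (cnj (F t k) * burgers_rhs a c (F t) k)
          = a * (of_int k * Im (cnj (F t k) * conv (F t) (F t) k))"
        unfolding e by simp
      moreover have e2: "cnj (of_real (tent_symbol s n k) * F t k) * conv (F t) (F t) k
          = of_real (?W k * of_int k) * (cnj (F t k) * conv (F t) (F t) k)"
        by (simp add: tent_symbol_def mult_ac)
      have "Im (cnj (of_real (tent_symbol s n k) * F t k) * conv (F t) (F t) k)
          = ?W k * of_int k * Im (cnj (F t k) * conv (F t) (F t) k)"
        unfolding e2 by (simp only: times_complex.sel Im_complex_of_real Re_complex_of_real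
            mult_zero_left add_0_right)
      ultimately show ?thesis by simp
    qed
    then have "(\<Sum>k\<in>?I. ?W k * (2 * Re (cnj (F t k) * burgers_rhs a c (F t) k)))
        = 2 * a * Im (\<Sum>k\<in>?I. cnj (of_real (tent_symbol s n k) * F t k) * conv (F t) (F t) k)"
      by (simp only: sum_distrib_left Im_sum)
    also have "norm \<dots> = 2 * \<bar>a\<bar>
        * \<bar>Im (\<Sum>k\<in>?I. cnj (of_real (tent_symbol s n k) * F t k) * conv (F t) (F t) k)\<bar>"
      by (simp add: abs_mult)
    also have "\<dots> \<le> 2 * \<bar>a\<bar> * ((1 + (2 + 2 * s) * 2 powr s) * (l1_const * M * M\<^sup>2))"
      by (intro mult_left_mono tent_energy_bound n s h) auto
    finally show "norm (\<Sum>k\<in>?I. ?W k * (2 * Re (cnj (F t k) * burgers_rhs a c (F t) k)))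
        \<le> 2 * \<bar>a\<bar> * ((1 + (2 + 2 * s) * 2 powr s) * (l1_const * M * M\<^sup>2))" .
  qed (use rt in auto)
  then show ?thesis by simp
qed

lemma tent_tendsto: "(\<lambda>n. tent n k) \<longlonglongrightarrow> 1"
proof -
  have "(\<lambda>n. max 0 (1 - \<bar>of_int k\<bar> / real n)) \<longlonglongrightarrow> max 0 (1 - 0)"
    by (intro tendsto_intros lim_const_over_n)
  then show ?thesis by (simp add: tent_def[abs_def])
qed

text \<open>
  As \<open>n\<close> grows the tents increase to \<open>1\<close>, and the Lipschitz bound of \<open>burgers_tent_norm_lipschitz\<close> survives.
\<close>

lemma burgers_norm_growth:
  assumes B: "burgers_coeffs a c s T M F" and s: "2 \<le> s" and rt: "r \<in> {0..<T}" "t \<in> {0..<T}"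
      and A: "finite A"
  shows "(\<Sum>k\<in>A. (weight s k * cmod (F r k))\<^sup>2) \<le> (\<Sum>\<^sub>\<infinity>k. (weight s k * cmod (F t k))\<^sup>2)
    + (2 * \<bar>a\<bar> * ((1 + (2 + 2 * s) * 2 powr s) * (l1_const * M * M\<^sup>2))) * \<bar>r - t\<bar>"
    (is "_ \<le> ?\<Phi> + ?L * _")
proof (rule tendsto_upperbound)
  have sq: "weight (2 * s) k * (cmod z)\<^sup>2 = (weight s k * cmod z)\<^sup>2" for k z
      by (simp add: weight_double power_mult_distrib)
  have "(\<lambda>n. \<Sum>k\<in>A. tent n k * (weight s k * cmod (F r k))\<^sup>2)
      \<longlonglongrightarrow> (\<Sum>k\<in>A. 1 * (weight s k * cmod (F r k))\<^sup>2)"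
    by (intro tendsto_intros tent_tendsto)
  then show "(\<lambda>n. \<Sum>k\<in>A. tent n k * (weight s k * cmod (F r k))\<^sup>2)
      \<longlonglongrightarrow> (\<Sum>k\<in>A. (weight s k * cmod (F r k))\<^sup>2)" by simp
  have Ft: "sob_le s (F t) M" using B rt by (auto simp: burgers_coeffs_def)
  note sum = sob_le_summable(1)[OF Ft]
  have "\<forall>\<^sub>F n in sequentially. finite {-int n..int n} \<and> A \<subseteq> {-int n..int n}
      \<and> {-int n..int n} \<subseteq> UNIV"
    using filterlim_int_intervals[unfolded filterlim_finite_subsets_at_top, rule_format, of A] A
        by simp
  then show "\<forall>\<^sub>F n in sequentially. (\<Sum>k\<in>A. tent n k * (weight s k * cmod (F r k))\<^sup>2)
      \<le> ?\<Phi> + ?L * \<bar>r - t\<bar>"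
    using eventually_gt_at_top[of 0]
  proof eventually_elim
    case (elim n)
    let ?I = "{-int n..int n}"
    have "(\<Sum>k\<in>A. tent n k * (weight s k * cmod (F r k))\<^sup>2)
        \<le> (\<Sum>k\<in>?I. tent n k * (weight s k * cmod (F r k))\<^sup>2)"
      using elim tent_bounds by (intro sum_mono2) auto
    also have "\<dots> = (\<Sum>k\<in>?I. weight (2 * s) k * tent n k * (cmod (F r k))\<^sup>2)"
      by (simp add: sq[symmetric] mult_ac)
    also have "\<dots> \<le> (\<Sum>k\<in>?I. weight (2 * s) k * tent n k * (cmod (F t k))\<^sup>2) + ?L * \<bar>r - t\<bar>"
      using burgers_tent_norm_lipschitz[OF B s _ rt, of n] elim by linarith
    also have "(\<Sum>k\<in>?I. weight (2 * s) k * tent n k * (cmod (F t k))\<^sup>2)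
        \<le> (\<Sum>k\<in>?I. (weight s k * cmod (F t k))\<^sup>2)"
    proof (rule sum_mono)
      fix k
      have "tent n k * (weight s k * cmod (F t k))\<^sup>2 \<le> 1 * (weight s k * cmod (F t k))\<^sup>2"
        using tent_bounds by (intro mult_right_mono) auto
      then show "weight (2 * s) k * tent n k * (cmod (F t k))\<^sup>2 \<le> (weight s k * cmod (F t k))\<^sup>2"
          by (simp add: sq[symmetric] mult_ac)
    qed
    also have "\<dots> \<le> ?\<Phi>" by (intro finite_sum_le_infsum sum) auto
    finally show ?case by simp
  qed
qed simp

text \<open>
  Each coefficient is continuous, so low frequencies are harmless. The high frequencies at time \<open>r\<close> carry
  what the low ones leave of the norm, and by \<open>burgers_norm_growth\<close> the norm at time \<open>r\<close> is close to
  the norm at time \<open>t\<close> or below it.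
\<close>

lemma burgers_continuous:
  assumes B: "burgers_coeffs a c s T M F" and s: "2 \<le> s" and t: "t \<in> {0..<T}" and \<eta>: "0 < \<eta>"
  shows "\<forall>\<^sub>F r in at t within {0..<T}. sob_le s (\<lambda>k. F r k - F t k) \<eta>"
proof -
  define L where "L = 2 * \<bar>a\<bar> * ((1 + (2 + 2 * s) * 2 powr s) * (l1_const * M * M\<^sup>2))"
  define p where "p r k = (weight s k * cmod (F r k))\<^sup>2" for r k
  define \<Phi> where "\<Phi> = (\<Sum>\<^sub>\<infinity>k. p t k)"
  \<comment> \<open>below, the square of the distance is at most \<open>9 \<delta>\<close>\<close>
  define \<delta> where "\<delta> = \<eta>\<^sup>2 / 9"
  have \<delta>: "0 < \<delta>" using \<eta> by (simp add: \<delta>_def)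
  have Ft: "sob_le s (F t) M" using B t by (auto simp: burgers_coeffs_def)
  have sum: "p t summable_on UNIV" using sob_le_summable(1)[OF Ft] by (simp add: p_def[abs_def])
  obtain A where A: "finite A" "\<Phi> - sum (p t) A < \<delta>"
  proof -
    from infsum_finite_approximation[OF sum \<delta>] obtain A where A: "finite A"
        "dist (sum (p t) A) \<Phi> \<le> \<delta> / 2"
      using infsum_finite_approximation[OF sum, of "\<delta> / 2"] \<delta> unfolding \<Phi>_def by auto
    then have "\<Phi> - sum (p t) A < \<delta>" using \<delta> unfolding dist_real_def by linarith
    with A show thesis by (intro that)
  qed
  have cF: "((\<lambda>r. F r k) \<longlongrightarrow> F t k) (at t within {0..<T})" for k
  proof -
    have "((\<lambda>t. F t k) has_vector_derivative burgers_rhs a c (F t) k) (at t within {0..<T})"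
      using B t by (auto simp: burgers_coeffs_def)
    from has_vector_derivative_continuous[OF this] show ?thesis by (simp add: continuous_within)
  qed
  have "((\<lambda>r. \<Sum>k\<in>A. (weight s k * cmod (F r k - F t k))\<^sup>2)
      \<longlongrightarrow> (\<Sum>k\<in>A. (weight s k * cmod (F t k - F t k))\<^sup>2)) (at t within {0..<T})"
    by (intro tendsto_intros cF)
  then have e1: "\<forall>\<^sub>F r in at t within {0..<T}. (\<Sum>k\<in>A. (weight s k * cmod (F r k - F t k))\<^sup>2) < \<delta>"
    using \<delta> by (intro order_tendstoD(2)) auto
  have "((\<lambda>r. sum (p r) A) \<longlongrightarrow> sum (p t) A) (at t within {0..<T})"
    unfolding p_def by (intro tendsto_intros cF)
  then have e2: "\<forall>\<^sub>F r in at t within {0..<T}. sum (p t) A - \<delta> < sum (p r) A"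
    using \<delta> by (intro order_tendstoD(1)) auto
  have "((\<lambda>r. L * \<bar>r - t\<bar>) \<longlongrightarrow> L * \<bar>t - t\<bar>) (at t within {0..<T})" by (intro tendsto_intros)
  then have e3: "\<forall>\<^sub>F r in at t within {0..<T}. L * \<bar>r - t\<bar> < \<delta>"
    using \<delta> by (intro order_tendstoD(2)) auto
  have e4: "\<forall>\<^sub>F r in at t within {0..<T}. r \<in> {0..<T}" by (auto simp: eventually_at_filter)
  from e1 e2 e3 e4 show ?thesis
  proof eventually_elim
    case (elim r)
    show ?case
    proof (rule sob_leI)
      fix S :: "int set" assume S: "finite S"
      define q where "q k = (weight s k * cmod (F r k - F t k))\<^sup>2" for k
      have fin: "finite (S \<union> A)" "finite (S - A)" using S A by auto
      have U: "S \<union> A = A \<union> (S - A)" by auto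
      have "sum (p r) (S \<union> A) \<le> \<Phi> + L * \<bar>r - t\<bar>"
        unfolding p_def \<Phi>_def L_def by (rule burgers_norm_growth[OF B s elim(4) t fin(1)])
      then have pr: "sum (p r) (S - A) \<le> \<Phi> + \<delta> - sum (p r) A"
        using elim(3) unfolding U by (subst (asm) sum.union_disjoint) (use A fin in auto)
      have "sum (p t) (S \<union> A) \<le> \<Phi>"
        unfolding \<Phi>_def using fin by (intro finite_sum_le_infsum sum) (auto simp: p_def)
      then have pt: "sum (p t) (S - A) \<le> \<Phi> - sum (p t) A"
        unfolding U by (subst (asm) sum.union_disjoint) (use A fin in auto)
      have "sum q S \<le> sum q (S \<union> A)" using fin by (intro sum_mono2) (auto simp: q_def)
      also have "\<dots> = sum q A + sum q (S - A)" unfolding U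
          by (subst sum.union_disjoint) (use A fin in auto)
      also have "sum q (S - A) \<le> (\<Sum>k\<in>S - A. 2 * p r k + 2 * p t k)"
      proof (rule sum_mono)
        fix k
        have "q k \<le> (weight s k * cmod (F r k) + weight s k * cmod (F t k))\<^sup>2"
          unfolding q_def distrib_left[symmetric]
              by (intro power_mono mult_left_mono norm_triangle_ineq4) auto
        also have "\<dots> \<le> 2 * p r k + 2 * p t k"
          using zero_le_power2[of "weight s k * cmod (F r k) - weight s k * cmod (F t k)"]
          unfolding p_def power2_sum power2_diff by linarith
        finally show "q k \<le> 2 * p r k + 2 * p t k" .
      qed
      also have "\<dots> = 2 * sum (p r) (S - A) + 2 * sum (p t) (S - A)"
          by (simp add: sum.distrib sum_distrib_left)
      finally have "sum q S \<le> 9 * \<delta>" using elim(1,2) pr pt A(2) unfolding q_def[symmetric]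
          by linarith
      then have "sqrt (sum q S) \<le> sqrt (\<eta>\<^sup>2)" by (intro real_sqrt_le_mono) (simp add: \<delta>_def)
      then show "L2_set (\<lambda>k. weight s k * cmod (F r k - F t k)) S \<le> \<eta>"
        using \<eta> by (simp add: L2_set_def q_def)
    qed
  qed
qed

lemma burgers_rhs_bound:
  assumes "sob_le s F M" "2 \<le> s"
  shows "sob_le (s - 1) (burgers_rhs a c F) (\<bar>a\<bar> * (alg_const s * (M * M)) + \<bar>c\<bar> * M)"
proof -
  have "sob_le s (\<lambda>k. of_real a * conv F F k + of_real c * F k) (\<bar>a\<bar> * (alg_const s * (M * M))
      + \<bar>c\<bar> * M)"
    using sob_le_add[OF sob_le_scale[OF sob_le_conv[OF _ assms(1) assms(1)], of
        "of_real a"] sob_le_scale[OF assms(1), of "of_real c"]] assms(2)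
    unfolding norm_of_real by simp
  then have "sob_le (s - 1) (\<lambda>k. \<i> * of_int k * (of_real a * conv F F k + of_real c * F k)) (\<bar>a\<bar>
      * (alg_const s * (M * M)) + \<bar>c\<bar> * M)"
    by (intro sob_le_deriv) simp
  then show ?thesis unfolding burgers_rhs_def by (rule sob_le_uminus)
qed

lemma burgers_rhs_diff_bound:
  assumes F: "sob_le s F M" "sob_le s H M" "sob_le s (\<lambda>k. F k - H k) \<eta>" "2 \<le> s"
  shows "sob_le (s - 1) (\<lambda>k. burgers_rhs a c F k
      - burgers_rhs a c H k) ((\<bar>a\<bar> * (alg_const s * (2 * M)) + \<bar>c\<bar>) * \<eta>)"
proof -
  have F0: "sob_le 0 F M" "sob_le 0 H M" "sob_le 0 (\<lambda>k. F k - H k) \<eta>" using F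
      by (auto intro: sob_le_weaken)
  have sum: "sob_le s (\<lambda>k. F k + H k) (2 * M)" using sob_le_add[OF F(1,2)] by simp
  have sum0: "sob_le 0 (\<lambda>k. F k + H k) (2 * M)" using sum F(4) by (auto intro: sob_le_weaken)
  have "conv F F k - conv H H k = conv (\<lambda>k. F k - H k) (\<lambda>k. F k + H k) k" for k
    using conv_diff_left[OF F0(1,2) sum0, of k] conv_add_right[OF F0(1) F0(1,2), of k]
        conv_add_right[OF F0(2) F0(1,2), of k]
      conv_commute[of F H] by simp
  then have eq: "(\<lambda>k. burgers_rhs a c F k - burgers_rhs a c H k)
    = (\<lambda>k. - (\<i> * of_int k * (of_real a * conv (\<lambda>k. F k - H k) (\<lambda>k. F k + H k) k + of_real c *
        (F k - H k))))"
    by (simp add: burgers_rhs_def fun_eq_iff algebra_simps)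
  have "sob_le s (\<lambda>k. of_real a * conv (\<lambda>k. F k - H k) (\<lambda>k. F k + H k) k + of_real c * (F k - H k))
     (\<bar>a\<bar> * (alg_const s * (\<eta> * (2 * M))) + \<bar>c\<bar> * \<eta>)"
    using sob_le_add[OF sob_le_scale[OF sob_le_conv[OF _ F(3) sum], of
        "of_real a"] sob_le_scale[OF F(3), of "of_real c"]] F(4)
    unfolding norm_of_real by simp
  then have "sob_le (s - 1) (\<lambda>k. \<i> * of_int k
      * (of_real a * conv (\<lambda>k. F k - H k) (\<lambda>k. F k + H k) k + of_real c * (F k - H k)))
     (\<bar>a\<bar> * (alg_const s * (\<eta> * (2 * M))) + \<bar>c\<bar> * \<eta>)"
    by (intro sob_le_deriv) simp
  from sob_le_uminus[OF this] show ?thesis unfolding eq by (simp add: algebra_simps)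
qed

text \<open>
  A mean value estimate. Pairing with the error \<open>z\<close> of the difference quotient reduces it to the scalar
  function \<open>\<psi>\<close>, whose increment is \<open>(r - t) \<parallel>z\<parallel>\<^sup>2\<close>; the right-hand side of the equation is continuous by
  \<open>burgers_continuous\<close>.
\<close>

lemma burgers_difference_quotient:
  assumes B: "burgers_coeffs a c s T M F" and s: "2 \<le> s" and t: "t \<in> {0..<T}" and \<eta>: "0 < \<eta>"
  shows "\<forall>\<^sub>F r in at t within {0..<T}. sob_le (s - 1) (\<lambda>k. (F r k - F t k) / of_real (r - t)
      - burgers_rhs a c (F t) k) \<eta>"
proof -
  define K where "K = \<bar>a\<bar> * (alg_const s * (2 * M)) + \<bar>c\<bar> + 1"
  have Ft: "sob_le s (F r) M" if "r \<in> {0..<T}" for r using B that by (auto simp: burgers_coeffs_def)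
  have M: "0 \<le> M" using Ft[OF t] by (rule sob_le_nonneg)
  have K: "1 \<le> K" using M by (simp add: K_def)
  define G where "G r = burgers_rhs a c (F r)" for r
  have ev: "\<forall>\<^sub>F r in at t within {0..<T}. sob_le s (\<lambda>k. F r k - F t k) (\<eta> / K)"
    using \<eta> K by (intro burgers_continuous[OF B s t]) auto
  then obtain d where d: "0 < d" "\<And>r. r \<in> {0..<T} \<Longrightarrow> r \<noteq> t \<Longrightarrow> dist r t < d
      \<Longrightarrow> sob_le s (\<lambda>k. F r k - F t k) (\<eta> / K)"
    unfolding eventually_at by auto
  have near: "sob_le (s - 1) (\<lambda>k. G r k - G t k) \<eta>" if r: "r \<in> {0..<T}" "dist r t < d" for r
  proof -
    have "sob_le s (\<lambda>k. F r k - F t k) (\<eta> / K)"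
      using d(2)[OF r(1) _ r(2)] sob_le_0[of "\<eta> / K" s] \<eta> K by (cases "r = t") auto
    from burgers_rhs_diff_bound[OF Ft[OF r(1)] Ft[OF t] this s, of a c]
    show ?thesis unfolding G_def
    proof (rule sob_le_mono)
      have "(\<bar>a\<bar> * (alg_const s * (2 * M)) + \<bar>c\<bar>) * (\<eta> / K) \<le> K * (\<eta> / K)"
        using \<eta> K by (intro mult_right_mono) (auto simp: K_def)
      then show "(\<bar>a\<bar> * (alg_const s * (2 * M)) + \<bar>c\<bar>) * (\<eta> / K) \<le> \<eta>" using K by simp
    qed
  qed
  have "sob_le (s - 1) (\<lambda>k. (F r k - F t k) / of_real (r - t) - G t k) \<eta>"
    if r: "r \<in> {0..<T}" "r \<noteq> t" "dist r t < d" for r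
  proof (rule sob_leI)
    fix A :: "int set" assume A: "finite A"
    define z where "z k = (F r k - F t k) / of_real (r - t) - G t k" for k
    define w where "w = weight (s - 1)"
    define Z where "Z = L2_set (\<lambda>k. w k * cmod (z k)) A"
    have Z2: "Z\<^sup>2 = (\<Sum>k\<in>A. (w k * cmod (z k))\<^sup>2)" by (simp add: Z_def L2_set_def sum_nonneg)
    define S where "S = closed_segment t r"
    have S: "convex S" "t \<in> S" "r \<in> S" by (auto simp: S_def)
    have Sin: "x \<in> {0..<T}" "dist x t < d" if "x \<in> S" for x
    proof -
      show "x \<in> {0..<T}" using that r(1) t unfolding S_def closed_segment_eq_real_ivl
          by (auto split: if_splits)
      show "dist x t < d" using that r(3) unfolding S_def closed_segment_eq_real_ivl
          by (auto simp: dist_real_def split: if_splits)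
    qed
    define \<psi> where "\<psi> x = (\<Sum>k\<in>A. (w k)\<^sup>2 * Re (cnj (z k) * (F x k - of_real x * G t k)))" for x
    have "norm (\<psi> r - \<psi> t) \<le> (Z * \<eta>) * \<bar>r - t\<bar>"
    proof (rule vector_derivative_bound[OF S(1)])
      fix x assume x: "x \<in> S"
      have dF: "((\<lambda>x. F x k) has_vector_derivative G x k) (at x within S)" for k
      proof -
        have "((\<lambda>x. F x k) has_vector_derivative G x k) (at x within {0..<T})"
          using B Sin(1)[OF x] by (auto simp: burgers_coeffs_def G_def)
        then show ?thesis by (rule has_vector_derivative_within_subset) (use Sin in auto)
      qed
      have dl: "((\<lambda>x. of_real x * G t k) has_vector_derivative G t k) (at x within S)" for k
        using has_vector_derivative_scaleR[of "\<lambda>x. x" 1 x S "\<lambda>x. G t k" 0]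
            by (simp add: scaleR_conv_of_real)
      show "(\<psi> has_vector_derivative (\<Sum>k\<in>A. (w k)\<^sup>2 * Re (cnj (z k) * (G x k - G t k))))
          (at x within S)"
        unfolding \<psi>_def
        by (intro has_vector_derivative_sum has_vector_derivative_mult_right
            bounded_linear.has_vector_derivative[OF bounded_linear_Re] has_vector_derivative_diff
                dF dl)
      have "norm (\<Sum>k\<in>A. (w k)\<^sup>2 * Re (cnj (z k) * (G x k - G t k)))
          \<le> (\<Sum>k\<in>A. \<bar>w k * cmod (z k)\<bar> * \<bar>w k * cmod (G x k - G t k)\<bar>)"
      proof (rule sum_norm_le)
        fix k
        have "\<bar>Re (cnj (z k) * (G x k - G t k))\<bar> \<le> cmod (z k) * cmod (G x k - G t k)"
          using abs_Re_le_cmod[of "cnj (z k) * (G x k - G t k)"] by (simp add: norm_mult)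
        then have "(w k)\<^sup>2 * \<bar>Re (cnj (z k) * (G x k - G t k))\<bar>
            \<le> (w k)\<^sup>2 * (cmod (z k) * cmod (G x k - G t k))"
          by (intro mult_left_mono) auto
        then show "norm ((w k)\<^sup>2 * Re (cnj (z k) * (G x k - G t k)))
            \<le> \<bar>w k * cmod (z k)\<bar> * \<bar>w k * cmod (G x k - G t k)\<bar>"
          by (simp add: abs_mult power2_eq_square mult_ac)
      qed
      also have "\<dots> \<le> Z * L2_set (\<lambda>k. w k * cmod (G x k - G t k)) A"
        unfolding Z_def by (rule L2_set_mult_ineq)
      also have "\<dots> \<le> Z * \<eta>"
        using sob_leD[OF near[OF Sin[OF x]] A] by (intro mult_left_mono) (auto simp: w_def Z_def)
      finally show "norm (\<Sum>k\<in>A. (w k)\<^sup>2 * Re (cnj (z k) * (G x k - G t k))) \<le> Z * \<eta>" .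
    qed (use S in auto)
    moreover have "\<psi> r - \<psi> t = (r - t) * Z\<^sup>2"
    proof -
      have "(F r k - of_real r * G t k) - (F t k - of_real t * G t k) = of_real (r - t) * z k" for k
        using r(2) by (simp add: z_def field_simps)
      then have "Re (cnj (z k) * (F r k - of_real r * G t k))
          - Re (cnj (z k) * (F t k - of_real t * G t k))
          = Re (cnj (z k) * (of_real (r - t) * z k))" for k
        unfolding minus_complex.sel(1)[symmetric] right_diff_distrib[symmetric] by (simp only:)
      moreover have "Re (cnj (z k) * (of_real (r - t) * z k)) = (r - t) * (cmod (z k))\<^sup>2" for k
        unfolding cmod_power2 by (simp add: power2_eq_square algebra_simps)
      ultimately have eq: "Re (cnj (z k) * (F r k - of_real r * G t k))
          - Re (cnj (z k) * (F t k - of_real t * G t k))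
          = (r - t) * (cmod (z k))\<^sup>2" for k by (simp only:)
      have "\<psi> r - \<psi> t = (\<Sum>k\<in>A. (w k)\<^sup>2 * ((r - t) * (cmod (z k))\<^sup>2))"
        unfolding \<psi>_def sum_subtractf[symmetric] eq[symmetric] right_diff_distrib[of "(w k)\<^sup>2"
            for k] ..
      then show ?thesis unfolding Z2 by (simp add: sum_distrib_left power_mult_distrib mult_ac)
    qed
    ultimately have "Z\<^sup>2 * \<bar>r - t\<bar> \<le> (Z * \<eta>) * \<bar>r - t\<bar>" by (simp add: abs_mult mult_ac)
    then have "Z\<^sup>2 \<le> Z * \<eta>" using r(2) by simp
    moreover have "0 \<le> Z" by (simp add: Z_def)
    ultimately have "Z \<le> \<eta>" using \<eta> by (cases "Z = 0") (auto simp: power2_eq_square)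
    then show "L2_set (\<lambda>k. weight (s - 1) k * cmod ((F r k - F t k) / of_real (r - t) - G t k)) A
        \<le> \<eta>"
      by (simp add: Z_def w_def z_def)
  qed
  then show ?thesis unfolding eventually_at G_def using d(1) by blast
qed

section \<open>Limits of approximate solutions\<close>

lemma burgers_imp_approx_solution:
  assumes "burgers_coeffs a c s T M F" "2 \<le> s" "0 \<le> K" "\<And>t. t \<in> {0..<T} \<Longrightarrow> sob_le 2 (F t) K"
  shows "approx_solution a c T 0 K F (\<lambda>t k. 0) (\<lambda>t k. 0)"
  using assms by (auto simp: burgers_coeffs_def approx_solution_def burgers_rhs_def herm_0 sob_le_0)

text \<open>Exact solutions are approximate solutions with \<open>\<epsilon> = 0\<close>.\<close>

lemma burgers_unique:
  assumes F: "burgers_coeffs a c s T M F" and H: "burgers_coeffs a c s T N H" and s: "2 \<le> s"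
    and init: "F 0 = H 0" and t: "t \<in> {0..<T}"
  shows "F t = H t"
proof -
  define K where "K = max M N"
  have FK: "sob_le 2 (F t) K" and HK: "sob_le 2 (H t) K" if "t \<in> {0..<T}" for t
  proof -
    have "sob_le s (F t) M" "sob_le s (H t) N" using F H that by (auto simp: burgers_coeffs_def)
    then show "sob_le 2 (F t) K" "sob_le 2 (H t) K"
      using s by (auto intro: sob_le_mono[OF sob_le_weaken] simp: K_def)
  qed
  have K: "0 \<le> K" using FK[OF t] by (rule sob_le_nonneg)
  obtain C where C: "\<And>\<epsilon>1 \<epsilon>2 f1 G1 R1 f2 G2 R2 t. \<lbrakk>approx_solution a c T \<epsilon>1 K f1 G1 R1;
      approx_solution a c T \<epsilon>2 K f2 G2 R2;
      \<bar>\<epsilon>1\<bar> \<le> 0; \<bar>\<epsilon>2\<bar> \<le> 0; f1 0 = f2 0; t \<in> {0..<T}\<rbrakk>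
      \<Longrightarrow> sob_le 0 (\<lambda>k. f1 t k - f2 t k) (C * (\<bar>\<epsilon>1\<bar> + \<bar>\<epsilon>2\<bar>))"
    by (rule approx_solution_stability[of 0 K T a c]) (use K t in auto)
  have "sob_le 0 (\<lambda>k. F t k - H t k) (C * (\<bar>0\<bar> + \<bar>0\<bar>))"
    by (rule C[OF burgers_imp_approx_solution[OF F s K FK]
        burgers_imp_approx_solution[OF H s K HK]]) (use init t in auto)
  then have "cmod (F t k - H t k) \<le> 0" for k
      using sob_le_coeff[of 0 "\<lambda>k. F t k - H t k" "C * (\<bar>0\<bar> + \<bar>0\<bar>)" k] by simp
  then show ?thesis by auto
qed

text \<open>
  By stability the family is a Cauchy family in \<open>L\<^sup>2\<close>, uniformly in time, and the bound by \<open>\<epsilon> + \<epsilon>'\<close> gives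
  the rate. The equation passes to the limit coefficient by coefficient, with uniform convergence of
  the time derivatives of \<open>f + e G\<close>.
\<close>

theorem approx_solution_limit:
  fixes f :: "real \<Rightarrow> real \<Rightarrow> int \<Rightarrow> complex"
  assumes E: "0 < E" and T: "0 < T" and s: "2 \<le> s"
    and ap: "\<And>\<epsilon>. \<epsilon> \<in> {0<..E} \<Longrightarrow> \<exists>e G R. \<bar>e\<bar> = \<epsilon> \<and> approx_solution a c T e K (f \<epsilon>) G R"
    and init: "\<And>\<epsilon>. \<epsilon> \<in> {0<..E} \<Longrightarrow> f \<epsilon> 0 = f0"
    and bd: "\<And>\<epsilon> t. \<epsilon> \<in> {0<..E} \<Longrightarrow> t \<in> {0..<T} \<Longrightarrow> sob_le s (f \<epsilon> t) M"
  obtains F C where "burgers_coeffs a c s T M F" "F 0 = f0" "0 \<le> C"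
    "\<And>\<epsilon> t. \<epsilon> \<in> {0<..E} \<Longrightarrow> t \<in> {0..<T} \<Longrightarrow> sob_le 0 (\<lambda>k. f \<epsilon> t k - F t k) (C * \<epsilon>)"
proof -
  let ?S = "{0..<T}"
  have ap2: "sob_le 2 (f \<epsilon> t) K" "herm (f \<epsilon> t)" if "\<epsilon> \<in> {0<..E}" "t \<in> ?S" for \<epsilon> t
    using ap[OF that(1)] that(2) by (auto simp: approx_solution_def)
  have K: "0 \<le> K" using ap2(1)[of E 0] E T by (auto dest: sob_le_nonneg)
  obtain C where C: "0 \<le> C" "\<And>\<epsilon>1 \<epsilon>2 f1 G1 R1 f2 G2 R2 t. \<lbrakk>approx_solution a c T \<epsilon>1 K f1 G1 R1;
      approx_solution a c T \<epsilon>2 K f2 G2 R2;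
      \<bar>\<epsilon>1\<bar> \<le> E; \<bar>\<epsilon>2\<bar> \<le> E; f1 0 = f2 0; t \<in> ?S\<rbrakk>
      \<Longrightarrow> sob_le 0 (\<lambda>k. f1 t k - f2 t k) (C * (\<bar>\<epsilon>1\<bar> + \<bar>\<epsilon>2\<bar>))"
    by (rule approx_solution_stability[of E K T a c]) (use K T E in auto)
  have cauchy: "sob_le 0 (\<lambda>k. f \<epsilon> t k - f \<epsilon>' t k) (C * (\<epsilon> + \<epsilon>'))"
    if \<epsilon>: "\<epsilon> \<in> {0<..E}" "\<epsilon>' \<in> {0<..E}" and t: "t \<in> ?S" for \<epsilon> \<epsilon>' t
  proof -
    obtain e G R e' G' R' where A: "\<bar>e\<bar> = \<epsilon>" "approx_solution a c T e K (f \<epsilon>) G R" "\<bar>e'\<bar> = \<epsilon>'"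
        "approx_solution a c T e' K (f \<epsilon>') G' R'"
      using ap[OF \<epsilon>(1)] ap[OF \<epsilon>(2)] by blast
    from C(2)[OF A(2,4) _ _ _ t] show ?thesis using A(1,3) \<epsilon> init by auto
  qed
  define \<epsilon> where "\<epsilon> n = E / (real n + 1)" for n :: nat
  have \<epsilon>: "\<epsilon> n \<in> {0<..E}" for n using E by (auto simp: \<epsilon>_def divide_le_eq)
  have \<epsilon>0: "\<epsilon> \<longlonglongrightarrow> 0"
    unfolding \<epsilon>_def using LIMSEQ_Suc[OF lim_const_over_n[of E]] by (simp add: add.commute)
  have pc: "cmod (f \<epsilon>' t k - f \<epsilon>'' t k) \<le> C * (\<epsilon>' + \<epsilon>'')"
      if "\<epsilon>' \<in> {0<..E}" "\<epsilon>'' \<in> {0<..E}" "t \<in> ?S" for \<epsilon>' \<epsilon>'' t k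
    using sob_le_coeff[OF cauchy[OF that], of k] by simp
  define F where "F t k = lim (\<lambda>n. f (\<epsilon> n) t k)" for t k
  have lim: "(\<lambda>n. f (\<epsilon> n) t k) \<longlonglongrightarrow> F t k" if t: "t \<in> ?S" for t k
  proof -
    have "Cauchy (\<lambda>n. f (\<epsilon> n) t k)"
    proof (rule CauchyI)
      fix e :: real assume e: "0 < e"
      have "(\<lambda>n. C * \<epsilon> n) \<longlonglongrightarrow> C * 0" by (intro tendsto_intros \<epsilon>0)
      then have "\<forall>\<^sub>F n in sequentially. C * \<epsilon> n < e / 2" using e by (intro order_tendstoD(2)) auto
      then obtain N where N: "\<And>n. N \<le> n \<Longrightarrow> C * \<epsilon> n < e / 2" by (auto simp: eventually_sequentially)
      show "\<exists>N. \<forall>m\<ge>N. \<forall>n\<ge>N. norm (f (\<epsilon> m) t k - f (\<epsilon> n) t k) < e"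
      proof (intro exI allI impI)
        fix m n assume "N \<le> m" "N \<le> n"
        then show "norm (f (\<epsilon> m) t k - f (\<epsilon> n) t k) < e"
          using pc[OF \<epsilon>[of m] \<epsilon>[of n] t, of k] N[of m] N[of n] by (simp add: distrib_left)
      qed
    qed
    then have "convergent (\<lambda>n. f (\<epsilon> n) t k)" by (rule Cauchy_convergent)
    then show ?thesis unfolding F_def by (simp add: convergent_LIMSEQ_iff)
  qed
  have close: "sob_le 0 (\<lambda>k. f \<epsilon>' t k - F t k) ((2 * C) * \<epsilon>')" if e: "\<epsilon>' \<in> {0<..E}"
      and t: "t \<in> ?S" for \<epsilon>' t
  proof (rule sob_le_limit[where F = sequentially and a = "\<lambda>n k. f \<epsilon>' t k - f (\<epsilon> n) t k"])
    show "(\<lambda>n. f \<epsilon>' t k - f (\<epsilon> n) t k) \<longlonglongrightarrow> f \<epsilon>' t k - F t k" for k by (intro tendsto_intros lim t)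
    have "\<forall>\<^sub>F n in sequentially. \<epsilon> n < \<epsilon>'" using e by (intro order_tendstoD(2)[OF \<epsilon>0]) auto
    then show "\<forall>\<^sub>F n in sequentially. sob_le 0 (\<lambda>k. f \<epsilon>' t k - f (\<epsilon> n) t k) ((2 * C) * \<epsilon>')"
    proof eventually_elim
      case (elim n)
      have "C * (\<epsilon>' + \<epsilon> n) \<le> C * (2 * \<epsilon>')" using elim C(1) by (intro mult_left_mono) auto
      then show ?case using cauchy[OF e \<epsilon>[of n] t] by (elim sob_le_mono) simp
    qed
  qed simp
  have FM: "sob_le s (F t) M" if t: "t \<in> ?S" for t
    by (rule sob_le_limit[OF sequentially_bot lim[OF t]]) (use bd[OF \<epsilon> t] in auto)
  have FK: "sob_le 2 (F t) K" if t: "t \<in> ?S" for t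
    by (rule sob_le_limit[OF sequentially_bot lim[OF t]]) (use ap2(1)[OF \<epsilon> t] in auto)
  have FH: "herm (F t)" if t: "t \<in> ?S" for t
    by (rule herm_limit[OF sequentially_bot lim[OF t]]) (use ap2(2)[OF \<epsilon> t] in auto)
  have F0: "F 0 = f0"
  proof
    fix k
    have "(\<lambda>n. f (\<epsilon> n) 0 k) \<longlonglongrightarrow> F 0 k" using T by (intro lim) auto
    then show "F 0 k = f0 k" using init[OF \<epsilon>] by (simp add: LIMSEQ_const_iff)
  qed
  have "\<forall>n. \<exists>e G R. \<bar>e\<bar> = \<epsilon> n \<and> approx_solution a c T e K (f (\<epsilon> n)) G R" using ap[OF \<epsilon>] by blast
  then obtain e G R where A: "\<And>n. \<bar>e n\<bar> = \<epsilon> n"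
      "\<And>n. approx_solution a c T (e n) K (f (\<epsilon> n)) (G n) (R n)"
    by metis
  have AG: "sob_le 1 (G n t) K" "sob_le 0 (R n t) K" if "t \<in> ?S" for n t
    using A(2)[of n] that by (auto simp: approx_solution_def)
  have deriv: "((\<lambda>t. F t k) has_vector_derivative burgers_rhs a c (F t) k) (at t within ?S)"
      if t: "t \<in> ?S" for t k
  proof -
    define h where "h n t = f (\<epsilon> n) t k + of_real (e n) * G n t k" for n t
    define h' where "h' n t = of_real (e n) * R n t k - \<i> * of_int k
        * (of_real a * conv (f (\<epsilon> n) t) (f (\<epsilon> n) t) k + of_real c * f (\<epsilon> n) t k)" for n t
    define B where "B = K + \<bar>of_int k\<bar> * (\<bar>a\<bar> * (l1_const * (2 * K) * (2 * C)) + \<bar>c\<bar> * (2 * C))"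
    have hlim: "(\<lambda>n. h n t) \<longlonglongrightarrow> F t k" if t: "t \<in> ?S" for t
    proof -
      have "(\<lambda>n. of_real (e n) * G n t k) \<longlonglongrightarrow> 0"
      proof (rule Lim_null_comparison)
        show "(\<lambda>n. \<epsilon> n * K) \<longlonglongrightarrow> 0" using tendsto_mult_right[OF \<epsilon>0, of K] by simp
        show "\<forall>\<^sub>F n in sequentially. norm (of_real (e n) * G n t k) \<le> \<epsilon> n * K"
          using sob_le_coeff[OF AG(1)[OF t]] \<epsilon>
              by (intro always_eventually allI) (auto simp: norm_mult A(1) intro!: mult_left_mono)
      qed
      from tendsto_add[OF lim[OF t] this] show ?thesis by (simp add: h_def)
    qed
    have bound: "cmod (h' n t - burgers_rhs a c (F t) k) \<le> B * \<epsilon> n" if t: "t \<in> ?S" for n t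
    proof -
      let ?f = "f (\<epsilon> n) t"
      have d0: "sob_le 0 (\<lambda>k. ?f k - F t k) ((2 * C) * \<epsilon> n)" by (rule close[OF \<epsilon> t])
      have f1: "sob_le 1 ?f K" "sob_le 1 (F t) K"
          using sob_le_weaken[OF ap2(1)[OF \<epsilon> t], of 1] sob_le_weaken[OF FK[OF t], of 1] by simp_all
      have f0: "sob_le 0 ?f K" "sob_le 0 (F t) K" using f1 by (auto intro: sob_le_weaken)
      have s1: "sob_le 1 (\<lambda>k. ?f k + F t k) (2 * K)" using sob_le_add[OF f1] by simp
      have s0: "sob_le 0 (\<lambda>k. ?f k + F t k) (2 * K)" using s1 by (rule sob_le_weaken) simp
      have cd: "conv ?f ?f k - conv (F t) (F t) k = conv (\<lambda>k. ?f k + F t k) (\<lambda>k. ?f k - F t k) k"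
        using conv_diff_right[OF s0 f0, of k] conv_add_left[OF f0 f0(1), of k]
            conv_add_left[OF f0 f0(2), of k] conv_commute[of "F t" ?f] by simp
      have c1: "cmod (conv ?f ?f k - conv (F t) (F t) k) \<le> l1_const * (2 * K) * ((2 * C) * \<epsilon> n)"
        unfolding cd by (rule sob_le_coeff[OF sob_le_0_conv[OF s1 d0]]) simp
      have c2: "cmod (?f k - F t k) \<le> (2 * C) * \<epsilon> n" by (rule sob_le_coeff[OF d0]) simp
      have c3: "cmod (R n t k) \<le> K" by (rule sob_le_coeff[OF AG(2)[OF t]]) simp
      have "h' n t - burgers_rhs a c (F t) k = of_real (e n) * R n t k
         - \<i> * of_int k * (of_real a * (conv ?f ?f k - conv (F t) (F t) k) + of_real c *
             (?f k - F t k))"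
        by (simp add: h'_def burgers_rhs_def algebra_simps)
      also have "cmod \<dots> \<le> cmod (of_real (e n) * R n t k)
          + cmod (\<i> * of_int k * (of_real a * (conv ?f ?f k - conv (F t) (F t) k) + of_real c *
          (?f k - F t k)))"
        by (rule norm_triangle_ineq4)
      also have "\<dots> \<le> \<epsilon> n * K + \<bar>of_int k\<bar>
          * (\<bar>a\<bar> * (l1_const * (2 * K) * ((2 * C) * \<epsilon> n)) + \<bar>c\<bar> * ((2 * C) * \<epsilon> n))"
      proof (rule add_mono)
        show "cmod (of_real (e n) * R n t k) \<le> \<epsilon> n * K"
          using c3 \<epsilon>[of n] by (auto simp: norm_mult A(1) intro!: mult_left_mono)
        have "cmod (of_real a * (conv ?f ?f k - conv (F t) (F t) k) + of_real c * (?f k - F t k))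
          \<le> cmod (of_real a * (conv ?f ?f k - conv (F t) (F t) k)) + cmod
              (of_real c * (?f k - F t k))" by (rule norm_triangle_ineq)
        also have "\<dots> \<le> \<bar>a\<bar> * (l1_const * (2 * K) * ((2 * C) * \<epsilon> n)) + \<bar>c\<bar> * ((2 * C) * \<epsilon> n)"
          unfolding norm_mult norm_of_real by (intro add_mono mult_left_mono c1 c2) auto
        finally show "cmod (\<i> * of_int k
            * (of_real a * (conv ?f ?f k - conv (F t) (F t) k) + of_real c * (?f k - F t k)))
          \<le> \<bar>of_int k\<bar> * (\<bar>a\<bar> * (l1_const * (2 * K) * ((2 * C) * \<epsilon> n)) + \<bar>c\<bar> * ((2 * C) * \<epsilon> n))"
          unfolding norm_mult by (simp add: mult_left_mono)
      qed
      also have "\<dots> = B * \<epsilon> n" by (simp add: B_def algebra_simps)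
      finally show ?thesis .
    qed
    have "\<exists>g. \<forall>t\<in>?S. (\<lambda>n. h n t) \<longlonglongrightarrow> g t
        \<and> (g has_derivative (\<lambda>x. x *\<^sub>R burgers_rhs a c (F t) k)) (at t within ?S)"
    proof (rule has_derivative_sequence[where f = h and S = ?S
        and ?x0.0 = t, OF _ _ _ t hlim[OF t]])
      fix n t assume t: "t \<in> ?S"
      show "(h n has_derivative (\<lambda>x. x *\<^sub>R h' n t)) (at t within ?S)"
        using A(2)[of n] t unfolding approx_solution_def h_def h'_def
            has_vector_derivative_def[symmetric] by auto
    next
      fix \<eta> :: real assume \<eta>: "0 < \<eta>"
      have "(\<lambda>n. B * \<epsilon> n) \<longlonglongrightarrow> B * 0" by (intro tendsto_intros \<epsilon>0)
      then have "\<forall>\<^sub>F n in sequentially. B * \<epsilon> n < \<eta>" using \<eta> by (intro order_tendstoD(2)) auto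
      then show "\<forall>\<^sub>F n in sequentially. \<forall>t\<in>?S. \<forall>x. norm (x *\<^sub>R h' n t
          - x *\<^sub>R burgers_rhs a c (F t) k) \<le> \<eta> * norm x"
      proof eventually_elim
        case (elim n)
        show ?case
        proof (intro ballI allI)
          fix t x assume "t \<in> ?S"
          then have "cmod (h' n t - burgers_rhs a c (F t) k) \<le> \<eta>" using bound[of t n] elim by simp
          then have "\<bar>x\<bar> * cmod (h' n t - burgers_rhs a c (F t) k) \<le> \<bar>x\<bar> * \<eta>"
              by (rule mult_left_mono) simp
          then show "norm (x *\<^sub>R h' n t - x *\<^sub>R burgers_rhs a c (F t) k) \<le> \<eta> * norm x"
            by (simp add: scaleR_diff_right[symmetric] mult.commute)
        qed
      qed
    qed simp
    then obtain g where g: "\<And>t. t \<in> ?S \<Longrightarrow> (\<lambda>n. h n t) \<longlonglongrightarrow> g t"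
      "\<And>t. t \<in> ?S \<Longrightarrow> (g has_derivative (\<lambda>x. x *\<^sub>R burgers_rhs a c (F t) k)) (at t within ?S)"
          by blast
    have "g t = F t k" if "t \<in> ?S" for t using g(1)[OF that] hlim[OF that] by (rule LIMSEQ_unique)
    then show ?thesis unfolding has_vector_derivative_def
        using has_derivative_transform[OF t _ g(2)[OF t], of "\<lambda>t. F t k"] by simp
  qed
  show thesis
  proof (rule that[of F "2 * C"])
    show "burgers_coeffs a c s T M F" unfolding burgers_coeffs_def using FH FM deriv by auto
  qed (use F0 C(1) close in auto)
qed

section \<open>Profiles as functions\<close>

lemma rseries_cmult: "rseries (\<lambda>k. of_real c * a k) x = c * rseries a x"
proof -
  have "fseries (\<lambda>k. of_real c * a k) x = of_real c * fseries a x"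
    unfolding fseries_def by (simp only: mult.assoc infsum_cmult_right')
  then show ?thesis by (simp add: rseries_def)
qed

text \<open>
  The derivative of the product with a periodic test function has integral \<open>0\<close>.
\<close>

lemma rseries_weak_derivative:
  assumes c: "sob_le 2 q M" "herm q"
  shows "has_weak_derivative (rseries q) (rseries (\<lambda>k. \<i> * of_int k * q k))"
proof -
  let ?q' = "\<lambda>k. \<i> * of_int k * q k"
  have l1: "l1_le q (l1_const * M)" by (rule sob_le_1_imp_l1_le[OF sob_le_weaken[OF c(1)]]) simp
  have "sob_le 1 ?q' M" using sob_le_deriv[of 1 q M] c by simp
  note d1 = sob_le_1_imp_l1_le[OF this]
  have cq: "continuous_on S (rseries q)" and cq': "continuous_on S (rseries ?q')" for S
    using rseries_continuous[OF l1] rseries_continuous[OF d1] by (auto intro: continuous_on_subset)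
  show ?thesis unfolding has_weak_derivative_def
  proof (intro conjI allI impI)
    show "integrable_T (rseries q)" "integrable_T (rseries ?q')"
        by (intro integrable_T_continuous cq cq')+
    fix \<phi> assume \<phi>: "smooth \<phi> \<and> torus_periodic \<phi>"
    have d\<phi>: "(\<phi> has_real_derivative deriv \<phi> x) (at x)" for x
        using smooth_derivatives(1)[of \<phi> 0] \<phi> by simp
    have c\<phi>: "continuous_on S \<phi>" "continuous_on S (deriv \<phi>)" for S
      using smooth_derivatives(2)[of \<phi> 0] smooth_derivatives(2)[of \<phi> 1] \<phi>
          by (auto intro: continuous_on_subset)
    have "torus_integral (\<lambda>x. rseries q x * deriv \<phi> x + rseries ?q' x * \<phi> x)
        = rseries q (2 * pi) * \<phi> (2 * pi) - rseries q 0 * \<phi> 0"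
    proof (rule torus_integral_FTC)
      fix x
      show "((\<lambda>x. rseries q x * \<phi> x) has_vector_derivative rseries q x * deriv \<phi> x + rseries ?q' x
          * \<phi> x) (at x)"
        unfolding has_real_derivative_iff_has_vector_derivative[symmetric]
        using DERIV_mult[OF rseries_has_derivative[OF c(1)] d\<phi>, of x] by (simp add: algebra_simps)
    qed (intro continuous_intros cq cq' c\<phi>)
    also have "rseries q (2 * pi) * \<phi> (2 * pi) = rseries q 0 * \<phi> 0"
      using rseries_periodic[of q] \<phi> unfolding torus_periodic_def by (metis add_0)
    finally have "torus_integral (\<lambda>x. rseries q x * deriv \<phi> x + rseries ?q' x * \<phi> x) = 0" by simp
    moreover have "torus_integral (\<lambda>x. rseries q x * deriv \<phi> x + rseries ?q' x * \<phi> x)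
      = torus_integral (\<lambda>x. rseries q x * deriv \<phi> x) + torus_integral (\<lambda>x. rseries ?q' x * \<phi> x)"
      by (intro torus_integral_add integrable_T_continuous continuous_on_mult cq cq' c\<phi>)
    ultimately show "torus_integral (\<lambda>x. rseries q x * deriv \<phi> x)
        = - torus_integral (\<lambda>x. rseries ?q' x * \<phi> x)" by simp
  qed
qed

lemma has_weak_derivative_cong_AE:
  assumes w: "has_weak_derivative f g" and ae: "AE x in lborel. f x = h x"
      and m: "f \<in> borel_measurable borel" "h \<in> borel_measurable borel"
  shows "has_weak_derivative h g"
  unfolding has_weak_derivative_def
proof (intro conjI allI impI)
  show "integrable_T h" by (rule integrable_T_cong_AE[OF _ ae m(2)])
      (use w in \<open>simp add: has_weak_derivative_def\<close>)
  show "integrable_T g" using w by (simp add: has_weak_derivative_def)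
  fix \<phi> assume \<phi>: "smooth \<phi> \<and> torus_periodic \<phi>"
  have "continuous_on UNIV (deriv \<phi>)" using smooth_derivatives(2)[of \<phi> 1] \<phi> by simp
  then have d: "deriv \<phi> \<in> borel_measurable borel" by (rule borel_measurable_continuous_onI)
  have "AE x in lborel. h x * deriv \<phi> x = f x * deriv \<phi> x" using ae by eventually_elim simp
  then have "torus_integral (\<lambda>x. h x * deriv \<phi> x) = torus_integral (\<lambda>x. f x * deriv \<phi> x)"
    by (rule torus_integral_cong_AE) (intro borel_measurable_times m d)+
  then show "torus_integral (\<lambda>x. h x * deriv \<phi> x) = - torus_integral (\<lambda>x. g x * \<phi> x)"
    using w \<phi> by (simp add: has_weak_derivative_def)
qed

lemma tendsto_sobolev_norm_0:
  assumes "\<And>\<eta>. 0 < \<eta> \<Longrightarrow> \<forall>\<^sub>F r in F. sobolev_norm \<sigma> (g r) \<le> \<eta>"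
  shows "((\<lambda>r. sobolev_norm \<sigma> (g r)) \<longlongrightarrow> 0) F"
proof (rule tendstoI)
  fix e :: real assume "0 < e"
  then have "\<forall>\<^sub>F r in F. sobolev_norm \<sigma> (g r) \<le> e / 2" by (intro assms) simp
  then show "\<forall>\<^sub>F r in F. dist (sobolev_norm \<sigma> (g r)) 0 < e"
  proof eventually_elim
    case (elim r)
    have "0 \<le> sobolev_norm \<sigma> (g r)" unfolding sobolev_norm_def
        by (intro real_sqrt_ge_zero infsum_nonneg) auto
    with elim \<open>0 < e\<close> show ?case by (simp add: dist_real_def)
  qed
qed

text \<open>
  The flux is continuous and has the coefficients \<open>a F\<^sup>2 + c F\<close> with the square taken as a convolution,
  hence equals their series almost everywhere, and this series may be differentiated.
\<close>

lemma burgers_coeffs_imp_profile: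
  assumes B: "burgers_coeffs ((\<gamma> + 1) / 4) c s T M F" and s: "2 \<le> s" and T: "0 < T"
    and mean: "\<And>t. t \<in> {0..<T} \<Longrightarrow> F t 0 = 0"
    and init: "AE x in lborel. rseries (F 0) x = P0 x"
  shows "profile_solution \<gamma> s T c P0 (\<lambda>t. rseries (F t))"
proof -
  let ?S = "{0..<T}"
  let ?a = "(\<gamma> + 1) / 4"
  have Fb: "herm (F t)" "sob_le s (F t) M" if "t \<in> ?S" for t using B that
      by (auto simp: burgers_coeffs_def)
  have s1: "1 \<le> s" "1 \<le> s - 1" using s by auto
  define G where "G t = burgers_rhs ?a c (F t)" for t
  define N where "N = \<bar>?a\<bar> * (alg_const s * (M * M)) + \<bar>c\<bar> * M"
  have Gb: "sob_le (s - 1) (G t) N" if "t \<in> ?S" for t unfolding G_def N_def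
      by (rule burgers_rhs_bound[OF Fb(2)[OF that] s])
  have Gh: "herm (G t)" if "t \<in> ?S" for t
  proof -
    have "herm (\<lambda>k. \<i> * of_int k * (of_real ?a * conv (F t) (F t) k + of_real c * F t k))"
      by (rule herm_deriv[OF herm_add[OF herm_scale[OF herm_conv] herm_scale]])
          (use Fb[OF that] in auto)
    then show ?thesis unfolding G_def burgers_rhs_def herm_def by simp
  qed
  note RF = rseries_sobolev[OF Fb(2) s1(1) Fb(1)]
  note RG = rseries_sobolev[OF Gb s1(2) Gh]
  have l2F: "rseries (F t) \<in> torus_L2" if "t \<in> ?S" for t
      using sobolev_imp_sob_le(1)[OF RF(1)[OF that that]] .
  have l2G: "rseries (G t) \<in> torus_L2" if "t \<in> ?S" for t
      using sobolev_imp_sob_le(1)[OF RG(1)[OF that that]] .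
  note iF = torus_L2_imp_integrable[OF l2F] and iG = torus_L2_imp_integrable[OF l2G]
  have cF: "fourier_coeff (rseries (F t)) = F t" if "t \<in> ?S" for t using RF(3)[OF that that] .
  have cG: "fourier_coeff (rseries (G t)) = G t" if "t \<in> ?S" for t using RG(3)[OF that that] .
  have in_S: "\<forall>\<^sub>F r in at t within ?S. r \<in> ?S \<and> r \<noteq> t" for t by (auto simp: eventually_at_filter)
  have C0: "(\<lambda>t. rseries (F t)) \<in> C0_sobolev T s"
    unfolding C0_sobolev_def
  proof (intro CollectI ballI conjI)
    fix t assume t: "t \<in> ?S"
    show "rseries (F t) \<in> sobolev s" by (rule RF(1)[OF t t])
    show "((\<lambda>r. sobolev_norm s (\<lambda>x. rseries (F r) x - rseries (F t) x)) \<longlongrightarrow> 0) (at t within ?S)"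
    proof (rule tendsto_sobolev_norm_0)
      fix \<eta> :: real assume "0 < \<eta>"
      from burgers_continuous[OF B s t this] in_S[of t]
      show "\<forall>\<^sub>F r in at t within ?S. sobolev_norm s (\<lambda>x. rseries (F r) x - rseries (F t) x) \<le> \<eta>"
      proof eventually_elim
        case (elim r)
        then have r: "r \<in> ?S" by simp
        have "fourier_coeff (\<lambda>x. rseries (F r) x - rseries (F t) x) = (\<lambda>k. F r k - F t k)"
          using fourier_coeff_diff[OF iF[OF r] iF[OF t]] cF[OF r] cF[OF t] by auto
        then show ?case using elim(1)
            by (intro sob_le_imp_sobolev(2)[OF torus_L2_diff[OF l2F[OF r] l2F[OF t]]]) simp
      qed
    qed
  qed
  have td: "has_time_derivative T (s - 1) (\<lambda>t. rseries (F t)) (\<lambda>t. rseries (G t))"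
    unfolding has_time_derivative_def
  proof (intro ballI conjI)
    fix t assume t: "t \<in> ?S"
    have "sob_le (s - 1) (F t) M" by (rule sob_le_weaken[OF Fb(2)[OF t]]) simp
    then show "rseries (F t) \<in> sobolev (s - 1)" using sob_le_imp_sobolev(1)[OF l2F[OF t]] cF[OF t]
        by simp
    show "rseries (G t) \<in> sobolev (s - 1)" by (rule RG(1)[OF t t])
    show "((\<lambda>r. sobolev_norm (s - 1) (\<lambda>x. (rseries (F r) x - rseries (F t) x) / (r - t)
        - rseries (G t) x)) \<longlongrightarrow> 0) (at t within ?S)"
    proof (rule tendsto_sobolev_norm_0)
      fix \<eta> :: real assume "0 < \<eta>"
      from burgers_difference_quotient[OF B s t this] in_S[of t]
      show "\<forall>\<^sub>F r in at t within ?S. sobolev_norm (s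
          - 1) (\<lambda>x. (rseries (F r) x - rseries (F t) x) / (r - t) - rseries (G t) x) \<le> \<eta>"
      proof eventually_elim
        case (elim r)
        then have r: "r \<in> ?S" by simp
        have eq: "(\<lambda>x. (rseries (F r) x - rseries (F t) x) / (r - t) - rseries (G t) x)
          = (\<lambda>x. 1 / (r - t) * (rseries (F r) x - rseries (F t) x) - rseries (G t) x)" by simp
        have d: "(\<lambda>x. 1 / (r - t) * (rseries (F r) x - rseries (F t) x)) \<in> torus_L2"
          by (rule torus_L2_cmult[OF torus_L2_diff[OF l2F[OF r] l2F[OF t]]])
        have "fourier_coeff (\<lambda>x. 1 / (r - t) * (rseries (F r) x - rseries (F t) x)
            - rseries (G t) x)
          = (\<lambda>k. (F r k - F t k) / of_real (r - t) - burgers_rhs ?a c (F t) k)"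
        proof
          fix k
          have "fourier_coeff (\<lambda>x. 1 / (r - t) * (rseries (F r) x - rseries (F t) x)
              - rseries (G t) x) k
            = of_real (1 / (r - t)) * (F r k - F t k) - G t k"
            using fourier_coeff_diff[OF torus_L2_imp_integrable[OF d] iG[OF t], of k]
              fourier_coeff_diff[OF iF[OF r] iF[OF t], of k] cF[OF r] cF[OF t] cG[OF t]
            by (simp only: fourier_coeff_cmult)
          then show "fourier_coeff (\<lambda>x. 1 / (r - t) * (rseries (F r) x - rseries (F t) x)
              - rseries (G t) x) k
            = (F r k - F t k) / of_real (r - t) - burgers_rhs ?a c (F t) k" by (simp add: G_def)
        qed
        then show ?case unfolding eq using elim(1)
            by (intro sob_le_imp_sobolev(2)[OF torus_L2_diff[OF d l2G[OF t]]]) simp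
      qed
    qed
  qed
  have wd: "has_weak_derivative (\<lambda>x. ?a * (rseries (F t) x)\<^sup>2 + c * rseries (F t) x) (\<lambda>x.
      - rseries (G t) x)" if t: "t \<in> ?S" for t
  proof -
    define q where "q = (\<lambda>k. of_real ?a * conv (F t) (F t) k + of_real c * F t k)"
    have F1: "sob_le 1 (F t) M" by (rule sob_le_weaken[OF Fb(2)[OF t] s1(1)])
    have F1': "sob_le 1 (fourier_coeff (rseries (F t))) M" using F1 cF[OF t] by simp
    have hq: "herm q" unfolding q_def
        by (rule herm_add[OF herm_scale[OF herm_conv] herm_scale]) (use Fb[OF t] in auto)
    have q2: "sob_le 2 q N"
    proof -
      have "sob_le s q N" unfolding q_def N_def
        using sob_le_add[OF sob_le_scale[OF sob_le_conv[OF s1(1) Fb(2)[OF t] Fb(2)[OF t]], of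
            "of_real ?a"] sob_le_scale[OF Fb(2)[OF t], of "of_real c"]]
        unfolding norm_of_real .
      then show ?thesis by (rule sob_le_weaken[OF _ s])
    qed
    have l1: "l1_le q (l1_const * N)" by (rule sob_le_1_imp_l1_le[OF sob_le_weaken[OF q2]]) simp
    let ?f = "\<lambda>x. ?a * (rseries (F t) x * rseries (F t) x) + c * rseries (F t) x"
    note mm = fourier_coeff_mult[OF l2F[OF t] l2F[OF t] F1']
    have cont: "continuous_on UNIV (rseries (F t))"
        by (rule rseries_continuous[OF sob_le_1_imp_l1_le[OF F1]])
    have fq: "fourier_coeff ?f = q"
    proof
      fix k
      show "fourier_coeff ?f k = q k"
        using fourier_coeff_add[OF set_integrable_mult_right[OF mm(1), of ?a]
            set_integrable_mult_right[OF iF[OF t], of c], of k]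
        by (simp only: fourier_coeff_cmult mm(2) cF[OF t] q_def)
    qed
    have cf: "continuous_on UNIV ?f" by (intro continuous_intros cont)
    have fL2: "?f \<in> torus_L2"
    proof -
      have "integrable_T (\<lambda>x. (?f x)\<^sup>2)"
        by (rule integrable_T_continuous[OF continuous_on_power[OF continuous_on_subset[OF cf]]])
            simp
      moreover have "torus_periodic ?f" using rseries_periodic[of "F t"]
          by (simp add: torus_periodic_def)
      ultimately show ?thesis using borel_measurable_continuous_onI[OF cf]
          by (simp only: torus_L2_def mem_Collect_eq)
    qed
    have "AE x in lborel. ?f x = rseries q x"
      using fourier_series_AE[OF fL2, of N] sob_le_weaken[OF q2, of 1] unfolding fq by simp
    then have ae: "AE x in lborel. rseries q x = ?f x" by eventually_elim simp
    have "has_weak_derivative ?f (rseries (\<lambda>k. \<i> * of_int k * q k))"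
      by (rule has_weak_derivative_cong_AE[OF rseries_weak_derivative[OF q2 hq] ae
          rseries_measurable[OF l1] borel_measurable_continuous_onI[OF cf]])
    moreover have "rseries (\<lambda>k. \<i> * of_int k * q k) = (\<lambda>x. - rseries (G t) x)"
    proof
      fix x
      have "G t = (\<lambda>k. of_real (- 1) * (\<i> * of_int k * q k))"
          by (simp add: G_def burgers_rhs_def q_def)
      then show "rseries (\<lambda>k. \<i> * of_int k * q k) x = - rseries (G t) x"
          by (simp only: rseries_cmult)
    qed
    ultimately show ?thesis by (simp add: power2_eq_square)
  qed
  have "torus_integral (rseries (F t)) = 0" if t: "t \<in> ?S" for t
  proof -
    have "of_real (torus_integral (rseries (F t)) / (2 * pi)) = (0::complex)"
      using fourier_coeff_0[of "rseries (F t)"] cF[OF t] mean[OF t] by simp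
    then show ?thesis unfolding of_real_eq_0_iff by simp
  qed
  with C0 td wd init show ?thesis
    unfolding profile_solution_def conservation_law_def by auto
qed

text \<open>
  The norm in \<open>H\<^sup>s\<close> is continuous in time, hence bounded on the compact interval \<open>[0,T']\<close>. On \<open>[0,T)\<close>
  boundedness is a consequence of uniqueness.
\<close>

lemma profile_imp_burgers_coeffs:
  assumes P: "profile_solution \<gamma> s T c P0 P" and s: "2 \<le> s" and T': "T' < T"
  shows "\<exists>M. burgers_coeffs ((\<gamma> + 1) / 4) c s T' M (\<lambda>t. fourier_coeff (P t))"
proof -
  let ?S = "{0..<T}"
  let ?a = "(\<gamma> + 1) / 4"
  have So: "P t \<in> sobolev s" if "t \<in> ?S" for t using P that
      by (auto simp: profile_solution_def C0_sobolev_def)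
  note SL = sobolev_imp_sob_le[OF So]
  have cont: "continuous_on ?S (\<lambda>t. sobolev_norm s (P t))"
    unfolding continuous_on_def
  proof
    fix t assume t: "t \<in> ?S"
    have "((\<lambda>r. sobolev_norm s (\<lambda>x. P r x - P t x)) \<longlongrightarrow> 0) (at t within ?S)"
      using P t by (auto simp: profile_solution_def C0_sobolev_def)
    moreover have "\<forall>\<^sub>F r in at t within ?S. norm (sobolev_norm s (P r) - sobolev_norm s (P t))
        \<le> sobolev_norm s (\<lambda>x. P r x - P t x)"
      unfolding eventually_at_filter
    proof (intro always_eventually allI impI)
      fix r assume r: "r \<in> ?S"
      have fc: "fourier_coeff (\<lambda>x. P r x - P t x)
          = (\<lambda>k. fourier_coeff (P r) k - fourier_coeff (P t) k)"
        using fourier_coeff_diff[OF torus_L2_imp_integrable[OF SL(1)[OF r]]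
            torus_L2_imp_integrable[OF SL(1)[OF t]]] by auto
      have dS: "(\<lambda>x. P r x - P t x) \<in> sobolev s"
        by (rule sob_le_imp_sobolev(1)[OF torus_L2_diff[OF SL(1)[OF r] SL(1)[OF t]]])
            (unfold fc, rule sob_le_diff[OF SL(2)[OF r] SL(2)[OF t]])
      let ?d = "sobolev_norm s (\<lambda>x. P r x - P t x)"
      have d: "sob_le s (\<lambda>k. fourier_coeff (P r) k - fourier_coeff (P t) k) ?d"
        using sobolev_imp_sob_le(2)[OF dS] unfolding fc .
      have "sob_le s (fourier_coeff (P r)) (?d + sobolev_norm s (P t))"
          using sob_le_add[OF d SL(2)[OF t]] by simp
      then have 1: "sobolev_norm s (P r) \<le> ?d + sobolev_norm s (P t)"
          by (rule sob_le_imp_sobolev(2)[OF SL(1)[OF r]])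
      have "sob_le s (fourier_coeff (P t)) (sobolev_norm s (P r) + ?d)"
          using sob_le_diff[OF SL(2)[OF r] d] by simp
      then have 2: "sobolev_norm s (P t) \<le> sobolev_norm s (P r) + ?d"
          by (rule sob_le_imp_sobolev(2)[OF SL(1)[OF t]])
      show "norm (sobolev_norm s (P r) - sobolev_norm s (P t)) \<le> ?d" using 1 2
          by (simp add: abs_le_iff)
    qed
    ultimately have "((\<lambda>r. sobolev_norm s (P r) - sobolev_norm s (P t)) \<longlongrightarrow> 0) (at t within ?S)"
      by (rule Lim_null_comparison[rotated])
    then show "((\<lambda>t. sobolev_norm s (P t)) \<longlongrightarrow> sobolev_norm s (P t)) (at t within ?S)"
        by (rule LIM_zero_cancel)
  qed
  have "compact ((\<lambda>t. sobolev_norm s (P t)) ` {0..T'})"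
    by (rule compact_continuous_image[OF continuous_on_subset[OF cont]]) (use T' in auto)
  then obtain M where M: "\<And>t. t \<in> {0..T'} \<Longrightarrow> sobolev_norm s (P t) \<le> M"
    by (metis bounded_real compact_imp_bounded image_eqI abs_le_D1)
  obtain w' where w': "has_time_derivative T (s - 1) P w'"
    "\<And>t. t \<in> ?S \<Longrightarrow> has_weak_derivative (\<lambda>x. ?a * (P t x)\<^sup>2 + c * P t x) (\<lambda>x. - w' t x)"
    using P by (auto simp: profile_solution_def conservation_law_def)
  have "burgers_coeffs ?a c s T' M (\<lambda>t. fourier_coeff (P t))"
    unfolding burgers_coeffs_def
  proof (intro ballI conjI allI)
    fix t assume t': "t \<in> {0..<T'}"
    then have t: "t \<in> ?S" using T' by auto
    show "herm (fourier_coeff (P t))" by (rule herm_fourier_coeff)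
    show "sob_le s (fourier_coeff (P t)) M" by (rule sob_le_mono[OF SL(2)[OF t]]) (use M t' in auto)
    fix k
    have P1: "sob_le 1 (fourier_coeff (P t)) (sobolev_norm s (P t))"
        by (rule sob_le_weaken[OF SL(2)[OF t]]) (use s in simp)
    note mm = fourier_coeff_mult[OF SL(1)[OF t] SL(1)[OF t] P1]
    have neg: "fourier_coeff (\<lambda>x. - f x) k = - fourier_coeff f k" for f
        using fourier_coeff_cmult[of "-1" f k] by simp
    have "fourier_coeff (w' t) k
        = - (\<i> * of_int k * fourier_coeff (\<lambda>x. ?a * (P t x)\<^sup>2 + c * P t x) k)"
      using weak_derivative_fourier_coeff[OF w'(2)[OF t], of k] unfolding neg by (metis minus_minus)
    also have "fourier_coeff (\<lambda>x. ?a * (P t x)\<^sup>2 + c * P t x) k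
        = of_real ?a * conv (fourier_coeff (P t)) (fourier_coeff (P t)) k + of_real c
        * fourier_coeff (P t) k"
      using fourier_coeff_add[OF set_integrable_mult_right[OF mm(1), of ?a]
          set_integrable_mult_right[OF torus_L2_imp_integrable[OF SL(1)[OF t]], of c], of k]
      by (simp only: fourier_coeff_cmult mm(2) power2_eq_square)
    finally have "fourier_coeff (w' t) k = burgers_rhs ?a c (fourier_coeff (P t)) k"
        by (simp only: burgers_rhs_def)
    with time_derivative_fourier_coeff[OF w'(1) _ t, of k] s
    have "((\<lambda>t. fourier_coeff (P t) k)
        has_vector_derivative burgers_rhs ?a c (fourier_coeff (P t)) k) (at t within ?S)" by simp
    then show "((\<lambda>t. fourier_coeff (P t) k)
        has_vector_derivative burgers_rhs ?a c (fourier_coeff (P t)) k) (at t within {0..<T'})"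
      by (rule has_vector_derivative_within_subset) (use T' in auto)
  qed
  then show ?thesis ..
qed

lemma burgers_coeffs_subset:
  assumes "burgers_coeffs a c s T M F" "T' \<le> T" shows "burgers_coeffs a c s T' M F"
  unfolding burgers_coeffs_def
proof (intro ballI conjI allI)
  fix t assume "t \<in> {0..<T'}"
  then have t: "t \<in> {0..<T}" using assms(2) by auto
  show "herm (F t)" "sob_le s (F t) M" using assms(1) t by (auto simp: burgers_coeffs_def)
  fix k
  have "((\<lambda>t. F t k) has_vector_derivative burgers_rhs a c (F t) k) (at t within {0..<T})"
    using assms(1) t by (auto simp: burgers_coeffs_def)
  then show "((\<lambda>t. F t k) has_vector_derivative burgers_rhs a c (F t) k) (at t within {0..<T'})"
    by (rule has_vector_derivative_within_subset) (use assms(2) in auto)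
qed

text \<open>
  Uniqueness is applied on an interval that ends strictly between \<open>t\<close> and \<open>T\<close>, where the profile is bounded.
\<close>

lemma profile_unique:
  assumes P: "profile_solution \<gamma> s T c P0 P" and s: "2 \<le> s"
    and F: "burgers_coeffs ((\<gamma> + 1) / 4) c s T M F" "F 0 = fourier_coeff (P 0)" and t: "t \<in> {0..<T}"
  shows "fourier_coeff (P t) = F t"
proof -
  define T' where "T' = (t + T) / 2"
  have T': "t < T'" "T' < T" using t by (auto simp: T'_def)
  obtain N where N: "burgers_coeffs ((\<gamma> + 1) / 4) c s T' N (\<lambda>t. fourier_coeff (P t))"
    using profile_imp_burgers_coeffs[OF P s T'(2)] by blast
  show ?thesis
    by (rule burgers_unique[OF N burgers_coeffs_subset[OF F(1)] s]) (use F(2) t T' in auto)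
qed

section \<open>Errors in space and time\<close>

text \<open>
  By Parseval's identity the squared norm is a countable sum of continuous functions of time, hence measurable.
\<close>

lemma L2_L2_bounded_fourier:
  assumes T: "0 < T"
    and w: "\<And>t. t \<in> {0..<T} \<Longrightarrow> w t \<in> torus_L2" "\<And>t. t \<in> {0..<T}
        \<Longrightarrow> sob_le 1 (fourier_coeff (w t)) (M t)"
      "\<And>t. t \<in> {0..<T} \<Longrightarrow> sob_le 0 (fourier_coeff (w t)) N"
    and cont: "\<And>k. continuous_on {0..<T} (\<lambda>t. fourier_coeff (w t) k)"
  shows "L2_L2_bounded T w (sqrt (2 * pi * T) * N)"
proof -
  let ?S = "{0..<T}"
  define g where "g t = (L2_norm_torus (w t))\<^sup>2" for t
  have N: "0 \<le> N" using w(3)[of 0] T by (auto dest: sob_le_nonneg)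
  have g_eq: "g t = 2 * pi * (\<Sum>\<^sub>\<infinity>k. (cmod (fourier_coeff (w t) k))\<^sup>2)" if "t \<in> ?S" for t
    unfolding g_def by (rule parseval(2)[OF w(1,2)[OF that]])
  have g_le: "g t \<le> 2 * pi * N\<^sup>2" if "t \<in> ?S" for t
    unfolding g_eq[OF that] using sob_le_summable(2)[OF w(3)[OF that]]
        by (intro mult_left_mono) auto
  have g0: "0 \<le> g t" for t by (simp add: g_def)
  have meas: "(\<lambda>t. indicator ?S t *\<^sub>R g t) \<in> borel_measurable lborel"
  proof (rule borel_measurable_LIMSEQ_real)
    fix n :: nat
    have "(\<lambda>t. indicator ?S t *\<^sub>R (2 * pi
        * (\<Sum>k\<in>{-int n..int n}. (cmod (fourier_coeff (w t) k))\<^sup>2))) \<in> borel_measurable borel"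
      by (rule borel_measurable_continuous_on_indicator) (auto intro!: continuous_intros cont)
    then show "(\<lambda>t. indicator ?S t *\<^sub>R (2 * pi
        * (\<Sum>k\<in>{-int n..int n}. (cmod (fourier_coeff (w t) k))\<^sup>2))) \<in> borel_measurable lborel"
        by simp
  next
    fix t
    show "(\<lambda>n. indicator ?S t *\<^sub>R (2 * pi
        * (\<Sum>k\<in>{-int n..int n}. (cmod (fourier_coeff (w t) k))\<^sup>2))) \<longlonglongrightarrow> indicator ?S t *\<^sub>R g t"
    proof (cases "t \<in> ?S")
      case True
      have "(\<lambda>n. \<Sum>k\<in>{-int n..int n}. (cmod (fourier_coeff (w t) k))\<^sup>2)
          \<longlonglongrightarrow> (\<Sum>\<^sub>\<infinity>k. (cmod (fourier_coeff (w t) k))\<^sup>2)"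
        by (rule filterlim_compose[OF infsum_tendsto[OF parseval(1)[OF w(1,2)[OF True]]]
            filterlim_int_intervals])
      then show ?thesis unfolding g_eq[OF True] by (intro tendsto_intros)
    qed simp
  qed
  have cint: "set_integrable lborel ?S (\<lambda>t. 2 * pi * N\<^sup>2)"
    unfolding set_integrable_def using T
        by (auto intro!: integrable_real_indicator simp: mult.commute)
  have gi: "set_integrable lborel ?S g"
    unfolding set_integrable_def
  proof (rule Bochner_Integration.integrable_bound[OF cint[unfolded set_integrable_def] meas])
    show "AE t in lborel. norm (indicator ?S t *\<^sub>R g t) \<le> norm (indicator ?S t *\<^sub>R (2 * pi * N\<^sup>2))"
      using g_le g0 by (intro AE_I2) (auto simp: indicator_def)
  qed
  have "(LINT t:?S|lborel. g t) \<le> (LINT t:?S|lborel. 2 * pi * N\<^sup>2)"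
    by (rule set_integral_mono[OF gi cint]) (rule g_le)
  also have "\<dots> = 2 * pi * T * N\<^sup>2" using T by (simp add: set_lebesgue_integral_def)
  finally have "sqrt (LINT t:?S|lborel. g t) \<le> sqrt (2 * pi * T * N\<^sup>2)" by (rule real_sqrt_le_mono)
  also have "\<dots> = sqrt (2 * pi * T) * N" using N by (simp add: real_sqrt_mult)
  finally show ?thesis unfolding L2_L2_bounded_def using w(1) gi by (simp add: g_def[abs_def])
qed

text \<open>
  Translations preserve null sets, so \<open>f (x - \<theta>)\<close> is almost everywhere the translated series.
\<close>

lemma translate_torus_L2:
  assumes f: "f \<in> torus_L2" "sob_le 1 (fourier_coeff f) M"
  shows "(\<lambda>x. f (x - \<theta>)) \<in> torus_L2"
      "fourier_coeff (\<lambda>x. f (x - \<theta>)) = modulate (- \<theta>) (fourier_coeff f)"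
proof -
  let ?c = "fourier_coeff f"
  let ?d = "modulate (- \<theta>) ?c"
  have d: "sob_le 1 ?d M" by (rule sob_le_modulate[OF f(2)])
  have hd: "herm ?d" by (rule herm_modulate[OF herm_fourier_coeff])
  note l1 = sob_le_1_imp_l1_le[OF f(2)] and l1d = sob_le_1_imp_l1_le[OF d]
  have fm: "f \<in> borel_measurable borel" using f by (simp add: torus_L2_def)
  have tm: "(\<lambda>x. f (x - \<theta>)) \<in> borel_measurable borel" using fm
      by (rule measurable_compose[rotated]) simp
  have "AE x in lborel. f x = rseries ?c x" by (rule fourier_series_AE[OF f])
  moreover have "{x \<in> space lborel. \<not> (f x = rseries ?c x)} \<in> sets lborel"
    using borel_measurable_neq[OF fm rseries_measurable[OF l1]] by simp
  ultimately have "{x \<in> space lborel. \<not> (f x = rseries ?c x)} \<in> null_sets lborel"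
      by (simp add: AE_iff_null)
  from null_sets_translation[OF this, of \<theta>]
  have ae: "AE x in lborel. rseries ?d x = f (x - \<theta>)"
  proof (rule AE_I', intro subsetI)
    fix x assume "x \<in> {x \<in> space lborel. rseries ?d x \<noteq> f (x - \<theta>)}"
    then show "x \<in> {x. x - \<theta> \<in> {x \<in> space lborel. \<not> (f x = rseries ?c x)}}"
      by (simp add: rseries_def fseries_translate modulate_def) 
  qed
  have "integrable_T (\<lambda>x. (rseries ?d x)\<^sup>2)" using rseries_in_torus_L2[OF l1d]
      by (simp add: torus_L2_def)
  moreover have "AE x in lborel. (rseries ?d x)\<^sup>2 = (f (x - \<theta>))\<^sup>2" using ae by eventually_elim simp
  ultimately have "integrable_T (\<lambda>x. (f (x - \<theta>))\<^sup>2)"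
      by (rule integrable_T_cong_AE) (intro borel_measurable_power tm)
  moreover have "torus_periodic (\<lambda>x. f (x - \<theta>))"
    unfolding torus_periodic_def
  proof
    fix x
    have "f (x + 2 * pi - \<theta>) = f ((x - \<theta>) + 2 * pi)" by (simp add: algebra_simps)
    also have "\<dots> = f (x - \<theta>)" using f by (simp add: torus_L2_def torus_periodic_def)
    finally show "f (x + 2 * pi - \<theta>) = f (x - \<theta>)" .
  qed
  ultimately show "(\<lambda>x. f (x - \<theta>)) \<in> torus_L2" using tm by (simp add: torus_L2_def)
  show "fourier_coeff (\<lambda>x. f (x - \<theta>)) = ?d"
  proof
    fix k
    show "fourier_coeff (\<lambda>x. f (x - \<theta>)) k = ?d k"
      using fourier_coeff_cong_AE[OF ae rseries_measurable[OF l1d] tm, of k]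
          fourier_coeff_rseries[OF l1d hd, of k] by simp
  qed
qed

section \<open>Convergence of the Euler solutions\<close>

lemma admissible_q1_bound:
  assumes "admissible_q1 E q1"
  obtains L where "0 \<le> L" "\<And>\<epsilon> x. \<epsilon> \<in> {0<..E} \<Longrightarrow> \<bar>x\<bar> \<le> r \<Longrightarrow> \<bar>deriv (q1 \<epsilon>) x\<bar> \<le> L"
    "\<And>\<epsilon> x. \<epsilon> \<in> {0<..E} \<Longrightarrow> \<bar>x\<bar> \<le> r \<Longrightarrow> \<bar>(deriv ^^ 2) (q1 \<epsilon>) x\<bar> \<le> L"
proof -
  have "\<exists>C. \<forall>\<epsilon>\<in>{0<..E}. \<forall>x\<in>{-r..r}. \<bar>(deriv ^^ n) (q1 \<epsilon>) x\<bar> \<le> C" if "1 \<le> n" for n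
    using assms that by (auto simp: admissible_q1_def)
  from this[of 1] this[of 2] obtain C1 C2 where
    C: "\<forall>\<epsilon>\<in>{0<..E}. \<forall>x\<in>{-r..r}. \<bar>(deriv ^^ 1) (q1 \<epsilon>) x\<bar> \<le> C1"
        "\<forall>\<epsilon>\<in>{0<..E}. \<forall>x\<in>{-r..r}. \<bar>(deriv ^^ 2) (q1 \<epsilon>) x\<bar> \<le> C2" by auto
  show thesis
  proof (rule that[of "max 0 (max C1 C2)"])
    fix \<epsilon> x assume "\<epsilon> \<in> {0<..E}" "\<bar>x\<bar> \<le> r"
    then have "\<bar>(deriv ^^ 1) (q1 \<epsilon>) x\<bar> \<le> C1" "\<bar>(deriv ^^ 2) (q1 \<epsilon>) x\<bar> \<le> C2" using C
        by (auto simp: abs_le_iff)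
    then show "\<bar>deriv (q1 \<epsilon>) x\<bar> \<le> max 0 (max C1 C2)" "\<bar>(deriv ^^ 2) (q1 \<epsilon>) x\<bar> \<le> max 0 (max C1 C2)"
        by auto
  qed simp
qed

text \<open>
  The initial value of a profile has the coefficients of the filtered wave at time \<open>0\<close>.
\<close>

lemma fourier_coeff_half_sum:
  assumes "f \<in> torus_L2" "g \<in> torus_L2"
  shows "(\<lambda>x. (f x + g x - (torus_integral f + torus_integral g) / (2 * pi)) / 2) \<in> torus_L2"
    "fourier_coeff (\<lambda>x. (f x + g x - (torus_integral f + torus_integral g) / (2 * pi)) / 2)
        = half_sum (fourier_coeff f) (fourier_coeff g)"
proof -
  let ?m = "(torus_integral f + torus_integral g) / (2 * pi)"
  have eq: "(\<lambda>x. (f x + g x - ?m) / 2) = (\<lambda>x. 1 / 2 * ((f x + g x) - ?m))" by simp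
  have s: "(\<lambda>x. f x + g x) \<in> torus_L2" by (rule torus_L2_add[OF assms])
  show "(\<lambda>x. (f x + g x - ?m) / 2) \<in> torus_L2"
    unfolding eq by (rule torus_L2_cmult[OF torus_L2_diff[OF s torus_L2_const]])
  show "fourier_coeff (\<lambda>x. (f x + g x - ?m) / 2) = half_sum (fourier_coeff f) (fourier_coeff g)"
  proof
    fix k
    have *: "fourier_coeff (\<lambda>x. 1 / 2 * ((f x + g x) - ?m)) k
      = of_real (1 / 2) * (fourier_coeff f k + fourier_coeff g k - (if k
          = 0 then of_real ?m else 0))"
      unfolding fourier_coeff_cmult
        fourier_coeff_diff[OF torus_L2_imp_integrable[OF s]
            torus_L2_imp_integrable[OF torus_L2_const]]
        fourier_coeff_add[OF torus_L2_imp_integrable[OF assms(1)]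
            torus_L2_imp_integrable[OF assms(2)]] fourier_coeff_const ..
    show "fourier_coeff (\<lambda>x. (f x + g x - ?m) / 2) k
        = half_sum (fourier_coeff f) (fourier_coeff g) k"
      unfolding eq * by (simp add: half_sum_def fourier_coeff_0 add_divide_distrib)
  qed
qed

lemma half_sum_decompose:
  assumes "u 0 = of_real m" "r 0 = of_real n"
  shows "u k = half_sum u r k + half_sum u (\<lambda>k. - r k) k + (if k = 0 then of_real m else 0)"
    "r k = half_sum u r k - half_sum u (\<lambda>k. - r k) k + (if k = 0 then of_real n else 0)"
  using assms by (auto simp: half_sum_def field_simps)

locale weakly_compressible_euler =
  fixes \<gamma> \<epsilon>\<^sub>0 s T M :: real
    and q1 :: "real \<Rightarrow> real \<Rightarrow> real" and u0 \<rho>0 :: "real \<Rightarrow> real" and u \<rho> :: "real \<Rightarrow> real \<Rightarrow> real \<Rightarrow> real"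
  assumes eps0: "0 < \<epsilon>\<^sub>0" and s: "2 \<le> s" and T: "0 < T" and q1: "admissible_q1 \<epsilon>\<^sub>0 q1"
    and u0: "u0 \<in> sobolev s" and r0: "\<rho>0 \<in> sobolev s"
    and solution: "\<And>\<epsilon>. \<epsilon> > 0 \<Longrightarrow> euler_solution \<gamma> q1 \<epsilon> s T u0 \<rho>0 (u \<epsilon>) (\<rho> \<epsilon>)"
    and bounded: "\<And>\<epsilon> t. \<epsilon> > 0 \<Longrightarrow> t \<in> {0..<T} \<Longrightarrow> sobolev_norm s (u \<epsilon> t) \<le> M \<and> sobolev_norm s (\<rho> \<epsilon> t)
        \<le> M"
begin

definition u_hat :: "real \<Rightarrow> real \<Rightarrow> int \<Rightarrow> complex" where "u_hat \<epsilon> t = fourier_coeff (u \<epsilon> t)"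
definition rho_hat :: "real \<Rightarrow> real \<Rightarrow> int \<Rightarrow> complex" where "rho_hat \<epsilon> t = fourier_coeff (\<rho> \<epsilon> t)"
definition q_hat :: "real \<Rightarrow> real \<Rightarrow> int \<Rightarrow> complex" where
  "q_hat \<epsilon> t = (\<lambda>k. \<i> * of_int k * fourier_coeff (\<lambda>x. q1 \<epsilon> (rseries (rho_hat \<epsilon> t) x)) k)"
definition mean_u :: real where "mean_u = torus_integral u0 / (2 * pi)"
definition mean_rho :: real where "mean_rho = torus_integral \<rho>0 / (2 * pi)"
abbreviation "forward_speed \<equiv> (2 * mean_u + (\<gamma> - 1) * mean_rho) / 2"
abbreviation "backward_speed \<equiv> (2 * mean_u - (\<gamma> - 1) * mean_rho) / 2"
abbreviation "forward_data \<equiv>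
    (\<lambda>x. (u0 x + \<rho>0 x - (torus_integral u0 + torus_integral \<rho>0) / (2 * pi)) / 2)"
abbreviation "backward_data \<equiv>
    (\<lambda>x. (u0 x - \<rho>0 x - (torus_integral u0 - torus_integral \<rho>0) / (2 * pi)) / 2)"
abbreviation "forward_start \<equiv> half_sum (fourier_coeff u0) (fourier_coeff \<rho>0)"
abbreviation "backward_start \<equiv> half_sum (fourier_coeff u0) (\<lambda>k. - fourier_coeff \<rho>0 k)"

text \<open>The waves travelling to the right and to the left, each in the frame that moves with it.\<close>

definition forward :: "real \<Rightarrow> real \<Rightarrow> int \<Rightarrow> complex" where
  "forward \<epsilon> t = modulate (t / \<epsilon>) (half_sum (u_hat \<epsilon> t) (rho_hat \<epsilon> t))"
definition backward :: "real \<Rightarrow> real \<Rightarrow> int \<Rightarrow> complex" where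
  "backward \<epsilon> t = modulate (- (t / \<epsilon>)) (half_sum (u_hat \<epsilon> t) (\<lambda>k. - rho_hat \<epsilon> t k))"

lemma solution_L2: "\<epsilon> > 0 \<Longrightarrow> t \<in> {0..<T} \<Longrightarrow> u \<epsilon> t \<in> torus_L2" "\<epsilon> > 0 \<Longrightarrow> t \<in> {0..<T} \<Longrightarrow> \<rho> \<epsilon> t \<in> torus_L2"
  using solution by (auto simp: euler_solution_def C0_sobolev_def sobolev_def)

lemma solution_Hs: assumes "\<epsilon> > 0" "t \<in> {0..<T}" shows "sob_le s (u_hat \<epsilon> t) M"
    "sob_le s (rho_hat \<epsilon> t) M"
proof -
  have "u \<epsilon> t \<in> sobolev s" "\<rho> \<epsilon> t \<in> sobolev s"
    using solution[OF assms(1)] assms(2) by (auto simp: euler_solution_def C0_sobolev_def)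
  then show "sob_le s (u_hat \<epsilon> t) M" "sob_le s (rho_hat \<epsilon> t) M"
    unfolding u_hat_def rho_hat_def using bounded[OF assms]
        by (auto intro: sob_le_mono[OF sobolev_imp_sob_le(2)])
qed

lemma smooth_q1: "\<epsilon> > 0 \<Longrightarrow> smooth (q1 \<epsilon>)" using q1 by (simp add: admissible_q1_def)

lemma solution_acoustic: assumes "\<epsilon> > 0" shows
    "acoustic_system \<gamma> \<epsilon> T (u_hat \<epsilon>) (rho_hat \<epsilon>) (q_hat \<epsilon>)"
  unfolding acoustic_system_def
proof (intro ballI allI conjI)
  fix t k assume t: "t \<in> {0..<T}"
  note E = euler_fourier[OF solution[OF assms] assms s smooth_q1[OF assms] t, of k]
  show "((\<lambda>t. u_hat \<epsilon> t k) has_vector_derivative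
      - \<i> * of_int k * (conv (u_hat \<epsilon> t) (u_hat \<epsilon> t) k / 2 + of_real ((\<gamma> - 2) / 2) * conv
          (rho_hat \<epsilon> t) (rho_hat \<epsilon> t) k + rho_hat \<epsilon> t k / of_real \<epsilon>)
      - of_real \<epsilon> * q_hat \<epsilon> t k) (at t within {0..<T})"
    using E(1) unfolding u_hat_def rho_hat_def q_hat_def .
  show "((\<lambda>t. rho_hat \<epsilon> t k) has_vector_derivative
      - \<i> * of_int k * (conv (rho_hat \<epsilon> t) (u_hat \<epsilon> t) k + u_hat \<epsilon> t k / of_real \<epsilon>))
          (at t within {0..<T})"
    using E(2) unfolding u_hat_def rho_hat_def .
qed

lemma solution_initial: assumes "\<epsilon> > 0" shows "u_hat \<epsilon> 0 = fourier_coeff u0"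
    "rho_hat \<epsilon> 0 = fourier_coeff \<rho>0"
proof -
  have ae: "AE x in lborel. u \<epsilon> 0 x = u0 x" "AE x in lborel. \<rho> \<epsilon> 0 x = \<rho>0 x"
    using solution[OF assms] by (auto simp: euler_solution_def)
  have m: "u \<epsilon> 0 \<in> borel_measurable borel" "\<rho> \<epsilon> 0 \<in> borel_measurable borel"
      "u0 \<in> borel_measurable borel" "\<rho>0 \<in> borel_measurable borel"
    using solution_L2[OF assms, of 0] T u0 r0 by (auto simp: torus_L2_def sobolev_def)
  show "u_hat \<epsilon> 0 = fourier_coeff u0" "rho_hat \<epsilon> 0 = fourier_coeff \<rho>0"
    unfolding u_hat_def rho_hat_def by (auto intro!: fourier_coeff_cong_AE ae m)
qed

text \<open>
  Both equations are conservation laws, so their right-hand sides vanish at frequency \<open>0\<close>.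
\<close>

lemma solution_means: assumes "\<epsilon> > 0" "t \<in> {0..<T}" shows "u_hat \<epsilon> t 0 = of_real mean_u"
    "rho_hat \<epsilon> t 0 = of_real mean_rho"
proof -
  have d: "((\<lambda>t. u_hat \<epsilon> t 0) has_vector_derivative 0) (at t within {0..<T})"
      "((\<lambda>t. rho_hat \<epsilon> t 0) has_vector_derivative 0) (at t within {0..<T})"
    if "t \<in> {0..<T}" for t
    using solution_acoustic[OF assms(1)] that unfolding acoustic_system_def
        by (auto dest!: bspec spec[of _ 0] simp: q_hat_def)
  have "norm (u_hat \<epsilon> t 0 - u_hat \<epsilon> 0 0) \<le> 0 * \<bar>t - 0\<bar>"
    by (rule vector_derivative_bound[where S = "{0..<T}", OF _ d(1)]) (use assms T in auto)
  moreover have "norm (rho_hat \<epsilon> t 0 - rho_hat \<epsilon> 0 0) \<le> 0 * \<bar>t - 0\<bar>"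
    by (rule vector_derivative_bound[where S = "{0..<T}", OF _ d(2)]) (use assms T in auto)
  ultimately show "u_hat \<epsilon> t 0 = of_real mean_u" "rho_hat \<epsilon> t 0 = of_real mean_rho"
    using solution_initial[OF assms(1)] by (simp_all add: fourier_coeff_0 mean_u_def mean_rho_def)
qed

lemma uniform_bounds:
  obtains N where "0 \<le> N" "\<And>\<epsilon> t. \<epsilon> \<in> {0<..\<epsilon>\<^sub>0} \<Longrightarrow> t \<in> {0..<T}
      \<Longrightarrow> sob_le 2 (u_hat \<epsilon> t) N \<and> sob_le 2 (rho_hat \<epsilon> t) N \<and> sob_le 1 (q_hat \<epsilon> t) N"
proof -
  obtain L where L: "0 \<le> L" "\<And>\<epsilon> x. \<epsilon> \<in> {0<..\<epsilon>\<^sub>0} \<Longrightarrow> \<bar>x\<bar> \<le> l1_const * M \<Longrightarrow> \<bar>deriv (q1 \<epsilon>) x\<bar> \<le> L"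
    "\<And>\<epsilon> x. \<epsilon> \<in> {0<..\<epsilon>\<^sub>0} \<Longrightarrow> \<bar>x\<bar> \<le> l1_const * M \<Longrightarrow> \<bar>(deriv ^^ 2) (q1 \<epsilon>) x\<bar> \<le> L"
    using admissible_q1_bound[OF q1] by blast
  define N where "N = max M (alg_const 1 * ((L + L * (l1_const * M)) * M))"
  have b2: "sob_le 2 (u_hat \<epsilon> t) M" "sob_le 2 (rho_hat \<epsilon> t) M" if "\<epsilon> \<in> {0<..\<epsilon>\<^sub>0}" "t \<in> {0..<T}"
      for \<epsilon> t
    using solution_Hs[of \<epsilon> t] that s by (auto intro: sob_le_weaken)
  show thesis
  proof (rule that[of N])
    have "0 \<le> M" using b2(1)[of \<epsilon>\<^sub>0 0] eps0 T by (auto dest: sob_le_nonneg)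
    then show "0 \<le> N" by (simp add: N_def)
    fix \<epsilon> t assume A: "\<epsilon> \<in> {0<..\<epsilon>\<^sub>0}" "t \<in> {0..<T}"
    have sm: "smooth (q1 \<epsilon>)" using A by (intro smooth_q1) auto
    have h: "herm (rho_hat \<epsilon> t)" unfolding rho_hat_def by (rule herm_fourier_coeff)
    have "sob_le 1 (q_hat \<epsilon> t) (alg_const 1 * ((L + L * (l1_const * M)) * M))"
      unfolding q_hat_def by (rule
          composition_derivative_H1[OF b2(2)[OF A] h sm L(2)[OF A(1)] L(3)[OF A(1)]])
    then show "sob_le 2 (u_hat \<epsilon> t) N \<and> sob_le 2 (rho_hat \<epsilon> t) N \<and> sob_le 1 (q_hat \<epsilon> t) N"
      using b2[OF A] by (auto simp: N_def elim!: sob_le_mono)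
  qed
qed

text \<open>
  The backward wave is the forward wave of the reflected system, with \<open>e = - \<epsilon>\<close> and the mean of the density reversed.
\<close>

lemma filtered_approx:
  obtains K where "\<And>\<epsilon>. \<epsilon> \<in> {0<..\<epsilon>\<^sub>0}
      \<Longrightarrow> \<exists>e G R. \<bar>e\<bar> = \<epsilon> \<and> approx_solution ((\<gamma> + 1) / 4) forward_speed T e K (forward \<epsilon>) G R"
    "\<And>\<epsilon>. \<epsilon> \<in> {0<..\<epsilon>\<^sub>0} \<Longrightarrow> \<exists>e G R. \<bar>e\<bar>
        = \<epsilon> \<and> approx_solution ((\<gamma> + 1) / 4) backward_speed T e K (backward \<epsilon>) G R"
proof -
  obtain N where N: "0 \<le> N" "\<And>\<epsilon> t. \<epsilon> \<in> {0<..\<epsilon>\<^sub>0} \<Longrightarrow> t \<in> {0..<T}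
      \<Longrightarrow> sob_le 2 (u_hat \<epsilon> t) N \<and> sob_le 2 (rho_hat \<epsilon> t) N \<and> sob_le 1 (q_hat \<epsilon> t) N"
    by (rule uniform_bounds) blast
  have h: "herm (u_hat \<epsilon> t)" "herm (rho_hat \<epsilon> t)" for \<epsilon> t unfolding u_hat_def rho_hat_def
      by (rule herm_fourier_coeff)+
  obtain K1 where K1: "\<And>e T u r Q. \<lbrakk>acoustic_system \<gamma> e T u r Q; e \<noteq> 0; \<bar>e\<bar> \<le> \<epsilon>\<^sub>0;
        \<And>t. t \<in> {0..<T} \<Longrightarrow> sob_le 2 (u t) N \<and> sob_le 2 (r t) N \<and> sob_le 1 (Q t) N \<and> herm (u t)
            \<and> herm (r t)
          \<and> u t 0 = of_real mean_u \<and> r t 0 = of_real mean_rho \<and> Q t 0 = 0\<rbrakk>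
      \<Longrightarrow> \<exists>G R. approx_solution ((\<gamma> + 1) / 4) forward_speed T e K1
            (\<lambda>t. modulate (t / e) (half_sum (u t) (r t))) G R"
    by (rule acoustic_approx_solution[OF less_imp_le[OF eps0] N(1), of \<gamma> mean_u mean_rho]) blast
  obtain K2 where K2: "\<And>e T u r Q. \<lbrakk>acoustic_system \<gamma> e T u r Q; e \<noteq> 0; \<bar>e\<bar> \<le> \<epsilon>\<^sub>0;
        \<And>t. t \<in> {0..<T} \<Longrightarrow> sob_le 2 (u t) N \<and> sob_le 2 (r t) N \<and> sob_le 1 (Q t) N \<and> herm (u t)
            \<and> herm (r t)
          \<and> u t 0 = of_real mean_u \<and> r t 0 = of_real (- mean_rho) \<and> Q t 0 = 0\<rbrakk>
      \<Longrightarrow> \<exists>G R. approx_solution ((\<gamma> + 1) / 4) ((2 * mean_u + (\<gamma> - 1) * (- mean_rho)) / 2) T e K2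
            (\<lambda>t. modulate (t / e) (half_sum (u t) (r t))) G R"
    by (rule acoustic_approx_solution[OF less_imp_le[OF eps0] N(1), of \<gamma> mean_u "- mean_rho"]) blast
  have mono: "approx_solution a c T e (max K1 K2) f G R"
      if "approx_solution a c T e K f G R" "K = K1 \<or> K = K2" for a c e K f G R
    using that unfolding approx_solution_def by (auto elim!: sob_le_mono)
  show thesis
  proof (rule that[of "max K1 K2"])
    fix \<epsilon> assume e: "\<epsilon> \<in> {0<..\<epsilon>\<^sub>0}"
    have "\<exists>G R. approx_solution ((\<gamma> + 1) / 4) forward_speed T \<epsilon> K1
        (\<lambda>t. modulate (t / \<epsilon>) (half_sum (u_hat \<epsilon> t) (rho_hat \<epsilon> t))) G R"
      by (rule K1[OF solution_acoustic])
          (use e N(2)[OF e] h solution_means in \<open>auto simp: q_hat_def\<close>)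
    then obtain G R where "approx_solution ((\<gamma> + 1) / 4) forward_speed T \<epsilon> K1 (forward \<epsilon>) G R"
      unfolding forward_def[abs_def] by auto
    then have "approx_solution ((\<gamma> + 1) / 4) forward_speed T \<epsilon> (max K1 K2) (forward \<epsilon>) G R"
        by (rule mono) simp
    moreover have "\<bar>\<epsilon>\<bar> = \<epsilon>" using e by simp
    ultimately show "\<exists>e G R. \<bar>e\<bar>
        = \<epsilon> \<and> approx_solution ((\<gamma> + 1) / 4) forward_speed T e (max K1 K2) (forward \<epsilon>) G R"
      by blast
    have "\<exists>G R. approx_solution ((\<gamma> + 1) / 4) ((2 * mean_u + (\<gamma> - 1) * (- mean_rho)) / 2) T (- \<epsilon>) K2
        (\<lambda>t. modulate (t / - \<epsilon>) (half_sum (u_hat \<epsilon> t) (\<lambda>k. - rho_hat \<epsilon> t k))) G R"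
    proof (rule K2[OF acoustic_system_reflect[OF solution_acoustic]])
      fix t assume t: "t \<in> {0..<T}"
      have "herm (\<lambda>k. - rho_hat \<epsilon> t k)" using h(2)[of \<epsilon> t] by (simp add: herm_def)
      then show "sob_le 2 (u_hat \<epsilon> t) N \<and> sob_le 2 (\<lambda>k. - rho_hat \<epsilon> t k) N
          \<and> sob_le 1 (\<lambda>k. - q_hat \<epsilon> t k) N \<and> herm (u_hat \<epsilon> t) \<and> herm (\<lambda>k. - rho_hat \<epsilon> t k)
          \<and> u_hat \<epsilon> t 0 = of_real mean_u \<and> - rho_hat \<epsilon> t 0 = of_real (- mean_rho) \<and> - q_hat \<epsilon> t 0
              = 0"
        using N(2)[OF e t] h solution_means[of \<epsilon> t] e t
            by (auto intro: sob_le_uminus simp: q_hat_def)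
    qed (use e in auto)
    then obtain G R where "approx_solution ((\<gamma> + 1) / 4) backward_speed T (- \<epsilon>) K2 (backward \<epsilon>) G R"
      unfolding backward_def[abs_def] by auto
    then have "approx_solution ((\<gamma> + 1) / 4) backward_speed T (- \<epsilon>) (max K1 K2) (backward \<epsilon>) G R"
        by (rule mono) simp
    moreover have "\<bar>- \<epsilon>\<bar> = \<epsilon>" using e by simp
    ultimately show "\<exists>e G R. \<bar>e\<bar>
        = \<epsilon> \<and> approx_solution ((\<gamma> + 1) / 4) backward_speed T e (max K1 K2) (backward \<epsilon>) G R"
      by blast
  qed
qed

lemma profile_speeds:
  "(2 * torus_integral u0 + (\<gamma> - 1) * torus_integral \<rho>0) / (4 * pi) = forward_speed"
  "(2 * torus_integral u0 - (\<gamma> - 1) * torus_integral \<rho>0) / (4 * pi) = backward_speed"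
  by (simp_all add: mean_u_def mean_rho_def field_simps)

lemma profile_data:
  "forward_data \<in> torus_L2"
  "fourier_coeff forward_data = forward_start"
  "backward_data \<in> torus_L2"
  "fourier_coeff backward_data = backward_start"
proof -
  have m: "u0 \<in> torus_L2" "\<rho>0 \<in> torus_L2" using u0 r0 by (auto simp: sobolev_def)
  show "forward_data \<in> torus_L2"
    "fourier_coeff forward_data = forward_start"
    by (rule fourier_coeff_half_sum[OF m])+
  have m': "(\<lambda>x. - 1 * \<rho>0 x) \<in> torus_L2" by (rule torus_L2_cmult[OF m(2)])
  have c: "fourier_coeff (\<lambda>x. - 1 * \<rho>0 x) = (\<lambda>k. - fourier_coeff \<rho>0 k)"
      using fourier_coeff_cmult[of "- 1" \<rho>0] by auto
  have i: "torus_integral (\<lambda>x. - 1 * \<rho>0 x) = - torus_integral \<rho>0"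
      using torus_integral_cmult[of "- 1" \<rho>0] by simp
  have eq: "(\<lambda>x. (u0 x + - 1 * \<rho>0 x - (torus_integral u0 + - torus_integral \<rho>0) / (2 * pi)) / 2)
    = backward_data" by simp
  from fourier_coeff_half_sum[OF m(1) m'] show "backward_data \<in> torus_L2"
    "fourier_coeff backward_data = backward_start"
    unfolding i eq c .
qed

lemma limits:
  obtains F B C where
    "burgers_coeffs ((\<gamma> + 1) / 4) forward_speed s T M F" "F 0 = forward_start"
    "burgers_coeffs ((\<gamma> + 1) / 4) backward_speed s T M B" "B 0 = backward_start"
    "0 \<le> C" "\<And>\<epsilon> t. \<epsilon> \<in> {0<..\<epsilon>\<^sub>0} \<Longrightarrow> t \<in> {0..<T} \<Longrightarrow> sob_le 0 (\<lambda>k. forward \<epsilon> t k - F t k) (C * \<epsilon>)"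
    "\<And>\<epsilon> t. \<epsilon> \<in> {0<..\<epsilon>\<^sub>0} \<Longrightarrow> t \<in> {0..<T} \<Longrightarrow> sob_le 0 (\<lambda>k. backward \<epsilon> t k - B t k) (C * \<epsilon>)"
proof -
  obtain K where K: "\<And>\<epsilon>. \<epsilon> \<in> {0<..\<epsilon>\<^sub>0}
      \<Longrightarrow> \<exists>e G R. \<bar>e\<bar> = \<epsilon> \<and> approx_solution ((\<gamma> + 1) / 4) forward_speed T e K (forward \<epsilon>) G R"
    "\<And>\<epsilon>. \<epsilon> \<in> {0<..\<epsilon>\<^sub>0} \<Longrightarrow> \<exists>e G R. \<bar>e\<bar>
        = \<epsilon> \<and> approx_solution ((\<gamma> + 1) / 4) backward_speed T e K (backward \<epsilon>) G R"
    using filtered_approx by blast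
  have i1: "forward \<epsilon> 0 = forward_start" "backward \<epsilon> 0 = backward_start"
    if "\<epsilon> \<in> {0<..\<epsilon>\<^sub>0}" for \<epsilon> using that solution_initial[of \<epsilon>]
        by (simp_all add: forward_def backward_def)
  have b1: "sob_le s (forward \<epsilon> t) M" "sob_le s (backward \<epsilon> t) M" if "\<epsilon> \<in> {0<..\<epsilon>\<^sub>0}" "t \<in> {0..<T}"
      for \<epsilon> t
    unfolding forward_def backward_def using solution_Hs[of \<epsilon> t] that
        by (auto intro!: sob_le_modulate half_sum_bound sob_le_uminus)
  obtain F C1 where F: "burgers_coeffs ((\<gamma> + 1) / 4) forward_speed s T M F" "F 0 = forward_start"
      "0 \<le> C1"
    "\<And>\<epsilon> t. \<epsilon> \<in> {0<..\<epsilon>\<^sub>0} \<Longrightarrow> t \<in> {0..<T} \<Longrightarrow> sob_le 0 (\<lambda>k. forward \<epsilon> t k - F t k) (C1 * \<epsilon>)"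
    by (rule approx_solution_limit[OF eps0 T s K(1) i1(1) b1(1)]) blast+
  obtain B C2 where B: "burgers_coeffs ((\<gamma> + 1) / 4) backward_speed s T M B"
      "B 0 = backward_start" "0 \<le> C2"
    "\<And>\<epsilon> t. \<epsilon> \<in> {0<..\<epsilon>\<^sub>0} \<Longrightarrow> t \<in> {0..<T} \<Longrightarrow> sob_le 0 (\<lambda>k. backward \<epsilon> t k - B t k) (C2 * \<epsilon>)"
    by (rule approx_solution_limit[OF eps0 T s K(2) i1(2) b1(2)]) blast+
  show thesis
  proof (rule that[OF F(1,2) B(1,2), of "max C1 C2"])
    show "0 \<le> max C1 C2" using F(3) by simp
    fix \<epsilon> t assume e: "\<epsilon> \<in> {0<..\<epsilon>\<^sub>0}" "t \<in> {0..<T}"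
    have "C1 * \<epsilon> \<le> max C1 C2 * \<epsilon>" "C2 * \<epsilon> \<le> max C1 C2 * \<epsilon>" using e by (auto intro!: mult_right_mono)
    then show "sob_le 0 (\<lambda>k. forward \<epsilon> t k - F t k) (max C1 C2 * \<epsilon>)"
        "sob_le 0 (\<lambda>k. backward \<epsilon> t k - B t k) (max C1 C2 * \<epsilon>)"
      using F(4)[OF e] B(4)[OF e] by (auto elim: sob_le_mono)
  qed
qed

lemma burgers_mean_zero:
  assumes "burgers_coeffs a c s T N H" "H 0 0 = 0" "t \<in> {0..<T}"
  shows "H t 0 = 0"
proof -
  have d: "((\<lambda>t. H t 0) has_vector_derivative 0) (at t within {0..<T})" if "t \<in> {0..<T}" for t
    using assms(1) that by (auto simp: burgers_coeffs_def burgers_rhs_def dest!: bspec spec[of _ 0])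
  have "norm (H t 0 - H 0 0) \<le> 0 * \<bar>t - 0\<bar>"
    by (rule vector_derivative_bound[where S = "{0..<T}", OF _ d]) (use assms T in auto)
  with assms(2) show ?thesis by simp
qed

lemma profile_exists: "\<exists>F B. profile_pair \<gamma> s T u0 \<rho>0 F B"
proof -
  obtain F B C where F: "burgers_coeffs ((\<gamma> + 1) / 4) forward_speed s T M F" "F 0 = forward_start"
    "burgers_coeffs ((\<gamma> + 1) / 4) backward_speed s T M B" "B 0 = backward_start"
    by (rule limits) blast
  have s1: "1 \<le> s" using s by simp
  have F0: "sob_le 1 (F 0) M" "sob_le 1 (B 0) M"
      using F(1,3) T sob_le_weaken[of s "F 0" M 1] sob_le_weaken[of s "B 0" M 1] s1
    by (auto simp: burgers_coeffs_def)
  have ae: "AE x in lborel. rseries (F 0) x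
      = (u0 x + \<rho>0 x - (torus_integral u0 + torus_integral \<rho>0) / (2 * pi)) / 2"
  proof -
    have "sob_le 1 (fourier_coeff forward_data) M"
      using F0(1) unfolding profile_data(2) F(2) .
    from fourier_series_AE[OF profile_data(1) this] show ?thesis
      unfolding profile_data(2) F(2) by eventually_elim (rule sym)
  qed
  have ae': "AE x in lborel. rseries (B 0) x
      = (u0 x - \<rho>0 x - (torus_integral u0 - torus_integral \<rho>0) / (2 * pi)) / 2"
  proof -
    have "sob_le 1 (fourier_coeff backward_data) M"
      using F0(2) unfolding profile_data(4) F(4) .
    from fourier_series_AE[OF profile_data(3) this] show ?thesis
      unfolding profile_data(4) F(4) by eventually_elim (rule sym)
  qed
  have z: "F t 0 = 0" "B t 0 = 0" if "t \<in> {0..<T}" for t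
    by (rule burgers_mean_zero[OF F(1) _ that] burgers_mean_zero[OF F(3) _ that], simp add: F(2,4)
        half_sum_def)+
  have "profile_pair \<gamma> s T u0 \<rho>0 (\<lambda>t. rseries (F t)) (\<lambda>t. rseries (B t))"
    unfolding profile_pair_def Let_def profile_speeds
    using burgers_coeffs_imp_profile[OF F(1) s T z(1) ae]
        burgers_coeffs_imp_profile[OF F(3) s T z(2) ae'] by simp
  then show ?thesis by blast
qed

text \<open>
  The coefficients of the errors are sums and differences of the differences between filtered waves and
  profiles, modulated back; modulation does not change norms.
\<close>

lemma profile_error:
  assumes P: "profile_pair \<gamma> s T u0 \<rho>0 F B"
  shows "\<exists>K>0. \<forall>\<epsilon>\<in>{0<..\<epsilon>\<^sub>0}.
        L2_L2_bounded T (\<lambda>t x. u \<epsilon> t x - profile_U u0 F B x (t / \<epsilon>) t) (K * \<epsilon>) \<and>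
        L2_L2_bounded T (\<lambda>t x. \<rho> \<epsilon> t x - profile_R \<rho>0 F B x (t / \<epsilon>) t) (K * \<epsilon>)"
proof -
  obtain F' B' C where L: "burgers_coeffs ((\<gamma> + 1) / 4) forward_speed s T M F'"
      "F' 0 = forward_start"
    "burgers_coeffs ((\<gamma> + 1) / 4) backward_speed s T M B'" "B' 0 = backward_start"
    "0 \<le> C" "\<And>\<epsilon> t. \<epsilon> \<in> {0<..\<epsilon>\<^sub>0} \<Longrightarrow> t \<in> {0..<T} \<Longrightarrow> sob_le 0 (\<lambda>k. forward \<epsilon> t k - F' t k) (C * \<epsilon>)"
    "\<And>\<epsilon> t. \<epsilon> \<in> {0<..\<epsilon>\<^sub>0} \<Longrightarrow> t \<in> {0..<T} \<Longrightarrow> sob_le 0 (\<lambda>k. backward \<epsilon> t k - B' t k) (C * \<epsilon>)"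
    by (rule limits) blast
  have PF: "profile_solution \<gamma> s T forward_speed forward_data F"
    and PB: "profile_solution \<gamma> s T backward_speed backward_data B"
    using P unfolding profile_pair_def Let_def profile_speeds by auto
  have FS: "F t \<in> sobolev s" "B t \<in> sobolev s" if "t \<in> {0..<T}" for t
    using PF PB that by (auto simp: profile_solution_def C0_sobolev_def)
  note FL = sobolev_imp_sob_le(1)[OF FS(1)] and BL = sobolev_imp_sob_le(1)[OF FS(2)]
  have s1: "1 \<le> s" using s by simp
  have i: "F' 0 = fourier_coeff (F 0)" "B' 0 = fourier_coeff (B 0)"
  proof -
    have z: "0 \<in> {0..<T}" using T by simp
    have "fourier_coeff (F 0) = forward_start"
      unfolding profile_data(2)[symmetric]
      by (rule ext, rule fourier_coeff_cong_AE)
          (use PF FL[OF z] profile_data(1) in \<open>auto simp: profile_solution_def torus_L2_def\<close>)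
    then show "F' 0 = fourier_coeff (F 0)" using L(2) by simp
    have "fourier_coeff (B 0) = backward_start"
      unfolding profile_data(4)[symmetric]
      by (rule ext, rule fourier_coeff_cong_AE)
          (use PB BL[OF z] profile_data(3) in \<open>auto simp: profile_solution_def torus_L2_def\<close>)
    then show "B' 0 = fourier_coeff (B 0)" using L(4) by simp
  qed
  have eqF: "fourier_coeff (F t) = F' t" if "t \<in> {0..<T}" for t
      by (rule profile_unique[OF PF s L(1) i(1) that])
  have eqB: "fourier_coeff (B t) = B' t" if "t \<in> {0..<T}" for t
      by (rule profile_unique[OF PB s L(3) i(2) that])
  have F'M: "sob_le 1 (F' t) M" "sob_le 1 (B' t) M" if "t \<in> {0..<T}" for t
    using L(1,3) that s1 sob_le_weaken[of s "F' t" M 1] sob_le_weaken[of s "B' t" M 1]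
        by (auto simp: burgers_coeffs_def)
  \<comment> \<open>the summand \<open>1\<close> makes \<open>K\<close> positive also if \<open>C = 0\<close>\<close>
  define K where "K = sqrt (2 * pi * T) * (2 * C) + 1"
  have K: "0 < K" unfolding K_def using L(5) T by (intro add_nonneg_pos mult_nonneg_nonneg) auto
  have main: "L2_L2_bounded T (\<lambda>t x. u \<epsilon> t x - profile_U u0 F B x (t / \<epsilon>) t) (K * \<epsilon>) \<and>
        L2_L2_bounded T (\<lambda>t x. \<rho> \<epsilon> t x - profile_R \<rho>0 F B x (t / \<epsilon>) t) (K * \<epsilon>)"
    if e: "\<epsilon> \<in> {0<..\<epsilon>\<^sub>0}" for \<epsilon>
  proof -
    have e0: "0 < \<epsilon>" using e by simp
    let ?S = "{0..<T}"
    define wu where "wu t x = u \<epsilon> t x - profile_U u0 F B x (t / \<epsilon>) t" for t x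
    define wr where "wr t x = \<rho> \<epsilon> t x - profile_R \<rho>0 F B x (t / \<epsilon>) t" for t x
    define X where "X t k = modulate (- (t / \<epsilon>)) (\<lambda>k. forward \<epsilon> t k - F' t k) k" for t k
    define Y where "Y t k = modulate (t / \<epsilon>) (\<lambda>k. backward \<epsilon> t k - B' t k) k" for t k
    have mod_diff: "modulate \<theta> (\<lambda>k. a k - b k) = (\<lambda>k. modulate \<theta> a k - modulate \<theta> b k)" for \<theta> a b
      by (simp add: modulate_def algebra_simps)
    have coeff: "wu t \<in> torus_L2" "fourier_coeff (wu t) = (\<lambda>k. X t k + Y t k)"
      "wr t \<in> torus_L2" "fourier_coeff (wr t) = (\<lambda>k. X t k - Y t k)" if t: "t \<in> ?S" for t
    proof -
      let ?\<tau> = "t / \<epsilon>"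
      have f1: "sob_le 1 (fourier_coeff (F t)) M" "sob_le 1 (fourier_coeff (B t)) M"
          using F'M[OF t] eqF[OF t] eqB[OF t] by simp_all
      note tF = translate_torus_L2[OF FL[OF t] f1(1), of ?\<tau>]
      note tB = translate_torus_L2[OF BL[OF t] f1(2), of "- ?\<tau>"]
      have wu_eq: "wu t = (\<lambda>x. u \<epsilon> t x - ((F t (x - ?\<tau>) + B t (x - - ?\<tau>)) + mean_u))"
        by (auto simp: wu_def profile_U_def mean_u_def)
      have wr_eq: "wr t = (\<lambda>x. \<rho> \<epsilon> t x - ((F t (x - ?\<tau>) - B t (x - - ?\<tau>)) + mean_rho))"
        by (auto simp: wr_def profile_R_def mean_rho_def)
      have p: "(\<lambda>x. F t (x - ?\<tau>) + B t (x - - ?\<tau>)) \<in> torus_L2"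
          by (rule torus_L2_add[OF tF(1) tB(1)])
      have d: "(\<lambda>x. F t (x - ?\<tau>) - B t (x - - ?\<tau>)) \<in> torus_L2"
          by (rule torus_L2_diff[OF tF(1) tB(1)])
      have pm: "(\<lambda>x. (F t (x - ?\<tau>) + B t (x - - ?\<tau>)) + mean_u) \<in> torus_L2"
          by (rule torus_L2_add[OF p torus_L2_const])
      have dm: "(\<lambda>x. (F t (x - ?\<tau>) - B t (x - - ?\<tau>)) + mean_rho) \<in> torus_L2"
          by (rule torus_L2_add[OF d torus_L2_const])
      show "wu t \<in> torus_L2" unfolding wu_eq by (rule torus_L2_diff[OF solution_L2(1)[OF e0 t] pm])
      show "wr t \<in> torus_L2" unfolding wr_eq by (rule torus_L2_diff[OF solution_L2(2)[OF e0 t] dm])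
      note I = torus_L2_imp_integrable
      have v: "half_sum (u_hat \<epsilon> t) (rho_hat \<epsilon> t) = modulate (- ?\<tau>) (forward \<epsilon> t)"
        and w: "half_sum (u_hat \<epsilon> t) (\<lambda>k. - rho_hat \<epsilon> t k) = modulate ?\<tau> (backward \<epsilon> t)"
        by (simp_all add: forward_def backward_def modulate_modulate)
      note dec = half_sum_decompose[where u = "u_hat \<epsilon> t"
          and r = "rho_hat \<epsilon> t", OF solution_means[OF e0 t]]
      show "fourier_coeff (wu t) = (\<lambda>k. X t k + Y t k)"
      proof
        fix k
        have "fourier_coeff (wu t) k
            = u_hat \<epsilon> t k - ((modulate (- ?\<tau>) (F' t) k + modulate ?\<tau> (B' t) k) + (if k
            = 0 then of_real mean_u else 0))"
          unfolding wu_eq fourier_coeff_diff[OF I[OF solution_L2(1)[OF e0 t]] I[OF pm]]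
              fourier_coeff_add[OF I[OF p] I[OF torus_L2_const]]
            fourier_coeff_add[OF I[OF tF(1)] I[OF tB(1)]] tF(2) tB(2) fourier_coeff_const
                eqF[OF t] eqB[OF t] u_hat_def by simp
        then show "fourier_coeff (wu t) k = X t k + Y t k"
          unfolding X_def Y_def mod_diff dec(1)[of k] v w by simp
      qed
      show "fourier_coeff (wr t) = (\<lambda>k. X t k - Y t k)"
      proof
        fix k
        have "fourier_coeff (wr t) k
            = rho_hat \<epsilon> t k - ((modulate (- ?\<tau>) (F' t) k - modulate ?\<tau> (B' t) k) + (if k
            = 0 then of_real mean_rho else 0))"
          unfolding wr_eq fourier_coeff_diff[OF I[OF solution_L2(2)[OF e0 t]] I[OF dm]]
              fourier_coeff_add[OF I[OF d] I[OF torus_L2_const]]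
            fourier_coeff_diff[OF I[OF tF(1)] I[OF tB(1)]] tF(2) tB(2) fourier_coeff_const
                eqF[OF t] eqB[OF t] rho_hat_def by simp
        then show "fourier_coeff (wr t) k = X t k - Y t k"
          unfolding X_def Y_def mod_diff dec(2)[of k] v w by simp
      qed
    qed
    have X0: "sob_le 0 (X t) (C * \<epsilon>)" and Y0: "sob_le 0 (Y t) (C * \<epsilon>)" if "t \<in> ?S" for t
      unfolding X_def[abs_def] Y_def[abs_def] by (auto intro!: sob_le_modulate L(6,7) e that)
    have b1: "sob_le 1 (forward \<epsilon> t) M" "sob_le 1 (backward \<epsilon> t) M" if t: "t \<in> ?S" for t
      unfolding forward_def backward_def
          using sob_le_weaken[OF solution_Hs(1)[OF e0 t] s1]
          sob_le_weaken[OF solution_Hs(2)[OF e0 t] s1]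
      by (auto intro!: sob_le_modulate half_sum_bound sob_le_uminus)
    have X1: "sob_le 1 (X t) (M + M)" and Y1: "sob_le 1 (Y t) (M + M)" if t: "t \<in> ?S" for t
      unfolding X_def[abs_def] Y_def[abs_def]
      by (rule sob_le_modulate[OF sob_le_diff[OF b1(1)[OF t] F'M(1)[OF t]]],
          rule sob_le_modulate[OF sob_le_diff[OF b1(2)[OF t] F'M(2)[OF t]]])
    have dc: "continuous_on ?S (\<lambda>t. a t k)"
      if "\<And>t. t \<in> ?S \<Longrightarrow> ((\<lambda>t. a t k) has_vector_derivative a' t k) (at t within ?S)"
          for a a' :: "real \<Rightarrow> int \<Rightarrow> complex" and k
      using that by (intro continuous_on_vector_derivative)
    have cu: "continuous_on ?S (\<lambda>t. u_hat \<epsilon> t k)" "continuous_on ?S (\<lambda>t. rho_hat \<epsilon> t k)" for k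
      using solution_acoustic[OF e0] unfolding acoustic_system_def
          by (auto intro!: continuous_on_vector_derivative)
    have cF: "continuous_on ?S (\<lambda>t. F' t k)" "continuous_on ?S (\<lambda>t. B' t k)" for k
      using L(1,3) unfolding burgers_coeffs_def by (auto intro!: continuous_on_vector_derivative)
    have cX: "continuous_on ?S (\<lambda>t. X t k)" "continuous_on ?S (\<lambda>t. Y t k)" for k
      unfolding X_def Y_def forward_def backward_def modulate_def half_sum_def
      by (cases "k = 0"; simp; intro continuous_intros cu cF; use e0 in simp)+
    have fin: "L2_L2_bounded T w (K * \<epsilon>)"
      if "\<And>t. t \<in> ?S \<Longrightarrow> w t \<in> torus_L2" "\<And>t. t \<in> ?S \<Longrightarrow> sob_le 1 (fourier_coeff (w t)) (4 * M)"
        "\<And>t. t \<in> ?S \<Longrightarrow> sob_le 0 (fourier_coeff (w t)) (2 * C * \<epsilon>)"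
            "\<And>k. continuous_on ?S (\<lambda>t. fourier_coeff (w t) k)" for w
    proof -
      have "L2_L2_bounded T w (sqrt (2 * pi * T) * (2 * C * \<epsilon>))"
        by (rule L2_L2_bounded_fourier[OF T that])
      moreover have "sqrt (2 * pi * T) * (2 * C * \<epsilon>) \<le> K * \<epsilon>" using e0
          by (simp add: K_def algebra_simps)
      ultimately show ?thesis unfolding L2_L2_bounded_def by auto
    qed
    have "L2_L2_bounded T wu (K * \<epsilon>)"
    proof (rule fin)
      fix t assume t: "t \<in> ?S"
      show "wu t \<in> torus_L2" by (rule coeff(1)[OF t])
      show "sob_le 1 (fourier_coeff (wu t)) (4 * M)" unfolding coeff(2)[OF t]
          using sob_le_add[OF X1[OF t] Y1[OF t]] by simp
      show "sob_le 0 (fourier_coeff (wu t)) (2 * C * \<epsilon>)" unfolding coeff(2)[OF t]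
          using sob_le_add[OF X0[OF t] Y0[OF t]] by (simp add: mult.assoc)
    next
      fix k
      have "continuous_on ?S (\<lambda>t. X t k + Y t k)" by (intro continuous_intros cX)
      then show "continuous_on ?S (\<lambda>t. fourier_coeff (wu t) k)"
          by (rule continuous_on_eq) (simp add: coeff(2))
    qed
    moreover have "L2_L2_bounded T wr (K * \<epsilon>)"
    proof (rule fin)
      fix t assume t: "t \<in> ?S"
      show "wr t \<in> torus_L2" by (rule coeff(3)[OF t])
      show "sob_le 1 (fourier_coeff (wr t)) (4 * M)" unfolding coeff(4)[OF t]
          using sob_le_diff[OF X1[OF t] Y1[OF t]] by simp
      show "sob_le 0 (fourier_coeff (wr t)) (2 * C * \<epsilon>)" unfolding coeff(4)[OF t]
          using sob_le_diff[OF X0[OF t] Y0[OF t]] by (simp add: mult.assoc)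
    next
      fix k
      have "continuous_on ?S (\<lambda>t. X t k - Y t k)" by (intro continuous_intros cX)
      then show "continuous_on ?S (\<lambda>t. fourier_coeff (wr t) k)"
          by (rule continuous_on_eq) (simp add: coeff(4))
    qed
    ultimately show ?thesis unfolding wu_def[abs_def] wr_def[abs_def] by blast
  qed
  show ?thesis using K main by blast
qed

end

theorem theorem1:
  fixes \<gamma> \<epsilon>\<^sub>0 s T :: real
    and q1 :: "real \<Rightarrow> real \<Rightarrow> real"
    and u0 \<rho>0 :: "real \<Rightarrow> real"
    and u \<rho> :: "real \<Rightarrow> real \<Rightarrow> real \<Rightarrow> real"
  assumes "\<epsilon>\<^sub>0 > 0" and "s \<ge> 2" and "T > 0"
    and "admissible_q1 \<epsilon>\<^sub>0 q1"
    and "u0 \<in> sobolev s" and "\<rho>0 \<in> sobolev s"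
    and solution: "\<And>\<epsilon>. \<epsilon> > 0 \<Longrightarrow> euler_solution \<gamma> q1 \<epsilon> s T u0 \<rho>0 (u \<epsilon>) (\<rho> \<epsilon>)"
    and bounded: "\<exists>M. \<forall>\<epsilon>>0. \<forall>t\<in>{0..<T}.
      sobolev_norm s (u \<epsilon> t) \<le> M \<and> sobolev_norm s (\<rho> \<epsilon> t) \<le> M"
  shows "(\<exists>F B. profile_pair \<gamma> s T u0 \<rho>0 F B) \<and>
    (\<forall>F B. profile_pair \<gamma> s T u0 \<rho>0 F B \<longrightarrow>
      (\<exists>K>0. \<forall>\<epsilon>\<in>{0<..\<epsilon>\<^sub>0}.
        L2_L2_bounded T (\<lambda>t x. u \<epsilon> t x - profile_U u0 F B x (t / \<epsilon>) t) (K * \<epsilon>) \<and>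
        L2_L2_bounded T (\<lambda>t x. \<rho> \<epsilon> t x - profile_R \<rho>0 F B x (t / \<epsilon>) t) (K * \<epsilon>)))"
proof -
  obtain M where M: "\<And>\<epsilon> t. \<epsilon> > 0 \<Longrightarrow> t \<in> {0..<T} \<Longrightarrow> sobolev_norm s (u \<epsilon> t) \<le> M \<and> sobolev_norm s (\<rho> \<epsilon> t) \<le> M"
    using bounded by blast
  interpret weakly_compressible_euler \<gamma> \<epsilon>\<^sub>0 s T M q1 u0 \<rho>0 u \<rho>
    by unfold_locales (use assms M in auto)
  show ?thesis using profile_exists profile_error by blast
qed

end
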